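(* Let $n\ge1$, $0\le j\le n$, $1\le k\le n+1$ be arbitrary integers, and let $\iota_{U,Y}\in WB_n$ with closed complement $Z=Y\setminus U$. Let $p:\mathcal B\ell_ZY\to Y$ be the blowup of $Y$ with center $Z$, and consider the diagram in $Sm_X$ with cartesian squares $$\begin{array}{ccccc} D&\xrightarrow{d}&\mathcal B\ell_ZY&\xleftarrow{u}&U\\ {\scriptstyle q}\downarrow&&\downarrow{\scriptstyle p}&&\|\\ Z&\xrightarrow{i}&Y&\xleftarrow{\iota_{U,Y}}&U\end{array}$$ where $i$ is the closed embedding, $D=p^{-1}(Z)$, and $u$ is the open immersion with $p\circ u=\iota_{U,Y}$. Then: (1) $t_1(u)=s_0(u)$ is an isomorphism in $\mathcal H$. (2) $t_k(\iota_{U,Y})$ is an isomorphism in $\mathcal H$, and with $\tilde r_k=t_k(u)\circ(t_k(\iota_{U,Y}))^{-1}:t_k(Y_+)\to t_k(\mathcal B\ell_ZY_+)$ one has $t_k(p)\circ\tilde r_k=id_{t_k(Y_+)}$. (3) $s_j(\iota_{U,Y})$ is an isomorphism in $\mathcal H$, and with $r_j=s_j(u)\circ(s_j(\iota_{U,Y}))^{-1}:s_j(Y_+)\to s_j(\mathcal B\ell_ZY_+)$ one has $s_j(p)\circ r_j=id_{s_j(Y_+)}$.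
   Context: $X$ is a Noetherian separated base scheme of finite Krull dimension, and $Sm_X$ is the category of smooth schemes of finite type over $X$, regarded as a site with the Nisnevich topology. Closed subsets are considered as closed subschemes with the reduced structure. $\mathcal M$ is the category of pointed simplicial presheaves on $Sm_X$ with Jardine's motivic (injective) model structure: cofibrations are the monomorphisms and weak equivalences are the motivic ($\mathbb A^1$-local Nisnevich) weak equivalences; $\mathcal H$ is its homotopy category and $\mathrm{Ho}:\mathcal M\to\mathcal H$ the localization functor. For $Y\in Sm_X$, $Y_+$ denotes the presheaf represented by $Y$ with a disjoint base point; for a map $f:Y\to W$ in $Sm_X$ the induced map $Y_+\to W_+$ is also denoted $f$. For $Z$ closed in $Y$, $codim_Y Z$ is the infimum of $\dim \mathcal O_{Y,z}$ over the generic points $z$ of $Z$ (so it is $\infty$ if $Z=\emptyset$). For $n\ge 0$, $WB_n$ is the set of maps $\iota_{U,Y}:U_+\to Y_+$ induced by open immersions $U\to Y$ with $Y\in Sm_X$ irreducible, $Z=Y\setminus U\in Sm_X$ and $codim_Y Z\ge n+1$; $WB_n\mathcal M$ is the left Bousfield localization of $\mathcal M$ with respect to $WB_n$. The functors $\tau_n:\mathcal M\to\mathcal M$ ($n\ge1$), with natural transformations $\tau_{\le n}:id\to\tau_n$ and $\nu_n:\tau_{n+1}\to\tau_n$, are defined inductively using the functorial factorizations (trivial cofibration followed by fibration): $A\xrightarrow{\tau_{\le 1}^A}\tau_1A\to *$ is the factorization of $A\to *$ in $WB_0\mathcal M$; and given $\tau_{\le n}^A:A\to\tau_nA$, it is factored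 in $WB_n\mathcal M$ as a trivial cofibration $\tau_{\le n+1}^A:A\to\tau_{n+1}A$ followed by a fibration $\nu_n^A:\tau_{n+1}A\to\tau_nA$. For $n\ge1$, $\tilde s_nA$ is the pullback of $\nu_n^A$ along the base point $*\to\tau_nA$; $\tilde s_0=\tau_1$. These induce functors $t_n,s_n:\mathcal H\to\mathcal H$ with $t_n\circ\mathrm{Ho}=\mathrm{Ho}\circ\tau_n$, $s_n\circ\mathrm{Ho}=\mathrm{Ho}\circ\tilde s_n$, $s_0=t_1$. *)

theory Defs
  imports
    "HOL-Homology.Simplices"
    "HOL-Algebra.QuotRing"
    "HOL-Algebra.Ring_Divisibility"
    "HOL-Algebra.Generated_Rings"
    "HOL-Library.Extended_Nat"
    "HOL-Library.Infinite_Typeclass"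
begin

section \<open>Categories\<close>

record ('o, 'a) cat =
  Obj :: "'o set"
  Arr :: "'a set"
  src :: "'a \<Rightarrow> 'o"
  tgt :: "'a \<Rightarrow> 'o"
  idn :: "'o \<Rightarrow> 'a"
  cmp :: "'a \<Rightarrow> 'a \<Rightarrow> 'a"  \<comment> \<open>\<open>cmp C g f\<close> is \<open>g\<close> after \<open>f\<close>\<close>

definition homs :: "('o, 'a) cat \<Rightarrow> 'o \<Rightarrow> 'o \<Rightarrow> 'a set" where
  "homs C A B = {f \<in> Arr C. src C f = A \<and> tgt C f = B}"

definition inverse_arr :: "('o, 'a) cat \<Rightarrow> 'a \<Rightarrow> 'a \<Rightarrow> bool" where
  "inverse_arr C f g \<longleftrightarrow> f \<in> Arr C \<and> g \<in> homs C (tgt C f) (src C f) \<and>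
     cmp C g f = idn C (src C f) \<and> cmp C f g = idn C (tgt C f)"

definition iso_arr :: "('o, 'a) cat \<Rightarrow> 'a \<Rightarrow> bool" where
  "iso_arr C f \<longleftrightarrow> (\<exists>g. inverse_arr C f g)"

definition the_inverse :: "('o, 'a) cat \<Rightarrow> 'a \<Rightarrow> 'a" where
  "the_inverse C f = (THE g. inverse_arr C f g)"


subsection \<open>Model structures with functorial factorizations\<close>

definition lifts :: "('o, 'a) cat \<Rightarrow> 'a \<Rightarrow> 'a \<Rightarrow> bool" where
  "lifts C i p \<longleftrightarrow> (\<forall>a b. a \<in> homs C (src C i) (src C p) \<longrightarrow> b \<in> homs C (tgt C i) (tgt C p) \<longrightarrow>
     cmp C p a = cmp C b i \<longrightarrow>
     (\<exists>h \<in> homs C (tgt C i) (src C p). cmp C h i = a \<and> cmp C p h = b))"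

definition rlp :: "('o, 'a) cat \<Rightarrow> 'a set \<Rightarrow> 'a set" where
  "rlp C I = {p \<in> Arr C. \<forall>i\<in>I. lifts C i p}"

definition retract_arr :: "('o, 'a) cat \<Rightarrow> 'a \<Rightarrow> 'a \<Rightarrow> bool" where
  "retract_arr C f g \<longleftrightarrow> f \<in> Arr C \<and> g \<in> Arr C \<and> (\<exists>a b r s.
     a \<in> homs C (src C f) (src C g) \<and> r \<in> homs C (src C g) (src C f) \<and>
     b \<in> homs C (tgt C f) (tgt C g) \<and> s \<in> homs C (tgt C g) (tgt C f) \<and>
     cmp C g a = cmp C b f \<and> cmp C f r = cmp C s g \<and>
     cmp C r a = idn C (src C f) \<and> cmp C s b = idn C (tgt C f))"

text \<open>A functorial factorization \<open>f = fr f \<circ> fl f\<close>; \<open>fm f g a b\<close> is the map of middle objects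
  induced by a commutative square \<open>(a, b)\<close> from \<open>f\<close> to \<open>g\<close>.\<close>

record 'a ffact =
  fl :: "'a \<Rightarrow> 'a"
  fr :: "'a \<Rightarrow> 'a"
  fm :: "'a \<Rightarrow> 'a \<Rightarrow> 'a \<Rightarrow> 'a \<Rightarrow> 'a"

definition square :: "('o, 'a) cat \<Rightarrow> 'a \<Rightarrow> 'a \<Rightarrow> 'a \<Rightarrow> 'a \<Rightarrow> bool" where
  "square C f g a b \<longleftrightarrow> f \<in> Arr C \<and> g \<in> Arr C \<and>
     a \<in> homs C (src C f) (src C g) \<and> b \<in> homs C (tgt C f) (tgt C g) \<and> cmp C g a = cmp C b f"

definition functorial_factorization ::
    "('o, 'a) cat \<Rightarrow> 'a set \<Rightarrow> 'a set \<Rightarrow> 'a ffact \<Rightarrow> bool" where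
  "functorial_factorization C L R F \<longleftrightarrow>
     (\<forall>f \<in> Arr C. fl F f \<in> L \<and> fr F f \<in> R \<and> src C (fl F f) = src C f \<and>
        tgt C (fl F f) = src C (fr F f) \<and> tgt C (fr F f) = tgt C f \<and>
        cmp C (fr F f) (fl F f) = f \<and>
        fm F f f (idn C (src C f)) (idn C (tgt C f)) = idn C (tgt C (fl F f))) \<and>
     (\<forall>f g a b. square C f g a b \<longrightarrow>
        fm F f g a b \<in> homs C (tgt C (fl F f)) (tgt C (fl F g)) \<and>
        cmp C (fm F f g a b) (fl F f) = cmp C (fl F g) a \<and>
        cmp C (fr F g) (fm F f g a b) = cmp C b (fr F f)) \<and>
     (\<forall>f g h a b a' b'. square C f g a b \<and> square C g h a' b' \<longrightarrow>
        fm F f h (cmp C a' a) (cmp C b' b) = cmp C (fm F g h a' b') (fm F f g a b))"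

text \<open>The last two arguments are the factorizations into a trivial cofibration followed by a
  fibration and into a cofibration followed by a trivial fibration.\<close>

definition model_structure :: "('o, 'a) cat \<Rightarrow> 'a set \<Rightarrow> 'a set \<Rightarrow> 'a set \<Rightarrow>
    'a ffact \<Rightarrow> 'a ffact \<Rightarrow> bool" where
  "model_structure C Weq Cof Fib TF CT \<longleftrightarrow>
     Weq \<subseteq> Arr C \<and> Cof \<subseteq> Arr C \<and> Fib \<subseteq> Arr C \<and>
     (\<forall>f g. f \<in> Arr C \<and> g \<in> Arr C \<and> tgt C f = src C g \<longrightarrow>
        (f \<in> Weq \<and> g \<in> Weq \<longrightarrow> cmp C g f \<in> Weq) \<and>
        (f \<in> Weq \<and> cmp C g f \<in> Weq \<longrightarrow> g \<in> Weq) \<and>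
        (g \<in> Weq \<and> cmp C g f \<in> Weq \<longrightarrow> f \<in> Weq)) \<and>
     (\<forall>f g. retract_arr C f g \<longrightarrow>
        (g \<in> Weq \<longrightarrow> f \<in> Weq) \<and> (g \<in> Cof \<longrightarrow> f \<in> Cof) \<and> (g \<in> Fib \<longrightarrow> f \<in> Fib)) \<and>
     (\<forall>i \<in> Cof \<inter> Weq. \<forall>p \<in> Fib. lifts C i p) \<and>
     (\<forall>i \<in> Cof. \<forall>p \<in> Fib \<inter> Weq. lifts C i p) \<and>
     functorial_factorization C (Cof \<inter> Weq) Fib TF \<and>
     functorial_factorization C Cof (Fib \<inter> Weq) CT"


subsection \<open>Localization at a class of arrows\<close>

text \<open>\<open>Weq\<close>-inverting localization in the sense of Gabriel and Zisman: arrows are zigzags modulo the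
  congruence that makes the forward inclusion a functor and each backward step \<open>Bw w\<close> an inverse
  of \<open>Fw w\<close>. Words are read in the order in which the steps are traversed.\<close>

datatype 'a zstep = Fw 'a | Bw 'a

inductive zpath :: "('o, 'a) cat \<Rightarrow> 'a set \<Rightarrow> 'o \<Rightarrow> 'a zstep list \<Rightarrow> 'o \<Rightarrow> bool"
  for C Weq where
  zp_nil: "A \<in> Obj C \<Longrightarrow> zpath C Weq A [] A"
| zp_fw: "f \<in> Arr C \<Longrightarrow> zpath C Weq (tgt C f) w B \<Longrightarrow> zpath C Weq (src C f) (Fw f # w) B"
| zp_bw: "f \<in> Arr C \<Longrightarrow> f \<in> Weq \<Longrightarrow> zpath C Weq (src C f) w B \<Longrightarrow>
    zpath C Weq (tgt C f) (Bw f # w) B"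

inductive zrel :: "('o, 'a) cat \<Rightarrow> 'a set \<Rightarrow> 'a zstep list \<Rightarrow> 'a zstep list \<Rightarrow> bool"
  for C Weq where
  zr_cmp: "f \<in> Arr C \<Longrightarrow> g \<in> Arr C \<Longrightarrow> tgt C f = src C g \<Longrightarrow>
    zrel C Weq [Fw f, Fw g] [Fw (cmp C g f)]"
| zr_id: "A \<in> Obj C \<Longrightarrow> zrel C Weq [Fw (idn C A)] []"
| zr_fb: "f \<in> Arr C \<Longrightarrow> f \<in> Weq \<Longrightarrow> zrel C Weq [Fw f, Bw f] []"
| zr_bf: "f \<in> Arr C \<Longrightarrow> f \<in> Weq \<Longrightarrow> zrel C Weq [Bw f, Fw f] []"

inductive zeq :: "('o, 'a) cat \<Rightarrow> 'a set \<Rightarrow> 'o \<Rightarrow> 'o \<Rightarrow> 'a zstep list \<Rightarrow> 'a zstep list \<Rightarrow> bool"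
  for C Weq A B where
  zq_refl: "zpath C Weq A w B \<Longrightarrow> zeq C Weq A B w w"
| zq_sym: "zeq C Weq A B w w' \<Longrightarrow> zeq C Weq A B w' w"
| zq_trans: "zeq C Weq A B w w' \<Longrightarrow> zeq C Weq A B w' w'' \<Longrightarrow> zeq C Weq A B w w''"
| zq_step: "zpath C Weq A (x @ l @ y) B \<Longrightarrow> zpath C Weq A (x @ r @ y) B \<Longrightarrow> zrel C Weq l r \<Longrightarrow>
    zeq C Weq A B (x @ l @ y) (x @ r @ y)"

type_synonym ('o, 'a) zarr = "'o \<times> 'a zstep list set \<times> 'o"

definition zclass :: "('o, 'a) cat \<Rightarrow> 'a set \<Rightarrow> 'o \<Rightarrow> 'a zstep list \<Rightarrow> 'o \<Rightarrow> ('o, 'a) zarr" where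
  "zclass C Weq A w B = (A, {w'. zeq C Weq A B w w'}, B)"

definition localization :: "('o, 'a) cat \<Rightarrow> 'a set \<Rightarrow> ('o, ('o, 'a) zarr) cat" where
  "localization C Weq =
     \<lparr>Obj = Obj C,
      Arr = {zclass C Weq A w B | A w B. zpath C Weq A w B},
      src = fst,
      tgt = (\<lambda>(A, c, B). B),
      idn = (\<lambda>A. zclass C Weq A [] A),
      cmp = (\<lambda>(B', d, D) (A, c, B). (A, {w. \<exists>u\<in>c. \<exists>v\<in>d. zeq C Weq A D (u @ v) w}, D))\<rparr>"

definition loc_fun :: "('o, 'a) cat \<Rightarrow> 'a set \<Rightarrow> 'a \<Rightarrow> ('o, 'a) zarr" where
  "loc_fun C Weq f = zclass C Weq (src C f) [Fw f] (tgt C f)"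

text \<open>The functor on the localization induced by a functor \<open>(Fo, Fa)\<close> of \<open>C\<close> which preserves
  \<open>Weq\<close>: apply \<open>Fa\<close> to each step of a zigzag.\<close>

definition induced :: "('o, 'a) cat \<Rightarrow> 'a set \<Rightarrow> ('o \<Rightarrow> 'o) \<Rightarrow> ('a \<Rightarrow> 'a) \<Rightarrow>
    ('o, 'a) zarr \<Rightarrow> ('o, 'a) zarr" where
  "induced C Weq Fo Fa = (\<lambda>(A, c, B).
     (Fo A, {w. \<exists>u\<in>c. zeq C Weq (Fo A) (Fo B) (map (map_zstep Fa) u) w}, Fo B))"

locale weq_functor =
  fixes C :: "('o,'a) cat" and Weq Fo Fa
  assumes F: "\<And>f. f \<in> Arr C \<Longrightarrow> Fa f \<in> Arr C" "\<And>f. f \<in> Arr C \<Longrightarrow> src C (Fa f) = Fo (src C f)" "\<And>f. f \<in> Arr C \<Longrightarrow> tgt C (Fa f) = Fo (tgt C f)"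
   and W: "\<And>f. f \<in> Weq \<Longrightarrow> Fa f \<in> Weq" and O: "\<And>A. A \<in> Obj C \<Longrightarrow> Fo A \<in> Obj C"
   and c: "\<And>f g. f \<in> Arr C \<Longrightarrow> g \<in> Arr C \<Longrightarrow> tgt C f = src C g \<Longrightarrow> Fa (cmp C g f) = cmp C (Fa g) (Fa f)"
   and i: "\<And>A. A \<in> Obj C \<Longrightarrow> Fa (idn C A) = idn C (Fo A)"
begin

lemma zpath_map: "zpath C Weq A w B \<Longrightarrow> zpath C Weq (Fo A) (map (map_zstep Fa) w) (Fo B)"
proof (induction rule: zpath.induct)
  case (zp_nil A) then show ?case using zpath.zp_nil[OF O] by simp
next
  case (zp_fw f w B)
  have "zpath C Weq (src C (Fa f)) (Fw (Fa f) # map (map_zstep Fa) w) (Fo B)"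
    by (rule zpath.zp_fw) (use zp_fw F in simp_all)
  then show ?case using F(2)[OF zp_fw(1)] by simp
next
  case (zp_bw f w B)
  have "zpath C Weq (tgt C (Fa f)) (Bw (Fa f) # map (map_zstep Fa) w) (Fo B)"
    by (rule zpath.zp_bw) (use zp_bw F W in simp_all)
  then show ?case using F(3)[OF zp_bw(1)] by simp
qed

lemma zrel_map: "zrel C Weq l r \<Longrightarrow> zrel C Weq (map (map_zstep Fa) l) (map (map_zstep Fa) r)"
proof (induction rule: zrel.induct)
  case (zr_cmp f g) then show ?case using zrel.zr_cmp[of "Fa f" C "Fa g"] by (simp add: F c)
next
  case (zr_id A) then show ?case using zrel.zr_id[OF O] by (simp add: i)
next
  case (zr_fb f) then show ?case using zrel.zr_fb[of "Fa f" C] by (simp add: F W)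
next
  case (zr_bf f) then show ?case using zrel.zr_bf[of "Fa f" C] by (simp add: F W)
qed

lemma zeq_map: "zeq C Weq A B w w' \<Longrightarrow> zeq C Weq (Fo A) (Fo B) (map (map_zstep Fa) w) (map (map_zstep Fa) w')"
proof (induction rule: zeq.induct)
  case (zq_refl w) then show ?case by (intro zeq.zq_refl zpath_map)
next
  case (zq_sym w w') from zq_sym(2) show ?case by (rule zeq.zq_sym)
next
  case (zq_trans w w' w'') from zq_trans(3,4) show ?case by (rule zeq.zq_trans)
next
  case (zq_step x l y r)
  show ?case using zpath_map[OF zq_step(1)] zpath_map[OF zq_step(2)] zrel_map[OF zq_step(3)] unfolding map_append by (rule zeq.zq_step)
qed

text \<open>That is, the induced functor \<open>t\<close> satisfies \<open>t \<circ> Ho = Ho \<circ> F\<close>.\<close>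

lemma induced_loc_fun:
  assumes f: "f \<in> Arr C" and t: "tgt C f \<in> Obj C"
  shows "induced C Weq Fo Fa (loc_fun C Weq f) = loc_fun C Weq (Fa f)"
proof -
  have "zpath C Weq (src C f) [Fw f] (tgt C f)" by (rule zpath.zp_fw[OF f zpath.zp_nil[OF t]])
  then have r: "zeq C Weq (src C f) (tgt C f) [Fw f] [Fw f]" by (rule zq_refl)
  have "(\<exists>u\<in>{w'. zeq C Weq (src C f) (tgt C f) [Fw f] w'}. zeq C Weq (Fo (src C f)) (Fo (tgt C f)) (map (map_zstep Fa) u) w)
     \<longleftrightarrow> zeq C Weq (Fo (src C f)) (Fo (tgt C f)) [Fw (Fa f)] w" (is "?L = ?R") for w
  proof
    assume ?L then obtain u where u: "zeq C Weq (src C f) (tgt C f) [Fw f] u" and "zeq C Weq (Fo (src C f)) (Fo (tgt C f)) (map (map_zstep Fa) u) w" by blast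
    with zq_trans[OF zeq_map[OF u]] show ?R by simp
  next
    assume ?R then show ?L using r by (intro bexI[of _ "[Fw f]"]) simp_all
  qed
  then show ?thesis unfolding induced_def loc_fun_def zclass_def by (simp add: F f)
qed
end


section \<open>Schemes\<close>

subsection \<open>Locally ringed spaces\<close>

record ('p, 's) rspace =
  topo :: "'p topology"
  sec :: "'p set \<Rightarrow> 's ring"
  res :: "'p set \<Rightarrow> 'p set \<Rightarrow> 's \<Rightarrow> 's"  \<comment> \<open>\<open>res X U V\<close> restricts from \<open>U\<close> to \<open>V\<close>\<close>

abbreviation pts :: "('p, 's) rspace \<Rightarrow> 'p set" where
  "pts X \<equiv> topspace (topo X)"

abbreviation opn :: "('p, 's) rspace \<Rightarrow> 'p set \<Rightarrow> bool" where
  "opn X \<equiv> openin (topo X)"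

abbreviation sct :: "('p, 's) rspace \<Rightarrow> 'p set \<Rightarrow> 's set" where
  "sct X U \<equiv> carrier (sec X U)"

definition ringed_space :: "('p, 's) rspace \<Rightarrow> bool" where
  "ringed_space X \<longleftrightarrow>
     (\<forall>U. opn X U \<longrightarrow> cring (sec X U)) \<and>
     (\<forall>U V. opn X U \<and> opn X V \<and> V \<subseteq> U \<longrightarrow> res X U V \<in> ring_hom (sec X U) (sec X V)) \<and>
     (\<forall>U. opn X U \<longrightarrow> (\<forall>s \<in> sct X U. res X U U s = s)) \<and>
     (\<forall>U V W. opn X U \<and> opn X V \<and> opn X W \<and> W \<subseteq> V \<and> V \<subseteq> U \<longrightarrow>
        (\<forall>s \<in> sct X U. res X V W (res X U V s) = res X U W s)) \<and>
     (\<forall>\<U> \<sigma>. (\<forall>U\<in>\<U>. opn X U \<and> \<sigma> U \<in> sct X U) \<and>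
        (\<forall>U\<in>\<U>. \<forall>V\<in>\<U>. res X U (U \<inter> V) (\<sigma> U) = res X V (U \<inter> V) (\<sigma> V)) \<longrightarrow>
        (\<exists>!s. s \<in> sct X (\<Union>\<U>) \<and> (\<forall>U\<in>\<U>. res X (\<Union>\<U>) U s = \<sigma> U)))"

definition germ :: "('p, 's) rspace \<Rightarrow> 'p \<Rightarrow> 'p set \<Rightarrow> 's \<Rightarrow> ('p set \<times> 's) set" where
  "germ X x U s = {(V, t). opn X V \<and> x \<in> V \<and> t \<in> sct X V \<and>
     (\<exists>W. opn X W \<and> x \<in> W \<and> W \<subseteq> U \<inter> V \<and> res X U W s = res X V W t)}"

definition stalk_op :: "('p, 's) rspace \<Rightarrow> 'p \<Rightarrow> ('p set \<Rightarrow> 's \<Rightarrow> 's \<Rightarrow> 's) \<Rightarrow>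
    ('p set \<times> 's) set \<Rightarrow> ('p set \<times> 's) set \<Rightarrow> ('p set \<times> 's) set" where
  "stalk_op X x f a b = (THE c. \<exists>U s t. opn X U \<and> x \<in> U \<and> s \<in> sct X U \<and> t \<in> sct X U \<and>
     a = germ X x U s \<and> b = germ X x U t \<and> c = germ X x U (f U s t))"

definition stalk :: "('p, 's) rspace \<Rightarrow> 'p \<Rightarrow> ('p set \<times> 's) set ring" where
  "stalk X x =
     \<lparr>carrier = {germ X x U s | U s. opn X U \<and> x \<in> U \<and> s \<in> sct X U},
      monoid.mult = stalk_op X x (\<lambda>U. monoid.mult (sec X U)),
      one = germ X x (pts X) \<one>\<^bsub>sec X (pts X)\<^esub>,
      zero = germ X x (pts X) \<zero>\<^bsub>sec X (pts X)\<^esub>,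
      add = stalk_op X x (\<lambda>U. add (sec X U))\<rparr>"

definition locally_ringed :: "('p, 's) rspace \<Rightarrow> bool" where
  "locally_ringed X \<longleftrightarrow> ringed_space X \<and> (\<forall>x \<in> pts X. \<exists>!m. maximalideal m (stalk X x))"

definition restr :: "('p, 's) rspace \<Rightarrow> 'p set \<Rightarrow> ('p, 's) rspace" where
  "restr X U = \<lparr>topo = subtopology (topo X) U, sec = sec X, res = res X\<rparr>"

text \<open>A morphism \<open>X \<rightarrow> Y\<close> is a map of points together with ring maps
  \<open>co f V : \<O>\<^sub>Y(V) \<rightarrow> \<O>\<^sub>X(f\<^sup>-\<^sup>1 V)\<close>. All components are extensional, so that equality of morphisms is
  equality in HOL.\<close>

record ('p, 's, 'q, 'r) rmap =
  pmap :: "'p \<Rightarrow> 'q"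
  co :: "'q set \<Rightarrow> 'r \<Rightarrow> 's"

definition pre :: "('p, 's) rspace \<Rightarrow> ('p, 's, 'q, 'r) rmap \<Rightarrow> 'q set \<Rightarrow> 'p set" where
  "pre X f V = {x \<in> pts X. pmap f x \<in> V}"

definition rmaps :: "('p, 's) rspace \<Rightarrow> ('q, 'r) rspace \<Rightarrow> ('p, 's, 'q, 'r) rmap set" where
  "rmaps X Y = {f.
     continuous_map (topo X) (topo Y) (pmap f) \<and> pmap f \<in> extensional (pts X) \<and>
     (\<forall>V. opn Y V \<longrightarrow> co f V \<in> ring_hom (sec Y V) (sec X (pre X f V)) \<and>
        co f V \<in> extensional (sct Y V)) \<and>
     (\<forall>V. \<not> opn Y V \<longrightarrow> co f V = (\<lambda>_. undefined)) \<and>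
     (\<forall>V W. opn Y V \<and> opn Y W \<and> W \<subseteq> V \<longrightarrow> (\<forall>s \<in> sct Y V.
        co f W (res Y V W s) = res X (pre X f V) (pre X f W) (co f V s))) \<and>
     (\<forall>x \<in> pts X. \<forall>V. opn Y V \<and> pmap f x \<in> V \<longrightarrow> (\<forall>s \<in> sct Y V.
        germ X x (pre X f V) (co f V s) \<in> Units (stalk X x) \<longrightarrow>
        germ Y (pmap f x) V s \<in> Units (stalk Y (pmap f x))))}"

definition rid :: "('p, 's) rspace \<Rightarrow> ('p, 's, 'p, 's) rmap" where
  "rid X = \<lparr>pmap = (\<lambda>x \<in> pts X. x),
     co = (\<lambda>V. if opn X V then (\<lambda>s \<in> sct X V. s) else (\<lambda>_. undefined))\<rparr>"

definition rcomp :: "('p, 's) rspace \<Rightarrow> ('q, 'r) rspace \<Rightarrow> ('k, 'l) rspace \<Rightarrow>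
    ('q, 'r, 'k, 'l) rmap \<Rightarrow> ('p, 's, 'q, 'r) rmap \<Rightarrow> ('p, 's, 'k, 'l) rmap" where
  "rcomp X Y Z g f = \<lparr>pmap = (\<lambda>x \<in> pts X. pmap g (pmap f x)),
     co = (\<lambda>W. if opn Z W then (\<lambda>s \<in> sct Z W. co f (pre Y g W) (co g W s)) else (\<lambda>_. undefined))\<rparr>"

definition risomorphic :: "('p, 's) rspace \<Rightarrow> ('q, 'r) rspace \<Rightarrow> bool" where
  "risomorphic X Y \<longleftrightarrow> (\<exists>f \<in> rmaps X Y. \<exists>g \<in> rmaps Y X.
     rcomp X Y X g f = rid X \<and> rcomp Y X Y f g = rid Y)"


subsection \<open>Affine schemes and schemes\<close>

definition frac :: "'s ring \<Rightarrow> 's set \<Rightarrow> 's \<Rightarrow> 's \<Rightarrow> ('s \<times> 's) set" where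
  "frac R P a f = {(b, g). b \<in> carrier R \<and> g \<in> carrier R - P \<and>
     (\<exists>h \<in> carrier R - P. h \<otimes>\<^bsub>R\<^esub> (a \<otimes>\<^bsub>R\<^esub> g) = h \<otimes>\<^bsub>R\<^esub> (b \<otimes>\<^bsub>R\<^esub> f))}"

definition frac_op :: "'s ring \<Rightarrow> 's set \<Rightarrow> ('s \<Rightarrow> 's \<Rightarrow> 's \<Rightarrow> 's \<Rightarrow> ('s \<times> 's) set) \<Rightarrow>
    ('s \<times> 's) set \<Rightarrow> ('s \<times> 's) set \<Rightarrow> ('s \<times> 's) set" where
  "frac_op R P k x y = (THE z. \<exists>a b. \<exists>f \<in> carrier R - P. \<exists>g \<in> carrier R - P.
     a \<in> carrier R \<and> b \<in> carrier R \<and> x = frac R P a f \<and> y = frac R P b g \<and> z = k a f b g)"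

definition loc_ring :: "'s ring \<Rightarrow> 's set \<Rightarrow> ('s \<times> 's) set ring" where
  "loc_ring R P =
     \<lparr>carrier = {frac R P a f | a f. a \<in> carrier R \<and> f \<in> carrier R - P},
      monoid.mult = frac_op R P (\<lambda>a f b g. frac R P (a \<otimes>\<^bsub>R\<^esub> b) (f \<otimes>\<^bsub>R\<^esub> g)),
      one = frac R P \<one>\<^bsub>R\<^esub> \<one>\<^bsub>R\<^esub>,
      zero = frac R P \<zero>\<^bsub>R\<^esub> \<one>\<^bsub>R\<^esub>,
      add = frac_op R P (\<lambda>a f b g. frac R P (a \<otimes>\<^bsub>R\<^esub> g \<oplus>\<^bsub>R\<^esub> b \<otimes>\<^bsub>R\<^esub> f) (f \<otimes>\<^bsub>R\<^esub> g))\<rparr>"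

definition Spec :: "'s ring \<Rightarrow> ('s set, 's set \<Rightarrow> ('s \<times> 's) set) rspace" where
  "Spec R =
     \<lparr>topo = topology (\<lambda>U. \<exists>S \<subseteq> carrier R. U = {P. primeideal P R \<and> \<not> S \<subseteq> P}),
      sec = (\<lambda>U.
        \<lparr>carrier = {\<sigma> \<in> extensional U. \<forall>P\<in>U. \<exists>S \<subseteq> carrier R. \<exists>a \<in> carrier R. \<exists>f \<in> carrier R.
            \<not> S \<subseteq> P \<and> (\<forall>Q. primeideal Q R \<and> \<not> S \<subseteq> Q \<longrightarrow> Q \<in> U \<and> f \<notin> Q \<and> \<sigma> Q = frac R Q a f)},
         monoid.mult = (\<lambda>\<sigma> \<tau>. \<lambda>P\<in>U. \<sigma> P \<otimes>\<^bsub>loc_ring R P\<^esub> \<tau> P),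
         one = (\<lambda>P\<in>U. \<one>\<^bsub>loc_ring R P\<^esub>),
         zero = (\<lambda>P\<in>U. \<zero>\<^bsub>loc_ring R P\<^esub>),
         add = (\<lambda>\<sigma> \<tau>. \<lambda>P\<in>U. \<sigma> P \<oplus>\<^bsub>loc_ring R P\<^esub> \<tau> P)\<rparr>),
      res = (\<lambda>U V \<sigma>. restrict \<sigma> V)\<rparr>"

definition affine_scheme :: "('p, 's) rspace \<Rightarrow> bool" where
  "affine_scheme X \<longleftrightarrow> (\<exists>R :: 's ring. cring R \<and> risomorphic X (Spec R))"

definition affine_open :: "('p, 's) rspace \<Rightarrow> 'p set \<Rightarrow> bool" where
  "affine_open X U \<longleftrightarrow> opn X U \<and> affine_scheme (restr X U)"

definition scheme :: "('p, 's) rspace \<Rightarrow> bool" where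
  "scheme X \<longleftrightarrow> locally_ringed X \<and> (\<forall>x \<in> pts X. \<exists>U. affine_open X U \<and> x \<in> U)"

definition noetherian_scheme :: "('p, 's) rspace \<Rightarrow> bool" where
  "noetherian_scheme X \<longleftrightarrow> scheme X \<and> (\<exists>\<U>. finite \<U> \<and> \<Union>\<U> = pts X \<and>
     (\<forall>U\<in>\<U>. affine_open X U \<and> noetherian_ring (sec X U)))"

text \<open>Separated over \<open>\<int>\<close>. The diagonal of \<open>X\<close> is a closed immersion iff for all affine opens
  \<open>U, V\<close> the intersection is affine and \<open>\<O>(U) \<otimes> \<O>(V) \<rightarrow> \<O>(U \<inter> V)\<close> is surjective; this form avoids
  the product \<open>X \<times> X\<close>, whose underlying set may be larger than the types at hand.\<close>

definition separated_scheme :: "('p, 's) rspace \<Rightarrow> bool" where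
  "separated_scheme X \<longleftrightarrow> (\<forall>U V. affine_open X U \<and> affine_open X V \<longrightarrow>
     affine_open X (U \<inter> V) \<and>
     generate_ring (sec X (U \<inter> V)) (res X U (U \<inter> V) ` sct X U \<union> res X V (U \<inter> V) ` sct X V)
       = sct X (U \<inter> V))"

definition reduced_scheme :: "('p, 's) rspace \<Rightarrow> bool" where
  "reduced_scheme X \<longleftrightarrow> (\<forall>U. opn X U \<longrightarrow> (\<forall>s \<in> sct X U. \<forall>k::nat.
     s [^]\<^bsub>sec X U\<^esub> k = \<zero>\<^bsub>sec X U\<^esub> \<longrightarrow> s = \<zero>\<^bsub>sec X U\<^esub>))"

definition irreducible_in :: "'p topology \<Rightarrow> 'p set \<Rightarrow> bool" where
  "irreducible_in T S \<longleftrightarrow> S \<subseteq> topspace T \<and> S \<noteq> {} \<and>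
     (\<forall>A B. closedin T A \<and> closedin T B \<and> S \<subseteq> A \<union> B \<longrightarrow> S \<subseteq> A \<or> S \<subseteq> B)"

definition finite_krull_dim :: "'p topology \<Rightarrow> bool" where
  "finite_krull_dim T \<longleftrightarrow> (\<exists>d. \<forall>m (c :: nat \<Rightarrow> 'p set).
     (\<forall>i\<le>m. closedin T (c i) \<and> irreducible_in T (c i)) \<and> (\<forall>i<m. c i \<subset> c (Suc i)) \<longrightarrow> m \<le> d)"

definition ring_dim :: "('s, 'b) ring_scheme \<Rightarrow> enat" where
  "ring_dim R = (SUP n \<in> {n. \<exists>P. (\<forall>i\<le>n. primeideal (P i) R) \<and> (\<forall>i<n. P i \<subset> P (Suc i))}. enat n)"

definition generic_points :: "'p topology \<Rightarrow> 'p set \<Rightarrow> 'p set" where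
  "generic_points T Z = {z \<in> Z. \<forall>A. irreducible_in T A \<and> A \<subseteq> Z \<and> T closure_of {z} \<subseteq> A \<longrightarrow>
     A = T closure_of {z}}"

definition codim :: "('p, 's) rspace \<Rightarrow> 'p set \<Rightarrow> enat" where
  "codim Y Z = (INF z \<in> generic_points (topo Y) Z. ring_dim (stalk Y z))"


subsection \<open>Morphisms of schemes\<close>

definition fg_algebra :: "'r ring \<Rightarrow> 's ring \<Rightarrow> ('r \<Rightarrow> 's) \<Rightarrow> bool" where
  "fg_algebra A B \<phi> \<longleftrightarrow> (\<exists>S \<subseteq> carrier B. finite S \<and> generate_ring B (\<phi> ` carrier A \<union> S) = carrier B)"

text \<open>Infinitesimal lifting in the sense of EGA, against square-zero extensions \<open>C \<rightarrow> C/I\<close> of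
  \<open>A\<close>-algebras. For an infinite type and \<open>B = P/J\<close> of finite type over \<open>A\<close>, the decisive test ring
  \<open>P/J\<^sup>2\<close> has a copy on that type, so testing on one type is enough.\<close>

definition infinitesimal_lifts :: "'s ring \<Rightarrow> 's ring \<Rightarrow> ('s \<Rightarrow> 's) \<Rightarrow>
    (('s \<Rightarrow> 's) set \<Rightarrow> bool) \<Rightarrow> bool" where
  "infinitesimal_lifts A B \<phi> \<Phi> \<longleftrightarrow> (\<forall>(C :: 's ring) I \<psi> h0.
     cring C \<and> ideal I C \<and> (\<forall>x\<in>I. \<forall>y\<in>I. x \<otimes>\<^bsub>C\<^esub> y = \<zero>\<^bsub>C\<^esub>) \<and>
     \<psi> \<in> ring_hom A C \<and> h0 \<in> ring_hom B (C Quot I) \<and>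
     (\<forall>a \<in> carrier A. h0 (\<phi> a) = I +>\<^bsub>C\<^esub> \<psi> a) \<longrightarrow>
     \<Phi> {h \<in> extensional (carrier B). h \<in> ring_hom B C \<and>
        (\<forall>a \<in> carrier A. h (\<phi> a) = \<psi> a) \<and> (\<forall>b \<in> carrier B. I +>\<^bsub>C\<^esub> h b = h0 b)})"

definition formally_smooth :: "'s ring \<Rightarrow> 's ring \<Rightarrow> ('s \<Rightarrow> 's) \<Rightarrow> bool" where
  "formally_smooth A B \<phi> \<longleftrightarrow> infinitesimal_lifts A B \<phi> (\<lambda>H. H \<noteq> {})"

definition formally_etale :: "'s ring \<Rightarrow> 's ring \<Rightarrow> ('s \<Rightarrow> 's) \<Rightarrow> bool" where
  "formally_etale A B \<phi> \<longleftrightarrow> infinitesimal_lifts A B \<phi> (\<lambda>H. \<exists>h. H = {h})"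

definition affine_locally :: "('p, 's) rspace \<Rightarrow> ('q, 'r) rspace \<Rightarrow> ('p, 's, 'q, 'r) rmap \<Rightarrow>
    ('r ring \<Rightarrow> 's ring \<Rightarrow> ('r \<Rightarrow> 's) \<Rightarrow> bool) \<Rightarrow> bool" where
  "affine_locally Y X f \<Phi> \<longleftrightarrow> (\<forall>U V. affine_open Y U \<and> affine_open X V \<and> pmap f ` U \<subseteq> V \<longrightarrow>
     \<Phi> (sec X V) (sec Y U) (\<lambda>s. res Y (pre Y f V) U (co f V s)))"

definition finite_type :: "('p, 's) rspace \<Rightarrow> ('q, 'r) rspace \<Rightarrow> ('p, 's, 'q, 'r) rmap \<Rightarrow> bool" where
  "finite_type Y X f \<longleftrightarrow> affine_locally Y X f fg_algebra \<and>
     (\<forall>V. affine_open X V \<longrightarrow> compactin (topo Y) (pre Y f V))"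

text \<open>Both definitions are only used over a locally Noetherian target, where locally of finite type
  and locally of finite presentation agree.\<close>

definition smooth_morphism :: "('p, 's) rspace \<Rightarrow> ('q, 's) rspace \<Rightarrow> ('p, 's, 'q, 's) rmap \<Rightarrow> bool" where
  "smooth_morphism Y X f \<longleftrightarrow> affine_locally Y X f (\<lambda>A B \<phi>. fg_algebra A B \<phi> \<and> formally_smooth A B \<phi>)"

definition etale_morphism :: "('p, 's) rspace \<Rightarrow> ('q, 's) rspace \<Rightarrow> ('p, 's, 'q, 's) rmap \<Rightarrow> bool" where
  "etale_morphism Y X f \<longleftrightarrow> affine_locally Y X f (\<lambda>A B \<phi>. fg_algebra A B \<phi> \<and> formally_etale A B \<phi>)"

definition open_immersion :: "('p, 's) rspace \<Rightarrow> ('q, 'r) rspace \<Rightarrow> ('p, 's, 'q, 'r) rmap \<Rightarrow> bool" where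
  "open_immersion U Y j \<longleftrightarrow> embedding_map (topo U) (topo Y) (pmap j) \<and> opn Y (pmap j ` pts U) \<and>
     (\<forall>V. opn Y V \<and> V \<subseteq> pmap j ` pts U \<longrightarrow> bij_betw (co j V) (sct Y V) (sct U (pre U j V)))"

definition closed_immersion :: "('p, 's) rspace \<Rightarrow> ('q, 'r) rspace \<Rightarrow> ('p, 's, 'q, 'r) rmap \<Rightarrow> bool" where
  "closed_immersion Z Y i \<longleftrightarrow>
     embedding_map (topo Z) (topo Y) (pmap i) \<and> closedin (topo Y) (pmap i ` pts Z) \<and>
     (\<forall>z \<in> pts Z. \<forall>b \<in> carrier (stalk Z z). \<exists>V s. opn Y V \<and> pmap i z \<in> V \<and> s \<in> sct Y V \<and>
        b = germ Z z (pre Z i V) (co i V s))"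


subsection \<open>Blowups\<close>

text \<open>The ideal sheaf of the closed set \<open>Z\<close> with its reduced structure: sections whose value at
  every point of \<open>Z\<close> is zero, that is, whose germ there is not a unit.\<close>

definition vanishing :: "('p, 's) rspace \<Rightarrow> 'p set \<Rightarrow> 'p set \<Rightarrow> 's set" where
  "vanishing Y Z V = {s \<in> sct Y V. \<forall>z \<in> V \<inter> Z. germ Y z V s \<notin> Units (stalk Y z)}"

definition inverse_image_ideal :: "('p, 's) rspace \<Rightarrow> ('q, 'r) rspace \<Rightarrow> ('p, 's, 'q, 'r) rmap \<Rightarrow>
    'q set \<Rightarrow> 'p \<Rightarrow> ('p set \<times> 's) set set" where
  "inverse_image_ideal T Y g Z t = genideal (stalk T t)
     {germ T t (pre T g V) (co g V s) | V s. opn Y V \<and> pmap g t \<in> V \<and> s \<in> vanishing Y Z V}"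

definition inverse_image_invertible :: "('p, 's) rspace \<Rightarrow> ('q, 'r) rspace \<Rightarrow>
    ('p, 's, 'q, 'r) rmap \<Rightarrow> 'q set \<Rightarrow> bool" where
  "inverse_image_invertible T Y g Z \<longleftrightarrow> (\<forall>t \<in> pts T. \<exists>W a. opn T W \<and> t \<in> W \<and> a \<in> sct T W \<and>
     (\<forall>W'. opn T W' \<and> W' \<subseteq> W \<longrightarrow> (\<forall>b \<in> sct T W'.
        res T W W' a \<otimes>\<^bsub>sec T W'\<^esub> b = \<zero>\<^bsub>sec T W'\<^esub> \<longrightarrow> b = \<zero>\<^bsub>sec T W'\<^esub>)) \<and>
     (\<forall>w\<in>W. inverse_image_ideal T Y g Z w = cgenideal (stalk T w) (germ T w W a)))"

text \<open>The blowup is characterized as the terminal \<open>Y\<close>-scheme on which the inverse image of the ideal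
  of the center is invertible.\<close>

definition is_blowup :: "('u, 'u) rspace \<Rightarrow> ('u, 'u) rspace \<Rightarrow> ('u, 'u, 'u, 'u) rmap \<Rightarrow>
    'u set \<Rightarrow> bool" where
  "is_blowup B Y p Z \<longleftrightarrow> scheme B \<and> p \<in> rmaps B Y \<and> inverse_image_invertible B Y p Z \<and>
     (\<forall>(T :: ('u, 'u) rspace) g. scheme T \<and> g \<in> rmaps T Y \<and> inverse_image_invertible T Y g Z \<longrightarrow>
        (\<exists>!h. h \<in> rmaps T B \<and> rcomp T B Y p h = g))"


section \<open>The site of smooth schemes over a base\<close>

text \<open>Points and sections of all schemes are drawn from one infinite type. A scheme of finite type
  over a Noetherian scheme on an infinite type \<open>'u\<close> has at most \<open>|'u|\<close> points and at most \<open>|'u|\<close>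
  sections over each open set, so the category below contains a copy of every smooth scheme of
  finite type over \<open>X\<close>.\<close>

type_synonym 'u sch = "('u, 'u) rspace"
type_synonym 'u smap = "('u, 'u, 'u, 'u) rmap"
type_synonym 'u over = "'u sch \<times> 'u smap"
type_synonym 'u sarr = "'u over \<times> 'u smap \<times> 'u over"

abbreviation und :: "'u sarr \<Rightarrow> 'u smap" where
  "und f \<equiv> fst (snd f)"

definition Sm :: "'u sch \<Rightarrow> ('u over, 'u sarr) cat" where
  "Sm X = (let Ob = {(Y, f). scheme Y \<and> f \<in> rmaps Y X \<and> smooth_morphism Y X f \<and> finite_type Y X f} in
     \<lparr>Obj = Ob,
      Arr = {(Y, g, W) | Y g W. Y \<in> Ob \<and> W \<in> Ob \<and> g \<in> rmaps (fst Y) (fst W) \<and>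
        rcomp (fst Y) (fst W) X (snd W) g = snd Y},
      src = fst,
      tgt = (\<lambda>(Y, g, W). W),
      idn = (\<lambda>Y. (Y, rid (fst Y), Y)),
      cmp = (\<lambda>(W', h, V) (Y, g, W). (Y, rcomp (fst Y) (fst W) (fst V) h g, V))\<rparr>)"

definition trivial_residue_ext :: "'u sch \<Rightarrow> 'u sch \<Rightarrow> 'u smap \<Rightarrow> 'u \<Rightarrow> bool" where
  "trivial_residue_ext V Y g v \<longleftrightarrow> (\<forall>b \<in> carrier (stalk V v). \<exists>W s. opn Y W \<and> pmap g v \<in> W \<and>
     s \<in> sct Y W \<and> b \<ominus>\<^bsub>stalk V v\<^esub> germ V v (pre V g W) (co g W s) \<notin> Units (stalk V v))"

definition nisnevich_cover :: "'u sch \<Rightarrow> 'u over \<Rightarrow> 'u sarr set \<Rightarrow> bool" where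
  "nisnevich_cover X Y \<C> \<longleftrightarrow> \<C> \<subseteq> {g \<in> Arr (Sm X). tgt (Sm X) g = Y} \<and>
     (\<forall>g\<in>\<C>. etale_morphism (fst (src (Sm X) g)) (fst Y) (und g)) \<and>
     (\<forall>y \<in> pts (fst Y). \<exists>g\<in>\<C>. \<exists>v \<in> pts (fst (src (Sm X) g)). pmap (und g) v = y \<and>
        trivial_residue_ext (fst (src (Sm X) g)) (fst Y) (und g) v)"

text \<open>\<open>\<pi> : W \<rightarrow> Y\<close> is the projection \<open>Y \<times> \<A>\<^sup>1 \<rightarrow> Y\<close>, i.e. \<open>W\<close> represents
  \<open>V \<mapsto> Hom(V, Y) \<times> \<Gamma>(V, \<O>)\<close>; the section \<open>c\<close> is the coordinate.\<close>

definition affine_line_projection :: "'u sch \<Rightarrow> 'u sarr \<Rightarrow> bool" where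
  "affine_line_projection X \<pi> \<longleftrightarrow> \<pi> \<in> Arr (Sm X) \<and> (\<exists>c \<in> sct (fst (src (Sm X) \<pi>)) (pts (fst (src (Sm X) \<pi>))).
     \<forall>g \<in> Arr (Sm X). tgt (Sm X) g = tgt (Sm X) \<pi> \<longrightarrow>
       (\<forall>s \<in> sct (fst (src (Sm X) g)) (pts (fst (src (Sm X) g))).
         \<exists>!h. h \<in> homs (Sm X) (src (Sm X) g) (src (Sm X) \<pi>) \<and> cmp (Sm X) \<pi> h = g \<and>
           co (und h) (pts (fst (src (Sm X) \<pi>))) c = s))"

definition cartesian :: "'u sch \<Rightarrow> 'u sarr \<Rightarrow> 'u sarr \<Rightarrow> 'u sarr \<Rightarrow> 'u sarr \<Rightarrow> bool" where
  "cartesian X d q p i \<longleftrightarrow> {d, q, p, i} \<subseteq> Arr (Sm X) \<and>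
     src (Sm X) d = src (Sm X) q \<and> tgt (Sm X) d = src (Sm X) p \<and> tgt (Sm X) q = src (Sm X) i \<and>
     tgt (Sm X) p = tgt (Sm X) i \<and> cmp (Sm X) p d = cmp (Sm X) i q \<and>
     (let D = fst (src (Sm X) d); B = fst (src (Sm X) p); Z = fst (src (Sm X) i);
          Y = fst (tgt (Sm X) p) in
      \<forall>(T :: 'u sch) a b. scheme T \<and> a \<in> rmaps T B \<and> b \<in> rmaps T Z \<and>
        rcomp T B Y (und p) a = rcomp T Z Y (und i) b \<longrightarrow>
        (\<exists>!h. h \<in> rmaps T D \<and> rcomp T D B (und d) h = a \<and> rcomp T D Z (und q) h = b))"

definition image_arr :: "'u sarr \<Rightarrow> 'u set" where
  "image_arr f = pmap (und f) ` pts (fst (fst f))"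

definition reduced_closed_subscheme :: "'u sch \<Rightarrow> 'u over \<Rightarrow> 'u set \<Rightarrow> 'u sarr \<Rightarrow> bool" where
  "reduced_closed_subscheme X Y Z i \<longleftrightarrow> i \<in> Arr (Sm X) \<and> tgt (Sm X) i = Y \<and>
     closed_immersion (fst (src (Sm X) i)) (fst Y) (und i) \<and>
     reduced_scheme (fst (src (Sm X) i)) \<and> image_arr i = Z"

definition complement_arr :: "'u sch \<Rightarrow> 'u sarr \<Rightarrow> 'u set" where
  "complement_arr X j = pts (fst (tgt (Sm X) j)) - image_arr j"

text \<open>The open immersions in \<open>Sm\<^sub>X\<close> which induce the elements of \<open>WB\<^sub>n\<close>.\<close>

definition WB_immersions :: "'u sch \<Rightarrow> nat \<Rightarrow> 'u sarr set" where
  "WB_immersions X n = {j \<in> Arr (Sm X).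
     (let Y = tgt (Sm X) j; Z = complement_arr X j in
      open_immersion (fst (src (Sm X) j)) (fst Y) (und j) \<and>
      irreducible_in (topo (fst Y)) (pts (fst Y)) \<and>
      (\<exists>i. reduced_closed_subscheme X Y Z i) \<and>
      enat (n + 1) \<le> codim (fst Y) Z)}"


section \<open>Simplicial sets\<close>

definition simp_maps :: "nat \<Rightarrow> nat \<Rightarrow> (nat \<Rightarrow> nat) set" where
  "simp_maps n m = {\<theta> \<in> {..n} \<rightarrow>\<^sub>E {..m}. mono_on {..n} \<theta>}"

definition simp_id :: "nat \<Rightarrow> nat \<Rightarrow> nat" where
  "simp_id n = (\<lambda>i\<in>{..n}. i)"

record 'x sset =
  spx :: "nat \<Rightarrow> 'x set"
  sop :: "nat \<Rightarrow> nat \<Rightarrow> (nat \<Rightarrow> nat) \<Rightarrow> 'x \<Rightarrow> 'x"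
    \<comment> \<open>\<open>sop S n m \<theta>\<close> maps \<open>m\<close>-simplices to \<open>n\<close>-simplices along \<open>\<theta> : [n] \<rightarrow> [m]\<close>\<close>

text \<open>Geometric realization, as a quotient of the coproduct of the standard topological simplices.\<close>

definition simplex_push :: "nat \<Rightarrow> (nat \<Rightarrow> nat) \<Rightarrow> (nat \<Rightarrow> real) \<Rightarrow> nat \<Rightarrow> real" where
  "simplex_push n \<theta> t = (\<lambda>j. \<Sum>i | i \<le> n \<and> \<theta> i = j. t i)"

definition presimplices :: "'x sset \<Rightarrow> ((nat \<times> 'x) \<times> (nat \<Rightarrow> real)) topology" where
  "presimplices S = sum_topology (\<lambda>(n, x). subtopology (powertop_real UNIV) (standard_simplex n))
     {(n, x). x \<in> spx S n}"

definition glue :: "'x sset \<Rightarrow> ((nat \<times> 'x) \<times> (nat \<Rightarrow> real)) rel" where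
  "glue S = {(((n, sop S n m \<theta> x), t), ((m, x), simplex_push n \<theta> t)) | n m \<theta> x t.
     \<theta> \<in> simp_maps n m \<and> x \<in> spx S m \<and> t \<in> standard_simplex n}"

definition glue_eq :: "'x sset \<Rightarrow> ((nat \<times> 'x) \<times> (nat \<Rightarrow> real)) rel" where
  "glue_eq S = (glue S \<union> (glue S)\<inverse>)\<^sup>*"

type_synonym 'x geo_point = "((nat \<times> 'x) \<times> (nat \<Rightarrow> real)) set"

definition geo :: "'x sset \<Rightarrow> 'x geo_point topology" where
  "geo S = topology (\<lambda>U. U \<subseteq> topspace (presimplices S) // glue_eq S \<and>
     openin (presimplices S) (\<Union>U))"

definition geo_map :: "'y sset \<Rightarrow> (nat \<Rightarrow> 'x \<Rightarrow> 'y) \<Rightarrow> 'x geo_point \<Rightarrow> 'y geo_point" where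
  "geo_map T f c = glue_eq T `` ((\<lambda>((n, x), t). ((n, f n x), t)) ` c)"

definition geo_vertex :: "'x sset \<Rightarrow> 'x \<Rightarrow> 'x geo_point" where
  "geo_vertex S a = glue_eq S `` {((0, a), (\<lambda>i. if i = 0 then 1 else 0))}"

text \<open>Realizations are CW complexes, so weak homotopy equivalences between them are homotopy
  equivalences.\<close>

definition sset_weq :: "'x sset \<Rightarrow> 'y sset \<Rightarrow> (nat \<Rightarrow> 'x \<Rightarrow> 'y) \<Rightarrow> bool" where
  "sset_weq S T f \<longleftrightarrow> continuous_map (geo S) (geo T) (geo_map T f) \<and>
     (\<exists>g. continuous_map (geo T) (geo S) g \<and>
       homotopic_with (\<lambda>_. True) (geo S) (geo S) (g \<circ> geo_map T f) id \<and>
       homotopic_with (\<lambda>_. True) (geo T) (geo T) (geo_map T f \<circ> g) id)"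

text \<open>Representatives \<open>(I\<^sup>n, \<partial>I\<^sup>n) \<rightarrow> (T, b)\<close> of elements of \<open>\<pi>\<^sub>n(T, b)\<close>. For \<open>n = 0\<close> the boundary is
  empty and these are the points of \<open>T\<close>, up to path components.\<close>

definition cube :: "nat \<Rightarrow> (nat \<Rightarrow> real) topology" where
  "cube n = product_topology (\<lambda>_. top_of_set {0..1}) {..<n}"

definition cube_boundary :: "nat \<Rightarrow> (nat \<Rightarrow> real) set" where
  "cube_boundary n = {x \<in> topspace (cube n). \<exists>i<n. x i = 0 \<or> x i = 1}"

definition spheroids :: "'y topology \<Rightarrow> nat \<Rightarrow> 'y \<Rightarrow> ((nat \<Rightarrow> real) \<Rightarrow> 'y) set" where
  "spheroids T n b = {\<sigma>. continuous_map (cube n) T \<sigma> \<and> (\<forall>x \<in> cube_boundary n. \<sigma> x = b)}"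

definition spheroid_homotopic :: "'y topology \<Rightarrow> nat \<Rightarrow> 'y \<Rightarrow>
    ((nat \<Rightarrow> real) \<Rightarrow> 'y) \<Rightarrow> ((nat \<Rightarrow> real) \<Rightarrow> 'y) \<Rightarrow> bool" where
  "spheroid_homotopic T n b = homotopic_with (\<lambda>h. \<forall>x \<in> cube_boundary n. h x = b) (cube n) T"


section \<open>Pointed simplicial presheaves\<close>

text \<open>\<open>act F g n m \<theta> : F(W)\<^sub>m \<rightarrow> F(V)\<^sub>n\<close> is the action of \<open>g : V \<rightarrow> W\<close> in \<open>Sm\<^sub>X\<close> and
  \<open>\<theta> : [n] \<rightarrow> [m]\<close>.\<close>

record ('u, 'e) spsh =
  smp :: "'u over \<Rightarrow> nat \<Rightarrow> 'e set"
  bpt :: "'u over \<Rightarrow> nat \<Rightarrow> 'e"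
  act :: "'u sarr \<Rightarrow> nat \<Rightarrow> nat \<Rightarrow> (nat \<Rightarrow> nat) \<Rightarrow> 'e \<Rightarrow> 'e"

definition is_spsh :: "'u sch \<Rightarrow> ('u, 'e) spsh \<Rightarrow> bool" where
  "is_spsh X F \<longleftrightarrow>
     (\<forall>Y \<in> Obj (Sm X). \<forall>n. bpt F Y n \<in> smp F Y n \<and>
        (\<forall>x \<in> smp F Y n. act F (idn (Sm X) Y) n n (simp_id n) x = x)) \<and>
     (\<forall>g \<in> Arr (Sm X). \<forall>n m. \<forall>\<theta> \<in> simp_maps n m.
        act F g n m \<theta> \<in> smp F (tgt (Sm X) g) m \<rightarrow> smp F (src (Sm X) g) n \<and>
        act F g n m \<theta> (bpt F (tgt (Sm X) g) m) = bpt F (src (Sm X) g) n) \<and>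
     (\<forall>g \<in> Arr (Sm X). \<forall>h \<in> Arr (Sm X). tgt (Sm X) h = src (Sm X) g \<longrightarrow>
        (\<forall>n m l. \<forall>\<theta> \<in> simp_maps n m. \<forall>\<xi> \<in> simp_maps m l. \<forall>x \<in> smp F (tgt (Sm X) g) l.
           act F (cmp (Sm X) g h) n l (compose {..n} \<xi> \<theta>) x = act F h n m \<theta> (act F g m l \<xi> x)))"

type_synonym ('u, 'e) trans = "'u over \<Rightarrow> nat \<Rightarrow> 'e \<Rightarrow> 'e"
type_synonym ('u, 'e) tarr = "('u, 'e) spsh \<times> ('u, 'e) trans \<times> ('u, 'e) spsh"

definition trans_restrict :: "'u sch \<Rightarrow> ('u, 'e) spsh \<Rightarrow> ('u, 'e) trans \<Rightarrow> ('u, 'e) trans" where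
  "trans_restrict X A \<phi> = (\<lambda>Y n. if Y \<in> Obj (Sm X) then restrict (\<phi> Y n) (smp A Y n) else (\<lambda>_. undefined))"

definition transformations :: "'u sch \<Rightarrow> ('u, 'e) spsh \<Rightarrow> ('u, 'e) spsh \<Rightarrow> ('u, 'e) trans set" where
  "transformations X A B = {\<phi>. trans_restrict X A \<phi> = \<phi> \<and>
     (\<forall>Y \<in> Obj (Sm X). \<forall>n. \<phi> Y n \<in> smp A Y n \<rightarrow> smp B Y n \<and> \<phi> Y n (bpt A Y n) = bpt B Y n) \<and>
     (\<forall>g \<in> Arr (Sm X). \<forall>n m. \<forall>\<theta> \<in> simp_maps n m. \<forall>x \<in> smp A (tgt (Sm X) g) m.
        \<phi> (src (Sm X) g) n (act A g n m \<theta> x) = act B g n m \<theta> (\<phi> (tgt (Sm X) g) m x))}"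

definition sPsh :: "'u sch \<Rightarrow> (('u, 'e) spsh, ('u, 'e) tarr) cat" where
  "sPsh X =
     \<lparr>Obj = {F. is_spsh X F},
      Arr = {(A, \<phi>, B) | A \<phi> B. is_spsh X A \<and> is_spsh X B \<and> \<phi> \<in> transformations X A B},
      src = fst,
      tgt = (\<lambda>(A, \<phi>, B). B),
      idn = (\<lambda>A. (A, trans_restrict X A (\<lambda>Y n x. x), A)),
      cmp = (\<lambda>(B', \<psi>, C) (A, \<phi>, B). (A, trans_restrict X A (\<lambda>Y n x. \<psi> Y n (\<phi> Y n x)), C))\<rparr>"

text \<open>The category of presheaves has to be small in order to be a HOL category. Simplices are drawn
  from the following type, where \<open>'v\<close> is arbitrary. It contains the arrows of \<open>Sm\<^sub>X\<close> and a base point,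
  and its cardinality \<open>\<lambda>\<close> satisfies \<open>\<lambda>\<^sup>\<kappa> = \<lambda>\<close> where \<open>\<kappa>\<close> is the cardinality of \<open>'u sarr set set\<close>, so the
  category is closed under the small object arguments which produce fibrant replacements and
  functorial factorizations.\<close>

type_synonym ('u, 'v) elt = "'u sarr set set \<Rightarrow> 'v option"
type_synonym ('u, 'v) psh = "('u, ('u, 'v) elt) spsh"
type_synonym ('u, 'v) parr = "('u, ('u, 'v) elt) tarr"

definition star :: "('u, 'v) elt" where
  "star = (\<lambda>_. None)"

definition elt_of :: "'u sarr \<Rightarrow> ('u, 'v) elt" where
  "elt_of f = (\<lambda>S. if S = {{f}} then Some undefined else None)"

definition arr_of :: "('u, 'v) elt \<Rightarrow> 'u sarr" where
  "arr_of e = (THE f. e = elt_of f)"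

definition rep_plus :: "'u sch \<Rightarrow> 'u over \<Rightarrow> ('u, 'v) psh" where
  "rep_plus X Y =
     \<lparr>smp = (\<lambda>V n. insert star (elt_of ` homs (Sm X) V Y)),
      bpt = (\<lambda>V n. star),
      act = (\<lambda>h n m \<theta> e. if e = star then star else elt_of (cmp (Sm X) (arr_of e) h))\<rparr>"

definition rep_map :: "'u sch \<Rightarrow> 'u sarr \<Rightarrow> ('u, 'v) parr" where
  "rep_map X f = (rep_plus X (src (Sm X) f),
     trans_restrict X (rep_plus X (src (Sm X) f))
       (\<lambda>V n e. if e = star then star else elt_of (cmp (Sm X) f (arr_of e))),
     rep_plus X (tgt (Sm X) f))"

definition point_psh :: "('u, 'v) psh" where
  "point_psh = \<lparr>smp = (\<lambda>V n. {star}), bpt = (\<lambda>V n. star), act = (\<lambda>h n m \<theta> e. star)\<rparr>"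

definition to_point :: "'u sch \<Rightarrow> ('u, 'v) psh \<Rightarrow> ('u, 'v) parr" where
  "to_point X A = (A, trans_restrict X A (\<lambda>V n e. star), point_psh)"

text \<open>The fiber of an arrow over the base point, and the map of fibers over the base points
  induced by a map of the sources.\<close>

definition fiber :: "'u sch \<Rightarrow> ('u, 'e) tarr \<Rightarrow> ('u, 'e) spsh" where
  "fiber X p = (case p of (E, \<phi>, B) \<Rightarrow>
     \<lparr>smp = (\<lambda>V n. {x \<in> smp E V n. \<phi> V n x = bpt B V n}), bpt = bpt E, act = act E\<rparr>)"

definition fiber_map :: "'u sch \<Rightarrow> ('u, 'e) tarr \<Rightarrow> ('u, 'e) tarr \<Rightarrow> ('u, 'e) tarr \<Rightarrow> ('u, 'e) tarr" where
  "fiber_map X p p' e = (fiber X p, trans_restrict X (fiber X p) (fst (snd e)), fiber X p')"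


subsection \<open>The motivic model structure\<close>

definition mono_arrs :: "'u sch \<Rightarrow> ('u, 'e) tarr set" where
  "mono_arrs X = {f \<in> Arr (sPsh X). \<forall>Y \<in> Obj (Sm X). \<forall>n. inj_on (fst (snd f) Y n) (smp (src (sPsh X) f) Y n)}"

definition sections :: "'u sch \<Rightarrow> ('u, 'e) spsh \<Rightarrow> 'u over \<Rightarrow> 'e sset" where
  "sections X A V = \<lparr>spx = smp A V, sop = act A (idn (Sm X) V)\<rparr>"

definition sections_res :: "'u sch \<Rightarrow> ('u, 'e) spsh \<Rightarrow> 'u sarr \<Rightarrow> 'e geo_point \<Rightarrow> 'e geo_point" where
  "sections_res X A g = geo_map (sections X A (src (Sm X) g)) (\<lambda>n. act A g n n (simp_id n))"

text \<open>Local weak equivalences for the Nisnevich topology: for every \<open>V\<close>, every vertex \<open>a\<close> of \<open>A(V)\<close>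
  and every \<open>n\<close> the map of presheaves \<open>\<pi>\<^sub>n(A|V, a) \<rightarrow> \<pi>\<^sub>n(B|V, \<phi> a)\<close> is locally surjective and locally
  injective, i.e. it becomes an isomorphism after Nisnevich sheafification.\<close>

definition nisnevich_weqs :: "'u sch \<Rightarrow> ('u, 'e) tarr set" where
  "nisnevich_weqs X = {(A, \<phi>, B). (A, \<phi>, B) \<in> Arr (sPsh X) \<and>
     (\<forall>n. \<forall>V \<in> Obj (Sm X). \<forall>a \<in> smp A V 0.
       let TA = (\<lambda>W. geo (sections X A W)); TB = (\<lambda>W. geo (sections X B W));
           \<Phi> = (\<lambda>W. geo_map (sections X B W) (\<phi> W));
           va = geo_vertex (sections X A V) a; vb = geo_vertex (sections X B V) (\<phi> V 0 a) in
       (\<forall>\<sigma> \<in> spheroids (TB V) n vb. \<exists>\<C>. nisnevich_cover X V \<C> \<and>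
          (\<forall>g\<in>\<C>. \<exists>\<rho> \<in> spheroids (TA (src (Sm X) g)) n (sections_res X A g va).
             spheroid_homotopic (TB (src (Sm X) g)) n (sections_res X B g vb)
               (\<Phi> (src (Sm X) g) \<circ> \<rho>) (sections_res X B g \<circ> \<sigma>))) \<and>
       (\<forall>\<rho> \<in> spheroids (TA V) n va. \<forall>\<rho>' \<in> spheroids (TA V) n va.
          spheroid_homotopic (TB V) n vb (\<Phi> V \<circ> \<rho>) (\<Phi> V \<circ> \<rho>') \<longrightarrow>
          (\<exists>\<C>. nisnevich_cover X V \<C> \<and>
             (\<forall>g\<in>\<C>. spheroid_homotopic (TA (src (Sm X) g)) n (sections_res X A g va)
                (sections_res X A g \<circ> \<rho>) (sections_res X A g \<circ> \<rho>')))))}"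

text \<open>The pointed function complex \<open>hom(A, Z)\<^sub>n = Hom(A \<and> \<Delta>[n]\<^sub>+, Z)\<close>, with maps out of
  \<open>A \<and> \<Delta>[n]\<^sub>+\<close> written as maps out of \<open>A \<times> \<Delta>[n]\<close> which are trivial on \<open>* \<times> \<Delta>[n]\<close>.\<close>

type_synonym ('u, 'e) fcpx = "'u over \<Rightarrow> nat \<Rightarrow> 'e \<times> (nat \<Rightarrow> nat) \<Rightarrow> 'e"

definition fcpx_restrict :: "'u sch \<Rightarrow> ('u, 'e) spsh \<Rightarrow> nat \<Rightarrow> ('u, 'e) fcpx \<Rightarrow> ('u, 'e) fcpx" where
  "fcpx_restrict X A n \<phi> = (\<lambda>Y m. if Y \<in> Obj (Sm X)
     then restrict (\<phi> Y m) (smp A Y m \<times> simp_maps m n) else (\<lambda>_. undefined))"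

definition function_complex :: "'u sch \<Rightarrow> ('u, 'e) spsh \<Rightarrow> ('u, 'e) spsh \<Rightarrow> ('u, 'e) fcpx sset" where
  "function_complex X A Z =
     \<lparr>spx = (\<lambda>n. {\<phi>. fcpx_restrict X A n \<phi> = \<phi> \<and>
        (\<forall>Y \<in> Obj (Sm X). \<forall>m. \<phi> Y m \<in> smp A Y m \<times> simp_maps m n \<rightarrow> smp Z Y m \<and>
           (\<forall>\<theta> \<in> simp_maps m n. \<phi> Y m (bpt A Y m, \<theta>) = bpt Z Y m)) \<and>
        (\<forall>g \<in> Arr (Sm X). \<forall>k m. \<forall>\<xi> \<in> simp_maps k m. \<forall>x \<in> smp A (tgt (Sm X) g) m.
           \<forall>\<theta> \<in> simp_maps m n.
             \<phi> (src (Sm X) g) k (act A g k m \<xi> x, compose {..k} \<theta> \<xi>)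
               = act Z g k m \<xi> (\<phi> (tgt (Sm X) g) m (x, \<theta>)))}),
      sop = (\<lambda>n' n \<zeta> \<phi>. fcpx_restrict X A n' (\<lambda>Y m (x, \<theta>). \<phi> Y m (x, compose {..m} \<zeta> \<theta>)))\<rparr>"

definition induces_weq :: "'u sch \<Rightarrow> ('u, 'e) tarr \<Rightarrow> ('u, 'e) spsh \<Rightarrow> bool" where
  "induces_weq X f Z \<longleftrightarrow> (case f of (A, \<phi>, B) \<Rightarrow>
     sset_weq (function_complex X B Z) (function_complex X A Z)
       (\<lambda>n \<psi>. fcpx_restrict X A n (\<lambda>Y m (x, \<theta>). \<psi> Y m (\<phi> Y m x, \<theta>))))"

definition nisnevich_fibrant :: "'u sch \<Rightarrow> ('u, 'v) psh \<Rightarrow> bool" where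
  "nisnevich_fibrant X Z \<longleftrightarrow> to_point X Z \<in> rlp (sPsh X) (mono_arrs X \<inter> nisnevich_weqs X)"

text \<open>Motivic fibrant objects and motivic weak equivalences as defined by Jardine.\<close>

definition motivic_fibrant :: "'u sch \<Rightarrow> ('u, 'v) psh \<Rightarrow> bool" where
  "motivic_fibrant X Z \<longleftrightarrow> nisnevich_fibrant X Z \<and>
     (\<forall>\<pi>. affine_line_projection X \<pi> \<longrightarrow> induces_weq X (rep_map X \<pi>) Z)"

definition motivic_weqs :: "'u sch \<Rightarrow> ('u, 'v) parr set" where
  "motivic_weqs X = {f \<in> Arr (sPsh X). \<forall>Z \<in> Obj (sPsh X). motivic_fibrant X Z \<longrightarrow> induces_weq X f Z}"

text \<open>Fibrations of a model structure whose cofibrations are the monomorphisms.\<close>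

definition fibs :: "'u sch \<Rightarrow> ('u, 'e) tarr set \<Rightarrow> ('u, 'e) tarr set" where
  "fibs X Weq = rlp (sPsh X) (mono_arrs X \<inter> Weq)"

definition motivic_model_structure :: "'u sch \<Rightarrow> ('u, 'v) parr ffact \<Rightarrow> ('u, 'v) parr ffact \<Rightarrow> bool" where
  "motivic_model_structure X = model_structure (sPsh X) (motivic_weqs X) (mono_arrs X) (fibs X (motivic_weqs X))"


subsection \<open>The weakly birational localizations\<close>

definition WB :: "'u sch \<Rightarrow> nat \<Rightarrow> ('u, 'v) parr set" where
  "WB X n = rep_map X ` WB_immersions X n"

definition WB_local :: "'u sch \<Rightarrow> nat \<Rightarrow> ('u, 'v) psh \<Rightarrow> bool" where
  "WB_local X n Z \<longleftrightarrow> motivic_fibrant X Z \<and> (\<forall>f \<in> WB X n. induces_weq X f Z)"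

definition WB_weqs :: "'u sch \<Rightarrow> nat \<Rightarrow> ('u, 'v) parr set" where
  "WB_weqs X n = {f \<in> Arr (sPsh X). \<forall>Z \<in> Obj (sPsh X). WB_local X n Z \<longrightarrow> induces_weq X f Z}"

definition WB_model_structure :: "'u sch \<Rightarrow> nat \<Rightarrow> ('u, 'v) parr ffact \<Rightarrow> ('u, 'v) parr ffact \<Rightarrow> bool" where
  "WB_model_structure X n = model_structure (sPsh X) (WB_weqs X n) (mono_arrs X) (fibs X (WB_weqs X n))"


subsection \<open>The towers\<close>

text \<open>\<open>F n\<close> is the factorization into a trivial cofibration and a fibration in \<open>WB\<^sub>n\<M>\<close>.
  The recursion starts at \<open>\<tau>\<^sub>0 A = *\<close>, so that the step from \<open>0\<close> to \<open>1\<close> is the factorization of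
  \<open>A \<rightarrow> *\<close> in \<open>WB\<^sub>0\<M>\<close>.\<close>

primrec tau_le :: "'u sch \<Rightarrow> (nat \<Rightarrow> ('u, 'v) parr ffact) \<Rightarrow> nat \<Rightarrow> ('u, 'v) psh \<Rightarrow> ('u, 'v) parr" where
  "tau_le X F 0 A = to_point X A"
| "tau_le X F (Suc n) A = fl (F n) (tau_le X F n A)"

definition tau :: "'u sch \<Rightarrow> (nat \<Rightarrow> ('u, 'v) parr ffact) \<Rightarrow> nat \<Rightarrow> ('u, 'v) psh \<Rightarrow> ('u, 'v) psh" where
  "tau X F n A = tgt (sPsh X) (tau_le X F n A)"

definition nu :: "'u sch \<Rightarrow> (nat \<Rightarrow> ('u, 'v) parr ffact) \<Rightarrow> nat \<Rightarrow> ('u, 'v) psh \<Rightarrow> ('u, 'v) parr" where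
  "nu X F n A = fr (F n) (tau_le X F n A)"

primrec tau_map :: "'u sch \<Rightarrow> (nat \<Rightarrow> ('u, 'v) parr ffact) \<Rightarrow> nat \<Rightarrow> ('u, 'v) parr \<Rightarrow> ('u, 'v) parr" where
  "tau_map X F 0 h = idn (sPsh X) point_psh"
| "tau_map X F (Suc n) h = fm (F n) (tau_le X F n (src (sPsh X) h)) (tau_le X F n (tgt (sPsh X) h))
     h (tau_map X F n h)"

definition s_tilde :: "'u sch \<Rightarrow> (nat \<Rightarrow> ('u, 'v) parr ffact) \<Rightarrow> nat \<Rightarrow> ('u, 'v) psh \<Rightarrow> ('u, 'v) psh" where
  "s_tilde X F n A = (if n = 0 then tau X F 1 A else fiber X (nu X F n A))"

definition s_tilde_map :: "'u sch \<Rightarrow> (nat \<Rightarrow> ('u, 'v) parr ffact) \<Rightarrow> nat \<Rightarrow> ('u, 'v) parr \<Rightarrow> ('u, 'v) parr" where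
  "s_tilde_map X F n h = (if n = 0 then tau_map X F 1 h
     else fiber_map X (nu X F n (src (sPsh X) h)) (nu X F n (tgt (sPsh X) h)) (tau_map X F (Suc n) h))"

type_synonym ('u, 'v) harr = "(('u, 'v) psh, ('u, 'v) parr) zarr"

definition Hcat :: "'u sch \<Rightarrow> (('u, 'v) psh, ('u, 'v) harr) cat" where
  "Hcat X = localization (sPsh X) (motivic_weqs X)"

definition Ho :: "'u sch \<Rightarrow> ('u, 'v) parr \<Rightarrow> ('u, 'v) harr" where
  "Ho X = loc_fun (sPsh X) (motivic_weqs X)"

definition t_fun :: "'u sch \<Rightarrow> (nat \<Rightarrow> ('u, 'v) parr ffact) \<Rightarrow> nat \<Rightarrow> ('u, 'v) harr \<Rightarrow> ('u, 'v) harr" where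
  "t_fun X F n = induced (sPsh X) (motivic_weqs X) (tau X F n) (tau_map X F n)"

definition s_fun :: "'u sch \<Rightarrow> (nat \<Rightarrow> ('u, 'v) parr ffact) \<Rightarrow> nat \<Rightarrow> ('u, 'v) harr \<Rightarrow> ('u, 'v) harr" where
  "s_fun X F n = induced (sPsh X) (motivic_weqs X) (s_tilde X F n) (s_tilde_map X F n)"

definition ho_rep :: "'u sch \<Rightarrow> 'u sarr \<Rightarrow> ('u, 'v) harr" where
  "ho_rep X f = Ho X (rep_map X f)"

end

theory Submission
  imports Defs "HOL-Algebra.Weak_Morphisms"
begin

text \<open>All the model structures have the monomorphisms as cofibrations, hence the same trivial
  fibrations, so a weak equivalence of \<open>WB\<^sub>m\<M>\<close> between \<open>WB\<^sub>m\<close>-fibrant presheaves is a motivic one.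
  Since \<open>\<tau>\<^sub>k A\<close> is fibrant in \<open>WB\<^sub>m\<M>\<close> for \<open>k \<le> m + 1\<close> and \<open>A \<rightarrow> \<tau>\<^sub>m\<^sub>+\<^sub>1 A\<close> is a weak equivalence of
  \<open>WB\<^sub>m\<M>\<close>, the functors \<open>\<tau>\<^sub>k\<close> with \<open>k \<le> n + 1\<close> turn weak equivalences of \<open>WB\<^sub>n\<M>\<close> into motivic ones.
  The same holds for the fibers \<open>s\<^sub>j\<close> with \<open>j \<le> n\<close>, because a map of fibrations between fibrant objects
  whose components are weak equivalences induces a weak equivalence of fibers. Applied to the
  inclusion of \<open>U\<close> into \<open>Y\<close> and to the equation expressing it as \<open>p\<close> after \<open>u\<close>, this gives the last two
  assertions.

  For the first one, \<open>u\<close> is a map of \<open>WB\<^sub>0\<close>: its complement is \<open>p\<^sup>-\<^sup>1(Z)\<close>, whose ideal is locally generated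
  by a nonzerodivisor. A section all of whose values vanish is locally nilpotent, so \<open>p\<^sup>-\<^sup>1(Z)\<close>
  contains no nonempty open set, and in the local ring at a point of \<open>p\<^sup>-\<^sup>1(Z)\<close> some prime ideal avoids the
  generator. Hence the blowup is irreducible and the codimension is at least 1.\<close>

section \<open>Categories with a zero object and pullbacks\<close>

text \<open>Weak equivalences are defined by mapping into local objects, so two-out-of-three,
  retracts and lifting enter only through the assumed model structures. The homotopy theory is
  therefore done for abstract arrows, with the constant presheaf at the base point as zero object
  and fibers as kernels. Fibers are the delicate point: a weak equivalence of total objects over one
  of bases need not induce one on fibers, and fibrancy of the bases takes the place of right
  properness. It gives a deformation retraction of the bases, which is lifted by means of a path
  object built over a path object of the base, so that all homotopies restrict to kernels.

  On the geometric side the cartesian square speaks of morphisms, while the complement of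
  \<open>u\<close> is a set of points. The passage between them tests the square on residue fields,
  whose elements must first be coded in the type of points and sections, because the square
  quantifies over schemes on that type. Affine charts serve two purposes: nilpotence of sections
  without unit germs, and a bound on the size of stalks.\<close>

lemma homsD: "f \<in> homs C A B \<Longrightarrow> f \<in> Arr C \<and> src C f = A \<and> tgt C f = B"
  by (simp add: homs_def)

locale category =
  fixes C :: "('o, 'a) cat"
  assumes src_obj: "f \<in> Arr C \<Longrightarrow> src C f \<in> Obj C"
    and tgt_obj: "f \<in> Arr C \<Longrightarrow> tgt C f \<in> Obj C"
    and idn_hom: "A \<in> Obj C \<Longrightarrow> idn C A \<in> homs C A A"
    and cmp_hom: "f \<in> homs C A B \<Longrightarrow> g \<in> homs C B D \<Longrightarrow> cmp C g f \<in> homs C A D"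
    and idn_left: "f \<in> homs C A B \<Longrightarrow> cmp C (idn C B) f = f"
    and idn_right: "f \<in> homs C A B \<Longrightarrow> cmp C f (idn C A) = f"
    and cmp_assoc: "f \<in> homs C A B \<Longrightarrow> g \<in> homs C B D \<Longrightarrow> h \<in> homs C D E \<Longrightarrow>
      cmp C (cmp C h g) f = cmp C h (cmp C g f)"
begin

abbreviation hom where "hom \<equiv> homs C"
abbreviation comp (infixl \<open>\<cdot>\<close> 70) where "g \<cdot> f \<equiv> cmp C g f"

lemma hom_obj: "f \<in> hom A B \<Longrightarrow> A \<in> Obj C \<and> B \<in> Obj C"
  using src_obj tgt_obj by (auto simp: homs_def)

lemma arr_hom: "f \<in> Arr C \<Longrightarrow> f \<in> hom (src C f) (tgt C f)"
  by (simp add: homs_def)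

lemma rlpI:
  assumes p: "p \<in> hom E B" and I: "I \<subseteq> Arr C"
    and l: "\<And>i K L a b. i \<in> I \<Longrightarrow> i \<in> hom K L \<Longrightarrow> a \<in> hom K E \<Longrightarrow> b \<in> hom L B \<Longrightarrow> p \<cdot> a = b \<cdot> i \<Longrightarrow>
      \<exists>h \<in> hom L E. h \<cdot> i = a \<and> p \<cdot> h = b"
  shows "p \<in> rlp C I"
  using p I l unfolding rlp_def lifts_def homs_def by blast

lemma rlpE:
  assumes "p \<in> rlp C I" "i \<in> I" "p \<in> hom E B" "i \<in> hom K L" "a \<in> hom K E" "b \<in> hom L B" "p \<cdot> a = b \<cdot> i"
  obtains h where "h \<in> hom L E" "h \<cdot> i = a" "p \<cdot> h = b"
  using assms homsD[OF assms(3)] homsD[OF assms(4)] unfolding rlp_def lifts_def by fastforce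

lemma rlp_comp:
  assumes I: "I \<subseteq> Arr C" and p: "p \<in> rlp C I" "p \<in> hom E B" and q: "q \<in> rlp C I" "q \<in> hom B D"
  shows "q \<cdot> p \<in> rlp C I"
proof (rule rlpI[OF cmp_hom[OF p(2) q(2)] I])
  fix i K L a b assume i: "i \<in> I" "i \<in> hom K L" and a: "a \<in> hom K E" and b: "b \<in> hom L D"
    and e: "q \<cdot> p \<cdot> a = b \<cdot> i"
  have "q \<cdot> (p \<cdot> a) = b \<cdot> i" using e cmp_assoc[OF a p(2) q(2)] by simp
  from rlpE[OF q(1) i(1) q(2) i(2) cmp_hom[OF a p(2)] b this]
  obtain g where g: "g \<in> hom L B" "g \<cdot> i = p \<cdot> a" "q \<cdot> g = b" .
  from rlpE[OF p(1) i(1) p(2) i(2) a g(1) g(2)[symmetric]]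
  obtain h where h: "h \<in> hom L E" "h \<cdot> i = a" "p \<cdot> h = g" .
  show "\<exists>h\<in>hom L E. h \<cdot> i = a \<and> q \<cdot> p \<cdot> h = b"
    using h g cmp_assoc[OF h(1) p(2) q(2)] by auto
qed

section \<open>Pullbacks in an abstract category\<close>

definition is_pb where
  "is_pb f g P a b \<longleftrightarrow> f \<in> Arr C \<and> g \<in> Arr C \<and> a \<in> hom P (src C f) \<and> b \<in> hom P (src C g) \<and> f \<cdot> a = g \<cdot> b \<and>
     (\<forall>T x y. x \<in> hom T (src C f) \<longrightarrow> y \<in> hom T (src C g) \<longrightarrow> f \<cdot> x = g \<cdot> y \<longrightarrow>
        (\<exists>!h. h \<in> hom T P \<and> a \<cdot> h = x \<and> b \<cdot> h = y))"

lemma is_pb_sym: "is_pb f g P a b \<Longrightarrow> is_pb g f P b a"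
  unfolding is_pb_def by (metis (no_types, lifting))

lemma pbE:
  assumes "is_pb f g P a b" "f \<in> hom A D" "g \<in> hom B D" "x \<in> hom T A" "y \<in> hom T B" "f \<cdot> x = g \<cdot> y"
  obtains h where "h \<in> hom T P" "a \<cdot> h = x" "b \<cdot> h = y"
  using assms homsD[OF assms(2)] homsD[OF assms(3)] unfolding is_pb_def by blast

lemma pb_unique:
  assumes P: "is_pb f g P a b" and h: "h \<in> hom T P" "h' \<in> hom T P" "a \<cdot> h = a \<cdot> h'" "b \<cdot> h = b \<cdot> h'"
  shows "h = h'"
proof -
  have a: "a \<in> hom P (src C f)" and b: "b \<in> hom P (src C g)" and f: "f \<in> Arr C" and g: "g \<in> Arr C"
    and e: "f \<cdot> a = g \<cdot> b"
    using P by (auto simp: is_pb_def)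
  \<comment> \<open>\<open>is_pb\<close> does not list a common target; it follows by comparing the
    targets of the two equal composites.\<close>
  have "tgt C f = tgt C g"
    using e homsD[OF cmp_hom[OF a arr_hom[OF f]]] homsD[OF cmp_hom[OF b arr_hom[OF g]]] by simp
  then have "f \<cdot> (a \<cdot> h) = g \<cdot> (b \<cdot> h)"
    using cmp_assoc[OF h(1) a arr_hom[OF f]] cmp_assoc[OF h(1) b arr_hom[OF g]] e by simp
  then have "\<exists>!k. k \<in> hom T P \<and> a \<cdot> k = a \<cdot> h \<and> b \<cdot> k = b \<cdot> h"
    using P cmp_hom[OF h(1) a] cmp_hom[OF h(1) b] unfolding is_pb_def by blast
  then show ?thesis using h by metis
qed

lemma pb_homs:
  assumes "is_pb f g P a b" "f \<in> hom A D" "g \<in> hom B D"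
  shows "a \<in> hom P A" "b \<in> hom P B" "f \<cdot> a = g \<cdot> b"
  using assms homsD[OF assms(2)] homsD[OF assms(3)] unfolding is_pb_def by auto

lemma rlp_pb:
  assumes I: "I \<subseteq> Arr C" and P: "is_pb f g P a b" and f: "f \<in> rlp C I" "f \<in> hom A D" and g: "g \<in> hom B D"
  shows "b \<in> rlp C I"
proof (rule rlpI[OF pb_homs(2)[OF P f(2) g] I])
  note ab = pb_homs[OF P f(2) g]
  fix i K L x y assume i: "i \<in> I" "i \<in> hom K L" and x: "x \<in> hom K P" and y: "y \<in> hom L B"
    and e: "b \<cdot> x = y \<cdot> i"
  have "f \<cdot> (a \<cdot> x) = g \<cdot> y \<cdot> i"
    using cmp_assoc[OF x ab(1) f(2)] cmp_assoc[OF x ab(2) g] cmp_assoc[OF i(2) y g] ab(3) e by simp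
  from rlpE[OF f(1) i(1) f(2) i(2) cmp_hom[OF x ab(1)] cmp_hom[OF y g] this]
  obtain h where h: "h \<in> hom L A" "h \<cdot> i = a \<cdot> x" "f \<cdot> h = g \<cdot> y" .
  from pbE[OF P f(2) g h(1) y h(3)] obtain k where k: "k \<in> hom L P" "a \<cdot> k = h" "b \<cdot> k = y" .
  have "k \<cdot> i = x"
    by (rule pb_unique[OF P cmp_hom[OF i(2) k(1)] x])
      (use cmp_assoc[OF i(2) k(1) ab(1)] cmp_assoc[OF i(2) k(1) ab(2)] h k e in simp_all)
  then show "\<exists>h\<in>hom L P. h \<cdot> i = x \<and> b \<cdot> h = y" using k by blast
qed

end

text \<open>The zero maps \<open>zr A B\<close> are given as data with their absorption laws, rather
  than as composites through \<open>Z\<close>. For pointed presheaves they are the maps constant at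
  the base point, and the fiber over the base point becomes a kernel.\<close>

locale zero_category = category C for C :: "('o, 'a) cat" +
  fixes Z :: 'o and zr :: "'o \<Rightarrow> 'o \<Rightarrow> 'a"
  assumes Z_obj: "Z \<in> Obj C"
    and zr_hom: "A \<in> Obj C \<Longrightarrow> B \<in> Obj C \<Longrightarrow> zr A B \<in> homs C A B"
    and zr_right: "f \<in> homs C B D \<Longrightarrow> A \<in> Obj C \<Longrightarrow> cmp C f (zr A B) = zr A D"
    and zr_left: "f \<in> homs C A B \<Longrightarrow> D \<in> Obj C \<Longrightarrow> cmp C (zr B D) f = zr A D"
    and zr_to_Z: "f \<in> homs C A Z \<Longrightarrow> f = zr A Z"
begin

definition is_ker where
  "is_ker p F j \<longleftrightarrow> p \<in> Arr C \<and> j \<in> hom F (src C p) \<and> p \<cdot> j = zr F (tgt C p) \<and>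
     (\<forall>T x. x \<in> hom T (src C p) \<longrightarrow> p \<cdot> x = zr T (tgt C p) \<longrightarrow> (\<exists>!h. h \<in> hom T F \<and> j \<cdot> h = x))"

lemma ker_homs:
  assumes "is_ker p F j" "p \<in> hom E B" shows "j \<in> hom F E" "p \<cdot> j = zr F B"
  using assms homsD[OF assms(2)] unfolding is_ker_def by auto

lemma kerE:
  assumes "is_ker p F j" "p \<in> hom E B" "x \<in> hom T E" "p \<cdot> x = zr T B"
  obtains h where "h \<in> hom T F" "j \<cdot> h = x"
  using assms homsD[OF assms(2)] unfolding is_ker_def by blast

lemma ker_unique:
  assumes k: "is_ker p F j" and h: "h \<in> hom T F" "h' \<in> hom T F" "j \<cdot> h = j \<cdot> h'"
  shows "h = h'"
proof -
  have j: "j \<in> hom F (src C p)" "p \<in> Arr C" "p \<cdot> j = zr F (tgt C p)" using k by (auto simp: is_ker_def)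
  have "p \<cdot> (j \<cdot> h) = zr T (tgt C p)"
    using cmp_assoc[OF h(1) j(1) arr_hom[OF j(2)]] j(3) zr_left[OF h(1) tgt_obj[OF j(2)]] by simp
  then have "\<exists>!g. g \<in> hom T F \<and> j \<cdot> g = j \<cdot> h"
    using k cmp_hom[OF h(1) j(1)] unfolding is_ker_def by blast
  then show ?thesis using h by metis
qed

lemma ker_map:
  assumes k: "is_ker p F j" "p \<in> hom E B" and k': "is_ker p' F' j'" "p' \<in> hom E' B'"
    and e: "e \<in> hom E E'" and b: "b \<in> hom B B'" and pe: "p' \<cdot> e = b \<cdot> p"
  obtains g where "g \<in> hom F F'" "j' \<cdot> g = e \<cdot> j"
proof -
  note j = ker_homs[OF k]
  have "p' \<cdot> (e \<cdot> j) = b \<cdot> zr F B"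
    using cmp_assoc[OF j(1) e k'(2)] cmp_assoc[OF j(1) k(2) b] pe j(2) by simp
  then have "p' \<cdot> (e \<cdot> j) = zr F B'" using zr_right[OF b] hom_obj[OF j(1)] by simp
  from kerE[OF k' cmp_hom[OF j(1) e] this] that show ?thesis by blast
qed

text \<open>Auxiliary fibers come from the assumed pullbacks, whereas the fibers of the towers are
  explicit presheaves. Kernels are the common form in which both can be mapped to each
  other.\<close>

lemma pb_zero_is_ker:
  assumes P: "is_pb p (zr Z B) F j z" and p: "p \<in> hom E B"
  shows "is_ker p F j"
proof -
  have B: "B \<in> Obj C" using hom_obj[OF p] by simp
  note zB = zr_hom[OF Z_obj B]
  note h = pb_homs[OF P p zB]
  have F: "F \<in> Obj C" using hom_obj[OF h(1)] by simp
  have pj: "p \<cdot> j = zr F B" using h(3) zr_left[OF h(2) B] by simp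
  have "\<exists>!h. h \<in> hom T F \<and> j \<cdot> h = x" if x: "x \<in> hom T E" "p \<cdot> x = zr T B" for T x
  proof -
    have T: "T \<in> Obj C" using hom_obj[OF x(1)] by simp
    have "p \<cdot> x = zr Z B \<cdot> zr T Z" using x(2) zr_left[OF zr_hom[OF T Z_obj] B] by simp
    from pbE[OF P p zB x(1) zr_hom[OF T Z_obj] this] obtain k where k: "k \<in> hom T F" "j \<cdot> k = x" by blast
    have "k' = k" if "k' \<in> hom T F" "j \<cdot> k' = x" for k'
      by (rule pb_unique[OF P that(1) k(1)])
        (use that k zr_to_Z[OF cmp_hom[OF that(1) h(2)]] zr_to_Z[OF cmp_hom[OF k(1) h(2)]] in simp_all)
    with k show ?thesis by blast
  qed
  then show ?thesis using p homsD[OF p] h(1) pj unfolding is_ker_def by simp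
qed

end

section \<open>Model structures determined by their cofibrations and weak equivalences\<close>

text \<open>\<open>Fib_eq\<close> holds in every model structure. Stated here, it allows fibrations
  to be recognized by lifting, and fibrations of two structures with the same \<open>Cof\<close> to
  be compared through their weak equivalences.\<close>

locale model_category = zero_category C Z zr for C :: "('o, 'a) cat" and Z zr +
  fixes W Cof Fib :: "'a set" and TF CT :: "'a ffact"
  assumes pullbacks: "f \<in> homs C A D \<Longrightarrow> g \<in> homs C B D \<Longrightarrow> \<exists>P a b. is_pb f g P a b"
    and model: "model_structure C W Cof Fib TF CT"
    and Fib_eq: "Fib = rlp C (Cof \<inter> W)"
begin

section \<open>Weak equivalences, factorizations and trivial fibrations\<close>

lemma Cof_arr: "Cof \<subseteq> Arr C" and TCof_arr: "Cof \<inter> W \<subseteq> Arr C"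
  using model unfolding model_structure_def by auto

lemma W_two_of_three:
  assumes "f \<in> hom A B" "g \<in> hom B D"
  shows "f \<in> W \<and> g \<in> W \<longrightarrow> g \<cdot> f \<in> W" "f \<in> W \<and> g \<cdot> f \<in> W \<longrightarrow> g \<in> W" "g \<in> W \<and> g \<cdot> f \<in> W \<longrightarrow> f \<in> W"
proof -
  have "f \<in> Arr C \<and> g \<in> Arr C \<and> tgt C f = src C g" using homsD[OF assms(1)] homsD[OF assms(2)] by simp
  moreover have "\<forall>f g. f \<in> Arr C \<and> g \<in> Arr C \<and> tgt C f = src C g \<longrightarrow>
      (f \<in> W \<and> g \<in> W \<longrightarrow> g \<cdot> f \<in> W) \<and> (f \<in> W \<and> g \<cdot> f \<in> W \<longrightarrow> g \<in> W) \<and> (g \<in> W \<and> g \<cdot> f \<in> W \<longrightarrow> f \<in> W)"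
    using model unfolding model_structure_def by blast
  ultimately show "f \<in> W \<and> g \<in> W \<longrightarrow> g \<cdot> f \<in> W" "f \<in> W \<and> g \<cdot> f \<in> W \<longrightarrow> g \<in> W" "g \<in> W \<and> g \<cdot> f \<in> W \<longrightarrow> f \<in> W"
    by blast+
qed

lemma W_comp: "f \<in> W \<Longrightarrow> g \<in> W \<Longrightarrow> f \<in> hom A B \<Longrightarrow> g \<in> hom B D \<Longrightarrow> g \<cdot> f \<in> W"
  and W_cancel_left: "f \<in> W \<Longrightarrow> g \<cdot> f \<in> W \<Longrightarrow> f \<in> hom A B \<Longrightarrow> g \<in> hom B D \<Longrightarrow> g \<in> W"
  and W_cancel_right: "g \<in> W \<Longrightarrow> g \<cdot> f \<in> W \<Longrightarrow> f \<in> hom A B \<Longrightarrow> g \<in> hom B D \<Longrightarrow> f \<in> W"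
  using W_two_of_three by blast+

lemma retract_W: "retract_arr C f g \<Longrightarrow> g \<in> W \<Longrightarrow> f \<in> W"
  and retract_Fib: "retract_arr C f g \<Longrightarrow> g \<in> Fib \<Longrightarrow> f \<in> Fib"
  using model unfolding model_structure_def by blast+

lemma TF_factor:
  assumes f: "f \<in> hom A B"
  obtains E l r where "l \<in> hom A E" "r \<in> hom E B" "l \<in> Cof" "l \<in> W" "r \<in> Fib" "r \<cdot> l = f"
proof -
  have "functorial_factorization C (Cof \<inter> W) Fib TF" using model by (simp add: model_structure_def)
  then have "fl TF f \<in> Cof \<inter> W \<and> fr TF f \<in> Fib \<and> src C (fl TF f) = src C f \<and>
      tgt C (fl TF f) = src C (fr TF f) \<and> tgt C (fr TF f) = tgt C f \<and> fr TF f \<cdot> fl TF f = f"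
    using homsD[OF f] unfolding functorial_factorization_def by blast
  moreover have "Fib \<subseteq> Arr C" using Fib_eq by (auto simp: rlp_def)
  ultimately show ?thesis using that[of "fl TF f" "tgt C (fl TF f)" "fr TF f"] homsD[OF f] Cof_arr by (auto simp: homs_def)
qed

lemma CT_factor:
  assumes f: "f \<in> hom A B"
  obtains E l r where "l \<in> hom A E" "r \<in> hom E B" "l \<in> Cof" "r \<in> Fib" "r \<in> W" "r \<cdot> l = f"
proof -
  have "functorial_factorization C Cof (Fib \<inter> W) CT" using model by (simp add: model_structure_def)
  then have "fl CT f \<in> Cof \<and> fr CT f \<in> Fib \<inter> W \<and> src C (fl CT f) = src C f \<and>
      tgt C (fl CT f) = src C (fr CT f) \<and> tgt C (fr CT f) = tgt C f \<and> fr CT f \<cdot> fl CT f = f"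
    using homsD[OF f] unfolding functorial_factorization_def by blast
  moreover have "Fib \<subseteq> Arr C" using Fib_eq by (auto simp: rlp_def)
  ultimately show ?thesis using that[of "fl CT f" "tgt C (fl CT f)" "fr CT f"] homsD[OF f] Cof_arr by (auto simp: homs_def)
qed

text \<open>Retract argument: factor \<open>p\<close> into a cofibration and a trivial fibration
  \<open>r\<close>; lifting \<open>p\<close> against the cofibration makes \<open>p\<close> a
  retract of \<open>r\<close>. The left side mentions \<open>Cof\<close> alone, which is what allows
  trivial fibrations to be carried from one localization to another.\<close>

lemma trivial_fib_iff: "p \<in> rlp C Cof \<longleftrightarrow> p \<in> Fib \<and> p \<in> W"
proof
  assume "p \<in> Fib \<and> p \<in> W"
  then show "p \<in> rlp C Cof"
    using model unfolding model_structure_def rlp_def by blast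
next
  assume p: "p \<in> rlp C Cof"
  then have ph: "p \<in> hom (src C p) (tgt C p)" by (simp add: rlp_def arr_hom)
  from CT_factor[OF ph] obtain E l r where lr: "l \<in> hom (src C p) E" "r \<in> hom E (tgt C p)" "l \<in> Cof" "r \<in> Fib" "r \<in> W" "r \<cdot> l = p"
    by metis
  note obj = hom_obj[OF ph]
  have "p \<cdot> idn C (src C p) = r \<cdot> l" using idn_right[OF ph] lr by simp
  from rlpE[OF p lr(3) ph lr(1) idn_hom[OF conjunct1[OF obj]] lr(2) this]
  obtain h where h: "h \<in> hom E (src C p)" "h \<cdot> l = idn C (src C p)" "p \<cdot> h = r" .
  have "retract_arr C p r"
    unfolding retract_arr_def
    using homsD[OF ph] homsD[OF lr(2)] lr(1,6) h idn_left[OF lr(2)] idn_left[OF ph] idn_hom[OF conjunct2[OF obj]]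
      idn_left[OF idn_hom[OF conjunct2[OF obj]]]
    by (intro conjI exI[of _ l] exI[of _ "idn C (tgt C p)"] exI[of _ h]) simp_all
  then show "p \<in> Fib \<and> p \<in> W" using retract_Fib retract_W lr by blast
qed

text \<open>The axioms do not list identities among the weak equivalences. An identity lifts against
  everything, so it is a trivial fibration.\<close>

lemma idn_W: assumes A: "A \<in> Obj C" shows "idn C A \<in> W"
proof -
  note i = idn_hom[OF A]
  have "idn C A \<in> rlp C Cof"
  proof (rule rlpI[OF i Cof_arr])
    fix i' K L a b assume h: "i' \<in> hom K L" "a \<in> hom K A" "b \<in> hom L A" "idn C A \<cdot> a = b \<cdot> i'"
    then show "\<exists>h\<in>hom L A. h \<cdot> i' = a \<and> idn C A \<cdot> h = b"
      using idn_left[OF h(2)] idn_left[OF h(3)] by auto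
  qed
  then show ?thesis by (simp add: trivial_fib_iff)
qed

lemma W_section:
  assumes e: "e \<in> hom E A" and s: "s \<in> hom A E" and es: "e \<cdot> s = idn C A"
  shows "e \<in> W \<longleftrightarrow> s \<in> W"
proof -
  have "idn C A \<in> W" using idn_W hom_obj[OF e] by simp
  then show ?thesis using W_cancel_left[OF _ _ s e] W_cancel_right[OF _ _ s e] es by auto
qed

text \<open>The square with \<open>i\<close> on sources and the identity of \<open>E\<close> on
  targets exhibits \<open>i\<close> as a retract of \<open>i \<cdot> r\<close>. This replaces
  two-out-of-six: once a homotopy shows that \<open>i \<cdot> r\<close> is a weak equivalence, so is
  \<open>i\<close>.\<close>

lemma W_retraction:
  assumes i: "i \<in> hom A E" and r: "r \<in> hom E A" and ri: "r \<cdot> i = idn C A" and ir: "i \<cdot> r \<in> W"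
  shows "i \<in> W"
proof -
  have A: "A \<in> Obj C" and E: "E \<in> Obj C" using hom_obj[OF i] by auto
  have "retract_arr C i (i \<cdot> r)"
    unfolding retract_arr_def
    using homsD[OF i] homsD[OF cmp_hom[OF r i]] i r ri idn_hom[OF E] cmp_assoc[OF i r i] idn_right[OF i] idn_left[OF i]
      idn_left[OF idn_hom[OF E]] idn_left[OF cmp_hom[OF r i]]
    by (intro conjI exI[of _ i] exI[of _ "idn C E"] exI[of _ r]) simp_all
  then show ?thesis using retract_W ir by blast
qed

text \<open>The path object is a factorization of \<open>E \<rightarrow> Q\<close>, where \<open>Q\<close> consists of the triples
  \<open>(x, \<beta>, y)\<close> with \<open>\<beta>\<close> a path in \<open>B\<close> from \<open>p x\<close> to \<open>p y\<close>.\<close>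

lemma path_object:
  assumes p: "p \<in> Fib" "p \<in> hom E B"
    and d: "d0 \<in> hom BI B" "d1 \<in> hom BI B" "d0 \<in> rlp C Cof"
    and c: "c \<in> hom B BI" "d0 \<cdot> c = idn C B" "d1 \<cdot> c = idn C B"
  obtains EI \<pi> e0 e1 s where
    "\<pi> \<in> hom EI BI" "e0 \<in> hom EI E" "e1 \<in> hom EI E" "s \<in> hom E EI"
    "e0 \<in> rlp C Cof" "e0 \<cdot> s = idn C E" "e1 \<cdot> s = idn C E" "\<pi> \<cdot> s = c \<cdot> p"
    "p \<cdot> e0 = d0 \<cdot> \<pi>" "p \<cdot> e1 = d1 \<cdot> \<pi>"
    "\<And>i K L \<eta> \<beta> x. i \<in> Cof \<Longrightarrow> i \<in> hom K L \<Longrightarrow> \<eta> \<in> hom K EI \<Longrightarrow> \<beta> \<in> hom L BI \<Longrightarrow> x \<in> hom L E \<Longrightarrow>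
       p \<cdot> x = d0 \<cdot> \<beta> \<Longrightarrow> \<pi> \<cdot> \<eta> = \<beta> \<cdot> i \<Longrightarrow> e0 \<cdot> \<eta> = x \<cdot> i \<Longrightarrow>
       \<exists>h \<in> hom L EI. h \<cdot> i = \<eta> \<and> \<pi> \<cdot> h = \<beta> \<and> e0 \<cdot> h = x"
    "\<And>i K L \<eta> \<beta> x y. i \<in> Cof \<Longrightarrow> i \<in> W \<Longrightarrow> i \<in> hom K L \<Longrightarrow> \<eta> \<in> hom K EI \<Longrightarrow> \<beta> \<in> hom L BI \<Longrightarrow>
       x \<in> hom L E \<Longrightarrow> y \<in> hom L E \<Longrightarrow> p \<cdot> x = d0 \<cdot> \<beta> \<Longrightarrow> p \<cdot> y = d1 \<cdot> \<beta> \<Longrightarrow>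
       \<pi> \<cdot> \<eta> = \<beta> \<cdot> i \<Longrightarrow> e0 \<cdot> \<eta> = x \<cdot> i \<Longrightarrow> e1 \<cdot> \<eta> = y \<cdot> i \<Longrightarrow>
       \<exists>h \<in> hom L EI. h \<cdot> i = \<eta> \<and> \<pi> \<cdot> h = \<beta> \<and> e0 \<cdot> h = x \<and> e1 \<cdot> h = y"
proof -
  have pF: "p \<in> rlp C (Cof \<inter> W)" using p Fib_eq by simp
  have E: "E \<in> Obj C" using hom_obj[OF p(2)] by simp
  note idE = idn_hom[OF E]
  \<comment> \<open>\<open>Q\<close> is formed in two stages. \<open>Q1\<close> holds the pairs of a
    point and a path in \<open>B\<close> starting below it, and only then is the end point
    \<open>y\<close> added. The intermediate object matters because \<open>a1\<close> is a base
    change of the trivial fibration \<open>d0\<close>.\<close>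
  obtain Q1 a1 b1 where Q1: "is_pb p d0 Q1 a1 b1" using pullbacks[OF p(2) d(1)] by blast
  note q1 = pb_homs[OF Q1 p(2) d(1)]
  note db = cmp_hom[OF q1(2) d(2)]
  obtain Q a2 b2 where Q: "is_pb p (d1 \<cdot> b1) Q a2 b2" using pullbacks[OF p(2) db] by blast
  note q = pb_homs[OF Q p(2) db]
  have cp: "c \<cdot> p \<in> hom E BI" using cmp_hom[OF p(2) c(1)] .
  have "p \<cdot> idn C E = d0 \<cdot> (c \<cdot> p)"
    using idn_right[OF p(2)] cmp_assoc[OF p(2) c(1) d(1)] c(2) idn_left[OF p(2)] by simp
  from pbE[OF Q1 p(2) d(1) idE cp this]
  obtain \<delta> where \<delta>: "\<delta> \<in> hom E Q1" "a1 \<cdot> \<delta> = idn C E" "b1 \<cdot> \<delta> = c \<cdot> p" .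
  have "p \<cdot> idn C E = d1 \<cdot> b1 \<cdot> \<delta>"
    using idn_right[OF p(2)] cmp_assoc[OF p(2) c(1) d(2)] c(3) idn_left[OF p(2)] cmp_assoc[OF \<delta>(1) q1(2) d(2)] \<delta>(3) by simp
  from pbE[OF Q p(2) db idE \<delta>(1) this]
  obtain \<epsilon> where \<epsilon>: "\<epsilon> \<in> hom E Q" "a2 \<cdot> \<epsilon> = idn C E" "b2 \<cdot> \<epsilon> = \<delta>" .
  from TF_factor[OF \<epsilon>(1)] obtain EI s r where sr: "s \<in> hom E EI" "r \<in> hom EI Q" "s \<in> Cof" "s \<in> W" "r \<in> Fib" "r \<cdot> s = \<epsilon>"
    by metis
  define t where "t = b2 \<cdot> r"
  have t: "t \<in> hom EI Q1" unfolding t_def using cmp_hom[OF sr(2) q(2)] .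
  define e0 e1 \<pi> where "e0 = a1 \<cdot> t" and "e1 = a2 \<cdot> r" and "\<pi> = b1 \<cdot> t"
  have e0: "e0 \<in> hom EI E" and e1: "e1 \<in> hom EI E" and \<pi>: "\<pi> \<in> hom EI BI"
    unfolding e0_def e1_def \<pi>_def using cmp_hom[OF t q1(1)] cmp_hom[OF sr(2) q(1)] cmp_hom[OF t q1(2)] .
  have ts: "t \<cdot> s = \<delta>" unfolding t_def using cmp_assoc[OF sr(1,2) q(2)] sr(6) \<epsilon>(3) by simp
  have e0s: "e0 \<cdot> s = idn C E" unfolding e0_def using cmp_assoc[OF sr(1) t q1(1)] ts \<delta>(2) by simp
  have e1s: "e1 \<cdot> s = idn C E" unfolding e1_def using cmp_assoc[OF sr(1,2) q(1)] sr(6) \<epsilon>(2) by simp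
  have \<pi>s: "\<pi> \<cdot> s = c \<cdot> p" unfolding \<pi>_def using cmp_assoc[OF sr(1) t q1(2)] ts \<delta>(3) by simp
  have pe0: "p \<cdot> e0 = d0 \<cdot> \<pi>" unfolding e0_def \<pi>_def using cmp_assoc[OF t q1(1) p(2)] cmp_assoc[OF t q1(2) d(1)] q1(3) by simp
  have pe1: "p \<cdot> e1 = d1 \<cdot> \<pi>" unfolding e1_def \<pi>_def t_def
    using cmp_assoc[OF sr(2) q(1) p(2)] q(3) cmp_assoc[OF sr(2) q(2) db] cmp_assoc[OF cmp_hom[OF sr(2) q(2)] q1(2) d(2)] by simp
  have a1: "a1 \<in> rlp C Cof" by (rule rlp_pb[OF Cof_arr is_pb_sym[OF Q1] d(3,1) p(2)])
  have "b2 \<in> rlp C (Cof \<inter> W)" by (rule rlp_pb[OF TCof_arr Q pF p(2) db])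
  then have tF: "t \<in> Fib" unfolding t_def Fib_eq using rlp_comp[OF TCof_arr _ sr(2) _ q(2)] sr(5) Fib_eq by blast
  have e0W: "e0 \<in> W" using W_section[OF e0 sr(1) e0s] sr(4) by blast
  \<comment> \<open>\<open>e0\<close> has the weak equivalence \<open>s\<close> as a section and
    equals \<open>a1 \<cdot> t\<close>, so two-out-of-three applies. Hence \<open>t\<close> is a
    trivial fibration, and prescribing only the initial point and the path in the base can be lifted
    against every cofibration.\<close>
  have tW: "t \<in> W" by (rule W_cancel_right[of a1 t, OF _ _ t q1(1)]) (use a1 trivial_fib_iff e0W e0_def in auto)
  have tT: "t \<in> rlp C Cof" using tF tW trivial_fib_iff by simp
  have e0T: "e0 \<in> rlp C Cof" unfolding e0_def by (rule rlp_comp[OF Cof_arr tT t a1 q1(1)])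
  have L1: "\<exists>h \<in> hom L EI. h \<cdot> i = \<eta> \<and> \<pi> \<cdot> h = \<beta> \<and> e0 \<cdot> h = x"
    if i: "i \<in> Cof" "i \<in> hom K L" and \<eta>: "\<eta> \<in> hom K EI" and \<beta>: "\<beta> \<in> hom L BI" and x: "x \<in> hom L E"
      and eq: "p \<cdot> x = d0 \<cdot> \<beta>" "\<pi> \<cdot> \<eta> = \<beta> \<cdot> i" "e0 \<cdot> \<eta> = x \<cdot> i" for i K L \<eta> \<beta> x
  proof -
    from pbE[OF Q1 p(2) d(1) x \<beta> eq(1)] obtain v where v: "v \<in> hom L Q1" "a1 \<cdot> v = x" "b1 \<cdot> v = \<beta>" .
    have "t \<cdot> \<eta> = v \<cdot> i"
      by (rule pb_unique[OF Q1 cmp_hom[OF \<eta> t] cmp_hom[OF i(2) v(1)]])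
        (use eq cmp_assoc[OF \<eta> t q1(1)] cmp_assoc[OF \<eta> t q1(2)] cmp_assoc[OF i(2) v(1) q1(1)] cmp_assoc[OF i(2) v(1) q1(2)] v
          in \<open>simp_all add: e0_def \<pi>_def\<close>)
    from rlpE[OF tT i(1) t i(2) \<eta> v(1) this] obtain h where h: "h \<in> hom L EI" "h \<cdot> i = \<eta>" "t \<cdot> h = v" .
    then show ?thesis using v cmp_assoc[OF h(1) t q1(1)] cmp_assoc[OF h(1) t q1(2)]
      by (intro bexI[of _ h]) (simp_all add: e0_def \<pi>_def)
  qed
  have L2: "\<exists>h \<in> hom L EI. h \<cdot> i = \<eta> \<and> \<pi> \<cdot> h = \<beta> \<and> e0 \<cdot> h = x \<and> e1 \<cdot> h = y"
    if i: "i \<in> Cof" "i \<in> W" "i \<in> hom K L" and \<eta>: "\<eta> \<in> hom K EI" and \<beta>: "\<beta> \<in> hom L BI" and x: "x \<in> hom L E" and y: "y \<in> hom L E"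
      and eq: "p \<cdot> x = d0 \<cdot> \<beta>" "p \<cdot> y = d1 \<cdot> \<beta>" "\<pi> \<cdot> \<eta> = \<beta> \<cdot> i" "e0 \<cdot> \<eta> = x \<cdot> i" "e1 \<cdot> \<eta> = y \<cdot> i" for i K L \<eta> \<beta> x y
  proof -
    from pbE[OF Q1 p(2) d(1) x \<beta> eq(1)] obtain v where v: "v \<in> hom L Q1" "a1 \<cdot> v = x" "b1 \<cdot> v = \<beta>" .
    have "p \<cdot> y = d1 \<cdot> b1 \<cdot> v" using eq(2) v(3) cmp_assoc[OF v(1) q1(2) d(2)] by simp
    from pbE[OF Q p(2) db y v(1) this] obtain w where w: "w \<in> hom L Q" "a2 \<cdot> w = y" "b2 \<cdot> w = v" .
    have "t \<cdot> \<eta> = v \<cdot> i"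
      by (rule pb_unique[OF Q1 cmp_hom[OF \<eta> t] cmp_hom[OF i(3) v(1)]])
        (use eq cmp_assoc[OF \<eta> t q1(1)] cmp_assoc[OF \<eta> t q1(2)] cmp_assoc[OF i(3) v(1) q1(1)] cmp_assoc[OF i(3) v(1) q1(2)] v
          in \<open>simp_all add: e0_def \<pi>_def\<close>)
    then have "r \<cdot> \<eta> = w \<cdot> i"
      by (intro pb_unique[OF Q cmp_hom[OF \<eta> sr(2)] cmp_hom[OF i(3) w(1)]])
        (use eq cmp_assoc[OF \<eta> sr(2) q(1)] cmp_assoc[OF \<eta> sr(2) q(2)] cmp_assoc[OF i(3) w(1) q(1)] cmp_assoc[OF i(3) w(1) q(2)] w
          in \<open>simp_all add: e1_def t_def\<close>)
    moreover have "r \<in> rlp C (Cof \<inter> W)" using sr(5) Fib_eq by simp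
    ultimately obtain h where h: "h \<in> hom L EI" "h \<cdot> i = \<eta>" "r \<cdot> h = w"
      using rlpE[OF _ IntI[OF i(1,2)] sr(2) i(3) \<eta> w(1)] by blast
    have th: "t \<cdot> h = v" unfolding t_def using cmp_assoc[OF h(1) sr(2) q(2)] h(3) w(3) by simp
    then show ?thesis using h v w cmp_assoc[OF h(1) t q1(1)] cmp_assoc[OF h(1) t q1(2)] cmp_assoc[OF h(1) sr(2) q(1)]
      by (intro bexI[of _ h]) (simp_all add: e0_def \<pi>_def e1_def)
  qed
  show thesis by (rule that[OF \<pi> e0 e1 sr(1) e0T e0s e1s \<pi>s pe0 pe1 L1 L2])
qed

section \<open>Fibrant objects and homotopies\<close>

definition fibrant where "fibrant A \<longleftrightarrow> A \<in> Obj C \<and> zr A Z \<in> Fib"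

lemma fibrant_hom: "fibrant A \<Longrightarrow> zr A Z \<in> hom A Z"
  by (simp add: fibrant_def zr_hom Z_obj)

lemma fibrant_total:
  assumes B: "fibrant B" and p: "p \<in> Fib" "p \<in> hom E B" shows "fibrant E"
proof -
  have "zr B Z \<in> Fib" using B by (simp add: fibrant_def)
  then have "zr B Z \<cdot> p \<in> Fib"
    using rlp_comp[OF TCof_arr _ p(2) _ fibrant_hom[OF B]] p(1) Fib_eq by simp
  then show ?thesis using zr_left[OF p(2) Z_obj] hom_obj[OF p(2)] by (simp add: fibrant_def)
qed

text \<open>This is the relative path object for \<open>B \<rightarrow> Z\<close>, where
  \<open>Z\<close> serves as its own path object. All conditions over \<open>Z\<close> hold because
  maps into \<open>Z\<close> are unique.\<close>

lemma fibrant_path: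
  assumes B: "fibrant B"
  obtains BI d0 d1 c where "d0 \<in> hom BI B" "d1 \<in> hom BI B" "d0 \<in> rlp C Cof"
    "c \<in> hom B BI" "d0 \<cdot> c = idn C B" "d1 \<cdot> c = idn C B"
    "\<And>i K L \<eta> x y. i \<in> Cof \<Longrightarrow> i \<in> W \<Longrightarrow> i \<in> hom K L \<Longrightarrow> \<eta> \<in> hom K BI \<Longrightarrow> x \<in> hom L B \<Longrightarrow> y \<in> hom L B \<Longrightarrow>
       d0 \<cdot> \<eta> = x \<cdot> i \<Longrightarrow> d1 \<cdot> \<eta> = y \<cdot> i \<Longrightarrow> \<exists>h \<in> hom L BI. h \<cdot> i = \<eta> \<and> d0 \<cdot> h = x \<and> d1 \<cdot> h = y"
proof -
  note iZ = idn_hom[OF Z_obj]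
  have iT: "idn C Z \<in> rlp C Cof"
    by (rule rlpI[OF iZ Cof_arr]) (use idn_left in metis)
  have pF: "zr B Z \<in> Fib" using B by (simp add: fibrant_def)
  from path_object[OF pF fibrant_hom[OF B] iZ iZ iT iZ idn_left[OF iZ] idn_left[OF iZ]]
  obtain BI \<pi> d0 d1 c where P: "\<pi> \<in> hom BI Z" "d0 \<in> hom BI B" "d1 \<in> hom BI B" "c \<in> hom B BI" "d0 \<in> rlp C Cof"
    "d0 \<cdot> c = idn C B" "d1 \<cdot> c = idn C B" and L: "\<And>i K L \<eta> \<beta> x y. i \<in> Cof \<Longrightarrow> i \<in> W \<Longrightarrow> i \<in> hom K L \<Longrightarrow> \<eta> \<in> hom K BI \<Longrightarrow> \<beta> \<in> hom L Z \<Longrightarrow>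
       x \<in> hom L B \<Longrightarrow> y \<in> hom L B \<Longrightarrow> zr B Z \<cdot> x = idn C Z \<cdot> \<beta> \<Longrightarrow> zr B Z \<cdot> y = idn C Z \<cdot> \<beta> \<Longrightarrow>
       \<pi> \<cdot> \<eta> = \<beta> \<cdot> i \<Longrightarrow> d0 \<cdot> \<eta> = x \<cdot> i \<Longrightarrow> d1 \<cdot> \<eta> = y \<cdot> i \<Longrightarrow>
       \<exists>h \<in> hom L BI. h \<cdot> i = \<eta> \<and> \<pi> \<cdot> h = \<beta> \<and> d0 \<cdot> h = x \<and> d1 \<cdot> h = y"
    by metis
  have "\<exists>h \<in> hom L BI. h \<cdot> i = \<eta> \<and> d0 \<cdot> h = x \<and> d1 \<cdot> h = y"
    if i: "i \<in> Cof" "i \<in> W" "i \<in> hom K L" and \<eta>: "\<eta> \<in> hom K BI" and x: "x \<in> hom L B" and y: "y \<in> hom L B"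
      and eq: "d0 \<cdot> \<eta> = x \<cdot> i" "d1 \<cdot> \<eta> = y \<cdot> i" for i K L \<eta> x y
  proof -
    have Lo: "L \<in> Obj C" using hom_obj[OF x] by simp
    note z = zr_hom[OF Lo Z_obj]
    show ?thesis
      using L[OF i \<eta> z x y _ _ _ eq] idn_left[OF z] zr_left[OF x Z_obj] zr_left[OF y Z_obj]
        zr_to_Z[OF cmp_hom[OF \<eta> P(1)]] zr_left[OF i(3) Z_obj] by auto
  qed
  then show ?thesis by (rule that[OF P(2,3,5,4,6,7)])
qed

text \<open>The path object is only required to have \<open>d0 \<in> rlp C Cof\<close>, a property which is shared by all
  model structures with the same cofibrations.\<close>

lemma deformation:
  assumes A: "fibrant A" and E: "fibrant E" and i: "i \<in> Cof" "i \<in> W" "i \<in> hom A E"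
  obtains r EI d0 d1 c h where "r \<in> hom E A" "r \<cdot> i = idn C A" "d0 \<in> hom EI E" "d1 \<in> hom EI E" "d0 \<in> rlp C Cof"
    "c \<in> hom E EI" "d0 \<cdot> c = idn C E" "d1 \<cdot> c = idn C E" "h \<in> hom E EI" "h \<cdot> i = c \<cdot> i" "d0 \<cdot> h = idn C E" "d1 \<cdot> h = i \<cdot> r"
proof -
  have Ao: "A \<in> Obj C" and Eo: "E \<in> Obj C" using A E by (auto simp: fibrant_def)
  have "zr A Z \<in> Fib" using A by (simp add: fibrant_def)
  then have "zr A Z \<in> rlp C (Cof \<inter> W)" using Fib_eq by simp
  moreover have "zr A Z \<cdot> idn C A = zr E Z \<cdot> i"
    using zr_left[OF idn_hom[OF Ao] Z_obj] zr_left[OF i(3) Z_obj] by simp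
  ultimately obtain r where r: "r \<in> hom E A" "r \<cdot> i = idn C A"
    using rlpE[OF _ IntI[OF i(1,2)] fibrant_hom[OF A] i(3) idn_hom[OF Ao] fibrant_hom[OF E]] by metis
  from fibrant_path[OF E] obtain EI d0 d1 c where P: "d0 \<in> hom EI E" "d1 \<in> hom EI E" "d0 \<in> rlp C Cof"
    "c \<in> hom E EI" "d0 \<cdot> c = idn C E" "d1 \<cdot> c = idn C E" and
    L: "\<And>i K L \<eta> x y. i \<in> Cof \<Longrightarrow> i \<in> W \<Longrightarrow> i \<in> hom K L \<Longrightarrow> \<eta> \<in> hom K EI \<Longrightarrow> x \<in> hom L E \<Longrightarrow> y \<in> hom L E \<Longrightarrow>
       d0 \<cdot> \<eta> = x \<cdot> i \<Longrightarrow> d1 \<cdot> \<eta> = y \<cdot> i \<Longrightarrow> \<exists>h \<in> hom L EI. h \<cdot> i = \<eta> \<and> d0 \<cdot> h = x \<and> d1 \<cdot> h = y"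
    by metis
  \<comment> \<open>On \<open>A\<close> the maps \<open>idn C E\<close> and
    \<open>i \<cdot> r\<close> agree, so the constant homotopy \<open>c \<cdot> i\<close> has the
    required ends there. Extending it along the trivial cofibration \<open>i\<close> gives a
    homotopy relative to \<open>A\<close>.\<close>
  have "d0 \<cdot> (c \<cdot> i) = idn C E \<cdot> i" using cmp_assoc[OF i(3) P(4,1)] P(5) by simp
  moreover have "d1 \<cdot> (c \<cdot> i) = i \<cdot> r \<cdot> i"
    using cmp_assoc[OF i(3) P(4,2)] P(6) cmp_assoc[OF i(3) r(1) i(3)] r(2) idn_left[OF i(3)] idn_right[OF i(3)] by simp
  ultimately obtain h where "h \<in> hom E EI" "h \<cdot> i = c \<cdot> i" "d0 \<cdot> h = idn C E" "d1 \<cdot> h = i \<cdot> r"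
    using L[OF i cmp_hom[OF i(3) P(4)] idn_hom[OF Eo] cmp_hom[OF r(1) i(3)]] by blast
  then show ?thesis by (rule that[OF r P])
qed

text \<open>Both \<open>j\<close> and \<open>k\<close> are inclusions of deformation retracts, and
  the retraction and homotopy for \<open>k\<close> can be chosen over those for \<open>j\<close>.
  Everything then restricts to kernels: \<open>g\<close> acquires the strict left inverse
  \<open>R'\<close>, and \<open>g \<cdot> R'\<close> is homotopic to the identity of
  \<open>F'\<close>.\<close>

lemma fiber_weq_of_trivial_cofibration:
  assumes p: "p \<in> Fib" "p \<in> hom E B" and q: "q \<in> Fib" "q \<in> hom E' B'" and B: "fibrant B" "fibrant B'"
    and j: "j \<in> Cof" "j \<in> W" "j \<in> hom B B'" and k: "k \<in> Cof" "k \<in> W" "k \<in> hom E E'" and qk: "q \<cdot> k = j \<cdot> p"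
    and F: "is_ker p F m" and F': "is_ker q F' m'" and g: "g \<in> hom F F'" "m' \<cdot> g = k \<cdot> m"
  shows "g \<in> W"
proof -
  note m = ker_homs[OF F p(2)] and m' = ker_homs[OF F' q(2)]
  from deformation[OF B j] obtain r BI d0 d1 c h where r: "r \<in> hom B' B" "r \<cdot> j = idn C B"
    and d: "d0 \<in> hom BI B'" "d1 \<in> hom BI B'" "d0 \<in> rlp C Cof"
    and c: "c \<in> hom B' BI" "d0 \<cdot> c = idn C B'" "d1 \<cdot> c = idn C B'"
    and h: "h \<in> hom B' BI" "h \<cdot> j = c \<cdot> j" "d0 \<cdot> h = idn C B'" "d1 \<cdot> h = j \<cdot> r" by metis
  have obj: "E \<in> Obj C" "E' \<in> Obj C" "BI \<in> Obj C" "F' \<in> Obj C" "F \<in> Obj C" "B \<in> Obj C" "B' \<in> Obj C"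
    using hom_obj[OF k(3)] hom_obj[OF d(1)] hom_obj[OF g(1)] hom_obj[OF j(3)] by auto
  have pF: "p \<in> rlp C (Cof \<inter> W)" using p(1) Fib_eq by simp
  \<comment> \<open>The square for a retraction \<open>R\<close> of \<open>k\<close> lying over
    \<open>r\<close>; it is solvable since \<open>p\<close> is a fibration and \<open>k\<close> a
    trivial cofibration. A retraction not lying over \<open>r\<close> would not restrict to the
    fibers.\<close>
  have "p \<cdot> idn C E = r \<cdot> q \<cdot> k"
    using cmp_assoc[OF k(3) q(2) r(1)] qk cmp_assoc[OF p(2) j(3) r(1)] r(2) idn_left[OF p(2)] idn_right[OF p(2)] by simp
  from rlpE[OF pF IntI[OF k(1,2)] p(2) k(3) idn_hom[OF obj(1)] cmp_hom[OF q(2) r(1)] this]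
  obtain R where R: "R \<in> hom E' E" "R \<cdot> k = idn C E" "p \<cdot> R = r \<cdot> q" .
  obtain EI \<pi> e0 e1 s where
    P: "\<pi> \<in> hom EI BI" "e0 \<in> hom EI E'" "e1 \<in> hom EI E'" "s \<in> hom E' EI" "e0 \<in> rlp C Cof"
    "e0 \<cdot> s = idn C E'" "e1 \<cdot> s = idn C E'" "\<pi> \<cdot> s = c \<cdot> q" "q \<cdot> e0 = d0 \<cdot> \<pi>" "q \<cdot> e1 = d1 \<cdot> \<pi>" and
    L1: "\<And>i K L \<eta> \<beta> x. i \<in> Cof \<Longrightarrow> i \<in> hom K L \<Longrightarrow> \<eta> \<in> hom K EI \<Longrightarrow> \<beta> \<in> hom L BI \<Longrightarrow> x \<in> hom L E' \<Longrightarrow>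
       q \<cdot> x = d0 \<cdot> \<beta> \<Longrightarrow> \<pi> \<cdot> \<eta> = \<beta> \<cdot> i \<Longrightarrow> e0 \<cdot> \<eta> = x \<cdot> i \<Longrightarrow>
       \<exists>h \<in> hom L EI. h \<cdot> i = \<eta> \<and> \<pi> \<cdot> h = \<beta> \<and> e0 \<cdot> h = x" and
    L2: "\<And>i K L \<eta> \<beta> x y. i \<in> Cof \<Longrightarrow> i \<in> W \<Longrightarrow> i \<in> hom K L \<Longrightarrow> \<eta> \<in> hom K EI \<Longrightarrow> \<beta> \<in> hom L BI \<Longrightarrow>
       x \<in> hom L E' \<Longrightarrow> y \<in> hom L E' \<Longrightarrow> q \<cdot> x = d0 \<cdot> \<beta> \<Longrightarrow> q \<cdot> y = d1 \<cdot> \<beta> \<Longrightarrow>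
       \<pi> \<cdot> \<eta> = \<beta> \<cdot> i \<Longrightarrow> e0 \<cdot> \<eta> = x \<cdot> i \<Longrightarrow> e1 \<cdot> \<eta> = y \<cdot> i \<Longrightarrow>
       \<exists>h \<in> hom L EI. h \<cdot> i = \<eta> \<and> \<pi> \<cdot> h = \<beta> \<and> e0 \<cdot> h = x \<and> e1 \<cdot> h = y"
    by (rule path_object[OF q d c]) (rule that; (assumption | (atomize, assumption)))
  note kR = cmp_hom[OF R(1) k(3)] and hq = cmp_hom[OF q(2) h(1)] and sk = cmp_hom[OF k(3) P(4)]
  have 1: "q \<cdot> idn C E' = d0 \<cdot> (h \<cdot> q)"
    using cmp_assoc[OF q(2) h(1) d(1)] h(3) idn_left[OF q(2)] idn_right[OF q(2)] by simp
  have 2: "q \<cdot> (k \<cdot> R) = d1 \<cdot> (h \<cdot> q)"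
    using cmp_assoc[OF q(2) h(1) d(2)] h(4) cmp_assoc[OF R(1) k(3) q(2)] qk cmp_assoc[OF R(1) p(2) j(3)] R(3)
      cmp_assoc[OF q(2) r(1) j(3)] by simp
  \<comment> \<open>Here the homotopy of the bases must be constant along \<open>j\<close>: the
    constant path \<open>s \<cdot> k\<close> has to lie over \<open>h \<cdot> q \<cdot> k\<close>,
    which amounts to \<open>h \<cdot> j = c \<cdot> j\<close> after composing with
    \<open>p\<close>.\<close>
  have 3: "\<pi> \<cdot> (s \<cdot> k) = h \<cdot> q \<cdot> k"
    using cmp_assoc[OF k(3) P(4,1)] P(8) cmp_assoc[OF k(3) q(2) c(1)] qk cmp_assoc[OF p(2) j(3) c(1)] h(2)
      cmp_assoc[OF k(3) q(2) h(1)] cmp_assoc[OF p(2) j(3) h(1)] by simp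
  have 4: "e0 \<cdot> (s \<cdot> k) = idn C E' \<cdot> k" using cmp_assoc[OF k(3) P(4,2)] P(6) by simp
  have 5: "e1 \<cdot> (s \<cdot> k) = k \<cdot> R \<cdot> k"
    using cmp_assoc[OF k(3) P(4,3)] P(7) cmp_assoc[OF k(3) R(1) k(3)] R(2) idn_left[OF k(3)] idn_right[OF k(3)] by simp
  from L2[OF k sk hq idn_hom[OF obj(2)] kR 1 2 3 4 5] obtain H where H: "H \<in> hom E' EI"
    "\<pi> \<cdot> H = h \<cdot> q" "e0 \<cdot> H = idn C E'" "e1 \<cdot> H = k \<cdot> R" by blast
  \<comment> \<open>The kernel of \<open>\<pi>\<close> consists of the paths in \<open>E'\<close>
    over the constant path at the base point of the base. It plays the role of a path object for
    \<open>F'\<close>.\<close>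
  obtain N n z where "is_pb \<pi> (zr Z BI) N n z" using pullbacks[OF P(1) zr_hom[OF Z_obj obj(3)]] by blast
  from pb_zero_is_ker[OF this P(1)] have N: "is_ker \<pi> N n" .
  note n = ker_homs[OF N P(1)]
  from ker_map[OF F' q(2) N P(1) H(1) h(1) H(2)] obtain H' where H': "H' \<in> hom F' N" "n \<cdot> H' = H \<cdot> m'" .
  from ker_map[OF F' q(2) N P(1,4) c(1) P(8)] obtain s' where s': "s' \<in> hom F' N" "n \<cdot> s' = s \<cdot> m'" .
  from ker_map[OF N P(1) F' q(2) P(2) d(1) P(9)] obtain e0' where e0': "e0' \<in> hom N F'" "m' \<cdot> e0' = e0 \<cdot> n" .
  from ker_map[OF N P(1) F' q(2) P(3) d(2) P(10)] obtain e1' where e1': "e1' \<in> hom N F'" "m' \<cdot> e1' = e1 \<cdot> n" .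
  from ker_map[OF F' q(2) F p(2) R(1) r(1) R(3)] obtain R' where R': "R' \<in> hom F' F" "m \<cdot> R' = R \<cdot> m'" .
  note uF = ker_unique[OF F] and uF' = ker_unique[OF F'] and uN = ker_unique[OF N]
  have Rg: "R' \<cdot> g = idn C F"
    by (rule uF[OF cmp_hom[OF g(1) R'(1)] idn_hom[OF obj(5)]])
      (use cmp_assoc[OF g(1) R'(1) m(1)] R'(2) cmp_assoc[OF g(1) m'(1) R(1)] g(2) cmp_assoc[OF m(1) k(3) R(1)] R(2)
        idn_left[OF m(1)] idn_right[OF m(1)] in simp)
  have e0H: "e0' \<cdot> H' = idn C F'"
    by (rule uF'[OF cmp_hom[OF H'(1) e0'(1)] idn_hom[OF obj(4)]])
      (use cmp_assoc[OF H'(1) e0'(1) m'(1)] e0'(2) cmp_assoc[OF H'(1) n(1) P(2)] H'(2) cmp_assoc[OF m'(1) H(1) P(2)] H(3)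
        idn_left[OF m'(1)] idn_right[OF m'(1)] in simp)
  have e1H: "e1' \<cdot> H' = g \<cdot> R'"
    by (rule uF'[OF cmp_hom[OF H'(1) e1'(1)] cmp_hom[OF R'(1) g(1)]])
      (use cmp_assoc[OF H'(1) e1'(1) m'(1)] e1'(2) cmp_assoc[OF H'(1) n(1) P(3)] H'(2) cmp_assoc[OF m'(1) H(1) P(3)] H(4)
        cmp_assoc[OF R'(1) g(1) m'(1)] g(2) cmp_assoc[OF R'(1) m(1) k(3)] R'(2) cmp_assoc[OF m'(1) R(1) k(3)] in simp)
  have e0s: "e0' \<cdot> s' = idn C F'"
    by (rule uF'[OF cmp_hom[OF s'(1) e0'(1)] idn_hom[OF obj(4)]])
      (use cmp_assoc[OF s'(1) e0'(1) m'(1)] e0'(2) cmp_assoc[OF s'(1) n(1) P(2)] s'(2) cmp_assoc[OF m'(1) P(4,2)] P(6)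
        idn_left[OF m'(1)] idn_right[OF m'(1)] in simp)
  have e1s: "e1' \<cdot> s' = idn C F'"
    by (rule uF'[OF cmp_hom[OF s'(1) e1'(1)] idn_hom[OF obj(4)]])
      (use cmp_assoc[OF s'(1) e1'(1) m'(1)] e1'(2) cmp_assoc[OF s'(1) n(1) P(3)] s'(2) cmp_assoc[OF m'(1) P(4,3)] P(7)
        idn_left[OF m'(1)] idn_right[OF m'(1)] in simp)
  \<comment> \<open>A lifting problem for \<open>e0'\<close> is one for \<open>e0\<close> in which
    the path in the base is prescribed to be zero. This is the reason why the first lifting property
    of the path object prescribes \<open>\<beta>\<close> as well as the initial point.\<close>
  have "e0' \<in> rlp C Cof"
  proof (rule rlpI[OF e0'(1) Cof_arr])
    fix i K L a b assume i: "i \<in> Cof" "i \<in> hom K L" and a: "a \<in> hom K N" and b: "b \<in> hom L F'" and e: "e0' \<cdot> a = b \<cdot> i"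
    have L: "L \<in> Obj C" and K: "K \<in> Obj C" using hom_obj[OF i(2)] by auto
    note x = cmp_hom[OF b m'(1)] and z = zr_hom[OF L obj(3)]
    have "q \<cdot> (m' \<cdot> b) = d0 \<cdot> zr L BI"
      using cmp_assoc[OF b m'(1) q(2)] m'(2) zr_left[OF b obj(7)] zr_right[OF d(1) L] by simp
    moreover have "\<pi> \<cdot> (n \<cdot> a) = zr L BI \<cdot> i"
      using cmp_assoc[OF a n(1) P(1)] n(2) zr_left[OF a obj(3)] zr_left[OF i(2) obj(3)] by simp
    moreover have "e0 \<cdot> (n \<cdot> a) = m' \<cdot> b \<cdot> i"
      using cmp_assoc[OF a n(1) P(2)] e0'(2) cmp_assoc[OF a e0'(1) m'(1)] e cmp_assoc[OF i(2) b m'(1)] by simp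
    ultimately obtain y where y: "y \<in> hom L EI" "y \<cdot> i = n \<cdot> a" "\<pi> \<cdot> y = zr L BI" "e0 \<cdot> y = m' \<cdot> b"
      using L1[OF i cmp_hom[OF a n(1)] z x] by blast
    from kerE[OF N P(1) y(1,3)] obtain w where w: "w \<in> hom L N" "n \<cdot> w = y" .
    have "w \<cdot> i = a"
      by (rule uN[OF cmp_hom[OF i(2) w(1)] a]) (use cmp_assoc[OF i(2) w(1) n(1)] w(2) y(2) in simp)
    moreover have "e0' \<cdot> w = b"
      by (rule uF'[OF cmp_hom[OF w(1) e0'(1)] b])
        (use cmp_assoc[OF w(1) e0'(1) m'(1)] e0'(2) cmp_assoc[OF w(1) n(1) P(2)] w(2) y(4) in simp)
    ultimately show "\<exists>h\<in>hom L N. h \<cdot> i = a \<and> e0' \<cdot> h = b" using w(1) by blast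
  qed
  then have "e0' \<in> W" by (simp add: trivial_fib_iff)
  then have "H' \<in> W" and "s' \<in> W" using W_section[OF e0'(1) H'(1) e0H] W_section[OF e0'(1) s'(1) e0s] by auto
  \<comment> \<open>The constant paths \<open>s'\<close> form a common section of both ends, so
    being a weak equivalence passes from \<open>e0'\<close> through \<open>s'\<close> to
    \<open>e1'\<close>.\<close>
  then have "e1' \<in> W" using W_section[OF e1'(1) s'(1) e1s] by simp
  with \<open>H' \<in> W\<close> have "g \<cdot> R' \<in> W" using W_comp[OF _ _ H'(1) e1'(1)] e1H by simp
  then show ?thesis by (rule W_retraction[OF g(1) R'(1) Rg])
qed

text \<open>Factoring the map of bases, and then the map into the pullback, reduces to a trivial
  fibration over a trivial fibration and a trivial cofibration over a trivial cofibration.\<close>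

lemma fiber_weq:
  assumes p: "p \<in> Fib" "p \<in> hom E B" and p': "p' \<in> Fib" "p' \<in> hom E' B'" and B: "fibrant B" "fibrant B'"
    and b: "b \<in> W" "b \<in> hom B B'" and e: "e \<in> W" "e \<in> hom E E'" and sq: "p' \<cdot> e = b \<cdot> p"
    and F: "is_ker p F m" and F': "is_ker p' F' m'" and g: "g \<in> hom F F'" "m' \<cdot> g = e \<cdot> m"
  shows "g \<in> W"
proof -
  note m = ker_homs[OF F p(2)] and m' = ker_homs[OF F' p'(2)]
  from TF_factor[OF b(2)] obtain B1 j r where j: "j \<in> Cof" "j \<in> W" "j \<in> hom B B1" and r: "r \<in> Fib" "r \<in> hom B1 B'" and rj: "r \<cdot> j = b"
    by metis
  have B1: "fibrant B1" by (rule fibrant_total[OF B(2) r])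
  have "r \<in> W" using W_cancel_left[OF j(2) _ j(3) r(2)] rj b(1) by simp
  then have rT: "r \<in> rlp C Cof" using r(1) by (simp add: trivial_fib_iff)
  obtain E1 a c where E1: "is_pb p' r E1 a c" using pullbacks[OF p'(2) r(2)] by blast
  note ac = pb_homs[OF E1 p'(2) r(2)]
  have cF: "c \<in> Fib" using rlp_pb[OF TCof_arr E1 _ p'(2) r(2)] p'(1) Fib_eq by simp
  have aW: "a \<in> W" using rlp_pb[OF Cof_arr is_pb_sym[OF E1] rT r(2) p'(2)] by (simp add: trivial_fib_iff)
  have "p' \<cdot> e = r \<cdot> (j \<cdot> p)" using sq rj cmp_assoc[OF p(2) j(3) r(2)] by simp
  from pbE[OF E1 p'(2) r(2) e(2) cmp_hom[OF p(2) j(3)] this]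
  obtain f where f: "f \<in> hom E E1" "a \<cdot> f = e" "c \<cdot> f = j \<cdot> p" .
  from TF_factor[OF f(1)] obtain E2 k q where k: "k \<in> Cof" "k \<in> W" "k \<in> hom E E2" and q: "q \<in> Fib" "q \<in> hom E2 E1" and qk: "q \<cdot> k = f"
    by metis
  have "f \<in> W" using W_cancel_right[OF aW _ f(1) ac(1)] f(2) e(1) by simp
  then have "q \<in> W" using W_cancel_left[OF k(2) _ k(3) q(2)] qk by simp
  then have qT: "q \<in> rlp C Cof" using q(1) by (simp add: trivial_fib_iff)
  note cq = cmp_hom[OF q(2) ac(2)] and aq = cmp_hom[OF q(2) ac(1)]
  have cqF: "c \<cdot> q \<in> Fib" using rlp_comp[OF TCof_arr _ q(2) _ ac(2)] q(1) cF Fib_eq by simp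
  have cqk: "c \<cdot> q \<cdot> k = j \<cdot> p" using cmp_assoc[OF k(3) q(2) ac(2)] qk f(3) by simp
  have B1o: "B1 \<in> Obj C" "B' \<in> Obj C" using hom_obj[OF r(2)] by auto
  obtain F2 n z where "is_pb (c \<cdot> q) (zr Z B1) F2 n z" using pullbacks[OF cq zr_hom[OF Z_obj B1o(1)]] by blast
  from pb_zero_is_ker[OF this cq] have F2: "is_ker (c \<cdot> q) F2 n" .
  note n = ker_homs[OF F2 cq]
  have "p' \<cdot> (a \<cdot> q) = r \<cdot> (c \<cdot> q)" using cmp_assoc[OF q(2) ac(1) p'(2)] cmp_assoc[OF q(2) ac(2) r(2)] ac(3) by simp
  from ker_map[OF F2 cq F' p'(2) aq r(2) this] obtain v where v: "v \<in> hom F2 F'" "m' \<cdot> v = a \<cdot> q \<cdot> n" .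
  from ker_map[OF F p(2) F2 cq k(3) j(3) cqk] obtain w where w: "w \<in> hom F F2" "n \<cdot> w = k \<cdot> m" .
  have wW: "w \<in> W" by (rule fiber_weq_of_trivial_cofibration[OF p cqF cq B(1) B1 j k cqk F F2 w])
  \<comment> \<open>Since \<open>c\<close> is a base change of \<open>p'\<close>, its fiber is
    already \<open>F'\<close>; over it, \<open>v\<close> is the restriction of the trivial fibration
    \<open>q\<close>. The lift is accordingly found first in \<open>E1\<close>, by the pullback
    property, and then in \<open>E2\<close>.\<close>
  have "v \<in> rlp C Cof"
  proof (rule rlpI[OF v(1) Cof_arr])
    fix i K L x y assume i: "i \<in> Cof" "i \<in> hom K L" and x: "x \<in> hom K F2" and y: "y \<in> hom L F'" and vx: "v \<cdot> x = y \<cdot> i"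
    have L: "L \<in> Obj C" and K: "K \<in> Obj C" using hom_obj[OF i(2)] by auto
    note z = zr_hom[OF L B1o(1)] and nx = cmp_hom[OF x n(1)]
    have "p' \<cdot> (m' \<cdot> y) = r \<cdot> zr L B1"
      using cmp_assoc[OF y m'(1) p'(2)] m'(2) zr_left[OF y B1o(2)] zr_right[OF r(2) L] by simp
    from pbE[OF E1 p'(2) r(2) cmp_hom[OF y m'(1)] z this]
    obtain t where t: "t \<in> hom L E1" "a \<cdot> t = m' \<cdot> y" "c \<cdot> t = zr L B1" .
    have "q \<cdot> (n \<cdot> x) = t \<cdot> i"
    proof (rule pb_unique[OF E1 cmp_hom[OF nx q(2)] cmp_hom[OF i(2) t(1)]])
      show "a \<cdot> (q \<cdot> (n \<cdot> x)) = a \<cdot> (t \<cdot> i)"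
        using cmp_assoc[OF nx q(2) ac(1)] cmp_assoc[OF x n(1) aq] v(2) cmp_assoc[OF x v(1) m'(1)] vx
          cmp_assoc[OF i(2) y m'(1)] t(2) cmp_assoc[OF i(2) t(1) ac(1)] by simp
      show "c \<cdot> (q \<cdot> (n \<cdot> x)) = c \<cdot> (t \<cdot> i)"
        using cmp_assoc[OF nx q(2) ac(2)] cmp_assoc[OF x n(1) cq] n(2) zr_left[OF x B1o(1)]
          t(3) cmp_assoc[OF i(2) t(1) ac(2)] zr_left[OF i(2) B1o(1)] by simp
    qed
    from rlpE[OF qT i(1) q(2) i(2) nx t(1) this] obtain h where h: "h \<in> hom L E2" "h \<cdot> i = n \<cdot> x" "q \<cdot> h = t" .
    have "c \<cdot> q \<cdot> h = zr L B1" using cmp_assoc[OF h(1) q(2) ac(2)] h(3) t(3) by simp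
    from kerE[OF F2 cq h(1) this] obtain h' where h': "h' \<in> hom L F2" "n \<cdot> h' = h" .
    have "h' \<cdot> i = x"
      by (rule ker_unique[OF F2 cmp_hom[OF i(2) h'(1)] x]) (use cmp_assoc[OF i(2) h'(1) n(1)] h'(2) h(2) in simp)
    moreover have "v \<cdot> h' = y"
      by (rule ker_unique[OF F' cmp_hom[OF h'(1) v(1)] y])
        (use cmp_assoc[OF h'(1) v(1) m'(1)] v(2) cmp_assoc[OF h'(1) n(1) aq] h'(2) cmp_assoc[OF h(1) q(2) ac(1)] h(3) t(2) in simp)
    ultimately show "\<exists>h\<in>hom L F2. h \<cdot> i = x \<and> v \<cdot> h = y" using h'(1) by blast
  qed
  then have "v \<in> W" by (simp add: trivial_fib_iff)
  then have "v \<cdot> w \<in> W" using W_comp[OF wW _ w(1) v(1)] by simp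
  moreover have "v \<cdot> w = g"
    by (rule ker_unique[OF F' cmp_hom[OF w(1) v(1)] g(1)])
      (use cmp_assoc[OF w(1) v(1) m'(1)] v(2) cmp_assoc[OF w(1) n(1) aq] w(2) cmp_assoc[OF m(1) k(3) aq] g(2)
        cmp_assoc[OF k(3) q(2) ac(1)] qk f(2) in simp)
  ultimately show ?thesis by simp
qed

end

text \<open>The trivial fibrations of both structures are the maps in \<open>rlp C Cof\<close>, so the homotopies of the
  second structure are homotopies of the first.\<close>

lemma weq_between_local_fibrant:
  fixes C :: "('o, 'a) cat"
  assumes M: "model_category C Z zr W Cof Fib TF CT" and N: "model_category C Z zr W' Cof Fib' TF' CT'"
    and f: "f \<in> W'" "f \<in> homs C A B"
    and A: "model_category.fibrant C Z zr Fib' A" and B: "model_category.fibrant C Z zr Fib' B"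
  shows "f \<in> W"
proof -
  interpret M: model_category C Z zr W Cof Fib TF CT by (rule M)
  interpret N: model_category C Z zr W' Cof Fib' TF' CT' by (rule N)
  from N.TF_factor[OF f(2)] obtain E i r where i: "i \<in> Cof" "i \<in> W'" "i \<in> homs C A E" and r: "r \<in> Fib'" "r \<in> homs C E B" and ri: "cmp C r i = f"
    by metis
  have "r \<in> W'" using N.W_cancel_left[OF i(2) _ i(3) r(2)] ri f(1) by simp
  then have rW: "r \<in> W" using r(1) N.trivial_fib_iff M.trivial_fib_iff by blast
  have E: "N.fibrant E" by (rule N.fibrant_total[OF B r])
  from N.deformation[OF A E i] obtain t EI d0 d1 c h where t: "t \<in> homs C E A" "cmp C t i = idn C A"
    and d: "d0 \<in> homs C EI E" "d1 \<in> homs C EI E" "d0 \<in> rlp C Cof"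
    and c: "c \<in> homs C E EI" "cmp C d0 c = idn C E" "cmp C d1 c = idn C E"
    and h: "h \<in> homs C E EI" "cmp C d0 h = idn C E" "cmp C d1 h = cmp C i t" by metis
  have "d0 \<in> W" using d(3) M.trivial_fib_iff by simp
  then have "c \<in> W" and hW: "h \<in> W" using M.W_section[OF d(1) c(1,2)] M.W_section[OF d(1) h(1,2)] by auto
  then have "d1 \<in> W" using M.W_section[OF d(2) c(1,3)] by simp
  then have "cmp C i t \<in> W" using M.W_comp[OF hW _ h(1) d(2)] h(3) by simp
  then have "i \<in> W" by (rule M.W_retraction[OF i(3) t])
  then show ?thesis using M.W_comp[OF _ rW i(3) r(2)] ri by simp
qed

section \<open>The localization as a category\<close>

context category
begin

lemma inverse_unique:
  assumes "inverse_arr C f g" "inverse_arr C f h" shows "g = h"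
proof -
  have f: "f \<in> hom (src C f) (tgt C f)" and g: "g \<in> hom (tgt C f) (src C f)" and h: "h \<in> hom (tgt C f) (src C f)"
    and "g \<cdot> f = idn C (src C f)" "f \<cdot> h = idn C (tgt C f)"
    using assms by (auto simp: inverse_arr_def arr_hom)
  then show ?thesis using cmp_assoc[OF h f g] idn_left[OF h] idn_right[OF g] by simp
qed

lemma the_inverse_eq: "inverse_arr C f g \<Longrightarrow> the_inverse C f = g"
  unfolding the_inverse_def using inverse_unique by blast

text \<open>The formal core of both assertions about sections: when an isomorphism factors through
  \<open>E\<close>, its second factor has a section built from the first.\<close>

lemma section_of_iso:
  assumes f: "iso_arr C f" "f \<in> hom A B" and u: "u \<in> hom A E" and p: "p \<in> hom E B" and pu: "p \<cdot> u = f"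
  shows "u \<cdot> the_inverse C f \<in> hom B E" "p \<cdot> (u \<cdot> the_inverse C f) = idn C B"
proof -
  obtain g where g: "inverse_arr C f g" using f(1) by (auto simp: iso_arr_def)
  then have h: "g \<in> hom B A" "f \<cdot> g = idn C B" using homsD[OF f(2)] by (auto simp: inverse_arr_def)
  show "u \<cdot> the_inverse C f \<in> hom B E" using the_inverse_eq[OF g] cmp_hom[OF h(1) u] by simp
  show "p \<cdot> (u \<cdot> the_inverse C f) = idn C B" using the_inverse_eq[OF g] cmp_assoc[OF h(1) u p] pu h(2) by simp
qed

end

locale weq_category = category C for C :: "('o, 'a) cat" +
  fixes Weq :: "'a set"
  assumes Weq_arr: "Weq \<subseteq> Arr C"
begin

abbreviation path where "path \<equiv> zpath C Weq"
abbreviation eqv where "eqv \<equiv> zeq C Weq"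
abbreviation cls where "cls \<equiv> zclass C Weq"

lemma path_obj: "path A w B \<Longrightarrow> A \<in> Obj C \<and> B \<in> Obj C"
  by (induction rule: zpath.induct) (simp_all add: src_obj tgt_obj)

lemma path_append: "path A u B \<Longrightarrow> path B v D \<Longrightarrow> path A (u @ v) D"
  by (induction rule: zpath.induct) (auto intro: zpath.intros)

lemma eqv_path: "eqv A B u v \<Longrightarrow> path A u B \<and> path A v B"
  by (induction rule: zeq.induct) auto

lemma eqv_append_right: "eqv A B u u' \<Longrightarrow> path B v D \<Longrightarrow> eqv A D (u @ v) (u' @ v)"
proof (induction rule: zeq.induct)
  case (zq_refl w) then show ?case by (intro zeq.zq_refl path_append)
next
  case (zq_sym w w') then show ?case by (simp add: zeq.zq_sym)
next
  case (zq_trans w w' w'') then show ?case by (simp add: zeq.zq_trans[OF zq_trans(3,4)])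
next
  case (zq_step x l y r)
  have "eqv A D (x @ l @ (y @ v)) (x @ r @ (y @ v))"
    by (rule zeq.zq_step) (use path_append[OF zq_step(1,4)] path_append[OF zq_step(2,4)] zq_step(3) in simp_all)
  then show ?case by simp
qed

lemma eqv_append_left: "eqv B D v v' \<Longrightarrow> path A u B \<Longrightarrow> eqv A D (u @ v) (u @ v')"
proof (induction rule: zeq.induct)
  case (zq_refl w) then show ?case by (intro zeq.zq_refl path_append)
next
  case (zq_sym w w') then show ?case by (simp add: zeq.zq_sym)
next
  case (zq_trans w w' w'') then show ?case by (simp add: zeq.zq_trans[OF zq_trans(3,4)])
next
  case (zq_step x l y r)
  have "eqv A D ((u @ x) @ l @ y) ((u @ x) @ r @ y)"
    by (rule zeq.zq_step) (use path_append[OF zq_step(4,1)] path_append[OF zq_step(4,2)] zq_step(3) in simp_all)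
  then show ?case by simp
qed

lemma eqv_append: "eqv A B u u' \<Longrightarrow> eqv B D v v' \<Longrightarrow> eqv A D (u @ v) (u' @ v')"
  by (rule zeq.zq_trans[OF eqv_append_right eqv_append_left]) (auto dest: eqv_path)

lemma cls_eqI: "eqv A B u v \<Longrightarrow> cls A u B = cls A v B"
  by (auto simp: zclass_def elim: zeq.zq_trans zeq.zq_trans[OF zeq.zq_sym])

lemma cls_hom: "path A w B \<Longrightarrow> cls A w B \<in> homs (localization C Weq) A B"
  unfolding homs_def by (auto simp: localization_def zclass_def)

lemma homsE_cls:
  assumes "f \<in> homs (localization C Weq) A B" obtains w where "path A w B" "f = cls A w B"
  using assms unfolding homs_def by (auto simp: localization_def zclass_def)

text \<open>Composition in the localization ranges over all representatives of both classes.
  Concatenation respects the congruence, so the outcome is one class; words are read in the order of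
  traversal, so \<open>u @ v\<close> represents \<open>v\<close> after \<open>u\<close>.\<close>

lemma cls_comp:
  assumes u: "path A u B" and v: "path B v D"
  shows "cmp (localization C Weq) (cls B v D) (cls A u B) = cls A (u @ v) D"
proof -
  have "(\<exists>u'\<in>{w. eqv A B u w}. \<exists>v'\<in>{w. eqv B D v w}. eqv A D (u' @ v') w) \<longleftrightarrow> eqv A D (u @ v) w" for w
  proof
    assume "\<exists>u'\<in>{w. eqv A B u w}. \<exists>v'\<in>{w. eqv B D v w}. eqv A D (u' @ v') w"
    then show "eqv A D (u @ v) w" by (auto elim: zeq.zq_trans[OF eqv_append])
  next
    assume "eqv A D (u @ v) w"
    then show "\<exists>u'\<in>{w. eqv A B u w}. \<exists>v'\<in>{w. eqv B D v w}. eqv A D (u' @ v') w"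
      using zeq.zq_refl[OF u] zeq.zq_refl[OF v] by (intro bexI[of _ u] bexI[of _ v]) simp_all
  qed
  then show ?thesis by (simp add: localization_def zclass_def)
qed

lemma localization_category: "category (localization C Weq)"
proof
  let ?L = "localization C Weq"
  have O: "Obj ?L = Obj C" and I: "idn ?L A = cls A [] A" for A by (simp_all add: localization_def)
  fix f :: "('o, 'a) zarr"
  show "src ?L f \<in> Obj ?L" "tgt ?L f \<in> Obj ?L" if "f \<in> Arr ?L"
    using that path_obj by (auto simp: localization_def zclass_def)
  fix A B show "cmp ?L (idn ?L B) f = f" "cmp ?L f (idn ?L A) = f" if f: "f \<in> homs ?L A B"
  proof -
    obtain w where w: "path A w B" "f = cls A w B" using homsE_cls[OF f] .
    have n: "path A [] A" "path B [] B" using path_obj[OF w(1)] by (auto intro: zpath.zp_nil)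
    show "cmp ?L (idn ?L B) f = f" "cmp ?L f (idn ?L A) = f"
      using cls_comp[OF w(1) n(2)] cls_comp[OF n(1) w(1)] w(2) I by auto
  qed
  fix g :: "('o, 'a) zarr" and D
  show "cmp ?L g f \<in> homs ?L A D" if fg: "f \<in> homs ?L A B" "g \<in> homs ?L B D"
  proof -
    obtain u where u: "path A u B" "f = cls A u B" using homsE_cls[OF fg(1)] .
    obtain v where v: "path B v D" "g = cls B v D" using homsE_cls[OF fg(2)] .
    show ?thesis using cls_comp[OF u(1) v(1)] cls_hom[OF path_append[OF u(1) v(1)]] u(2) v(2) by simp
  qed
  fix h :: "('o, 'a) zarr" and E
  show "cmp ?L (cmp ?L h g) f = cmp ?L h (cmp ?L g f)" if fgh: "f \<in> homs ?L A B" "g \<in> homs ?L B D" "h \<in> homs ?L D E"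
  proof -
    obtain u where u: "path A u B" "f = cls A u B" using homsE_cls[OF fgh(1)] .
    obtain v where v: "path B v D" "g = cls B v D" using homsE_cls[OF fgh(2)] .
    obtain w where w: "path D w E" "h = cls D w E" using homsE_cls[OF fgh(3)] .
    show ?thesis
      using cls_comp[OF u(1) v(1)] cls_comp[OF v(1) w(1)] cls_comp[OF path_append[OF u(1) v(1)] w(1)]
        cls_comp[OF u(1) path_append[OF v(1) w(1)]] u(2) v(2) w(2) by simp
  qed
next
  let ?L = "localization C Weq"
  show "idn ?L A \<in> homs ?L A A" if "A \<in> Obj ?L" for A
    using that cls_hom[OF zpath.zp_nil] by (simp add: localization_def)
qed

lemma fw_path: "f \<in> hom A B \<Longrightarrow> path A [Fw f] B"
  using zpath.zp_fw[of f C Weq "[]" B] zpath.zp_nil[of B C Weq] hom_obj[of f A B] homsD[of f C A B] by simp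

lemma bw_path: "f \<in> Weq \<Longrightarrow> f \<in> hom A B \<Longrightarrow> path B [Bw f] A"
  using zpath.zp_bw[of f C Weq "[]" A] zpath.zp_nil[of A C Weq] hom_obj[of f A B] homsD[of f C A B] by simp

lemma loc_fun_cls: "f \<in> hom A B \<Longrightarrow> loc_fun C Weq f = cls A [Fw f] B"
  by (auto simp: loc_fun_def homs_def)

lemma loc_fun_hom: "f \<in> hom A B \<Longrightarrow> loc_fun C Weq f \<in> homs (localization C Weq) A B"
  using loc_fun_cls cls_hom[OF fw_path] by simp

lemma eqvI: "path A l B \<Longrightarrow> path A r B \<Longrightarrow> zrel C Weq l r \<Longrightarrow> eqv A B l r"
  using zeq.zq_step[of C Weq A "[]" l "[]" B r] by simp

lemma loc_fun_cmp:
  assumes f: "f \<in> hom A B" and g: "g \<in> hom B D"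
  shows "cmp (localization C Weq) (loc_fun C Weq g) (loc_fun C Weq f) = loc_fun C Weq (g \<cdot> f)"
proof -
  have "eqv A D ([Fw f] @ [Fw g]) [Fw (g \<cdot> f)]"
    by (rule eqvI[OF path_append[OF fw_path[OF f] fw_path[OF g]] fw_path[OF cmp_hom[OF f g]]])
      (use zrel.zr_cmp[of f C g] homsD[OF f] homsD[OF g] in simp)
  from cls_eqI[OF this] show ?thesis
    using cls_comp[OF fw_path[OF f] fw_path[OF g]] loc_fun_cls[OF f] loc_fun_cls[OF g] loc_fun_cls[OF cmp_hom[OF f g]] by simp
qed

lemma loc_fun_iso:
  assumes w: "f \<in> Weq" shows "iso_arr (localization C Weq) (loc_fun C Weq f)"
proof -
  have f: "f \<in> hom (src C f) (tgt C f)" (is "f \<in> hom ?A ?B") using w Weq_arr arr_hom by blast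
  note F = fw_path[OF f] and G = bw_path[OF w f]
  have n: "path ?A [] ?A" "path ?B [] ?B" using path_obj[OF F] by (auto intro: zpath.zp_nil)
  have 1: "eqv ?A ?A ([Fw f] @ [Bw f]) []"
    by (rule eqvI[OF path_append[OF F G] n(1)]) (use zrel.zr_fb[of f C Weq] w homsD[OF f] in simp)
  have 2: "eqv ?B ?B ([Bw f] @ [Fw f]) []"
    by (rule eqvI[OF path_append[OF G F] n(2)]) (use zrel.zr_bf[of f C Weq] w homsD[OF f] in simp)
  have "inverse_arr (localization C Weq) (loc_fun C Weq f) (cls ?B [Bw f] ?A)"
    unfolding inverse_arr_def loc_fun_cls[OF f]
    using cls_hom[OF F] cls_hom[OF G] cls_comp[OF F G] cls_comp[OF G F] cls_eqI[OF 1] cls_eqI[OF 2]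
    by (auto simp: localization_def homs_def)
  then show ?thesis unfolding iso_arr_def by blast
qed

end

section \<open>The category of smooth schemes\<close>

lemma rmaps_continuous: "f \<in> rmaps X Y \<Longrightarrow> continuous_map (topo X) (topo Y) (pmap f)"
  and rmaps_ext: "f \<in> rmaps X Y \<Longrightarrow> pmap f \<in> extensional (pts X)"
  and rmaps_co_hom: "f \<in> rmaps X Y \<Longrightarrow> opn Y V \<Longrightarrow> co f V \<in> ring_hom (sec Y V) (sec X (pre X f V))"
  and rmaps_co_ext: "f \<in> rmaps X Y \<Longrightarrow> opn Y V \<Longrightarrow> co f V \<in> extensional (sct Y V)"
  and rmaps_co_undefined: "f \<in> rmaps X Y \<Longrightarrow> \<not> opn Y V \<Longrightarrow> co f V = (\<lambda>_. undefined)"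
  by (simp_all add: rmaps_def)

lemma rmaps_res:
  assumes f: "f \<in> rmaps X Y" and V: "opn Y V" "opn Y W" "W \<subseteq> V" and s: "s \<in> sct Y V"
  shows "co f W (res Y V W s) = res X (pre X f V) (pre X f W) (co f V s)"
proof -
  have "\<forall>V W. opn Y V \<and> opn Y W \<and> W \<subseteq> V \<longrightarrow> (\<forall>s \<in> sct Y V.
        co f W (res Y V W s) = res X (pre X f V) (pre X f W) (co f V s))"
    using f unfolding rmaps_def mem_Collect_eq by (elim conjE)
  then have "\<forall>s \<in> sct Y V. co f W (res Y V W s) = res X (pre X f V) (pre X f W) (co f V s)" using V by blast
  then show ?thesis using s by (rule bspec)
qed

lemma rmaps_local:
  assumes f: "f \<in> rmaps X Y" and x: "x \<in> pts X" and V: "opn Y V" "pmap f x \<in> V" and s: "s \<in> sct Y V"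
    and u: "germ X x (pre X f V) (co f V s) \<in> Units (stalk X x)"
  shows "germ Y (pmap f x) V s \<in> Units (stalk Y (pmap f x))"
proof -
  have "\<forall>x \<in> pts X. \<forall>V. opn Y V \<and> pmap f x \<in> V \<longrightarrow> (\<forall>s \<in> sct Y V.
        germ X x (pre X f V) (co f V s) \<in> Units (stalk X x) \<longrightarrow>
        germ Y (pmap f x) V s \<in> Units (stalk Y (pmap f x)))"
    using f unfolding rmaps_def mem_Collect_eq by (elim conjE)
  from bspec[OF this x] have "\<forall>s \<in> sct Y V. germ X x (pre X f V) (co f V s) \<in> Units (stalk X x) \<longrightarrow>
        germ Y (pmap f x) V s \<in> Units (stalk Y (pmap f x))" using V by blast
  from bspec[OF this s] u show ?thesis by blast
qed

lemma rmaps_pmap: "f \<in> rmaps X Y \<Longrightarrow> x \<in> pts X \<Longrightarrow> pmap f x \<in> pts Y"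
  using rmaps_continuous by (fastforce simp: continuous_map_def)

lemma rmaps_pre_open: "f \<in> rmaps X Y \<Longrightarrow> opn Y V \<Longrightarrow> opn X (pre X f V)"
  using rmaps_continuous[of f X Y] by (simp add: pre_def continuous_map_def)

lemma rmaps_co: "f \<in> rmaps X Y \<Longrightarrow> opn Y V \<Longrightarrow> s \<in> sct Y V \<Longrightarrow> co f V s \<in> sct X (pre X f V)"
  by (rule ring_hom_closed[OF rmaps_co_hom])

lemma rmapsI:
  assumes "continuous_map (topo X) (topo Y) (pmap f)" "pmap f \<in> extensional (pts X)"
    and "\<And>V. opn Y V \<Longrightarrow> co f V \<in> ring_hom (sec Y V) (sec X (pre X f V))"
    and "\<And>V. opn Y V \<Longrightarrow> co f V \<in> extensional (sct Y V)"
    and "\<And>V. \<not> opn Y V \<Longrightarrow> co f V = (\<lambda>_. undefined)"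
    and "\<And>V W s. opn Y V \<Longrightarrow> opn Y W \<Longrightarrow> W \<subseteq> V \<Longrightarrow> s \<in> sct Y V \<Longrightarrow>
      co f W (res Y V W s) = res X (pre X f V) (pre X f W) (co f V s)"
    and "\<And>x V s. x \<in> pts X \<Longrightarrow> opn Y V \<Longrightarrow> pmap f x \<in> V \<Longrightarrow> s \<in> sct Y V \<Longrightarrow>
      germ X x (pre X f V) (co f V s) \<in> Units (stalk X x) \<Longrightarrow> germ Y (pmap f x) V s \<in> Units (stalk Y (pmap f x))"
  shows "f \<in> rmaps X Y"
  unfolding rmaps_def mem_Collect_eq
  by (intro conjI allI impI ballI; (elim conjE)?; (rule assms; assumption))

lemma rmaps_eqI:
  assumes f: "f \<in> rmaps X Y" and g: "g \<in> rmaps X Y"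
    and p: "\<And>x. x \<in> pts X \<Longrightarrow> pmap f x = pmap g x"
    and c: "\<And>V s. opn Y V \<Longrightarrow> s \<in> sct Y V \<Longrightarrow> co f V s = co g V s"
  shows "f = g"
proof -
  have "pmap f = pmap g" by (rule extensionalityI[OF rmaps_ext[OF f] rmaps_ext[OF g] p])
  moreover have "co f V = co g V" for V
  proof (cases "opn Y V")
    case True
    show ?thesis by (rule extensionalityI[OF rmaps_co_ext[OF f True] rmaps_co_ext[OF g True] c[OF True]])
  next
    case False then show ?thesis using rmaps_co_undefined[OF f] rmaps_co_undefined[OF g] by simp
  qed
  ultimately show ?thesis by (intro rmap.equality) auto
qed

lemma pre_rcomp: "f \<in> rmaps X Y \<Longrightarrow> pre X (rcomp X Y Z g f) V = pre X f (pre Y g V)"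
  by (auto simp: pre_def rcomp_def rmaps_pmap)

lemma co_rcomp: "opn Z V \<Longrightarrow> s \<in> sct Z V \<Longrightarrow> co (rcomp X Y Z g f) V s = co f (pre Y g V) (co g V s)"
  by (simp add: rcomp_def)

lemma pmap_rcomp: "x \<in> pts X \<Longrightarrow> pmap (rcomp X Y Z g f) x = pmap g (pmap f x)"
  by (simp add: rcomp_def)

text \<open>Components of morphisms are extensional, so a composite of ring maps becomes a component
  only after restriction to the carrier.\<close>

lemma restrict_ring_hom: "ring R \<Longrightarrow> h \<in> ring_hom R S \<Longrightarrow> restrict h (carrier R) \<in> ring_hom R S"
  unfolding ring_hom_def by (auto simp: ring.ring_simprules)

lemma scheme_ringed_space: "scheme X \<Longrightarrow> ringed_space X"
  by (simp add: scheme_def locally_ringed_def)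

lemma ringed_space_cring: "ringed_space X \<Longrightarrow> opn X U \<Longrightarrow> cring (sec X U)"
  and ringed_space_res_hom: "ringed_space X \<Longrightarrow> opn X U \<Longrightarrow> opn X V \<Longrightarrow> V \<subseteq> U \<Longrightarrow> res X U V \<in> ring_hom (sec X U) (sec X V)"
  and ringed_space_res_id: "ringed_space X \<Longrightarrow> opn X U \<Longrightarrow> s \<in> sct X U \<Longrightarrow> res X U U s = s"
  by (simp_all add: ringed_space_def)

lemma ringed_space_res_res:
  assumes X: "ringed_space X" and U: "opn X U" "opn X V" "opn X W" "W \<subseteq> V" "V \<subseteq> U" and s: "s \<in> sct X U"
  shows "res X V W (res X U V s) = res X U W s"
proof -
  have "\<forall>U V W. opn X U \<and> opn X V \<and> opn X W \<and> W \<subseteq> V \<and> V \<subseteq> U \<longrightarrow>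
        (\<forall>s \<in> sct X U. res X V W (res X U V s) = res X U W s)"
    using X unfolding ringed_space_def by (elim conjE)
  then have "\<forall>s \<in> sct X U. res X V W (res X U V s) = res X U W s" using U by simp
  then show ?thesis using s by (rule bspec)
qed

lemma ringed_space_glue:
  assumes X: "ringed_space X" and U: "\<And>U. U \<in> \<U> \<Longrightarrow> opn X U" "\<And>U. U \<in> \<U> \<Longrightarrow> \<sigma> U \<in> sct X U"
    and eq: "\<And>U V. U \<in> \<U> \<Longrightarrow> V \<in> \<U> \<Longrightarrow> res X U (U \<inter> V) (\<sigma> U) = res X V (U \<inter> V) (\<sigma> V)"
  shows "\<exists>!s. s \<in> sct X (\<Union>\<U>) \<and> (\<forall>U\<in>\<U>. res X (\<Union>\<U>) U s = \<sigma> U)"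
proof -
  have all: "\<forall>\<U> \<sigma>. (\<forall>U\<in>\<U>. opn X U \<and> \<sigma> U \<in> sct X U) \<and>
        (\<forall>U\<in>\<U>. \<forall>V\<in>\<U>. res X U (U \<inter> V) (\<sigma> U) = res X V (U \<inter> V) (\<sigma> V)) \<longrightarrow>
        (\<exists>!s. s \<in> sct X (\<Union>\<U>) \<and> (\<forall>U\<in>\<U>. res X (\<Union>\<U>) U s = \<sigma> U))"
    using X unfolding ringed_space_def by (elim conjE)
  have "(\<forall>U\<in>\<U>. opn X U \<and> \<sigma> U \<in> sct X U) \<and>
        (\<forall>U\<in>\<U>. \<forall>V\<in>\<U>. res X U (U \<inter> V) (\<sigma> U) = res X V (U \<inter> V) (\<sigma> V))"
    by (intro conjI ballI; (rule U eq; assumption))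
  with spec[OF spec[OF all, of \<U>], of \<sigma>] show ?thesis by (rule mp)
qed

lemma ringed_space_ring: "ringed_space X \<Longrightarrow> opn X U \<Longrightarrow> ring (sec X U)"
  by (rule cring.axioms(1)[OF ringed_space_cring])

lemma ringed_space_res: "ringed_space X \<Longrightarrow> opn X U \<Longrightarrow> opn X V \<Longrightarrow> V \<subseteq> U \<Longrightarrow> s \<in> sct X U \<Longrightarrow> res X U V s \<in> sct X V"
  by (rule ring_hom_closed[OF ringed_space_res_hom])

lemma rcomp_rmaps:
  assumes f: "f \<in> rmaps X Y" and g: "g \<in> rmaps Y Z" and Z: "ringed_space Z"
  shows "rcomp X Y Z g f \<in> rmaps X Z"
proof (rule rmapsI)
  have "continuous_map (topo X) (topo Z) (pmap g \<circ> pmap f)"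
    by (rule continuous_map_compose[OF rmaps_continuous[OF f] rmaps_continuous[OF g]])
  then show "continuous_map (topo X) (topo Z) (pmap (rcomp X Y Z g f))"
    by (rule continuous_map_eq) (simp add: rcomp_def)
  show "pmap (rcomp X Y Z g f) \<in> extensional (pts X)" by (simp add: rcomp_def)
next
  fix V assume V: "opn Z V"
  note gV = rmaps_pre_open[OF g V]
  have "co f (pre Y g V) \<circ> co g V \<in> ring_hom (sec Z V) (sec X (pre X f (pre Y g V)))"
    by (rule ring_hom_trans[OF rmaps_co_hom[OF g V] rmaps_co_hom[OF f gV]])
  from restrict_ring_hom[OF ringed_space_ring[OF Z V] this]
  show "co (rcomp X Y Z g f) V \<in> ring_hom (sec Z V) (sec X (pre X (rcomp X Y Z g f) V))"
    using V by (simp add: pre_rcomp[OF f]) (simp add: rcomp_def o_def)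
  show "co (rcomp X Y Z g f) V \<in> extensional (sct Z V)" using V by (simp add: rcomp_def)
next
  fix V assume "\<not> opn Z V" then show "co (rcomp X Y Z g f) V = (\<lambda>_. undefined)" by (simp add: rcomp_def)
next
  fix V W s assume h: "opn Z V" "opn Z W" "W \<subseteq> V" "s \<in> sct Z V"
  have "pre Y g W \<subseteq> pre Y g V" using h(3) by (auto simp: pre_def)
  then show "co (rcomp X Y Z g f) W (res Z V W s) =
      res X (pre X (rcomp X Y Z g f) V) (pre X (rcomp X Y Z g f) W) (co (rcomp X Y Z g f) V s)"
    using rmaps_res[OF g h] rmaps_res[OF f rmaps_pre_open[OF g h(1)] rmaps_pre_open[OF g h(2)] _ rmaps_co[OF g h(1,4)]]
    by (simp add: co_rcomp[OF h(1,4)] co_rcomp[OF h(2) ringed_space_res[OF Z h]] pre_rcomp[OF f])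
next
  fix x V s assume h: "x \<in> pts X" "opn Z V" "pmap (rcomp X Y Z g f) x \<in> V" "s \<in> sct Z V"
    "germ X x (pre X (rcomp X Y Z g f) V) (co (rcomp X Y Z g f) V s) \<in> Units (stalk X x)"
  note x = rmaps_pmap[OF f h(1)]
  have V: "pmap g (pmap f x) \<in> V" using h(3) by (simp add: pmap_rcomp[OF h(1)])
  have "germ X x (pre X f (pre Y g V)) (co f (pre Y g V) (co g V s)) \<in> Units (stalk X x)"
    using h(5) co_rcomp[OF h(2,4)] pre_rcomp[OF f] by metis
  from rmaps_local[OF f h(1) rmaps_pre_open[OF g h(2)] _ rmaps_co[OF g h(2,4)] this]
  have "germ Y (pmap f x) (pre Y g V) (co g V s) \<in> Units (stalk Y (pmap f x))" using V x by (simp add: pre_def)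
  from rmaps_local[OF g x h(2) V h(4) this]
  show "germ Z (pmap (rcomp X Y Z g f) x) V s \<in> Units (stalk Z (pmap (rcomp X Y Z g f) x))"
    using pmap_rcomp[OF h(1)] by metis
qed

lemma rcomp_assoc:
  assumes f: "f \<in> rmaps X Y" and g: "g \<in> rmaps Y Z" and h: "h \<in> rmaps Z W"
  shows "rcomp X Y W (rcomp Y Z W h g) f = rcomp X Z W h (rcomp X Y Z g f)"
proof (rule rmap.equality)
  show "pmap (rcomp X Y W (rcomp Y Z W h g) f) = pmap (rcomp X Z W h (rcomp X Y Z g f))"
    by (auto simp: rcomp_def rmaps_pmap[OF f])
  have "co (rcomp X Y W (rcomp Y Z W h g) f) V s = co (rcomp X Z W h (rcomp X Y Z g f)) V s" for V s
  proof (cases "opn W V \<and> s \<in> sct W V")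
    case True
    then have V: "opn W V" "s \<in> sct W V" by auto
    show ?thesis
      by (simp only: co_rcomp[OF V] pre_rcomp[OF g] co_rcomp[OF rmaps_pre_open[OF h V(1)] rmaps_co[OF h V]])
  next
    case False then show ?thesis by (auto simp: rcomp_def)
  qed
  then show "co (rcomp X Y W (rcomp Y Z W h g) f) = co (rcomp X Z W h (rcomp X Y Z g f))" by (intro ext)
qed simp

lemma opn_subset: "opn X V \<Longrightarrow> V \<subseteq> pts X" by (rule openin_subset)

lemma pre_rid: "opn X V \<Longrightarrow> pre X (rid X) V = V"
  using opn_subset[of X V] by (auto simp: pre_def rid_def)

lemma rid_rmaps:
  assumes X: "ringed_space X" shows "rid X \<in> rmaps X X"
proof (rule rmapsI)
  show "continuous_map (topo X) (topo X) (pmap (rid X))"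
    by (rule continuous_map_eq[OF continuous_map_id]) (simp add: rid_def)
  show "pmap (rid X) \<in> extensional (pts X)" by (simp add: rid_def)
next
  fix V assume V: "opn X V"
  have "(\<lambda>s. s) \<in> ring_hom (sec X V) (sec X V)" by (simp add: ring_hom_def)
  from restrict_ring_hom[OF ringed_space_ring[OF X V] this]
  show "co (rid X) V \<in> ring_hom (sec X V) (sec X (pre X (rid X) V))" using V by (simp add: pre_rid) (simp add: rid_def)
  show "co (rid X) V \<in> extensional (sct X V)" using V by (simp add: rid_def)
next
  fix V assume "\<not> opn X V" then show "co (rid X) V = (\<lambda>_. undefined)" by (simp add: rid_def)
next
  fix V W s assume h: "opn X V" "opn X W" "W \<subseteq> V" "s \<in> sct X V"
  show "co (rid X) W (res X V W s) = res X (pre X (rid X) V) (pre X (rid X) W) (co (rid X) V s)"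
    using h ringed_space_res[OF X h] by (simp add: pre_rid) (simp add: rid_def)
next
  fix x V s assume h: "x \<in> pts X" "opn X V" "pmap (rid X) x \<in> V" "s \<in> sct X V"
    "germ X x (pre X (rid X) V) (co (rid X) V s) \<in> Units (stalk X x)"
  then show "germ X (pmap (rid X) x) V s \<in> Units (stalk X (pmap (rid X) x))"
    by (simp add: pre_rid) (simp add: rid_def)
qed

lemma rcomp_rid_right: assumes f: "f \<in> rmaps X Y" shows "rcomp X X Y f (rid X) = f"
proof (rule rmap.equality)
  show "pmap (rcomp X X Y f (rid X)) = pmap f"
    using rmaps_ext[OF f] by (auto simp: rcomp_def rid_def extensional_def)
  have "co (rcomp X X Y f (rid X)) V s = co f V s" for V s
  proof (cases "opn Y V")
    case True
    then show ?thesis using rmaps_co_ext[OF f True] rmaps_pre_open[OF f True] rmaps_co[OF f True, of s]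
      by (auto simp: rcomp_def rid_def extensional_def)
  next
    case False then show ?thesis using rmaps_co_undefined[OF f False] by (simp add: rcomp_def)
  qed
  then show "co (rcomp X X Y f (rid X)) = co f" by (intro ext)
qed simp

lemma rcomp_rid_left: assumes f: "f \<in> rmaps X Y" shows "rcomp X Y Y (rid Y) f = f"
proof (rule rmap.equality)
  show "pmap (rcomp X Y Y (rid Y) f) = pmap f"
    using rmaps_ext[OF f] by (auto simp: rcomp_def rid_def extensional_def rmaps_pmap[OF f])
  have "co (rcomp X Y Y (rid Y) f) V s = co f V s" for V s
  proof (cases "opn Y V")
    case True
    then show ?thesis using rmaps_co_ext[OF f True] pre_rid[OF True]
      by (auto simp: rcomp_def extensional_def) (auto simp: rid_def)
  next
    case False then show ?thesis using rmaps_co_undefined[OF f False] by (simp add: rcomp_def)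
  qed
  then show "co (rcomp X Y Y (rid Y) f) = co f" by (intro ext)
qed simp

text \<open>Names the object set that is bound by \<open>let\<close> inside the category, so that
  membership can be handled without unfolding the whole record.\<close>

definition smooth_over :: "'u sch \<Rightarrow> 'u over set" where
  "smooth_over X = {(Y, f). scheme Y \<and> f \<in> rmaps Y X \<and> smooth_morphism Y X f \<and> finite_type Y X f}"

lemma Sm_simps: "Obj (Sm X) = smooth_over X" "src (Sm X) = fst" "tgt (Sm X) = (\<lambda>(Y, g, W). W)"
  "idn (Sm X) Y = (Y, rid (fst Y), Y)"
  "cmp (Sm X) (W', h, V) (Y, g, W) = (Y, rcomp (fst Y) (fst W) (fst V) h g, V)"
  by (simp_all add: Sm_def Let_def smooth_over_def)

lemma Sm_homs: "f \<in> homs (Sm X) Y W \<longleftrightarrow> (\<exists>g. f = (Y, g, W) \<and> Y \<in> smooth_over X \<and> W \<in> smooth_over X \<and>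
    g \<in> rmaps (fst Y) (fst W) \<and> rcomp (fst Y) (fst W) X (snd W) g = snd Y)"
  by (auto simp: homs_def Sm_simps) (auto simp: Sm_def smooth_over_def)

lemma smooth_overD: "Y \<in> smooth_over X \<Longrightarrow> scheme (fst Y) \<and> snd Y \<in> rmaps (fst Y) X"
  by (auto simp: smooth_over_def)

lemma Sm_arr_hom: "f \<in> Arr (Sm X) \<Longrightarrow> f \<in> homs (Sm X) (src (Sm X) f) (tgt (Sm X) f)"
  by (simp add: homs_def)

lemma Sm_category: "category (Sm X)"
proof
  fix f :: "'a sarr"
  show "src (Sm X) f \<in> Obj (Sm X)" "tgt (Sm X) f \<in> Obj (Sm X)" if "f \<in> Arr (Sm X)"
    using Sm_arr_hom[OF that] by (auto simp: Sm_homs Sm_simps)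
next
  fix A :: "'a over" assume "A \<in> Obj (Sm X)"
  then show "idn (Sm X) A \<in> homs (Sm X) A A"
    using smooth_overD[of A X] by (simp add: Sm_homs Sm_simps rid_rmaps scheme_ringed_space rcomp_rid_right)
next
  fix f g :: "'a sarr" and A B D
  assume "f \<in> homs (Sm X) A B" "g \<in> homs (Sm X) B D"
  then show "cmp (Sm X) g f \<in> homs (Sm X) A D"
    using smooth_overD[of D X] smooth_overD[of B X]
    by (auto simp: Sm_homs Sm_simps rcomp_rmaps scheme_ringed_space rcomp_assoc[symmetric])
next
  fix f :: "'a sarr" and A B
  assume "f \<in> homs (Sm X) A B"
  then show "cmp (Sm X) (idn (Sm X) B) f = f" "cmp (Sm X) f (idn (Sm X) A) = f"
    by (auto simp: Sm_homs Sm_simps rcomp_rid_left rcomp_rid_right)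
next
  fix f g h :: "'a sarr" and A B D E
  assume "f \<in> homs (Sm X) A B" "g \<in> homs (Sm X) B D" "h \<in> homs (Sm X) D E"
  then show "cmp (Sm X) (cmp (Sm X) h g) f = cmp (Sm X) h (cmp (Sm X) g f)"
    by (auto simp: Sm_homs Sm_simps rcomp_assoc)
qed

interpretation Sm: category "Sm X" for X by (rule Sm_category)

section \<open>The category of pointed simplicial presheaves\<close>

lemma sPsh_simps: "Obj (sPsh X) = {F. is_spsh X F}" "src (sPsh X) = fst" "tgt (sPsh X) (A, \<phi>, B) = B"
  "idn (sPsh X) A = (A, trans_restrict X A (\<lambda>Y n x. x), A)"
  "cmp (sPsh X) (B', \<psi>, D) (A, \<phi>, B) = (A, trans_restrict X A (\<lambda>Y n x. \<psi> Y n (\<phi> Y n x)), D)"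
  by (simp_all add: sPsh_def)

lemma sPsh_homs: "f \<in> homs (sPsh X) A B \<longleftrightarrow>
    (\<exists>\<phi>. f = (A, \<phi>, B) \<and> is_spsh X A \<and> is_spsh X B \<and> \<phi> \<in> transformations X A B)"
  unfolding homs_def sPsh_def by auto

lemma trans_restrict_apply: "Y \<in> Obj (Sm X) \<Longrightarrow> x \<in> smp A Y n \<Longrightarrow> trans_restrict X A \<phi> Y n x = \<phi> Y n x"
  by (simp add: trans_restrict_def)

lemma spsh_bpt: "is_spsh X A \<Longrightarrow> Y \<in> Obj (Sm X) \<Longrightarrow> bpt A Y n \<in> smp A Y n"
  by (simp add: is_spsh_def)

lemma spsh_act:
  assumes A: "is_spsh X A" and h: "g \<in> Arr (Sm X)" "\<theta> \<in> simp_maps n m"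
  shows "x \<in> smp A (tgt (Sm X) g) m \<Longrightarrow> act A g n m \<theta> x \<in> smp A (src (Sm X) g) n"
    and "act A g n m \<theta> (bpt A (tgt (Sm X) g) m) = bpt A (src (Sm X) g) n"
proof -
  have "\<forall>g \<in> Arr (Sm X). \<forall>n m. \<forall>\<theta> \<in> simp_maps n m.
        act A g n m \<theta> \<in> smp A (tgt (Sm X) g) m \<rightarrow> smp A (src (Sm X) g) n \<and>
        act A g n m \<theta> (bpt A (tgt (Sm X) g) m) = bpt A (src (Sm X) g) n"
    using A unfolding is_spsh_def by (elim conjE)
  then have *: "act A g n m \<theta> \<in> smp A (tgt (Sm X) g) m \<rightarrow> smp A (src (Sm X) g) n \<and>
        act A g n m \<theta> (bpt A (tgt (Sm X) g) m) = bpt A (src (Sm X) g) n" using h by blast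
  then show "act A g n m \<theta> (bpt A (tgt (Sm X) g) m) = bpt A (src (Sm X) g) n" ..
  show "act A g n m \<theta> x \<in> smp A (src (Sm X) g) n" if "x \<in> smp A (tgt (Sm X) g) m"
    using funcset_mem[OF conjunct1[OF *] that] .
qed

lemma spsh_act_id: "is_spsh X A \<Longrightarrow> Y \<in> Obj (Sm X) \<Longrightarrow> x \<in> smp A Y n \<Longrightarrow> act A (idn (Sm X) Y) n n (simp_id n) x = x"
  by (simp add: is_spsh_def)

lemma spsh_act_comp:
  assumes A: "is_spsh X A" and h: "g \<in> Arr (Sm X)" "h \<in> Arr (Sm X)" "tgt (Sm X) h = src (Sm X) g"
    "\<theta> \<in> simp_maps n m" "\<xi> \<in> simp_maps m l" "x \<in> smp A (tgt (Sm X) g) l"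
  shows "act A (cmp (Sm X) g h) n l (compose {..n} \<xi> \<theta>) x = act A h n m \<theta> (act A g m l \<xi> x)"
proof -
  have "\<forall>g \<in> Arr (Sm X). \<forall>h \<in> Arr (Sm X). tgt (Sm X) h = src (Sm X) g \<longrightarrow>
        (\<forall>n m l. \<forall>\<theta> \<in> simp_maps n m. \<forall>\<xi> \<in> simp_maps m l. \<forall>x \<in> smp A (tgt (Sm X) g) l.
           act A (cmp (Sm X) g h) n l (compose {..n} \<xi> \<theta>) x = act A h n m \<theta> (act A g m l \<xi> x))"
    using A unfolding is_spsh_def by (elim conjE)
  from mp[OF bspec[OF bspec[OF this h(1)] h(2)] h(3)] have "\<forall>\<theta> \<in> simp_maps n m. \<forall>\<xi> \<in> simp_maps m l. \<forall>x \<in> smp A (tgt (Sm X) g) l.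
           act A (cmp (Sm X) g h) n l (compose {..n} \<xi> \<theta>) x = act A h n m \<theta> (act A g m l \<xi> x)" by (elim allE)
  from bspec[OF bspec[OF bspec[OF this h(4)] h(5)] h(6)] show ?thesis .
qed

lemma is_spshI:
  assumes "\<And>Y n. Y \<in> Obj (Sm X) \<Longrightarrow> bpt F Y n \<in> smp F Y n"
    and "\<And>Y n x. Y \<in> Obj (Sm X) \<Longrightarrow> x \<in> smp F Y n \<Longrightarrow> act F (idn (Sm X) Y) n n (simp_id n) x = x"
    and "\<And>g n m \<theta> x. g \<in> Arr (Sm X) \<Longrightarrow> \<theta> \<in> simp_maps n m \<Longrightarrow> x \<in> smp F (tgt (Sm X) g) m \<Longrightarrow>
      act F g n m \<theta> x \<in> smp F (src (Sm X) g) n"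
    and "\<And>g n m \<theta>. g \<in> Arr (Sm X) \<Longrightarrow> \<theta> \<in> simp_maps n m \<Longrightarrow>
      act F g n m \<theta> (bpt F (tgt (Sm X) g) m) = bpt F (src (Sm X) g) n"
    and "\<And>g h n m l \<theta> \<xi> x. g \<in> Arr (Sm X) \<Longrightarrow> h \<in> Arr (Sm X) \<Longrightarrow> tgt (Sm X) h = src (Sm X) g \<Longrightarrow>
      \<theta> \<in> simp_maps n m \<Longrightarrow> \<xi> \<in> simp_maps m l \<Longrightarrow> x \<in> smp F (tgt (Sm X) g) l \<Longrightarrow>
      act F (cmp (Sm X) g h) n l (compose {..n} \<xi> \<theta>) x = act F h n m \<theta> (act F g m l \<xi> x)"
  shows "is_spsh X F"
  unfolding is_spsh_def by (intro conjI ballI allI impI Pi_I; rule assms; assumption)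

lemma
  assumes "\<phi> \<in> transformations X A B"
  shows trans_mem: "Y \<in> Obj (Sm X) \<Longrightarrow> x \<in> smp A Y n \<Longrightarrow> \<phi> Y n x \<in> smp B Y n"
    and trans_bpt: "Y \<in> Obj (Sm X) \<Longrightarrow> \<phi> Y n (bpt A Y n) = bpt B Y n"
    and trans_nat: "g \<in> Arr (Sm X) \<Longrightarrow> \<theta> \<in> simp_maps n m \<Longrightarrow> x \<in> smp A (tgt (Sm X) g) m \<Longrightarrow>
      \<phi> (src (Sm X) g) n (act A g n m \<theta> x) = act B g n m \<theta> (\<phi> (tgt (Sm X) g) m x)"
    and trans_ext: "trans_restrict X A \<phi> = \<phi>"
proof -
  have 123: "trans_restrict X A \<phi> = \<phi> \<and> (\<forall>Y \<in> Obj (Sm X). \<forall>n. \<phi> Y n \<in> smp A Y n \<rightarrow> smp B Y n \<and> \<phi> Y n (bpt A Y n) = bpt B Y n) \<and>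
    (\<forall>g \<in> Arr (Sm X). \<forall>n m. \<forall>\<theta> \<in> simp_maps n m. \<forall>x \<in> smp A (tgt (Sm X) g) m.
        \<phi> (src (Sm X) g) n (act A g n m \<theta> x) = act B g n m \<theta> (\<phi> (tgt (Sm X) g) m x))"
    using assms unfolding transformations_def by (rule CollectD)
  note 1 = conjunct1[OF conjunct2[OF 123]] and 2 = conjunct2[OF conjunct2[OF 123]] and 3 = conjunct1[OF 123]
  show "\<phi> Y n x \<in> smp B Y n" if "Y \<in> Obj (Sm X)" "x \<in> smp A Y n"
    using 1 that by (auto simp: Pi_iff)
  show "\<phi> Y n (bpt A Y n) = bpt B Y n" if "Y \<in> Obj (Sm X)" using 1 that by simp
  show "\<phi> (src (Sm X) g) n (act A g n m \<theta> x) = act B g n m \<theta> (\<phi> (tgt (Sm X) g) m x)"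
    if "g \<in> Arr (Sm X)" "\<theta> \<in> simp_maps n m" "x \<in> smp A (tgt (Sm X) g) m"
    by (rule bspec[OF bspec[OF spec[OF spec[OF bspec[OF 2 that(1)]]] that(2)] that(3)])
  show "trans_restrict X A \<phi> = \<phi>" by (rule 3)
qed

lemma trans_restrictI:
  assumes A: "is_spsh X A"
    and "\<And>Y n x. Y \<in> Obj (Sm X) \<Longrightarrow> x \<in> smp A Y n \<Longrightarrow> \<phi> Y n x \<in> smp B Y n"
    and "\<And>Y n. Y \<in> Obj (Sm X) \<Longrightarrow> \<phi> Y n (bpt A Y n) = bpt B Y n"
    and "\<And>g n m \<theta> x. g \<in> Arr (Sm X) \<Longrightarrow> \<theta> \<in> simp_maps n m \<Longrightarrow> x \<in> smp A (tgt (Sm X) g) m \<Longrightarrow>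
      \<phi> (src (Sm X) g) n (act A g n m \<theta> x) = act B g n m \<theta> (\<phi> (tgt (Sm X) g) m x)"
  shows "trans_restrict X A \<phi> \<in> transformations X A B"
  unfolding transformations_def mem_Collect_eq
proof (intro conjI ballI allI Pi_I)
  show "trans_restrict X A (trans_restrict X A \<phi>) = trans_restrict X A \<phi>"
    by (auto simp: trans_restrict_def fun_eq_iff)
next
  fix Y n assume Y: "Y \<in> Obj (Sm X)"
  show "trans_restrict X A \<phi> Y n x \<in> smp B Y n" if "x \<in> smp A Y n" for x
    using assms(2)[OF Y that] by (simp add: trans_restrict_apply[OF Y that])
  show "trans_restrict X A \<phi> Y n (bpt A Y n) = bpt B Y n"
    using assms(3)[OF Y] by (simp add: trans_restrict_apply[OF Y spsh_bpt[OF A Y]])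
next
  fix g n m \<theta> x assume h: "g \<in> Arr (Sm X)" "\<theta> \<in> simp_maps n m" "x \<in> smp A (tgt (Sm X) g) m"
  show "trans_restrict X A \<phi> (src (Sm X) g) n (act A g n m \<theta> x) = act B g n m \<theta> (trans_restrict X A \<phi> (tgt (Sm X) g) m x)"
    using assms(4)[OF h]
    by (simp add: trans_restrict_apply[OF Sm.src_obj[OF h(1)] spsh_act(1)[OF A h]] trans_restrict_apply[OF Sm.tgt_obj[OF h(1)] h(3)])
qed

lemma trans_restrict_eqI:
  assumes "\<And>Y n x. Y \<in> Obj (Sm X) \<Longrightarrow> x \<in> smp A Y n \<Longrightarrow> \<phi> Y n x = \<psi> Y n x"
  shows "trans_restrict X A \<phi> = trans_restrict X A \<psi>"
  using assms by (auto simp: trans_restrict_def fun_eq_iff)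

lemma trans_eqI:
  assumes "\<phi> \<in> transformations X A B" "\<psi> \<in> transformations X A B"
    and "\<And>Y n x. Y \<in> Obj (Sm X) \<Longrightarrow> x \<in> smp A Y n \<Longrightarrow> \<phi> Y n x = \<psi> Y n x"
  shows "\<phi> = \<psi>"
  using trans_restrict_eqI[of X A \<phi> \<psi>, OF assms(3)] trans_ext[OF assms(1)] trans_ext[OF assms(2)] by simp

lemma trans_comp:
  assumes A: "is_spsh X A" and \<phi>: "\<phi> \<in> transformations X A B" and \<psi>: "\<psi> \<in> transformations X B D"
  shows "trans_restrict X A (\<lambda>Y n x. \<psi> Y n (\<phi> Y n x)) \<in> transformations X A D"
  by (rule trans_restrictI[OF A])
    (simp_all add: trans_mem[OF \<psi>] trans_mem[OF \<phi>] trans_bpt[OF \<phi>] trans_bpt[OF \<psi>] trans_nat[OF \<phi>] trans_nat[OF \<psi>] Sm.tgt_obj)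

lemma sPsh_category: "category (sPsh X)"
proof
  fix f :: "('a, 'b) tarr"
  assume "f \<in> Arr (sPsh X)"
  then show "src (sPsh X) f \<in> Obj (sPsh X)" "tgt (sPsh X) f \<in> Obj (sPsh X)" by (auto simp: sPsh_def)
next
  fix A :: "('a, 'b) spsh" assume "A \<in> Obj (sPsh X)"
  then show "idn (sPsh X) A \<in> homs (sPsh X) A A"
    by (auto simp: sPsh_simps sPsh_homs intro: trans_restrictI)
next
  fix f g :: "('a, 'b) tarr" and A B D
  assume "f \<in> homs (sPsh X) A B" "g \<in> homs (sPsh X) B D"
  then show "cmp (sPsh X) g f \<in> homs (sPsh X) A D"
    by (auto simp: sPsh_simps sPsh_homs intro: trans_comp)
next
  fix f :: "('a, 'b) tarr" and A B
  assume "f \<in> homs (sPsh X) A B"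
  then obtain \<phi> where f: "f = (A, \<phi>, B)" "\<phi> \<in> transformations X A B" by (auto simp: sPsh_homs)
  have "trans_restrict X A (\<lambda>Y n x. trans_restrict X B (\<lambda>Y n x. x) Y n (\<phi> Y n x)) = trans_restrict X A \<phi>"
    by (rule trans_restrict_eqI) (simp add: trans_restrict_apply trans_mem[OF f(2)])
  then show "cmp (sPsh X) (idn (sPsh X) B) f = f" by (simp add: sPsh_simps f trans_ext[OF f(2)])
  have "trans_restrict X A (\<lambda>Y n x. \<phi> Y n (trans_restrict X A (\<lambda>Y n x. x) Y n x)) = trans_restrict X A \<phi>"
    by (rule trans_restrict_eqI) (simp add: trans_restrict_apply)
  then show "cmp (sPsh X) f (idn (sPsh X) A) = f" by (simp add: sPsh_simps f trans_ext[OF f(2)])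
next
  fix f g h :: "('a, 'b) tarr" and A B D E
  assume "f \<in> homs (sPsh X) A B" "g \<in> homs (sPsh X) B D" "h \<in> homs (sPsh X) D E"
  then obtain \<phi> \<psi> \<omega> where f: "f = (A, \<phi>, B)" "\<phi> \<in> transformations X A B" and g: "g = (B, \<psi>, D)" and h: "h = (D, \<omega>, E)"
    by (auto simp: sPsh_homs)
  show "cmp (sPsh X) (cmp (sPsh X) h g) f = cmp (sPsh X) h (cmp (sPsh X) g f)"
    unfolding f(1) g h sPsh_simps
    by (intro arg_cong2[where f = Pair] refl trans_restrict_eqI) (simp add: trans_restrict_apply trans_mem[OF f(2)])
qed

interpretation sPsh: category "sPsh X" for X by (rule sPsh_category)

definition zero_map :: "'u sch \<Rightarrow> ('u, 'e) spsh \<Rightarrow> ('u, 'e) spsh \<Rightarrow> ('u, 'e) tarr" where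
  "zero_map X A B = (A, trans_restrict X A (\<lambda>Y n x. bpt B Y n), B)"

lemma point_is_spsh: "is_spsh X point_psh"
  by (rule is_spshI) (simp_all add: point_psh_def)

lemma point_trans_unique:
  assumes "f \<in> homs (sPsh X) A point_psh" "g \<in> homs (sPsh X) A point_psh" shows "f = g"
proof -
  obtain \<phi> \<psi> where h: "f = (A, \<phi>, point_psh)" "\<phi> \<in> transformations X A point_psh"
    "g = (A, \<psi>, point_psh)" "\<psi> \<in> transformations X A point_psh" using assms by (auto simp: sPsh_homs)
  have "\<phi> = \<psi>"
    by (rule trans_eqI[OF h(2,4)]) (use trans_mem[OF h(2)] trans_mem[OF h(4)] in \<open>simp add: point_psh_def\<close>)
  then show ?thesis using h by simp
qed

lemma zero_map_hom: "is_spsh X A \<Longrightarrow> is_spsh X B \<Longrightarrow> zero_map X A B \<in> homs (sPsh X) A B"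
  by (auto simp: sPsh_homs zero_map_def spsh_bpt spsh_act intro!: trans_restrictI)

lemma to_point_zero: "to_point X A = zero_map X A point_psh"
  by (simp add: to_point_def zero_map_def point_psh_def)

lemma sPsh_zero_category: "zero_category (sPsh X) point_psh (zero_map X)"
proof
  show "point_psh \<in> Obj (sPsh X)" by (simp add: sPsh_simps point_is_spsh)
  fix f :: "('a, 'b) parr" and A B D :: "('a, 'b) psh"
  show "zero_map X A B \<in> homs (sPsh X) A B" if "A \<in> Obj (sPsh X)" "B \<in> Obj (sPsh X)"
    using that by (simp add: sPsh_simps zero_map_hom)
  show "cmp (sPsh X) f (zero_map X A B) = zero_map X A D" if f: "f \<in> homs (sPsh X) B D" and A: "A \<in> Obj (sPsh X)"
    using f unfolding sPsh_homs zero_map_def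
    by (auto simp: sPsh_simps trans_restrict_apply trans_bpt intro!: trans_restrict_eqI)
  show "cmp (sPsh X) (zero_map X B D) f = zero_map X A D" if f: "f \<in> homs (sPsh X) A B" and D: "D \<in> Obj (sPsh X)"
    using f unfolding sPsh_homs zero_map_def
    by (auto simp: sPsh_simps trans_restrict_apply trans_mem intro!: trans_restrict_eqI)
  show "f = zero_map X A point_psh" if f: "f \<in> homs (sPsh X) A point_psh"
    by (rule point_trans_unique[OF f zero_map_hom]) (use f in \<open>auto simp: sPsh_homs\<close>)
qed

section \<open>Fibers as kernels\<close>

lemma fiber_is_spsh:
  assumes p: "p \<in> homs (sPsh X) E B" shows "is_spsh X (fiber X p)"
proof -
  obtain \<phi> where h: "p = (E, \<phi>, B)" "\<phi> \<in> transformations X E B" "is_spsh X E" "is_spsh X B" using p by (auto simp: sPsh_homs)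
  show ?thesis
    by (rule is_spshI)
      (simp_all add: h(1) fiber_def spsh_bpt[OF h(3)] trans_bpt[OF h(2)] spsh_act_id[OF h(3)] spsh_act[OF h(3)]
        trans_nat[OF h(2)] spsh_act[OF h(4)] spsh_act_comp[OF h(3)])
qed

definition fiber_incl :: "'u sch \<Rightarrow> ('u, 'e) tarr \<Rightarrow> ('u, 'e) tarr" where
  "fiber_incl X p = (fiber X p, trans_restrict X (fiber X p) (\<lambda>Y n x. x), fst p)"

lemma fiber_incl_hom:
  assumes p: "p \<in> homs (sPsh X) E B" shows "fiber_incl X p \<in> homs (sPsh X) (fiber X p) E"
proof -
  have 1: "is_spsh X E" "fst p = E" using p by (auto simp: sPsh_homs)
  have "trans_restrict X (fiber X p) (\<lambda>Y n x. x) \<in> transformations X (fiber X p) E"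
    by (rule trans_restrictI[OF fiber_is_spsh[OF p]]) (use p in \<open>auto simp: fiber_def sPsh_homs\<close>)
  then show ?thesis using 1 fiber_is_spsh[OF p] by (simp add: fiber_incl_def sPsh_homs)
qed

text \<open>A map killed by \<open>p\<close> takes its values in the fiber, so the same components
  define its factorization. The inclusion is the identity on simplices, which leaves no second
  choice.\<close>

lemma fiber_is_ker:
  fixes p :: "('u, 'v) parr"
  assumes p: "p \<in> homs (sPsh X) E B"
  shows "zero_category.is_ker (sPsh X) (zero_map X) p (fiber X p) (fiber_incl X p)"
proof -
  interpret zero_category "sPsh X" "point_psh :: ('u, 'v) psh" "zero_map X" by (rule sPsh_zero_category)
  obtain \<phi> where h: "p = (E, \<phi>, B)" "\<phi> \<in> transformations X E B" "is_spsh X E" "is_spsh X B" using p by (auto simp: sPsh_homs)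
  note F = fiber_is_spsh[OF p]
  have incl: "cmp (sPsh X) p (fiber_incl X p) = zero_map X (fiber X p) B"
    unfolding h(1) fiber_incl_def zero_map_def sPsh_simps
    by (intro arg_cong2[where f = Pair] refl trans_restrict_eqI) (simp add: trans_restrict_apply, simp add: fiber_def)
  have "\<exists>!k. k \<in> homs (sPsh X) T (fiber X p) \<and> cmp (sPsh X) (fiber_incl X p) k = x"
    if x: "x \<in> homs (sPsh X) T E" and px: "cmp (sPsh X) p x = zero_map X T B" for T x
  proof -
    obtain \<xi> where \<xi>: "x = (T, \<xi>, E)" "\<xi> \<in> transformations X T E" "is_spsh X T" using x by (auto simp: sPsh_homs)
    have eq: "\<phi> Y n (\<xi> Y n t) = bpt B Y n" if "Y \<in> Obj (Sm X)" "t \<in> smp T Y n" for Y n t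
      using px trans_restrict_apply[OF that, of "\<lambda>Y n x. \<phi> Y n (\<xi> Y n x)"] trans_restrict_apply[OF that, of "\<lambda>Y n x. bpt B Y n"]
      by (simp add: h(1) \<xi>(1) zero_map_def sPsh_simps)
    have mem: "\<xi> Y n t \<in> smp (fiber X p) Y n" if "Y \<in> Obj (Sm X)" "t \<in> smp T Y n" for Y n t
      using eq[OF that] trans_mem[OF \<xi>(2) that] by (simp add: fiber_def h(1))
    have "trans_restrict X T \<xi> \<in> transformations X T (fiber X p)"
      by (rule trans_restrictI[OF \<xi>(3) mem]) (simp_all add: fiber_def h(1) trans_bpt[OF \<xi>(2)] trans_nat[OF \<xi>(2)])
    then have k: "(T, \<xi>, fiber X p) \<in> homs (sPsh X) T (fiber X p)"
      using \<xi>(3) F trans_ext[OF \<xi>(2)] by (simp add: sPsh_homs)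
    have "trans_restrict X T (\<lambda>Y n x. trans_restrict X (fiber X p) (\<lambda>Y n x. x) Y n (\<xi> Y n x)) = trans_restrict X T \<xi>"
      by (rule trans_restrict_eqI) (simp add: trans_restrict_apply mem)
    then have 1: "cmp (sPsh X) (fiber_incl X p) (T, \<xi>, fiber X p) = x"
      by (simp add: fiber_incl_def sPsh_simps \<xi>(1) h(1) trans_ext[OF \<xi>(2)])
    have "k' = (T, \<xi>, fiber X p)" if k': "k' \<in> homs (sPsh X) T (fiber X p)" "cmp (sPsh X) (fiber_incl X p) k' = x" for k'
    proof -
      obtain \<kappa> where \<kappa>: "k' = (T, \<kappa>, fiber X p)" "\<kappa> \<in> transformations X T (fiber X p)" using k'(1) by (auto simp: sPsh_homs)
      have "\<kappa> Y n t = \<xi> Y n t" if "Y \<in> Obj (Sm X)" "t \<in> smp T Y n" for Y n t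
      proof -
        have "\<xi> = trans_restrict X T (\<lambda>Y n x. trans_restrict X (fiber X p) (\<lambda>Y n x. x) Y n (\<kappa> Y n x))"
          using k'(2) by (simp add: \<kappa>(1) \<xi>(1) fiber_incl_def sPsh_simps)
        then have "\<xi> Y n t = trans_restrict X T (\<lambda>Y n x. trans_restrict X (fiber X p) (\<lambda>Y n x. x) Y n (\<kappa> Y n x)) Y n t"
          by simp
        then show ?thesis by (simp add: trans_restrict_apply that trans_mem[OF \<kappa>(2) that])
      qed
      then have "trans_restrict X T \<kappa> = trans_restrict X T \<xi>" by (rule trans_restrict_eqI)
      then show ?thesis using trans_ext[OF \<kappa>(2)] trans_ext[OF \<xi>(2)] \<kappa>(1) by simp
    qed
    with k 1 show ?thesis by blast
  qed
  then show ?thesis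
    unfolding is_ker_def using p incl fiber_incl_hom[OF p] homsD[OF p] by simp
qed

subsection \<open>Pullbacks of presheaves\<close>

text \<open>Pairs of simplices are coded by single simplices: the index type of \<open>elt\<close> is infinite, hence
  absorbs the sum with itself.\<close>

lemma infinite_index: "infinite (UNIV :: ('u::infinite) sarr set set set)"
proof
  assume fin: "finite (UNIV :: 'u sarr set set set)"
  define f :: "'u \<Rightarrow> 'u sarr set set" where "f y = {{(undefined, \<lparr>pmap = (\<lambda>_. y), co = undefined\<rparr>, undefined)}}" for y
  have "inj f"
  proof (rule injI)
    fix x y assume "f x = f y"
    then have "(\<lambda>_::'u. x) = (\<lambda>_. y)" by (simp add: f_def)
    then show "x = y" by (metis (no_types))
  qed
  moreover have "finite (range f)" by (rule finite_subset[OF _ fin]) simp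
  ultimately have "finite (UNIV :: 'u set)" by (rule finite_imageD[rotated])
  then show False using infinite_UNIV[where 'a = 'u] by simp
qed

lemma inj_index_sum: "\<exists>c :: ('u::infinite) sarr set set + 'u sarr set set \<Rightarrow> 'u sarr set set. inj c"
proof -
  have "|(UNIV :: 'u sarr set set set) <+> (UNIV :: 'u sarr set set set)| =o |UNIV :: 'u sarr set set set|"
    by (rule card_of_Plus_infinite1[OF infinite_index]) simp
  then have "|UNIV :: ('u sarr set set + 'u sarr set set) set| \<le>o |UNIV :: 'u sarr set set set|"
    unfolding UNIV_Plus_UNIV by (rule ordIso_imp_ordLeq)
  then have "\<exists>c :: 'u sarr set set + 'u sarr set set \<Rightarrow> 'u sarr set set. inj c \<and> range c \<subseteq> UNIV"
    by (rule card_of_ordLeq[THEN iffD2])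
  then show ?thesis by (elim exE conjE) (rule exI)
qed

definition index_sum :: "('u::infinite) sarr set set + 'u sarr set set \<Rightarrow> 'u sarr set set" where
  "index_sum = (SOME c. inj c)"

definition pr1 :: "('u::infinite, 'v) elt \<Rightarrow> ('u, 'v) elt" where "pr1 e = (\<lambda>S. e (index_sum (Inl S)))"
definition pr2 :: "('u::infinite, 'v) elt \<Rightarrow> ('u, 'v) elt" where "pr2 e = (\<lambda>S. e (index_sum (Inr S)))"
text \<open>Indices outside the range of \<open>index_sum\<close> receive the default
  \<open>None\<close>, so an arbitrary element need not be a coded pair. Injectivity of the code
  suffices, because the pullback contains coded pairs only.\<close>

definition pair :: "('u::infinite, 'v) elt \<Rightarrow> ('u, 'v) elt \<Rightarrow> ('u, 'v) elt" where
  "pair x y = (\<lambda>S. if S \<in> range index_sum then case_sum x y (inv_into UNIV index_sum S) else None)"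

lemma pr_pair [simp]: "pr1 (pair x y) = x" "pr2 (pair x y) = y"
proof -
  have "inj (index_sum :: 'a sarr set set + 'a sarr set set \<Rightarrow> _)"
    unfolding index_sum_def by (rule someI_ex[OF inj_index_sum])
  then show "pr1 (pair x y) = x" "pr2 (pair x y) = y" by (simp_all add: pr1_def pr2_def pair_def)
qed

lemma pair_eq [simp]: "pair x y = pair x' y' \<longleftrightarrow> x = x' \<and> y = y'"
  by (metis pr_pair)

definition pullback_psh :: "('u::infinite, 'v) parr \<Rightarrow> ('u, 'v) parr \<Rightarrow> ('u, 'v) psh" where
  "pullback_psh f g = (case (f, g) of ((A, \<phi>, D), (B, \<psi>, D')) \<Rightarrow>
     \<lparr>smp = (\<lambda>Y n. {pair x y | x y. x \<in> smp A Y n \<and> y \<in> smp B Y n \<and> \<phi> Y n x = \<psi> Y n y}),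
      bpt = (\<lambda>Y n. pair (bpt A Y n) (bpt B Y n)),
      act = (\<lambda>h n m \<theta> e. pair (act A h n m \<theta> (pr1 e)) (act B h n m \<theta> (pr2 e)))\<rparr>)"

lemma sPsh_pullback:
  fixes f g :: "('u::infinite, 'v) parr"
  assumes f: "f \<in> homs (sPsh X) A D" and g: "g \<in> homs (sPsh X) B D"
  shows "\<exists>P a b. category.is_pb (sPsh X) f g P a b"
proof -
  obtain \<phi> where \<phi>: "f = (A, \<phi>, D)" "\<phi> \<in> transformations X A D" and A: "is_spsh X A" and D: "is_spsh X D" using f by (auto simp: sPsh_homs)
  obtain \<psi> where \<psi>: "g = (B, \<psi>, D)" "\<psi> \<in> transformations X B D" and B: "is_spsh X B" using g by (auto simp: sPsh_homs)
  define P where "P = pullback_psh f g"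
  have P_simps: "smp P Y n = {pair x y | x y. x \<in> smp A Y n \<and> y \<in> smp B Y n \<and> \<phi> Y n x = \<psi> Y n y}"
    "bpt P Y n = pair (bpt A Y n) (bpt B Y n)"
    "act P h n m \<theta> e = pair (act A h n m \<theta> (pr1 e)) (act B h n m \<theta> (pr2 e))" for Y n h m \<theta> e
    by (simp_all add: P_def pullback_psh_def \<phi>(1) \<psi>(1))
  have P: "is_spsh X P"
    by (rule is_spshI)
      (auto simp: P_simps spsh_bpt[OF A] spsh_bpt[OF B] trans_bpt[OF \<phi>(2)] trans_bpt[OF \<psi>(2)] spsh_act_id[OF A] spsh_act_id[OF B]
        spsh_act[OF A] spsh_act[OF B] trans_nat[OF \<phi>(2)] trans_nat[OF \<psi>(2)] spsh_act_comp[OF A] spsh_act_comp[OF B])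
  define \<alpha> \<beta> where "\<alpha> = trans_restrict X P (\<lambda>Y n. pr1)" and "\<beta> = trans_restrict X P (\<lambda>Y n. pr2)"
  have \<alpha>: "\<alpha> \<in> transformations X P A" and \<beta>: "\<beta> \<in> transformations X P B"
    unfolding \<alpha>_def \<beta>_def by (rule trans_restrictI[OF P]; auto simp: P_simps)+
  have \<alpha>e: "\<alpha> Y n e = pr1 e" and \<beta>e: "\<beta> Y n e = pr2 e" if "Y \<in> Obj (Sm X)" "e \<in> smp P Y n" for Y n e
    unfolding \<alpha>_def \<beta>_def using trans_restrict_apply[OF that] by auto
  have h: "(P, \<alpha>, A) \<in> homs (sPsh X) P A" "(P, \<beta>, B) \<in> homs (sPsh X) P B" using P A B \<alpha> \<beta> by (auto simp: sPsh_homs)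
  have sq: "cmp (sPsh X) f (P, \<alpha>, A) = cmp (sPsh X) g (P, \<beta>, B)"
    unfolding \<phi>(1) \<psi>(1) sPsh_simps
    by (intro arg_cong2[where f = Pair] refl trans_restrict_eqI) (auto simp: \<alpha>e \<beta>e P_simps)
  have "\<exists>!k. k \<in> homs (sPsh X) T P \<and> cmp (sPsh X) (P, \<alpha>, A) k = x \<and> cmp (sPsh X) (P, \<beta>, B) k = y"
    if x: "x \<in> homs (sPsh X) T A" and y: "y \<in> homs (sPsh X) T B" and e: "cmp (sPsh X) f x = cmp (sPsh X) g y" for T x y
  proof -
    obtain \<xi> where \<xi>: "x = (T, \<xi>, A)" "\<xi> \<in> transformations X T A" and T: "is_spsh X T" using x by (auto simp: sPsh_homs)
    obtain \<eta> where \<eta>: "y = (T, \<eta>, B)" "\<eta> \<in> transformations X T B" using y by (auto simp: sPsh_homs)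
    have eq: "\<phi> Y n (\<xi> Y n t) = \<psi> Y n (\<eta> Y n t)" if "Y \<in> Obj (Sm X)" "t \<in> smp T Y n" for Y n t
      using e trans_restrict_apply[OF that, of "\<lambda>Y n x. \<phi> Y n (\<xi> Y n x)"] trans_restrict_apply[OF that, of "\<lambda>Y n x. \<psi> Y n (\<eta> Y n x)"]
      by (simp add: \<xi>(1) \<eta>(1) \<phi>(1) \<psi>(1) sPsh_simps)
    define \<kappa> where "\<kappa> = trans_restrict X T (\<lambda>Y n t. pair (\<xi> Y n t) (\<eta> Y n t))"
    have mem: "pair (\<xi> Y n t) (\<eta> Y n t) \<in> smp P Y n" if "Y \<in> Obj (Sm X)" "t \<in> smp T Y n" for Y n t
      using eq[OF that] trans_mem[OF \<xi>(2) that] trans_mem[OF \<eta>(2) that] by (auto simp: P_simps)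
    have \<kappa>: "\<kappa> \<in> transformations X T P" unfolding \<kappa>_def
      by (rule trans_restrictI[OF T mem])
        (simp_all add: P_simps trans_bpt[OF \<xi>(2)] trans_bpt[OF \<eta>(2)] trans_nat[OF \<xi>(2)] trans_nat[OF \<eta>(2)])
    have \<kappa>e: "\<kappa> Y n t = pair (\<xi> Y n t) (\<eta> Y n t)" if "Y \<in> Obj (Sm X)" "t \<in> smp T Y n" for Y n t
      unfolding \<kappa>_def by (rule trans_restrict_apply[OF that])
    have k: "(T, \<kappa>, P) \<in> homs (sPsh X) T P" using T P \<kappa> by (simp add: sPsh_homs)
    have "trans_restrict X T (\<lambda>Y n t. \<alpha> Y n (\<kappa> Y n t)) = trans_restrict X T \<xi>" "trans_restrict X T (\<lambda>Y n t. \<beta> Y n (\<kappa> Y n t)) = trans_restrict X T \<eta>"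
      by (rule trans_restrict_eqI; simp add: \<kappa>e \<alpha>e \<beta>e mem)+
    then have 1: "cmp (sPsh X) (P, \<alpha>, A) (T, \<kappa>, P) = x" "cmp (sPsh X) (P, \<beta>, B) (T, \<kappa>, P) = y"
      by (simp_all add: sPsh_simps \<xi>(1) \<eta>(1) trans_ext[OF \<xi>(2)] trans_ext[OF \<eta>(2)])
    have "k' = (T, \<kappa>, P)" if k': "k' \<in> homs (sPsh X) T P" "cmp (sPsh X) (P, \<alpha>, A) k' = x" "cmp (sPsh X) (P, \<beta>, B) k' = y" for k'
    proof -
      obtain \<mu> where \<mu>: "k' = (T, \<mu>, P)" "\<mu> \<in> transformations X T P" using k'(1) by (auto simp: sPsh_homs)
      have "\<mu> Y n t = \<kappa> Y n t" if t: "Y \<in> Obj (Sm X)" "t \<in> smp T Y n" for Y n t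
      proof -
        have "\<xi> = trans_restrict X T (\<lambda>Y n t. \<alpha> Y n (\<mu> Y n t))" "\<eta> = trans_restrict X T (\<lambda>Y n t. \<beta> Y n (\<mu> Y n t))"
          using k'(2,3) by (simp_all add: \<mu>(1) \<xi>(1) \<eta>(1) sPsh_simps)
        then have "\<xi> Y n t = trans_restrict X T (\<lambda>Y n t. \<alpha> Y n (\<mu> Y n t)) Y n t" "\<eta> Y n t = trans_restrict X T (\<lambda>Y n t. \<beta> Y n (\<mu> Y n t)) Y n t"
          by simp_all
        then have *: "pr1 (\<mu> Y n t) = \<xi> Y n t" "pr2 (\<mu> Y n t) = \<eta> Y n t"
          using \<alpha>e[OF t(1) trans_mem[OF \<mu>(2) t]] \<beta>e[OF t(1) trans_mem[OF \<mu>(2) t]] trans_restrict_apply[OF t] by simp_all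
        \<comment> \<open>The projections determine an element only among coded pairs; this is where
          membership in \<open>P\<close> enters the uniqueness.\<close>
        obtain a b where "\<mu> Y n t = pair a b" using trans_mem[OF \<mu>(2) t] by (auto simp: P_simps)
        then show ?thesis using * by (simp add: \<kappa>e[OF t])
      qed
      then show ?thesis using trans_eqI[OF \<mu>(2) \<kappa>] \<mu>(1) by simp
    qed
    with k 1 show ?thesis by blast
  qed
  then have "category.is_pb (sPsh X) f g P (P, \<alpha>, A) (P, \<beta>, B)"
    unfolding sPsh.is_pb_def using f g h sq homsD[OF f] homsD[OF g] by simp
  then show ?thesis by blast
qed

lemma sPsh_model_category:
  fixes W :: "('u::infinite, 'v) parr set"
  assumes "model_structure (sPsh X) W (mono_arrs X) (fibs X W) F C"
  shows "model_category (sPsh X) point_psh (zero_map X) W (mono_arrs X) (fibs X W) F C"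
proof -
  interpret zero_category "sPsh X" "point_psh :: ('u, 'v) psh" "zero_map X" by (rule sPsh_zero_category)
  show ?thesis
    by unfold_locales (use assms sPsh_pullback in \<open>auto simp: fibs_def\<close>)
qed

section \<open>Representable presheaves\<close>

text \<open>The index \<open>{{f}}\<close> is the only one at which \<open>elt_of f\<close> differs
  from \<open>None\<close>, so evaluation there recovers the arrow.\<close>

lemma elt_of_eq [simp]: "elt_of f = (elt_of g :: ('u, 'v) elt) \<longleftrightarrow> f = g"
proof
  assume "elt_of f = (elt_of g :: ('u, 'v) elt)"
  then have "elt_of f {{f}} = (elt_of g {{f}} :: 'v option)" by simp
  then show "f = g" by (simp add: elt_of_def split: if_splits)
qed simp

lemma star_elt_of [simp]: "(star :: ('u, 'v) elt) \<noteq> elt_of f" "elt_of f \<noteq> (star :: ('u, 'v) elt)"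
proof -
  have "(star :: ('u, 'v) elt) {{f}} \<noteq> elt_of f {{f}}" by (simp add: star_def elt_of_def)
  then show "(star :: ('u, 'v) elt) \<noteq> elt_of f" "elt_of f \<noteq> (star :: ('u, 'v) elt)" by auto
qed

lemma arr_of_elt_of [simp]: "arr_of (elt_of f) = f"
  by (simp add: arr_of_def)

lemma rep_plus_simps: "smp (rep_plus X Y) V n = insert star (elt_of ` homs (Sm X) V Y)" "bpt (rep_plus X Y) V n = star"
  "act (rep_plus X Y) h n m \<theta> e = (if e = star then star else elt_of (cmp (Sm X) (arr_of e) h))"
  by (simp_all add: rep_plus_def)

lemma rep_plus_elt_cases:
  assumes "e \<in> smp (rep_plus X Y) V n"
  obtains "e = star" | f where "f \<in> homs (Sm X) V Y" "e = elt_of f"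
  using assms by (simp add: rep_plus_simps) blast

lemma rep_plus_is_spsh: "is_spsh X (rep_plus X Y)"
proof (rule is_spshI, goal_cases)
  case (1 V n) then show ?case by (simp add: rep_plus_simps)
next
  case (2 V n e) from 2(2) show ?case by (rule rep_plus_elt_cases) (simp_all add: rep_plus_simps Sm.idn_right)
next
  case (3 g n m \<theta> e)
  from 3(3) show ?case
  proof (rule rep_plus_elt_cases)
    fix f assume f: "f \<in> homs (Sm X) (tgt (Sm X) g) Y" "e = elt_of f"
    show ?thesis using Sm.cmp_hom[OF Sm.arr_hom[OF 3(1)] f(1)] f(2) by (simp add: rep_plus_simps)
  qed (simp add: rep_plus_simps)
next
  case (4 g n m \<theta>) then show ?case by (simp add: rep_plus_simps)
next
  case (5 g h n m l \<theta> \<xi> e)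
  have h: "h \<in> homs (Sm X) (src (Sm X) h) (src (Sm X) g)" using Sm.arr_hom[OF 5(2)] 5(3) by simp
  from 5(6) show ?case
  proof (rule rep_plus_elt_cases)
    fix f assume f: "f \<in> homs (Sm X) (tgt (Sm X) g) Y" "e = elt_of f"
    show ?thesis using Sm.cmp_assoc[OF h Sm.arr_hom[OF 5(1)] f(1)] f(2) by (simp add: rep_plus_simps)
  qed (simp add: rep_plus_simps)
qed

lemma rep_map_hom:
  assumes f: "f \<in> homs (Sm X) Y W" shows "rep_map X f \<in> homs (sPsh X) (rep_plus X Y) (rep_plus X W)"
proof -
  have "trans_restrict X (rep_plus X Y) (\<lambda>V n e. if e = star then star else elt_of (cmp (Sm X) f (arr_of e)))
      \<in> transformations X (rep_plus X Y) (rep_plus X W)"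
  proof (rule trans_restrictI[OF rep_plus_is_spsh], goal_cases)
    case (1 V n e)
    from 1(2) show ?case
    proof (rule rep_plus_elt_cases)
      fix h assume "h \<in> homs (Sm X) V Y" "e = elt_of h"
      then show ?thesis using Sm.cmp_hom[OF _ f] by (simp add: rep_plus_simps)
    qed (simp add: rep_plus_simps)
  next
    case (2 V n) then show ?case by (simp add: rep_plus_simps)
  next
    case (3 g n m \<theta> e)
    from 3(3) show ?case
    proof (rule rep_plus_elt_cases)
      fix h assume h: "h \<in> homs (Sm X) (tgt (Sm X) g) Y" "e = elt_of h"
      then show ?thesis using Sm.cmp_assoc[OF Sm.arr_hom[OF 3(1)] h(1) f] by (simp add: rep_plus_simps)
    qed (simp add: rep_plus_simps)
  qed
  then show ?thesis using homsD[OF f] by (simp add: rep_map_def sPsh_homs rep_plus_is_spsh)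
qed

lemma rep_map_cmp:
  assumes f: "f \<in> homs (Sm X) Y W" and g: "g \<in> homs (Sm X) W D"
  shows "cmp (sPsh X) (rep_map X g) (rep_map X f) = (rep_map X (cmp (Sm X) g f) :: ('u, 'v) parr)"
proof -
  have "trans_restrict X (rep_plus X Y :: ('u, 'v) psh) (\<lambda>V n e. trans_restrict X (rep_plus X W)
        (\<lambda>V n e. if e = star then star else elt_of (cmp (Sm X) g (arr_of e))) V n
        (trans_restrict X (rep_plus X Y) (\<lambda>V n e. if e = star then star else elt_of (cmp (Sm X) f (arr_of e))) V n e)) =
      trans_restrict X (rep_plus X Y) (\<lambda>V n e. if e = star then star else elt_of (cmp (Sm X) (cmp (Sm X) g f) (arr_of e)))"
  proof (rule trans_restrict_eqI)
    fix V n and e :: "('u, 'v) elt" assume V: "V \<in> Obj (Sm X)" and e: "e \<in> smp (rep_plus X Y) V n"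
    from e show "trans_restrict X (rep_plus X W :: ('u, 'v) psh) (\<lambda>V n e. if e = star then star else elt_of (cmp (Sm X) g (arr_of e))) V n
        (trans_restrict X (rep_plus X Y) (\<lambda>V n e. if e = star then star else elt_of (cmp (Sm X) f (arr_of e))) V n e) =
      (if e = star then star else elt_of (cmp (Sm X) (cmp (Sm X) g f) (arr_of e)))"
    proof (rule rep_plus_elt_cases)
      fix h assume h: "h \<in> homs (Sm X) V Y" "e = elt_of h"
      then show ?thesis using V Sm.cmp_hom[OF h(1) f] Sm.cmp_assoc[OF h(1) f g]
        by (simp add: trans_restrict_apply rep_plus_simps)
    qed (use V in \<open>simp add: trans_restrict_apply rep_plus_simps\<close>)
  qed
  then show ?thesis
    using homsD[OF f] homsD[OF g] homsD[OF Sm.cmp_hom[OF f g]] by (simp add: rep_map_def sPsh_simps)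
qed

lemma rep_map_idn:
  assumes Y: "Y \<in> Obj (Sm X)"
  shows "rep_map X (idn (Sm X) Y) = (idn (sPsh X) (rep_plus X Y) :: ('u, 'v) parr)"
proof -
  have "trans_restrict X (rep_plus X Y :: ('u, 'v) psh) (\<lambda>V n e. if e = star then star else elt_of (cmp (Sm X) (idn (Sm X) Y) (arr_of e))) =
      trans_restrict X (rep_plus X Y) (\<lambda>V n e. e)"
  proof (rule trans_restrict_eqI)
    fix V n and e :: "('u, 'v) elt" assume "e \<in> smp (rep_plus X Y) V n"
    then show "(if e = star then star else elt_of (cmp (Sm X) (idn (Sm X) Y) (arr_of e))) = e"
      by (rule rep_plus_elt_cases) (simp_all add: Sm.idn_left)
  qed
  then show ?thesis using homsD[OF Sm.idn_hom[OF Y]] by (simp add: rep_map_def sPsh_simps)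
qed

section \<open>The towers\<close>

lemma WB_immersions_antimono:
  assumes "m \<le> n" shows "WB_immersions X n \<subseteq> WB_immersions X m"
proof -
  have "enat (m + 1) \<le> c" if "enat (n + 1) \<le> c" for c
    using that assms by (meson add_le_mono1 enat_ord_simps(1) order_trans)
  then show ?thesis unfolding WB_immersions_def Let_def by blast
qed

text \<open>A larger codimension bound leaves fewer maps to invert, hence more local objects to test
  against and fewer weak equivalences.\<close>

lemma WB_weqs_antimono:
  assumes "m \<le> n" shows "(WB_weqs X n :: ('u, 'v) parr set) \<subseteq> WB_weqs X m"
proof -
  have "(WB X n :: ('u, 'v) parr set) \<subseteq> WB X m" unfolding WB_def using WB_immersions_antimono[OF assms] by blast
  then have "WB_local X m Z \<Longrightarrow> WB_local X n Z" for Z :: "('u, 'v) psh" unfolding WB_local_def by blast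
  then show ?thesis unfolding WB_weqs_def by blast
qed

lemma motivic_weqs_subset: "motivic_weqs X \<subseteq> WB_weqs X n"
  unfolding motivic_weqs_def WB_weqs_def WB_local_def by blast

lemma fibs_antimono: "W \<subseteq> W' \<Longrightarrow> fibs X W' \<subseteq> fibs X W"
  unfolding fibs_def rlp_def by blast

lemma rep_map_WB_weqs:
  assumes "j \<in> WB_immersions X n" shows "rep_map X j \<in> WB_weqs X n"
proof -
  have "j \<in> Arr (Sm X)" using assms by (simp add: WB_immersions_def)
  then have "rep_map X j \<in> Arr (sPsh X)" using homsD[OF rep_map_hom[OF Sm.arr_hom]] by blast
  then show ?thesis using assms by (auto simp: WB_weqs_def WB_local_def WB_def)
qed

context model_category
begin

lemma fibrant_Z: "fibrant Z"
proof -
  note i = idn_hom[OF Z_obj]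
  have "idn C Z \<in> rlp C (Cof \<inter> W)"
  proof (rule rlpI[OF i TCof_arr])
    fix i' K L a b assume h: "i' \<in> hom K L" "a \<in> hom K Z" "b \<in> hom L Z" "idn C Z \<cdot> a = b \<cdot> i'"
    then show "\<exists>h\<in>hom L Z. h \<cdot> i' = a \<and> idn C Z \<cdot> h = b"
      using idn_left[OF h(2)] idn_left[OF h(3)] by auto
  qed
  then have "zr Z Z \<in> Fib" using Fib_eq zr_to_Z[OF i] by simp
  then show ?thesis using Z_obj by (simp add: fibrant_def)
qed

lemma iso_W:
  assumes f: "f \<in> hom A B" and g: "g \<in> hom B A" and e: "g \<cdot> f = idn C A" "f \<cdot> g = idn C B"
  shows "f \<in> W"
  by (rule W_retraction[OF f g e(1)]) (use e(2) idn_W hom_obj[OF f] in simp)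

lemma TF_functorial: "functorial_factorization C (Cof \<inter> W) Fib TF"
  using model by (simp add: model_structure_def)

lemma TF_simps:
  assumes f: "f \<in> hom A B"
  shows "fl TF f \<in> hom A (tgt C (fl TF f))" "fl TF f \<in> W" "fr TF f \<in> hom (tgt C (fl TF f)) B" "fr TF f \<in> Fib"
    "fr TF f \<cdot> fl TF f = f" "fm TF f f (idn C A) (idn C B) = idn C (tgt C (fl TF f))"
proof -
  have "\<forall>f \<in> Arr C. fl TF f \<in> Cof \<inter> W \<and> fr TF f \<in> Fib \<and> src C (fl TF f) = src C f \<and>
        tgt C (fl TF f) = src C (fr TF f) \<and> tgt C (fr TF f) = tgt C f \<and> cmp C (fr TF f) (fl TF f) = f \<and>
        fm TF f f (idn C (src C f)) (idn C (tgt C f)) = idn C (tgt C (fl TF f))"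
    using TF_functorial unfolding functorial_factorization_def by (elim conjE)
  with homsD[OF f] have h: "fl TF f \<in> Cof \<inter> W \<and> fr TF f \<in> Fib \<and> src C (fl TF f) = A \<and>
        tgt C (fl TF f) = src C (fr TF f) \<and> tgt C (fr TF f) = B \<and> cmp C (fr TF f) (fl TF f) = f \<and>
        fm TF f f (idn C A) (idn C B) = idn C (tgt C (fl TF f))" by blast
  moreover have "Fib \<subseteq> Arr C" using Fib_eq by (auto simp: rlp_def)
  ultimately show "fl TF f \<in> hom A (tgt C (fl TF f))" "fl TF f \<in> W" "fr TF f \<in> hom (tgt C (fl TF f)) B" "fr TF f \<in> Fib"
    "fr TF f \<cdot> fl TF f = f" "fm TF f f (idn C A) (idn C B) = idn C (tgt C (fl TF f))"
    using TCof_arr by (auto simp: homs_def)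
qed

lemma squareI: "f \<in> hom A B \<Longrightarrow> g \<in> hom A' B' \<Longrightarrow> a \<in> hom A A' \<Longrightarrow> b \<in> hom B B' \<Longrightarrow> g \<cdot> a = b \<cdot> f \<Longrightarrow> square C f g a b"
  by (auto simp: square_def homs_def)

lemma TF_map:
  assumes s: "square C f g a b"
  shows "fm TF f g a b \<in> hom (tgt C (fl TF f)) (tgt C (fl TF g))" "fm TF f g a b \<cdot> fl TF f = fl TF g \<cdot> a"
    "fr TF g \<cdot> fm TF f g a b = b \<cdot> fr TF f"
proof -
  have "\<forall>f g a b. square C f g a b \<longrightarrow>
        fm TF f g a b \<in> homs C (tgt C (fl TF f)) (tgt C (fl TF g)) \<and>
        cmp C (fm TF f g a b) (fl TF f) = cmp C (fl TF g) a \<and>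
        cmp C (fr TF g) (fm TF f g a b) = cmp C b (fr TF f)"
    using TF_functorial unfolding functorial_factorization_def by (elim conjE)
  with s show "fm TF f g a b \<in> hom (tgt C (fl TF f)) (tgt C (fl TF g))" "fm TF f g a b \<cdot> fl TF f = fl TF g \<cdot> a"
    "fr TF g \<cdot> fm TF f g a b = b \<cdot> fr TF f" by blast+
qed

lemma TF_map_comp:
  assumes "square C f g a b" "square C g h a' b'"
  shows "fm TF f h (a' \<cdot> a) (b' \<cdot> b) = fm TF g h a' b' \<cdot> fm TF f g a b"
proof -
  have "\<forall>f g h a b a' b'. square C f g a b \<and> square C g h a' b' \<longrightarrow>
        fm TF f h (cmp C a' a) (cmp C b' b) = cmp C (fm TF g h a' b') (fm TF f g a b)"
    using TF_functorial unfolding functorial_factorization_def by (elim conjE)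
  with assms show ?thesis by blast
qed

end

lemma fiber_map_hom:
  assumes p: "p \<in> homs (sPsh X) E B" and p': "p' \<in> homs (sPsh X) E' B'" and e: "e \<in> homs (sPsh X) E E'"
    and b: "b \<in> homs (sPsh X) B B'" and sq: "cmp (sPsh X) p' e = cmp (sPsh X) b p"
  shows "fiber_map X p p' e \<in> homs (sPsh X) (fiber X p) (fiber X p')"
    and "cmp (sPsh X) (fiber_incl X p') (fiber_map X p p' e) = cmp (sPsh X) e (fiber_incl X p)"
proof -
  obtain \<phi> where \<phi>: "p = (E, \<phi>, B)" "\<phi> \<in> transformations X E B" "is_spsh X E" using p by (auto simp: sPsh_homs)
  obtain \<phi>' where \<phi>': "p' = (E', \<phi>', B')" using p' by (auto simp: sPsh_homs)
  obtain \<epsilon> where \<epsilon>: "e = (E, \<epsilon>, E')" "\<epsilon> \<in> transformations X E E'" using e by (auto simp: sPsh_homs)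
  obtain \<beta> where \<beta>: "b = (B, \<beta>, B')" "\<beta> \<in> transformations X B B'" using b by (auto simp: sPsh_homs)
  have eq: "\<phi>' Y n (\<epsilon> Y n x) = \<beta> Y n (\<phi> Y n x)" if "Y \<in> Obj (Sm X)" "x \<in> smp E Y n" for Y n x
    using sq trans_restrict_apply[OF that, of "\<lambda>Y n x. \<phi>' Y n (\<epsilon> Y n x)"] trans_restrict_apply[OF that, of "\<lambda>Y n x. \<beta> Y n (\<phi> Y n x)"]
    by (simp add: \<phi> \<phi>' \<epsilon> \<beta> sPsh_simps)
  have F: "x \<in> smp (fiber X p) Y n \<longleftrightarrow> x \<in> smp E Y n \<and> \<phi> Y n x = bpt B Y n" for x Y n by (simp add: fiber_def \<phi>(1))
  have mem: "\<epsilon> Y n x \<in> smp (fiber X p') Y n" if "Y \<in> Obj (Sm X)" "x \<in> smp (fiber X p) Y n" for Y n x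
    using that eq[OF that(1)] trans_mem[OF \<epsilon>(2) that(1)] trans_bpt[OF \<beta>(2) that(1)] by (simp add: F) (simp add: fiber_def \<phi>'(1))
  have "trans_restrict X (fiber X p) \<epsilon> \<in> transformations X (fiber X p) (fiber X p')"
    by (rule trans_restrictI[OF fiber_is_spsh[OF p] mem])
      (use trans_bpt[OF \<epsilon>(2)] trans_nat[OF \<epsilon>(2)] in \<open>simp_all add: fiber_def \<phi>(1) \<phi>'(1)\<close>)
  then show "fiber_map X p p' e \<in> homs (sPsh X) (fiber X p) (fiber X p')"
    using fiber_is_spsh[OF p] fiber_is_spsh[OF p'] by (simp add: fiber_map_def sPsh_homs \<epsilon>(1))
  have "trans_restrict X (fiber X p) (\<lambda>Y n x. trans_restrict X (fiber X p') (\<lambda>Y n x. x) Y n (trans_restrict X (fiber X p) \<epsilon> Y n x)) =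
      trans_restrict X (fiber X p) (\<lambda>Y n x. \<epsilon> Y n (trans_restrict X (fiber X p) (\<lambda>Y n x. x) Y n x))"
    by (rule trans_restrict_eqI) (simp add: trans_restrict_apply mem)
  then show "cmp (sPsh X) (fiber_incl X p') (fiber_map X p p' e) = cmp (sPsh X) e (fiber_incl X p)"
    by (simp add: fiber_map_def fiber_incl_def sPsh_simps \<epsilon>(1) \<phi>(1) \<phi>'(1))
qed

locale wb_towers =
  fixes X :: "('u::infinite) sch" and T0 C0 :: "('u, 'v) parr ffact" and F C :: "nat \<Rightarrow> ('u, 'v) parr ffact"
  assumes M: "motivic_model_structure X T0 C0" and WBM: "\<And>m. WB_model_structure X m (F m) (C m)"
begin

lemma motivic_model_category: "model_category (sPsh X) point_psh (zero_map X) (motivic_weqs X) (mono_arrs X)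
    (fibs X (motivic_weqs X)) T0 C0"
  by (rule sPsh_model_category) (use M in \<open>simp add: motivic_model_structure_def\<close>)

lemma WB_model_category: "model_category (sPsh X) point_psh (zero_map X) (WB_weqs X m) (mono_arrs X)
    (fibs X (WB_weqs X m)) (F m) (C m)"
  by (rule sPsh_model_category) (use WBM in \<open>simp add: WB_model_structure_def\<close>)

interpretation M: model_category "sPsh X" point_psh "zero_map X" "motivic_weqs X" "mono_arrs X" "fibs X (motivic_weqs X)" T0 C0
  by (rule motivic_model_category)

interpretation N: model_category "sPsh X" point_psh "zero_map X" "WB_weqs X m" "mono_arrs X" "fibs X (WB_weqs X m)" "F m" "C m" for m
  by (rule WB_model_category)

abbreviation hm where "hm \<equiv> homs (sPsh X)"
abbreviation cp (infixl \<open>\<cdot>\<close> 70) where "g \<cdot> f \<equiv> cmp (sPsh X) g f"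

section \<open>Functoriality and homotopy invariance of the stages of the tower\<close>

lemma tau_0: "tau X F 0 A = point_psh"
  by (simp add: tau_def to_point_zero zero_map_def sPsh_simps)

lemma tau_le_hom: "is_spsh X A \<Longrightarrow> tau_le X F n A \<in> hm A (tau X F n A)"
proof (induction n)
  case 0
  then show ?case using zero_map_hom[OF 0 point_is_spsh] by (simp add: tau_0 to_point_zero)
next
  case (Suc n)
  show ?case using N.TF_simps(1)[OF Suc.IH[OF Suc.prems]] by (simp add: tau_def)
qed

lemma nu_hom: "is_spsh X A \<Longrightarrow> nu X F n A \<in> hm (tau X F (Suc n) A) (tau X F n A)"
  and nu_fib: "is_spsh X A \<Longrightarrow> nu X F n A \<in> fibs X (WB_weqs X n)"
  using N.TF_simps(3,4)[OF tau_le_hom] by (simp_all add: nu_def tau_def)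

lemma hm_spsh: "h \<in> hm A B \<Longrightarrow> is_spsh X A" "h \<in> hm A B \<Longrightarrow> is_spsh X B"
  by (auto simp: sPsh_homs)

lemma tau_map_Suc: "h \<in> hm A B \<Longrightarrow>
    tau_map X F (Suc n) h = fm (F n) (tau_le X F n A) (tau_le X F n B) h (tau_map X F n h)"
  using homsD[of h "sPsh X" A B] by simp

text \<open>The functorial factorization at the next stage takes a commutative square as input, so
  the square itself is carried through the induction. Its lower edge is the map produced at the
  preceding stage.\<close>

lemma tau_square:
  assumes h: "h \<in> hm A B"
  shows "square (sPsh X) (tau_le X F n A) (tau_le X F n B) h (tau_map X F n h)"
proof (induction n)
  case 0
  have i: "idn (sPsh X) (point_psh :: ('u, 'v) psh) \<in> hm point_psh point_psh" by (rule sPsh.idn_hom) (simp add: sPsh_simps point_is_spsh)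
  note l = tau_le_hom[of _ 0, unfolded tau_0]
  have "tau_le X F 0 B \<cdot> h = idn (sPsh X) point_psh \<cdot> tau_le X F 0 A"
    by (rule point_trans_unique[OF sPsh.cmp_hom[OF h l] sPsh.cmp_hom[OF l i]]) (use hm_spsh[OF h] in auto)
  then show ?case using M.squareI[OF l l h i] hm_spsh[OF h] by simp
next
  case (Suc n)
  have "tau_map X F (Suc n) h \<in> hm (tau X F (Suc n) A) (tau X F (Suc n) B)"
    "tau_le X F (Suc n) B \<cdot> h = tau_map X F (Suc n) h \<cdot> tau_le X F (Suc n) A"
    unfolding tau_map_Suc[OF h] using N.TF_map(1,2)[OF Suc.IH] by (simp_all add: tau_def)
  then show ?case using M.squareI[OF tau_le_hom tau_le_hom h] hm_spsh[OF h] by blast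
qed

lemma tau_map_hom: "h \<in> hm A B \<Longrightarrow> tau_map X F n h \<in> hm (tau X F n A) (tau X F n B)"
  using tau_square[of h A B n] homsD[OF tau_le_hom[of A n]] homsD[OF tau_le_hom[of B n]] hm_spsh[of h A B]
  by (simp add: square_def)

lemma nu_natural: "h \<in> hm A B \<Longrightarrow> nu X F n B \<cdot> tau_map X F (Suc n) h = tau_map X F n h \<cdot> nu X F n A"
  using N.TF_map(3)[OF tau_square] tau_map_Suc by (simp add: nu_def)

lemma tau_map_idn: "is_spsh X A \<Longrightarrow> tau_map X F n (idn (sPsh X) A) = idn (sPsh X) (tau X F n A)"
proof (induction n)
  case 0 then show ?case by (simp add: tau_0)
next
  case (Suc n)
  have i: "idn (sPsh X) A \<in> hm A A" by (rule sPsh.idn_hom) (use Suc.prems in \<open>simp add: sPsh_simps\<close>)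
  show ?case unfolding tau_map_Suc[OF i] Suc.IH[OF Suc.prems] N.TF_simps(6)[OF tau_le_hom[OF Suc.prems]] by (simp add: tau_def)
qed

lemma tau_map_cmp:
  assumes h: "h \<in> hm A B" and g: "g \<in> hm B D"
  shows "tau_map X F n (g \<cdot> h) = tau_map X F n g \<cdot> tau_map X F n h"
proof (induction n)
  case 0
  have i: "idn (sPsh X) (point_psh :: ('u, 'v) psh) \<in> hm point_psh point_psh" by (rule sPsh.idn_hom) (simp add: sPsh_simps point_is_spsh)
  show ?case using sPsh.idn_left[OF i] by simp
next
  case (Suc n)
  show ?case
    unfolding tau_map_Suc[OF h] tau_map_Suc[OF g] tau_map_Suc[OF sPsh.cmp_hom[OF h g]] Suc.IH
    by (rule N.TF_map_comp[OF tau_square[OF h] tau_square[OF g]])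
qed

text \<open>The stage \<open>k\<close> is reached from the point by the maps \<open>nu\<close> with
  indices below \<open>k\<close>, hence at most \<open>m\<close>. A structure of smaller index has
  more weak equivalences and so fewer fibrations, all of which remain fibrations at index
  \<open>m\<close>. This is the origin of the bound \<open>Suc m\<close>.\<close>

lemma tau_fibrant: "is_spsh X A \<Longrightarrow> k \<le> Suc m \<Longrightarrow> N.fibrant m (tau X F k A)"
proof (induction k)
  case 0 then show ?case by (simp add: tau_0 N.fibrant_Z)
next
  case (Suc k)
  have "nu X F k A \<in> fibs X (WB_weqs X m)"
    using nu_fib[OF Suc.prems(1)] fibs_antimono[OF WB_weqs_antimono[of k m]] Suc.prems(2) by blast
  from N.fibrant_total[OF Suc.IH[OF Suc.prems(1)] this nu_hom[OF Suc.prems(1)]] Suc.prems(2) show ?case by simp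
qed

lemma WB_fib_motivic_fib: "p \<in> fibs X (WB_weqs X m) \<Longrightarrow> p \<in> fibs X (motivic_weqs X)"
  using fibs_antimono[OF motivic_weqs_subset] by blast

lemma tau_motivic_fibrant:
  assumes "is_spsh X A" shows "M.fibrant (tau X F k A)"
  using tau_fibrant[OF assms, of k k] by (simp add: N.fibrant_def M.fibrant_def WB_fib_motivic_fib[of _ k])

text \<open>For positive \<open>k\<close> the argument runs in the localization of index
  \<open>k - 1\<close>: there the maps into stage \<open>k\<close> are weak equivalences and the
  stages are fibrant. A weak equivalence of index \<open>n\<close> is one of index
  \<open>k - 1\<close> exactly by the bound on \<open>k\<close>, since weak equivalences grow as the
  index decreases.\<close>

lemma tau_map_weq:
  assumes f: "f \<in> WB_weqs X n" "f \<in> hm A B" and k: "k \<le> Suc n"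
  shows "tau_map X F k f \<in> motivic_weqs X"
proof (cases k)
  case 0 then show ?thesis using M.idn_W[OF M.Z_obj] by simp
next
  case (Suc m)
  note A = hm_spsh(1)[OF f(2)] and B = hm_spsh(2)[OF f(2)]
  note lA = tau_le_hom[OF A, of m] and lB = tau_le_hom[OF B, of m]
  have fm: "f \<in> WB_weqs X m" using f(1) WB_weqs_antimono[of m n X] k Suc by auto
  note h = tau_map_hom[OF f(2), of k]
  have l: "tau_le X F k A \<in> hm A (tau X F k A)" "tau_le X F k B \<in> hm B (tau X F k B)"
    using tau_le_hom A B by blast+
  have W: "tau_le X F k A \<in> WB_weqs X m" "tau_le X F k B \<in> WB_weqs X m"
    using N.TF_simps(2)[OF lA] N.TF_simps(2)[OF lB] Suc by simp_all
  have "tau_map X F k f \<cdot> tau_le X F k A = tau_le X F k B \<cdot> f" using tau_square[OF f(2), of k] by (simp add: square_def)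
  moreover have "tau_le X F k B \<cdot> f \<in> WB_weqs X m" by (rule N.W_comp[OF fm W(2) f(2) l(2)])
  ultimately have "tau_map X F k f \<in> WB_weqs X m" using N.W_cancel_left[OF W(1) _ l(1) h] by simp
  then show ?thesis
    by (rule weq_between_local_fibrant[OF motivic_model_category WB_model_category _ h])
      (use tau_fibrant[OF A, of k m] tau_fibrant[OF B, of k m] Suc in simp_all)
qed

section \<open>Functoriality and homotopy invariance of the fibers of the tower\<close>

lemma s_tilde_Suc: "s_tilde X F (Suc n) A = fiber X (nu X F (Suc n) A)"
  by (simp add: s_tilde_def)

lemma s_tilde_map_Suc: "h \<in> hm A B \<Longrightarrow>
    s_tilde_map X F (Suc n) h = fiber_map X (nu X F (Suc n) A) (nu X F (Suc n) B) (tau_map X F (Suc (Suc n)) h)"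
  using homsD[of h "sPsh X" A B] by (simp add: s_tilde_map_def)

lemma s_tilde_0: "s_tilde X F 0 = tau X F 1" "s_tilde_map X F 0 = tau_map X F 1"
  by (auto simp: s_tilde_def s_tilde_map_def)

lemma s_tilde_map_hom:
  assumes h: "h \<in> hm A B" shows "s_tilde_map X F n h \<in> hm (s_tilde X F n A) (s_tilde X F n B)"
proof (cases n)
  case 0 then show ?thesis using tau_map_hom[OF h, of 1] by (simp add: s_tilde_0)
next
  case (Suc m)
  show ?thesis unfolding Suc s_tilde_Suc s_tilde_map_Suc[OF h]
    by (rule fiber_map_hom(1)[OF nu_hom nu_hom tau_map_hom[OF h] tau_map_hom[OF h] nu_natural[OF h]])
      (use hm_spsh[OF h] in auto)
qed

lemma s_tilde_map_incl:
  assumes h: "h \<in> hm A B"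
  shows "fiber_incl X (nu X F (Suc n) B) \<cdot> s_tilde_map X F (Suc n) h = tau_map X F (Suc (Suc n)) h \<cdot> fiber_incl X (nu X F (Suc n) A)"
  unfolding s_tilde_map_Suc[OF h]
  by (rule fiber_map_hom(2)[OF nu_hom nu_hom tau_map_hom[OF h] tau_map_hom[OF h] nu_natural[OF h]])
    (use hm_spsh[OF h] in auto)

text \<open>Maps into a fiber are determined by their composites with its inclusion, and there the
  claim reduces to functoriality of \<open>tau\<close>. The same device handles composition.\<close>

lemma s_tilde_map_idn:
  assumes A: "is_spsh X A" shows "s_tilde_map X F n (idn (sPsh X) A) = idn (sPsh X) (s_tilde X F n A)"
proof (cases n)
  case 0 then show ?thesis using tau_map_idn[OF A, of 1] by (simp add: s_tilde_0)
next
  case (Suc m)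
  have i: "idn (sPsh X) A \<in> hm A A" by (rule sPsh.idn_hom) (use A in \<open>simp add: sPsh_simps\<close>)
  note nu = nu_hom[OF A, of "Suc m"]
  note incl = fiber_incl_hom[OF nu]
  have j: "idn (sPsh X) (fiber X (nu X F (Suc m) A)) \<in> hm (fiber X (nu X F (Suc m) A)) (fiber X (nu X F (Suc m) A))"
    by (rule sPsh.idn_hom) (use fiber_is_spsh[OF nu] in \<open>simp add: sPsh_simps\<close>)
  have "s_tilde_map X F (Suc m) (idn (sPsh X) A) = idn (sPsh X) (fiber X (nu X F (Suc m) A))"
    by (rule M.ker_unique[OF fiber_is_ker[OF nu] s_tilde_map_hom[OF i, of "Suc m", unfolded s_tilde_Suc] j])
      (use s_tilde_map_incl[OF i] tau_map_idn[OF A] sPsh.idn_left[OF incl] sPsh.idn_right[OF incl] in metis)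
  then show ?thesis by (simp add: Suc s_tilde_Suc)
qed

lemma s_tilde_map_cmp:
  assumes h: "h \<in> hm A B" and g: "g \<in> hm B D"
  shows "s_tilde_map X F n (g \<cdot> h) = s_tilde_map X F n g \<cdot> s_tilde_map X F n h"
proof (cases n)
  case 0 then show ?thesis using tau_map_cmp[OF h g, of 1] by (simp add: s_tilde_0)
next
  case (Suc m)
  let ?n = "Suc m"
  note gh = sPsh.cmp_hom[OF h g]
  note sh = s_tilde_map_hom[OF h, of ?n, unfolded s_tilde_Suc] and sg = s_tilde_map_hom[OF g, of ?n, unfolded s_tilde_Suc]
    and sgh = s_tilde_map_hom[OF gh, of ?n, unfolded s_tilde_Suc]
  note nuA = nu_hom[OF hm_spsh(1)[OF h], of ?n] and nuB = nu_hom[OF hm_spsh(2)[OF h], of ?n] and nuD = nu_hom[OF hm_spsh(2)[OF g], of ?n]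
  have "s_tilde_map X F ?n (g \<cdot> h) = s_tilde_map X F ?n g \<cdot> s_tilde_map X F ?n h"
  proof (rule M.ker_unique[OF fiber_is_ker[OF nuD] sgh sPsh.cmp_hom[OF sh sg]])
    have "fiber_incl X (nu X F ?n D) \<cdot> s_tilde_map X F ?n (g \<cdot> h) = tau_map X F (Suc ?n) g \<cdot> tau_map X F (Suc ?n) h \<cdot> fiber_incl X (nu X F ?n A)"
      by (simp only: s_tilde_map_incl[OF gh] tau_map_cmp[OF h g])
    also have "\<dots> = tau_map X F (Suc ?n) g \<cdot> (fiber_incl X (nu X F ?n B) \<cdot> s_tilde_map X F ?n h)"
      by (simp only: s_tilde_map_incl[OF h] sPsh.cmp_assoc[OF fiber_incl_hom[OF nuA] tau_map_hom[OF h] tau_map_hom[OF g]])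
    also have "\<dots> = fiber_incl X (nu X F ?n D) \<cdot> s_tilde_map X F ?n g \<cdot> s_tilde_map X F ?n h"
      by (simp only: s_tilde_map_incl[OF g] sPsh.cmp_assoc[OF sh fiber_incl_hom[OF nuB] tau_map_hom[OF g]])
    also have "\<dots> = fiber_incl X (nu X F ?n D) \<cdot> (s_tilde_map X F ?n g \<cdot> s_tilde_map X F ?n h)"
      by (rule sPsh.cmp_assoc[OF sh sg fiber_incl_hom[OF nuD]])
    finally show "fiber_incl X (nu X F ?n D) \<cdot> s_tilde_map X F ?n (g \<cdot> h) =
      fiber_incl X (nu X F ?n D) \<cdot> (s_tilde_map X F ?n g \<cdot> s_tilde_map X F ?n h)" .
  qed
  then show ?thesis by (simp add: Suc)
qed

text \<open>The fiber lies between the stages \<open>j\<close> and \<open>j + 1\<close>, both of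
  which must be covered by the result for \<open>tau\<close>. This accounts for the bound
  \<open>n\<close> here against \<open>n + 1\<close> there; at \<open>j = 0\<close> the functor is
  stage 1 itself.\<close>

lemma s_tilde_map_weq:
  assumes f: "f \<in> WB_weqs X n" "f \<in> hm A B" and j: "j \<le> n"
  shows "s_tilde_map X F j f \<in> motivic_weqs X"
proof (cases j)
  case 0 then show ?thesis using tau_map_weq[OF f, of 1] by (simp add: s_tilde_0)
next
  case (Suc m)
  note A = hm_spsh(1)[OF f(2)] and B = hm_spsh(2)[OF f(2)]
  note nuA = nu_hom[OF A, of j] and nuB = nu_hom[OF B, of j]
  have W: "tau_map X F j f \<in> motivic_weqs X" "tau_map X F (Suc j) f \<in> motivic_weqs X"
    by (rule tau_map_weq[OF f], use j in simp)+
  show ?thesis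
    by (rule M.fiber_weq[OF WB_fib_motivic_fib[OF nu_fib[OF A]] nuA WB_fib_motivic_fib[OF nu_fib[OF B]] nuB
          tau_motivic_fibrant[OF A] tau_motivic_fibrant[OF B] W(1) tau_map_hom[OF f(2)] W(2) tau_map_hom[OF f(2)]
          nu_natural[OF f(2)] fiber_is_ker[OF nuA] fiber_is_ker[OF nuB]])
      (use s_tilde_map_hom[OF f(2), of j] s_tilde_map_incl[OF f(2), of m] Suc in \<open>simp_all add: s_tilde_Suc\<close>)
qed

section \<open>Passage to the homotopy category\<close>

lemma weq_functorI:
  fixes Fo :: "('u, 'v) psh \<Rightarrow> ('u, 'v) psh" and Fa :: "('u, 'v) parr \<Rightarrow> ('u, 'v) parr"
  assumes hom: "\<And>h A B. h \<in> hm A B \<Longrightarrow> Fa h \<in> hm (Fo A) (Fo B)"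
    and id: "\<And>A. is_spsh X A \<Longrightarrow> Fa (idn (sPsh X) A) = idn (sPsh X) (Fo A)"
    and cmp: "\<And>h g A B D. h \<in> hm A B \<Longrightarrow> g \<in> hm B D \<Longrightarrow> Fa (g \<cdot> h) = Fa g \<cdot> Fa h"
    and weq: "\<And>f A B. f \<in> motivic_weqs X \<Longrightarrow> f \<in> hm A B \<Longrightarrow> Fa f \<in> motivic_weqs X"
  shows "weq_functor (sPsh X) (motivic_weqs X) Fo Fa"
proof
  fix f :: "('u, 'v) parr" assume f: "f \<in> Arr (sPsh X)"
  note h = homsD[OF hom[OF sPsh.arr_hom[OF f]]]
  show "Fa f \<in> Arr (sPsh X)" "src (sPsh X) (Fa f) = Fo (src (sPsh X) f)" "tgt (sPsh X) (Fa f) = Fo (tgt (sPsh X) f)"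
    using h by auto
next
  fix f :: "('u, 'v) parr" assume f: "f \<in> motivic_weqs X"
  show "Fa f \<in> motivic_weqs X" using weq[OF f sPsh.arr_hom] f by (simp add: motivic_weqs_def)
next
  fix A :: "('u, 'v) psh" assume A: "A \<in> Obj (sPsh X)"
  then have A': "is_spsh X A" by (simp add: sPsh_simps)
  show "Fo A \<in> Obj (sPsh X)" using sPsh.hom_obj[OF hom[OF sPsh.idn_hom[OF A]]] by simp
  show "Fa (idn (sPsh X) A) = idn (sPsh X) (Fo A)" by (rule id[OF A'])
next
  fix f g :: "('u, 'v) parr" assume h: "f \<in> Arr (sPsh X)" "g \<in> Arr (sPsh X)" "tgt (sPsh X) f = src (sPsh X) g"
  show "Fa (g \<cdot> f) = Fa g \<cdot> Fa f" using cmp[OF sPsh.arr_hom[OF h(1)]] sPsh.arr_hom[OF h(2)] h(3) by simp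
qed

lemma tau_weq_functor: "weq_functor (sPsh X) (motivic_weqs X) (tau X F n) (tau_map X F n)"
  by (rule weq_functorI[OF tau_map_hom tau_map_idn tau_map_cmp])
    (use tau_map_weq[of _ n] motivic_weqs_subset[of X n] in auto)

lemma s_tilde_weq_functor: "weq_functor (sPsh X) (motivic_weqs X) (s_tilde X F n) (s_tilde_map X F n)"
  by (rule weq_functorI[OF s_tilde_map_hom s_tilde_map_idn s_tilde_map_cmp])
    (use s_tilde_map_weq[of _ n] motivic_weqs_subset[of X n] in auto)

text \<open>The induced functor commutes with localization, so the identity
  \<open>p \<cdot> u = i\<close> survives and an inverted \<open>i\<close> yields a section of the
  image of \<open>p\<close>. An arbitrary functor is allowed in order to serve \<open>tau\<close>
  and \<open>s_tilde\<close> alike.\<close>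

lemma induced_section:
  fixes Fo :: "('u, 'v) psh \<Rightarrow> ('u, 'v) psh" and Fa :: "('u, 'v) parr \<Rightarrow> ('u, 'v) parr"
  assumes Fn: "weq_functor (sPsh X) (motivic_weqs X) Fo Fa"
    and u: "u \<in> hm U B" and p: "p \<in> hm B Y" and pu: "p \<cdot> u = i" and Wi: "Fa i \<in> motivic_weqs X"
  defines "G \<equiv> \<lambda>f. induced (sPsh X) (motivic_weqs X) Fo Fa (Ho X f)"
  shows "iso_arr (Hcat X) (G i)"
    "cmp (Hcat X) (G u) (the_inverse (Hcat X) (G i)) \<in> homs (Hcat X) (Fo Y) (Fo B)"
    "cmp (Hcat X) (G p) (cmp (Hcat X) (G u) (the_inverse (Hcat X) (G i))) = idn (Hcat X) (Fo Y)"
proof -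
  interpret weq_functor "sPsh X" "motivic_weqs X" Fo Fa by (rule Fn)
  interpret L: weq_category "sPsh X" "motivic_weqs X" by unfold_locales (auto simp: motivic_weqs_def)
  interpret H: category "Hcat X :: (('u, 'v) psh, ('u, 'v) harr) cat"
    unfolding Hcat_def by (rule L.localization_category)
  have G: "G f = Ho X (Fa f)" if "f \<in> hm A B" for f A B
    unfolding G_def Ho_def by (rule induced_loc_fun) (use homsD[OF that] sPsh.hom_obj[OF that] in auto)
  have hom: "Fa f \<in> hm (Fo A) (Fo B)" if "f \<in> hm A B" for f A B
    using F[of f] homsD[OF that] by (auto simp: homs_def)
  have i: "i \<in> hm U Y" using sPsh.cmp_hom[OF u p] pu by simp
  have h: "Ho X f \<in> homs (Hcat X) A B" if "f \<in> hm A B" for f A B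
    unfolding Ho_def Hcat_def by (rule L.loc_fun_hom[OF that])
  have "Fa p \<cdot> Fa u = Fa i" using c[of u p] homsD[OF u] homsD[OF p] pu by simp
  then have e: "cmp (Hcat X) (G p) (G u) = G i"
    unfolding G[OF u] G[OF p] G[OF i] using L.loc_fun_cmp[OF hom[OF u] hom[OF p]] by (simp add: Ho_def Hcat_def)
  show iso: "iso_arr (Hcat X) (G i)" unfolding G[OF i] Ho_def Hcat_def by (rule L.loc_fun_iso[OF Wi])
  note hi = h[OF hom[OF i], folded G[OF i]] and hu = h[OF hom[OF u], folded G[OF u]] and hp = h[OF hom[OF p], folded G[OF p]]
  from H.section_of_iso[OF iso hi hu hp e]
  show "cmp (Hcat X) (G u) (the_inverse (Hcat X) (G i)) \<in> homs (Hcat X) (Fo Y) (Fo B)"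
    "cmp (Hcat X) (G p) (cmp (Hcat X) (G u) (the_inverse (Hcat X) (G i))) = idn (Hcat X) (Fo Y)" .
qed

text \<open>Intended for an empty blowup: the empty space is not irreducible, so the open immersion
  cannot be a generating map of the localization, yet it is an isomorphism.\<close>

lemma iso_in_Sm_weq:
  assumes u: "u \<in> homs (Sm X) U B" and v: "v \<in> homs (Sm X) B U"
    and uv: "cmp (Sm X) u v = idn (Sm X) B" "cmp (Sm X) v u = idn (Sm X) U"
  shows "(rep_map X u :: ('u, 'v) parr) \<in> WB_weqs X n"
proof -
  have "(rep_map X u :: ('u, 'v) parr) \<in> motivic_weqs X"
    by (rule M.iso_W[OF rep_map_hom[OF u] rep_map_hom[OF v]])
      (use Sm.hom_obj[OF u] in \<open>simp_all add: rep_map_cmp[OF u v] rep_map_cmp[OF v u] uv rep_map_idn\<close>)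
  then show ?thesis using motivic_weqs_subset by blast
qed

end

section \<open>Stalks\<close>

lemma (in cring) UnitsI: "a \<in> carrier R \<Longrightarrow> b \<in> carrier R \<Longrightarrow> a \<otimes> b = \<one> \<Longrightarrow> a \<in> Units R"
  using m_comm[of a b] unfolding Units_def by (intro CollectI conjI bexI[of _ b]) simp_all

context
  fixes X :: "('p, 's) rspace" and x :: 'p
  assumes X: "ringed_space X"
begin

lemma germ_memI: "opn X V \<Longrightarrow> x \<in> V \<Longrightarrow> t \<in> sct X V \<Longrightarrow> opn X W \<Longrightarrow> x \<in> W \<Longrightarrow> W \<subseteq> U \<Longrightarrow> W \<subseteq> V \<Longrightarrow>
    res X U W s = res X V W t \<Longrightarrow> (V, t) \<in> germ X x U s"
  unfolding germ_def by blast

text \<open>A germ is the full set of equivalent pairs, so equality amounts to transitivity of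
  agreement near \<open>x\<close>. The hypotheses are symmetric, and one inclusion gives the
  other.\<close>

lemma germ_eqI:
  assumes U: "opn X U" "s \<in> sct X U" and V: "opn X V" "t \<in> sct X V"
    and W: "opn X W" "x \<in> W" "W \<subseteq> U" "W \<subseteq> V" "res X U W s = res X V W t"
  shows "germ X x U s = germ X x V t"
proof -
  have sub: "germ X x U s \<subseteq> germ X x V t"
    if U: "opn X U" "s \<in> sct X U" and V: "opn X V" "t \<in> sct X V" and W: "W \<subseteq> U" "W \<subseteq> V" "res X U W s = res X V W t"
    for U V s t
  proof clarify
    fix V' t' assume "(V', t') \<in> germ X x U s"
    then obtain W' where h: "opn X V'" "x \<in> V'" "t' \<in> sct X V'" "opn X W'" "x \<in> W'" "W' \<subseteq> U \<inter> V'" "res X U W' s = res X V' W' t'"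
      unfolding germ_def by blast
    let ?W = "W \<inter> W'"
    have o: "opn X ?W" using assms(5) h(4) by (rule openin_Int)
    have "res X V ?W t = res X W ?W (res X V W t)"
      using ringed_space_res_res[OF X V(1) assms(5) o _ W(2) V(2)] by simp
    also have "\<dots> = res X U ?W s" unfolding W(3)[symmetric]
      using ringed_space_res_res[OF X U(1) assms(5) o _ W(1) U(2)] by simp
    also have "\<dots> = res X W' ?W (res X U W' s)"
      using ringed_space_res_res[OF X U(1) h(4) o _ _ U(2)] h(6) by simp
    also have "\<dots> = res X V' ?W t'" unfolding h(7)
      using ringed_space_res_res[OF X h(1) h(4) o _ _ h(3)] h(6) by simp
    finally show "(V', t') \<in> germ X x V t"
      using germ_memI[OF h(1-3) o] assms(6) h(5,6) W(2) by blast
  qed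
  show ?thesis using sub[OF U V W(3-5)] sub[OF V U W(4,3) W(5)[symmetric]] by blast
qed

lemma germ_eqE:
  assumes V: "opn X V" "x \<in> V" "t \<in> sct X V" and e: "germ X x U s = germ X x V t"
  obtains W where "opn X W" "x \<in> W" "W \<subseteq> U" "W \<subseteq> V" "res X U W s = res X V W t"
proof -
  have "(V, t) \<in> germ X x V t" by (rule germ_memI[OF V V(1,2)]) auto
  then have "(V, t) \<in> germ X x U s" using e by simp
  then show ?thesis using that unfolding germ_def by blast
qed

lemma germ_res:
  assumes "opn X U" "opn X V" "V \<subseteq> U" "x \<in> V" "s \<in> sct X U"
  shows "germ X x V (res X U V s) = germ X x U s"
  by (rule germ_eqI[OF assms(2) ringed_space_res[OF X assms(1-3,5)] assms(1,5) assms(2,4) order_refl assms(3)])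
    (simp add: ringed_space_res_id[OF X assms(2) ringed_space_res[OF X assms(1-3,5)]])

lemma stalk_carrierI: "opn X U \<Longrightarrow> x \<in> U \<Longrightarrow> s \<in> sct X U \<Longrightarrow> germ X x U s \<in> carrier (stalk X x)"
  by (auto simp: stalk_def)

lemma stalk_carrierE:
  assumes "a \<in> carrier (stalk X x)" obtains U s where "opn X U" "x \<in> U" "s \<in> sct X U" "a = germ X x U s"
  using assms by (auto simp: stalk_def)

lemma stalk_carrierE2:
  assumes a: "a \<in> carrier (stalk X x)" and b: "b \<in> carrier (stalk X x)" and W: "opn X W" "x \<in> W"
  obtains U s t where "opn X U" "x \<in> U" "U \<subseteq> W" "s \<in> sct X U" "t \<in> sct X U" "a = germ X x U s" "b = germ X x U t"
proof -
  obtain U s where U: "opn X U" "x \<in> U" "s \<in> sct X U" "a = germ X x U s" using stalk_carrierE[OF a] .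
  obtain V t where V: "opn X V" "x \<in> V" "t \<in> sct X V" "b = germ X x V t" using stalk_carrierE[OF b] .
  let ?W = "U \<inter> V \<inter> W"
  have o: "opn X ?W" "x \<in> ?W" using U V W by auto
  show ?thesis
    using that[of ?W "res X U ?W s" "res X V ?W t"] o ringed_space_res[OF X U(1) o(1) _ U(3)] ringed_space_res[OF X V(1) o(1) _ V(3)]
      germ_res[OF U(1) o(1) _ o(2) U(3)] germ_res[OF V(1) o(1) _ o(2) V(3)] U(4) V(4) by auto
qed

text \<open>The operation is a definite description over all pairs of representatives on a common
  open set. Two choices of representatives agree on \<open>W1 \<inter> W2\<close>, and naturality of
  \<open>f\<close> under restriction makes the results agree there too.\<close>

lemma stalk_op_germ:
  assumes closed: "\<And>U s t. opn X U \<Longrightarrow> s \<in> sct X U \<Longrightarrow> t \<in> sct X U \<Longrightarrow> f U s t \<in> sct X U"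
    and nat: "\<And>U V s t. opn X U \<Longrightarrow> opn X V \<Longrightarrow> V \<subseteq> U \<Longrightarrow> s \<in> sct X U \<Longrightarrow> t \<in> sct X U \<Longrightarrow>
      res X U V (f U s t) = f V (res X U V s) (res X U V t)"
    and U: "opn X U" "x \<in> U" "s \<in> sct X U" "t \<in> sct X U"
  shows "stalk_op X x f (germ X x U s) (germ X x U t) = germ X x U (f U s t)"
  unfolding stalk_op_def
proof (rule the_equality)
  show "\<exists>U' s' t'. opn X U' \<and> x \<in> U' \<and> s' \<in> sct X U' \<and> t' \<in> sct X U' \<and> germ X x U s = germ X x U' s' \<and>
      germ X x U t = germ X x U' t' \<and> germ X x U (f U s t) = germ X x U' (f U' s' t')"
    using U by blast
next
  fix c assume "\<exists>U' s' t'. opn X U' \<and> x \<in> U' \<and> s' \<in> sct X U' \<and> t' \<in> sct X U' \<and> germ X x U s = germ X x U' s' \<and>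
      germ X x U t = germ X x U' t' \<and> c = germ X x U' (f U' s' t')"
  then obtain V s' t' where V: "opn X V" "x \<in> V" "s' \<in> sct X V" "t' \<in> sct X V"
    and e: "germ X x U s = germ X x V s'" "germ X x U t = germ X x V t'" "c = germ X x V (f V s' t')" by blast
  obtain W1 where W1: "opn X W1" "x \<in> W1" "W1 \<subseteq> U" "W1 \<subseteq> V" "res X U W1 s = res X V W1 s'" using germ_eqE[OF V(1,2,3) e(1)] .
  obtain W2 where W2: "opn X W2" "x \<in> W2" "W2 \<subseteq> U" "W2 \<subseteq> V" "res X U W2 t = res X V W2 t'" using germ_eqE[OF V(1,2,4) e(2)] .
  let ?W = "W1 \<inter> W2"
  have o: "opn X ?W" "x \<in> ?W" "?W \<subseteq> U" "?W \<subseteq> V" using W1 W2 by auto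
  have "res X U ?W s = res X V ?W s'"
    using ringed_space_res_res[OF X U(1) W1(1) o(1) _ W1(3) U(3)] ringed_space_res_res[OF X V(1) W1(1) o(1) _ W1(4) V(3)] W1(5) by simp
  moreover have "res X U ?W t = res X V ?W t'"
    using ringed_space_res_res[OF X U(1) W2(1) o(1) _ W2(3) U(4)] ringed_space_res_res[OF X V(1) W2(1) o(1) _ W2(4) V(4)] W2(5) by simp
  ultimately have "res X U ?W (f U s t) = res X V ?W (f V s' t')"
    using nat[OF U(1) o(1,3) U(3,4)] nat[OF V(1) o(1,4) V(3,4)] by simp
  from germ_eqI[OF U(1) closed[OF U(1,3,4)] V(1) closed[OF V(1,3,4)] o this] e(3)
  show "c = germ X x U (f U s t)" by simp
qed

lemma stalk_mult:
  assumes U: "opn X U" "x \<in> U" "s \<in> sct X U" "t \<in> sct X U"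
  shows "germ X x U s \<otimes>\<^bsub>stalk X x\<^esub> germ X x U t = germ X x U (s \<otimes>\<^bsub>sec X U\<^esub> t)"
proof -
  have "stalk_op X x (\<lambda>U. monoid.mult (sec X U)) (germ X x U s) (germ X x U t) = germ X x U (s \<otimes>\<^bsub>sec X U\<^esub> t)"
    by (rule stalk_op_germ[OF _ _ U]) (auto intro: ring.ring_simprules(5)[OF ringed_space_ring[OF X]] ring_hom_mult[OF ringed_space_res_hom[OF X]])
  then show ?thesis by (simp add: stalk_def)
qed

lemma stalk_add:
  assumes U: "opn X U" "x \<in> U" "s \<in> sct X U" "t \<in> sct X U"
  shows "germ X x U s \<oplus>\<^bsub>stalk X x\<^esub> germ X x U t = germ X x U (s \<oplus>\<^bsub>sec X U\<^esub> t)"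
proof -
  have "stalk_op X x (\<lambda>U. add (sec X U)) (germ X x U s) (germ X x U t) = germ X x U (s \<oplus>\<^bsub>sec X U\<^esub> t)"
    by (rule stalk_op_germ[OF _ _ U]) (auto intro: ring.ring_simprules(1)[OF ringed_space_ring[OF X]] ring_hom_add[OF ringed_space_res_hom[OF X]])
  then show ?thesis by (simp add: stalk_def)
qed

lemma opn_pts: "opn X (pts X)" by (rule openin_topspace)

lemma res_zero: "opn X U \<Longrightarrow> opn X V \<Longrightarrow> V \<subseteq> U \<Longrightarrow> res X U V \<zero>\<^bsub>sec X U\<^esub> = \<zero>\<^bsub>sec X V\<^esub>"
  using ring_hom_zero[OF ringed_space_res_hom[OF X] ringed_space_ring[OF X] ringed_space_ring[OF X]] by blast

lemma res_one: "opn X U \<Longrightarrow> opn X V \<Longrightarrow> V \<subseteq> U \<Longrightarrow> res X U V \<one>\<^bsub>sec X U\<^esub> = \<one>\<^bsub>sec X V\<^esub>"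
  by (rule ring_hom_one[OF ringed_space_res_hom[OF X]])

lemma stalk_one:
  assumes U: "opn X U" "x \<in> U" shows "\<one>\<^bsub>stalk X x\<^esub> = germ X x U \<one>\<^bsub>sec X U\<^esub>"
  using germ_res[OF opn_pts U(1) opn_subset[OF U(1)] U(2), of "\<one>\<^bsub>sec X (pts X)\<^esub>"] res_one[OF opn_pts U(1) opn_subset[OF U(1)]]
    ring.ring_simprules(6)[OF ringed_space_ring[OF X opn_pts]] by (simp add: stalk_def)

lemma stalk_zero:
  assumes U: "opn X U" "x \<in> U" shows "\<zero>\<^bsub>stalk X x\<^esub> = germ X x U \<zero>\<^bsub>sec X U\<^esub>"
  using germ_res[OF opn_pts U(1) opn_subset[OF U(1)] U(2), of "\<zero>\<^bsub>sec X (pts X)\<^esub>"] res_zero[OF opn_pts U(1) opn_subset[OF U(1)]]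
    ring.ring_simprules(2)[OF ringed_space_ring[OF X opn_pts]] by (simp add: stalk_def)

lemma stalk_carrierE3:
  assumes "a \<in> carrier (stalk X x)" "b \<in> carrier (stalk X x)" "c \<in> carrier (stalk X x)"
  obtains U s t r where "opn X U" "x \<in> U" "s \<in> sct X U" "t \<in> sct X U" "r \<in> sct X U"
    "a = germ X x U s" "b = germ X x U t" "c = germ X x U r"
proof -
  obtain V r where V: "opn X V" "x \<in> V" "r \<in> sct X V" "c = germ X x V r" using stalk_carrierE[OF assms(3)] .
  obtain U s t where U: "opn X U" "x \<in> U" "U \<subseteq> V" "s \<in> sct X U" "t \<in> sct X U" "a = germ X x U s" "b = germ X x U t"
    using stalk_carrierE2[OF assms(1,2) V(1,2)] .
  show ?thesis
    by (rule that[OF U(1,2,4,5) ringed_space_res[OF X V(1) U(1,3) V(3)] U(6,7)])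
      (use germ_res[OF V(1) U(1,3,2) V(3)] V(4) in simp)
qed

lemma stalk_cring:
  assumes x: "x \<in> pts X" shows "cring (stalk X x)"
proof (rule cringI)
  let ?S = "stalk X x"
  note R = ring.ring_simprules[OF ringed_space_ring[OF X]]
  show "abelian_group ?S"
  proof (rule abelian_groupI)
    fix a b assume ab: "a \<in> carrier ?S" "b \<in> carrier ?S"
    obtain U s t where U: "opn X U" "x \<in> U" "s \<in> sct X U" "t \<in> sct X U" "a = germ X x U s" "b = germ X x U t"
      using stalk_carrierE2[OF ab opn_pts x] by metis
    show "a \<oplus>\<^bsub>?S\<^esub> b \<in> carrier ?S" "a \<oplus>\<^bsub>?S\<^esub> b = b \<oplus>\<^bsub>?S\<^esub> a"
      unfolding U(5,6) stalk_add[OF U(1,2,3,4)] stalk_add[OF U(1,2,4,3)]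
      using stalk_carrierI[OF U(1,2)] R(1)[OF U(1,3,4)] R(10)[OF U(1,3,4)] by simp_all
  next
    show "\<zero>\<^bsub>?S\<^esub> \<in> carrier ?S" unfolding stalk_zero[OF opn_pts x] by (rule stalk_carrierI[OF opn_pts x R(2)[OF opn_pts]])
  next
    fix a b c assume "a \<in> carrier ?S" "b \<in> carrier ?S" "c \<in> carrier ?S"
    then obtain U s t r where U: "opn X U" "x \<in> U" "s \<in> sct X U" "t \<in> sct X U" "r \<in> sct X U"
      "a = germ X x U s" "b = germ X x U t" "c = germ X x U r" by (rule stalk_carrierE3)
    show "(a \<oplus>\<^bsub>?S\<^esub> b) \<oplus>\<^bsub>?S\<^esub> c = a \<oplus>\<^bsub>?S\<^esub> (b \<oplus>\<^bsub>?S\<^esub> c)"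
      unfolding U(6-8) using stalk_add[OF U(1,2)] R(1)[OF U(1)] U(3-5) ring.ring_simprules(7)[OF ringed_space_ring[OF X U(1)] U(3-5)] by simp
  next
    fix a assume a: "a \<in> carrier ?S"
    obtain U s where U: "opn X U" "x \<in> U" "s \<in> sct X U" "a = germ X x U s" using stalk_carrierE[OF a] .
    have z: "\<zero>\<^bsub>sec X U\<^esub> \<in> sct X U" "\<ominus>\<^bsub>sec X U\<^esub> s \<in> sct X U" using R(2,3)[OF U(1)] U(3) by auto
    show "\<zero>\<^bsub>?S\<^esub> \<oplus>\<^bsub>?S\<^esub> a = a"
      unfolding U(4) stalk_zero[OF U(1,2)] stalk_add[OF U(1,2) z(1) U(3)] using ring.ring_simprules(8)[OF ringed_space_ring[OF X U(1)] U(3)] by simp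
    have "germ X x U (\<ominus>\<^bsub>sec X U\<^esub> s) \<oplus>\<^bsub>?S\<^esub> a = \<zero>\<^bsub>?S\<^esub>"
      unfolding U(4) stalk_zero[OF U(1,2)] stalk_add[OF U(1,2) z(2) U(3)] using ring.ring_simprules(9)[OF ringed_space_ring[OF X U(1)] U(3)] by simp
    then show "\<exists>y\<in>carrier ?S. y \<oplus>\<^bsub>?S\<^esub> a = \<zero>\<^bsub>?S\<^esub>" using stalk_carrierI[OF U(1,2) z(2)] by blast
  qed
  show "Group.comm_monoid ?S"
  proof (rule comm_monoidI)
    fix a b assume ab: "a \<in> carrier ?S" "b \<in> carrier ?S"
    obtain U s t where U: "opn X U" "x \<in> U" "s \<in> sct X U" "t \<in> sct X U" "a = germ X x U s" "b = germ X x U t"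
      using stalk_carrierE2[OF ab opn_pts x] by metis
    show "a \<otimes>\<^bsub>?S\<^esub> b \<in> carrier ?S" "a \<otimes>\<^bsub>?S\<^esub> b = b \<otimes>\<^bsub>?S\<^esub> a"
      unfolding U(5,6) stalk_mult[OF U(1,2,3,4)] stalk_mult[OF U(1,2,4,3)]
      using stalk_carrierI[OF U(1,2)] R(5)[OF U(1,3,4)] cring.cring_simprules(14)[OF ringed_space_cring[OF X U(1)] U(3,4)] by simp_all
  next
    show "\<one>\<^bsub>?S\<^esub> \<in> carrier ?S" unfolding stalk_one[OF opn_pts x] by (rule stalk_carrierI[OF opn_pts x R(6)[OF opn_pts]])
  next
    fix a b c assume "a \<in> carrier ?S" "b \<in> carrier ?S" "c \<in> carrier ?S"
    then obtain U s t r where U: "opn X U" "x \<in> U" "s \<in> sct X U" "t \<in> sct X U" "r \<in> sct X U"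
      "a = germ X x U s" "b = germ X x U t" "c = germ X x U r" by (rule stalk_carrierE3)
    show "(a \<otimes>\<^bsub>?S\<^esub> b) \<otimes>\<^bsub>?S\<^esub> c = a \<otimes>\<^bsub>?S\<^esub> (b \<otimes>\<^bsub>?S\<^esub> c)"
      unfolding U(6-8) using stalk_mult[OF U(1,2)] R(5)[OF U(1)] U(3-5) cring.cring_simprules(11)[OF ringed_space_cring[OF X U(1)] U(3-5)] by simp
  next
    fix a assume a: "a \<in> carrier ?S"
    obtain U s where U: "opn X U" "x \<in> U" "s \<in> sct X U" "a = germ X x U s" using stalk_carrierE[OF a] .
    show "\<one>\<^bsub>?S\<^esub> \<otimes>\<^bsub>?S\<^esub> a = a"
      unfolding U(4) stalk_one[OF U(1,2)] stalk_mult[OF U(1,2) R(6)[OF U(1)] U(3)]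
      using cring.cring_simprules(12)[OF ringed_space_cring[OF X U(1)] U(3)] by simp
  qed
  fix a b c assume "a \<in> carrier ?S" "b \<in> carrier ?S" "c \<in> carrier ?S"
  then obtain U s t r where U: "opn X U" "x \<in> U" "s \<in> sct X U" "t \<in> sct X U" "r \<in> sct X U"
    "a = germ X x U s" "b = germ X x U t" "c = germ X x U r" by (rule stalk_carrierE3)
  show "(a \<oplus>\<^bsub>?S\<^esub> b) \<otimes>\<^bsub>?S\<^esub> c = a \<otimes>\<^bsub>?S\<^esub> c \<oplus>\<^bsub>?S\<^esub> b \<otimes>\<^bsub>?S\<^esub> c"
    unfolding U(6-8) using stalk_mult[OF U(1,2)] stalk_add[OF U(1,2)] R(1,5)[OF U(1)] U(3-5)
      cring.cring_simprules(13)[OF ringed_space_cring[OF X U(1)] U(3-5)] by simp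
qed

lemma germ_hom: "opn X U \<Longrightarrow> x \<in> U \<Longrightarrow> germ X x U \<in> ring_hom (sec X U) (stalk X x)"
  by (rule ring_hom_memI) (simp_all add: stalk_carrierI stalk_mult stalk_add stalk_one)

text \<open>An inverse germ and the equation it satisfies both live on a smaller neighbourhood. This
  turns statements about local rings into statements about sections, which can be moved along
  charts.\<close>

lemma germ_unit_iff:
  assumes U: "opn X U" "x \<in> U" "s \<in> sct X U"
  shows "germ X x U s \<in> Units (stalk X x) \<longleftrightarrow> (\<exists>V. opn X V \<and> x \<in> V \<and> V \<subseteq> U \<and> res X U V s \<in> Units (sec X V))"
proof
  assume "germ X x U s \<in> Units (stalk X x)"
  then obtain b where b: "b \<in> carrier (stalk X x)" "germ X x U s \<otimes>\<^bsub>stalk X x\<^esub> b = \<one>\<^bsub>stalk X x\<^esub>"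
    unfolding Units_def by blast
  obtain V t where V: "opn X V" "x \<in> V" "t \<in> sct X V" "b = germ X x V t" using stalk_carrierE[OF b(1)] .
  let ?W = "U \<inter> V"
  have W: "opn X ?W" "x \<in> ?W" using U V by auto
  let ?s = "res X U ?W s" and ?t = "res X V ?W t"
  have st: "?s \<in> sct X ?W" "?t \<in> sct X ?W" using ringed_space_res[OF X U(1) W(1) _ U(3)] ringed_space_res[OF X V(1) W(1) _ V(3)] by auto
  note cW = ringed_space_cring[OF X W(1)]
  have "germ X x ?W (?s \<otimes>\<^bsub>sec X ?W\<^esub> ?t) = germ X x ?W \<one>\<^bsub>sec X ?W\<^esub>"
    using b(2) germ_res[OF U(1) W(1) _ W(2) U(3)] germ_res[OF V(1) W(1) _ W(2) V(3)] V(4) stalk_mult[OF W st] stalk_one[OF W] by simp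
  then obtain W' where W': "opn X W'" "x \<in> W'" "W' \<subseteq> ?W"
    "res X ?W W' (?s \<otimes>\<^bsub>sec X ?W\<^esub> ?t) = res X ?W W' \<one>\<^bsub>sec X ?W\<^esub>"
    using germ_eqE[OF W cring.cring_simprules(6)[OF cW]] by metis
  have s': "res X ?W W' ?s = res X U W' s" using ringed_space_res_res[OF X U(1) W(1) W'(1) W'(3) _ U(3)] by simp
  have "res X U W' s \<otimes>\<^bsub>sec X W'\<^esub> res X ?W W' ?t = \<one>\<^bsub>sec X W'\<^esub>"
    using ring_hom_mult[OF ringed_space_res_hom[OF X W(1) W'(1,3)] st] W'(4) res_one[OF W(1) W'(1,3)] s' by simp
  moreover have "res X U W' s \<in> sct X W'" "res X ?W W' ?t \<in> sct X W'"
    using ringed_space_res[OF X W(1) W'(1,3) st(1)] ringed_space_res[OF X W(1) W'(1,3) st(2)] s' by auto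
  ultimately have "res X U W' s \<in> Units (sec X W')"
    by (intro cring.UnitsI[OF ringed_space_cring[OF X W'(1)]])
  then show "\<exists>V. opn X V \<and> x \<in> V \<and> V \<subseteq> U \<and> res X U V s \<in> Units (sec X V)" using W' by blast
next
  assume "\<exists>V. opn X V \<and> x \<in> V \<and> V \<subseteq> U \<and> res X U V s \<in> Units (sec X V)"
  then obtain V where V: "opn X V" "x \<in> V" "V \<subseteq> U" "res X U V s \<in> Units (sec X V)" by blast
  let ?s = "res X U V s"
  obtain t where t: "?s \<in> sct X V" "t \<in> sct X V" "t \<otimes>\<^bsub>sec X V\<^esub> ?s = \<one>\<^bsub>sec X V\<^esub>" "?s \<otimes>\<^bsub>sec X V\<^esub> t = \<one>\<^bsub>sec X V\<^esub>"
    using V(4) unfolding Units_def by blast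
  have "germ X x V ?s \<in> Units (stalk X x)"
    by (rule cring.UnitsI[OF stalk_cring stalk_carrierI[OF V(1,2) t(1)] stalk_carrierI[OF V(1,2) t(2)]])
      (use t stalk_mult[OF V(1,2) t(1,2)] stalk_one[OF V(1,2)] opn_subset[OF V(1)] V(2) in auto)
  then show "germ X x U s \<in> Units (stalk X x)" using germ_res[OF U(1) V(1,3,2) U(3)] by simp
qed

end

section \<open>Prime and maximal ideals\<close>

text \<open>Zorn's lemma, stated for an arbitrary set \<open>M\<close> because it is used twice:
  with the set of \<open>\<one>\<close> alone for maximal ideals, and with the powers of an element
  for prime ideals.\<close>

lemma (in cring) ideal_maximal_avoiding:
  assumes I: "ideal I R" and M: "I \<inter> M = {}"
  shows "\<exists>J. ideal J R \<and> I \<subseteq> J \<and> J \<inter> M = {} \<and> (\<forall>K. ideal K R \<and> J \<subseteq> K \<and> K \<inter> M = {} \<longrightarrow> K = J)"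
proof -
  let ?A = "{J. ideal J R \<and> I \<subseteq> J \<and> J \<inter> M = {}}"
  have "\<exists>J\<in>?A. \<forall>K\<in>?A. J \<subseteq> K \<longrightarrow> K = J"
  proof (rule subset_Zorn_nonempty)
    show "?A \<noteq> {}" using assms by blast
    fix c assume c: "c \<noteq> {}" "subset.chain ?A c"
    then have sub: "c \<subseteq> ?A" and lin: "\<And>J K. J \<in> c \<Longrightarrow> K \<in> c \<Longrightarrow> J \<subseteq> K \<or> K \<subseteq> J"
      by (auto simp: subset_chain_def)
    have id: "ideal J R" if "J \<in> c" for J using that sub by blast
    have "ideal (\<Union>c) R"
    proof (rule idealI[OF ring_axioms])
      show "subgroup (\<Union>c) (add_monoid R)"
      proof
        show "\<Union>c \<subseteq> carrier (add_monoid R)" using id[THEN ideal.Icarr] by auto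
        obtain J where J: "J \<in> c" using c(1) by blast
        then show "\<one>\<^bsub>add_monoid R\<^esub> \<in> \<Union>c" using additive_subgroup.zero_closed[OF ideal.axioms(1)[OF id[OF J]]] by auto
        fix a b assume "a \<in> \<Union>c" "b \<in> \<Union>c"
        then obtain J where J: "J \<in> c" "a \<in> J" "b \<in> J" using lin by blast
        then show "a \<otimes>\<^bsub>add_monoid R\<^esub> b \<in> \<Union>c"
          using additive_subgroup.a_closed[OF ideal.axioms(1)[OF id[OF J(1)]] J(2,3)] by auto
      next
        fix a assume "a \<in> \<Union>c"
        then obtain J where J: "J \<in> c" "a \<in> J" by blast
        then have "\<ominus> a \<in> J" using additive_subgroup.a_inv_closed[OF ideal.axioms(1)[OF id[OF J(1)]]] by blast
        then show "inv\<^bsub>add_monoid R\<^esub> a \<in> \<Union>c" using J by (auto simp: a_inv_def)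
      qed
      show "x \<otimes> a \<in> \<Union>c" "a \<otimes> x \<in> \<Union>c" if "a \<in> \<Union>c" "x \<in> carrier R" for a x
        using that ideal.I_l_closed[OF id] ideal.I_r_closed[OF id] by blast+
    qed
    then show "\<Union>c \<in> ?A" using c(1) sub by blast
  qed
  then obtain J where J: "J \<in> ?A" and max: "\<forall>K\<in>?A. J \<subseteq> K \<longrightarrow> K = J" by (rule bexE)
  have "K = J" if "ideal K R \<and> J \<subseteq> K \<and> K \<inter> M = {}" for K
  proof -
    have "K \<in> ?A" using that J by auto
    then show ?thesis using max that by simp
  qed
  then show ?thesis using J by (intro exI[of _ J]) simp
qed

lemma (in cring) nonunit_in_maximalideal:
  assumes a: "a \<in> carrier R" "a \<notin> Units R"
  shows "\<exists>m. maximalideal m R \<and> a \<in> m"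
proof -
  have "\<one> \<notin> PIdl a" using a by (auto simp: cgenideal_def Units_def m_comm)
  from ideal_maximal_avoiding[OF cgenideal_ideal[OF a(1)], of "{\<one>}"] this
  obtain J where J: "ideal J R" "PIdl a \<subseteq> J" "\<one> \<notin> J"
    and max: "\<forall>K. ideal K R \<and> J \<subseteq> K \<and> K \<inter> {\<one>} = {} \<longrightarrow> K = J" by auto
  have "maximalideal J R"
  proof (rule maximalidealI[OF J(1)])
    show "carrier R \<noteq> J" using J(3) by auto
    fix K assume "ideal K R" "J \<subseteq> K" "K \<subseteq> carrier R"
    then show "K = J \<or> K = carrier R" using spec[OF max, of K] ideal.one_imp_carrier[of K R] by auto
  qed
  then show ?thesis using J(2) cgenideal_self[OF a(1)] by blast
qed

text \<open>An ideal \<open>J\<close> maximal among those avoiding the powers of \<open>a\<close> is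
  prime: if \<open>x\<close> and \<open>y\<close> are outside \<open>J\<close>, some powers of
  \<open>a\<close> lie in \<open>J\<close> plus the multiples of \<open>x\<close> and of
  \<open>y\<close>. If \<open>x \<otimes> y\<close> were in \<open>J\<close>, the product of these
  powers would be in \<open>J\<close> as well.\<close>

lemma (in cring) prime_avoiding_powers:
  assumes a: "a \<in> carrier R" and nil: "\<And>n::nat. a [^] n \<noteq> \<zero>"
  shows "\<exists>P. primeideal P R \<and> a \<notin> P"
proof -
  let ?M = "range (\<lambda>n::nat. a [^] n)"
  have "\<zero> \<notin> ?M" using nil by (metis rangeE)
  then have "{\<zero>} \<inter> ?M = {}" by blast
  from ideal_maximal_avoiding[OF zeroideal this]
  obtain J where J: "ideal J R" "J \<inter> ?M = {}" and max: "\<forall>K. ideal K R \<and> J \<subseteq> K \<and> K \<inter> ?M = {} \<longrightarrow> K = J"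
    by (elim exE conjE)
  interpret J: ideal J R by (rule J(1))
  have meets: "\<exists>n::nat. \<exists>j\<in>J. \<exists>r\<in>carrier R. a [^] n = j \<oplus> r \<otimes> x" if x: "x \<in> carrier R" "x \<notin> J" for x
  proof -
    let ?K = "J <+>\<^bsub>R\<^esub> PIdl x"
    have K: "ideal ?K R" by (rule add_ideals[OF J(1) cgenideal_ideal[OF x(1)]])
    have mem: "y \<in> ?K \<longleftrightarrow> (\<exists>j\<in>J. \<exists>r\<in>carrier R. y = j \<oplus> r \<otimes> x)" for y
      by (auto simp: set_add_def' cgenideal_def)
    have "J \<subseteq> ?K"
    proof
      fix j assume "j \<in> J" then show "j \<in> ?K" unfolding mem using x(1) by (intro bexI[of _ j] bexI[of _ \<zero>]) auto
    qed
    moreover have "x \<in> ?K" unfolding mem using x(1) by (intro bexI[of _ \<zero>] bexI[of _ \<one>]) auto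
    ultimately have "?K \<inter> ?M \<noteq> {}" using mp[OF spec[OF max, of ?K]] K x(2) by blast
    then show ?thesis using mem by auto
  qed
  have "primeideal J R"
  proof (rule primeidealI[OF J(1) cring_axioms])
    show "carrier R \<noteq> J" using J(2) a by (metis IntI empty_iff nat_pow_closed rangeI)
    fix x y assume h: "x \<in> carrier R" "y \<in> carrier R" "x \<otimes> y \<in> J"
    show "x \<in> J \<or> y \<in> J"
    proof (rule ccontr)
      assume c: "\<not> (x \<in> J \<or> y \<in> J)"
      obtain n j r where 1: "a [^] (n::nat) = j \<oplus> r \<otimes> x" "j \<in> J" "r \<in> carrier R" using meets[OF h(1)] c by blast
      obtain m k s where 2: "a [^] (m::nat) = k \<oplus> s \<otimes> y" "k \<in> J" "s \<in> carrier R" using meets[OF h(2)] c by blast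
      have jk: "j \<in> carrier R" "k \<in> carrier R" using 1(2) 2(2) by auto
      have "a [^] (n + m) = (j \<oplus> r \<otimes> x) \<otimes> (k \<oplus> s \<otimes> y)" using 1(1) 2(1) nat_pow_mult[OF a, of n m] by simp
      also have "\<dots> = j \<otimes> (k \<oplus> s \<otimes> y) \<oplus> ((r \<otimes> x) \<otimes> k \<oplus> (r \<otimes> s) \<otimes> (x \<otimes> y))"
        using jk 1(3) 2(3) h(1,2) by (simp add: l_distr r_distr m_ac a_ac)
      also have "\<dots> \<in> J" 
        using J.I_r_closed[OF 1(2), of "k \<oplus> s \<otimes> y"] J.I_l_closed[OF 2(2), of "r \<otimes> x"] J.I_l_closed[OF h(3), of "r \<otimes> s"]
          1(3) 2(3) jk h(1,2) by (intro J.a_closed) simp_all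
      finally show False using J(2) by blast
    qed
  qed
  moreover have "a \<notin> J" using J(2) nat_pow_eone[OF a] by (metis IntI empty_iff rangeI)
  ultimately show ?thesis by blast
qed

text \<open>Every nonunit lies in some maximal ideal, and there is only one; conversely a proper
  ideal contains no unit. Applied to a prime ideal, these two facts place it inside
  \<open>m\<close>.\<close>

lemma locally_ringedD:
  assumes "locally_ringed X" "x \<in> pts X"
  obtains m where "maximalideal m (stalk X x)" "\<And>a. a \<in> carrier (stalk X x) \<Longrightarrow> a \<notin> Units (stalk X x) \<longleftrightarrow> a \<in> m"
    "\<And>P. primeideal P (stalk X x) \<Longrightarrow> P \<subseteq> m" "\<one>\<^bsub>stalk X x\<^esub> \<noteq> \<zero>\<^bsub>stalk X x\<^esub>"
proof -
  interpret S: cring "stalk X x" using assms by (auto simp: locally_ringed_def intro: stalk_cring)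
  have "\<exists>!m. maximalideal m (stalk X x)" using assms by (simp add: locally_ringed_def)
  then obtain m where m: "maximalideal m (stalk X x)" and uniq: "\<forall>m'. maximalideal m' (stalk X x) \<longrightarrow> m' = m"
    by (rule ex1E)
  interpret m: maximalideal m "stalk X x" by (rule m)
  have nu: "y \<notin> Units (stalk X x)" if J: "ideal J (stalk X x)" "J \<noteq> carrier (stalk X x)" "y \<in> J" for J y
  proof
    assume y: "y \<in> Units (stalk X x)"
    have "inv\<^bsub>stalk X x\<^esub> y \<otimes>\<^bsub>stalk X x\<^esub> y \<in> J" using ideal.I_l_closed[OF J(1,3)] S.Units_inv_closed[OF y] by blast
    then show False using ideal.one_imp_carrier[OF J(1)] S.Units_l_inv[OF y] J(2) by simp
  qed
  have iff: "a \<notin> Units (stalk X x) \<longleftrightarrow> a \<in> m" if a: "a \<in> carrier (stalk X x)" for a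
    using nu[OF m.is_ideal m.I_notcarr[symmetric]] S.nonunit_in_maximalideal[OF a] uniq by blast
  show ?thesis
  proof (rule that[OF m iff])
    show "P \<subseteq> m" if P: "primeideal P (stalk X x)" for P
    proof
      fix a assume "a \<in> P"
      then show "a \<in> m"
        using nu[OF primeideal.axioms(1)[OF P] primeideal.I_notcarr[OF P, symmetric]] iff ideal.Icarr[OF primeideal.axioms(1)[OF P]] by blast
    qed
    show "\<one>\<^bsub>stalk X x\<^esub> \<noteq> \<zero>\<^bsub>stalk X x\<^esub>"
      using nu[OF m.is_ideal m.I_notcarr[symmetric], of "\<zero>\<^bsub>stalk X x\<^esub>"] m.zero_closed S.Units_one_closed by metis
  qed
qed

section \<open>Spectra\<close>

locale loc_at_prime = cring R for R :: "'s ring" (structure) +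
  fixes P assumes prime: "primeideal P R"
begin

interpretation P: primeideal P R by (rule prime)

lemma one_notin: "\<one> \<notin> P" using P.I_notcarr P.one_imp_carrier by auto

lemma comp_mult: "f \<in> carrier R - P \<Longrightarrow> g \<in> carrier R - P \<Longrightarrow> f \<otimes> g \<in> carrier R - P"
  using P.I_prime by blast

lemma comp_pow: "f \<in> carrier R - P \<Longrightarrow> f [^] (n::nat) \<in> carrier R - P"
  by (induction n) (use one_notin comp_mult in auto)

text \<open>Transitivity of equality of fractions. The ring may have zero divisors, so the middle
  denominator \<open>f\<close> cannot be cancelled and goes into the multiplier
  \<open>h \<otimes> k \<otimes> f\<close>.\<close>

lemma frac_subset:
  assumes c: "a \<in> carrier R" "b \<in> carrier R" "f \<in> carrier R - P" "g \<in> carrier R - P"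
    and h: "h \<in> carrier R - P" "h \<otimes> (a \<otimes> g) = h \<otimes> (b \<otimes> f)"
  shows "frac R P a f \<subseteq> frac R P b g"
proof
  fix z assume "z \<in> frac R P a f"
  then obtain d e k where z: "z = (d, e)" "d \<in> carrier R" "e \<in> carrier R - P" "k \<in> carrier R - P" "k \<otimes> (a \<otimes> e) = k \<otimes> (d \<otimes> f)"
    by (auto simp: frac_def)
  have C: "a \<in> carrier R" "b \<in> carrier R" "d \<in> carrier R" "e \<in> carrier R" "f \<in> carrier R" "g \<in> carrier R" "h \<in> carrier R" "k \<in> carrier R"
    using c h z by auto
  have "(h \<otimes> k \<otimes> f) \<otimes> (b \<otimes> e) = (k \<otimes> e) \<otimes> (h \<otimes> (b \<otimes> f))" using C by (simp add: m_ac)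
  also have "\<dots> = (h \<otimes> g) \<otimes> (k \<otimes> (a \<otimes> e))" unfolding h(2)[symmetric] using C by (simp add: m_ac)
  also have "\<dots> = (h \<otimes> k \<otimes> f) \<otimes> (d \<otimes> g)" unfolding z(5) using C by (simp add: m_ac)
  finally have e: "(h \<otimes> k \<otimes> f) \<otimes> (b \<otimes> e) = (h \<otimes> k \<otimes> f) \<otimes> (d \<otimes> g)" .
  have hkf: "h \<otimes> k \<otimes> f \<in> carrier R - P" using comp_mult h(1) z(4) c(3) by blast
  show "z \<in> frac R P b g" unfolding frac_def z(1) using z(2,3) hkf e by blast
qed

lemma frac_eqI:
  assumes "a \<in> carrier R" "b \<in> carrier R" "f \<in> carrier R - P" "g \<in> carrier R - P"
    and "h \<in> carrier R - P" "h \<otimes> (a \<otimes> g) = h \<otimes> (b \<otimes> f)"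
  shows "frac R P a f = frac R P b g"
  using frac_subset[OF assms] frac_subset[OF assms(2,1,4,3,5) assms(6)[symmetric]] by blast

lemma frac_eqE:
  assumes "b \<in> carrier R" "g \<in> carrier R - P" "frac R P a f = frac R P b g"
  obtains h where "h \<in> carrier R - P" "h \<otimes> (a \<otimes> g) = h \<otimes> (b \<otimes> f)"
proof -
  have "(b, g) \<in> frac R P b g" unfolding frac_def using assms(1,2) one_notin by auto
  then have "(b, g) \<in> frac R P a f" using assms(3) by simp
  then show ?thesis using that by (auto simp: frac_def)
qed

lemma frac_op_eq:
  assumes resp: "\<And>a f b g a' f' b' g'. a \<in> carrier R \<Longrightarrow> b \<in> carrier R \<Longrightarrow> a' \<in> carrier R \<Longrightarrow> b' \<in> carrier R \<Longrightarrow>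
      f \<in> carrier R - P \<Longrightarrow> g \<in> carrier R - P \<Longrightarrow> f' \<in> carrier R - P \<Longrightarrow> g' \<in> carrier R - P \<Longrightarrow>
      frac R P a f = frac R P a' f' \<Longrightarrow> frac R P b g = frac R P b' g' \<Longrightarrow> k a f b g = k a' f' b' g'"
    and c: "a \<in> carrier R" "b \<in> carrier R" "f \<in> carrier R - P" "g \<in> carrier R - P"
  shows "frac_op R P k (frac R P a f) (frac R P b g) = k a f b g"
  unfolding frac_op_def
proof (rule the_equality)
  show "\<exists>a' b'. \<exists>f'\<in>carrier R - P. \<exists>g'\<in>carrier R - P. a' \<in> carrier R \<and> b' \<in> carrier R \<and> frac R P a f = frac R P a' f' \<and>
      frac R P b g = frac R P b' g' \<and> k a f b g = k a' f' b' g'" using c by blast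
  fix z assume "\<exists>a' b'. \<exists>f'\<in>carrier R - P. \<exists>g'\<in>carrier R - P. a' \<in> carrier R \<and> b' \<in> carrier R \<and> frac R P a f = frac R P a' f' \<and>
      frac R P b g = frac R P b' g' \<and> z = k a' f' b' g'"
  then obtain a' b' f' g' where h: "f' \<in> carrier R - P" "g' \<in> carrier R - P" "a' \<in> carrier R" "b' \<in> carrier R"
    "frac R P a f = frac R P a' f'" "frac R P b g = frac R P b' g'" "z = k a' f' b' g'" by (elim exE bexE conjE)
  show "z = k a f b g" unfolding h(7) by (rule resp[OF c(1,2) h(3,4) c(3,4) h(1,2,5,6), symmetric])
qed

lemma loc_mult:
  assumes c: "a \<in> carrier R" "b \<in> carrier R" "f \<in> carrier R - P" "g \<in> carrier R - P"
  shows "frac R P a f \<otimes>\<^bsub>loc_ring R P\<^esub> frac R P b g = frac R P (a \<otimes> b) (f \<otimes> g)"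
proof -
  have "frac_op R P (\<lambda>a f b g. frac R P (a \<otimes> b) (f \<otimes> g)) (frac R P a f) (frac R P b g) = frac R P (a \<otimes> b) (f \<otimes> g)"
  proof (rule frac_op_eq[OF _ c])
    fix a f b g a' f' b' g'
    assume C: "a \<in> carrier R" "b \<in> carrier R" "a' \<in> carrier R" "b' \<in> carrier R" "f \<in> carrier R - P" "g \<in> carrier R - P"
      "f' \<in> carrier R - P" "g' \<in> carrier R - P" and e: "frac R P a f = frac R P a' f'" "frac R P b g = frac R P b' g'"
    obtain h where h: "h \<in> carrier R - P" "h \<otimes> (a \<otimes> f') = h \<otimes> (a' \<otimes> f)" using frac_eqE[OF C(3,7) e(1)] .
    obtain k where k: "k \<in> carrier R - P" "k \<otimes> (b \<otimes> g') = k \<otimes> (b' \<otimes> g)" using frac_eqE[OF C(4,8) e(2)] .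
    have D: "f \<in> carrier R" "g \<in> carrier R" "f' \<in> carrier R" "g' \<in> carrier R" "h \<in> carrier R" "k \<in> carrier R" using C h k by auto
    have "(h \<otimes> k) \<otimes> ((a \<otimes> b) \<otimes> (f' \<otimes> g')) = (h \<otimes> (a \<otimes> f')) \<otimes> (k \<otimes> (b \<otimes> g'))" using C(1-4) D by (simp add: m_ac)
    also have "\<dots> = (h \<otimes> k) \<otimes> ((a' \<otimes> b') \<otimes> (f \<otimes> g))" unfolding h(2) k(2) using C(1-4) D by (simp add: m_ac)
    finally show "frac R P (a \<otimes> b) (f \<otimes> g) = frac R P (a' \<otimes> b') (f' \<otimes> g')"
      by (rule frac_eqI[rotated 5]) (use C D h k comp_mult in auto)
  qed
  then show ?thesis by (simp add: loc_ring_def)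
qed

lemma loc_add:
  assumes c: "a \<in> carrier R" "b \<in> carrier R" "f \<in> carrier R - P" "g \<in> carrier R - P"
  shows "frac R P a f \<oplus>\<^bsub>loc_ring R P\<^esub> frac R P b g = frac R P (a \<otimes> g \<oplus> b \<otimes> f) (f \<otimes> g)"
proof -
  have "frac_op R P (\<lambda>a f b g. frac R P (a \<otimes> g \<oplus> b \<otimes> f) (f \<otimes> g)) (frac R P a f) (frac R P b g) = frac R P (a \<otimes> g \<oplus> b \<otimes> f) (f \<otimes> g)"
  proof (rule frac_op_eq[OF _ c])
    fix a f b g a' f' b' g'
    assume C: "a \<in> carrier R" "b \<in> carrier R" "a' \<in> carrier R" "b' \<in> carrier R" "f \<in> carrier R - P" "g \<in> carrier R - P"
      "f' \<in> carrier R - P" "g' \<in> carrier R - P" and e: "frac R P a f = frac R P a' f'" "frac R P b g = frac R P b' g'"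
    obtain h where h: "h \<in> carrier R - P" "h \<otimes> (a \<otimes> f') = h \<otimes> (a' \<otimes> f)" using frac_eqE[OF C(3,7) e(1)] .
    obtain k where k: "k \<in> carrier R - P" "k \<otimes> (b \<otimes> g') = k \<otimes> (b' \<otimes> g)" using frac_eqE[OF C(4,8) e(2)] .
    have D: "f \<in> carrier R" "g \<in> carrier R" "f' \<in> carrier R" "g' \<in> carrier R" "h \<in> carrier R" "k \<in> carrier R" using C h k by auto
    have "(h \<otimes> k) \<otimes> ((a \<otimes> g \<oplus> b \<otimes> f) \<otimes> (f' \<otimes> g')) =
        (h \<otimes> (a \<otimes> f')) \<otimes> (k \<otimes> (g \<otimes> g')) \<oplus> (k \<otimes> (b \<otimes> g')) \<otimes> (h \<otimes> (f \<otimes> f'))"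
      using C(1-4) D by (simp add: m_ac l_distr r_distr)
    also have "\<dots> = (h \<otimes> k) \<otimes> ((a' \<otimes> g' \<oplus> b' \<otimes> f') \<otimes> (f \<otimes> g))" unfolding h(2) k(2)
      using C(1-4) D by (simp add: m_ac l_distr r_distr)
    finally show "frac R P (a \<otimes> g \<oplus> b \<otimes> f) (f \<otimes> g) = frac R P (a' \<otimes> g' \<oplus> b' \<otimes> f') (f' \<otimes> g')"
      by (rule frac_eqI[rotated 5]) (use C D h k comp_mult in auto)
  qed
  then show ?thesis by (simp add: loc_ring_def)
qed

end

definition Dopen :: "'s ring \<Rightarrow> 's \<Rightarrow> 's set set" where
  "Dopen R h = {P. primeideal P R \<and> h \<notin> P}"

context
  fixes R :: "'s ring" (structure)
  assumes R: "cring R"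
begin

interpretation cring R by (rule R)

lemma locI: "primeideal P R \<Longrightarrow> loc_at_prime R P"
  by (intro loc_at_prime.intro loc_at_prime_axioms.intro R)

lemma Spec_open_iff: "opn (Spec R) U \<longleftrightarrow> (\<exists>S \<subseteq> carrier R. U = {P. primeideal P R \<and> \<not> S \<subseteq> P})"
proof -
  let ?O = "\<lambda>U. \<exists>S \<subseteq> carrier R. U = {P. primeideal P R \<and> \<not> S \<subseteq> P}"
  have "istopology ?O"
    unfolding istopology_def
  proof (intro conjI allI impI)
    fix A B assume "?O A" "?O B"
    then obtain S T where S: "S \<subseteq> carrier R" "A = {P. primeideal P R \<and> \<not> S \<subseteq> P}" and T: "T \<subseteq> carrier R" "B = {P. primeideal P R \<and> \<not> T \<subseteq> P}"
      by blast
    let ?ST = "{s \<otimes> t | s t. s \<in> S \<and> t \<in> T}"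
    have "P \<in> A \<inter> B \<longleftrightarrow> primeideal P R \<and> \<not> ?ST \<subseteq> P" for P
    proof
      assume "P \<in> A \<inter> B"
      then obtain s t where h: "primeideal P R" "s \<in> S" "s \<notin> P" "t \<in> T" "t \<notin> P" using S T by blast
      then have "s \<otimes> t \<notin> P" using primeideal.I_prime[OF h(1), of s t] S(1) T(1) by blast
      then show "primeideal P R \<and> \<not> ?ST \<subseteq> P" using h by blast
    next
      assume h: "primeideal P R \<and> \<not> ?ST \<subseteq> P"
      then obtain s t where st: "s \<in> S" "t \<in> T" "s \<otimes> t \<notin> P" by blast
      have "ideal P R" using h primeideal.axioms(1) by blast
      then have "s \<notin> P" "t \<notin> P" using st S(1) T(1) ideal.I_l_closed[of P R t s] ideal.I_r_closed[of P R s t] by blast+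
      then show "P \<in> A \<inter> B" using h st S T by blast
    qed
    moreover have "?ST \<subseteq> carrier R" using S(1) T(1) by auto
    ultimately show "?O (A \<inter> B)" by (intro exI[of _ ?ST]) blast
  next
    fix \<K> assume K: "\<forall>K\<in>\<K>. ?O K"
    \<comment> \<open>The union of all sets describing members of the family is taken, which avoids
      choosing one description for each member.\<close>
    let ?S = "\<Union>{S. S \<subseteq> carrier R \<and> {P. primeideal P R \<and> \<not> S \<subseteq> P} \<in> \<K>}"
    have "P \<in> \<Union>\<K> \<longleftrightarrow> primeideal P R \<and> \<not> ?S \<subseteq> P" for P
    proof
      assume "P \<in> \<Union>\<K>"
      then obtain K where "K \<in> \<K>" "P \<in> K" by blast
      moreover obtain S where "S \<subseteq> carrier R" "K = {P. primeideal P R \<and> \<not> S \<subseteq> P}" using K \<open>K \<in> \<K>\<close> by blast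
      ultimately show "primeideal P R \<and> \<not> ?S \<subseteq> P" by blast
    next
      assume "primeideal P R \<and> \<not> ?S \<subseteq> P" then show "P \<in> \<Union>\<K>" by blast
    qed
    then show "?O (\<Union>\<K>)" by (intro exI[of _ ?S]) blast
  qed
  then show ?thesis unfolding Spec_def rspace.simps by (simp add: topology_inverse')
qed

lemma Spec_pts: "pts (Spec R) = {P. primeideal P R}"
proof -
  have "opn (Spec R) {P. primeideal P R}"
    unfolding Spec_open_iff by (rule exI[of _ "{\<one>}"]) (use loc_at_prime.one_notin[OF locI] in auto)
  moreover have "\<And>U. opn (Spec R) U \<Longrightarrow> U \<subseteq> {P. primeideal P R}" unfolding Spec_open_iff by blast
  ultimately show ?thesis by (metis openin_subset openin_topspace subset_antisym)
qed

lemma Dopen_open: "h \<in> carrier R \<Longrightarrow> opn (Spec R) (Dopen R h)"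
  unfolding Spec_open_iff Dopen_def by (rule exI[of _ "{h}"]) auto

lemma Dopen_iff: "P \<in> Dopen R h \<longleftrightarrow> primeideal P R \<and> h \<notin> P"
  by (simp add: Dopen_def)

lemma Dopen_mult_iff:
  assumes c: "c \<in> carrier R" "h \<in> carrier R"
  shows "P \<in> Dopen R (h \<otimes> c) \<longleftrightarrow> primeideal P R \<and> h \<notin> P \<and> c \<notin> P"
proof (cases "primeideal P R")
  case P: True
  have "h \<otimes> c \<in> P \<longleftrightarrow> h \<in> P \<or> c \<in> P"
    using primeideal.I_prime[OF P c(2,1)] ideal.I_r_closed[OF primeideal.axioms(1)[OF P] _ c(1), of h]
      ideal.I_l_closed[OF primeideal.axioms(1)[OF P] _ c(2), of c] by blast
  then show ?thesis using P by (simp add: Dopen_iff)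
qed (simp add: Dopen_iff)

lemma Spec_simps:
  "\<sigma> \<otimes>\<^bsub>sec (Spec R) U\<^esub> \<tau> = (\<lambda>P\<in>U. \<sigma> P \<otimes>\<^bsub>loc_ring R P\<^esub> \<tau> P)"
  "\<sigma> \<oplus>\<^bsub>sec (Spec R) U\<^esub> \<tau> = (\<lambda>P\<in>U. \<sigma> P \<oplus>\<^bsub>loc_ring R P\<^esub> \<tau> P)"
  "\<one>\<^bsub>sec (Spec R) U\<^esub> = (\<lambda>P\<in>U. frac R P \<one> \<one>)"
  "\<zero>\<^bsub>sec (Spec R) U\<^esub> = (\<lambda>P\<in>U. frac R P \<zero> \<one>)"
  "res (Spec R) U V \<sigma> = restrict \<sigma> V"
  by (simp_all add: Spec_def loc_ring_def)

lemma Spec_section: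
  assumes U: "opn (Spec R) U" and a: "a \<in> carrier R" and b: "b \<in> carrier R" "\<And>Q. Q \<in> U \<Longrightarrow> b \<notin> Q"
  shows "(\<lambda>Q\<in>U. frac R Q a b) \<in> sct (Spec R) U"
proof -
  obtain S where S: "S \<subseteq> carrier R" "U = {P. primeideal P R \<and> \<not> S \<subseteq> P}"
    using U unfolding Spec_open_iff by (elim exE conjE)
  have "\<exists>S \<subseteq> carrier R. \<exists>c \<in> carrier R. \<exists>f \<in> carrier R.
            \<not> S \<subseteq> P \<and> (\<forall>Q. primeideal Q R \<and> \<not> S \<subseteq> Q \<longrightarrow> Q \<in> U \<and> f \<notin> Q \<and> (\<lambda>Q\<in>U. frac R Q a b) Q = frac R Q c f)" if "P \<in> U" for P
  proof -
    have "\<not> S \<subseteq> P \<and> (\<forall>Q. primeideal Q R \<and> \<not> S \<subseteq> Q \<longrightarrow> Q \<in> U \<and> b \<notin> Q \<and> (\<lambda>Q\<in>U. frac R Q a b) Q = frac R Q a b)"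
    proof (intro conjI[OF _ allI[OF impI]])
      show "\<not> S \<subseteq> P" using that S(2) by blast
      fix Q assume "primeideal Q R \<and> \<not> S \<subseteq> Q"
      then have "Q \<in> U" using S(2) by blast
      then show "Q \<in> U \<and> b \<notin> Q \<and> (\<lambda>Q\<in>U. frac R Q a b) Q = frac R Q a b" using b(2) by simp
    qed
    then show ?thesis by (intro exI[of _ S] conjI[OF S(1)] bexI[OF _ a] bexI[OF _ b(1)])
  qed
  then show ?thesis unfolding Spec_def rspace.simps partial_object.simps by (intro CollectI conjI ballI restrict_extensional)
qed

text \<open>The neighbourhoods in the definition are given by subsets \<open>S\<close> of the ring.
  One element of \<open>S\<close> outside \<open>P\<close> already cuts out a smaller basic open
  set, and a single denominator is what the later computations need.\<close>

lemma Spec_sectionE: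
  assumes s: "\<sigma> \<in> sct (Spec R) U" and P: "P \<in> U"
  obtains c f h where "c \<in> carrier R" "f \<in> carrier R" "h \<in> carrier R" "h \<notin> P"
    "\<forall>Q\<in>Dopen R h. Q \<in> U \<and> f \<notin> Q \<and> \<sigma> Q = frac R Q c f"
proof -
  have "\<forall>P\<in>U. \<exists>S \<subseteq> carrier R. \<exists>a \<in> carrier R. \<exists>f \<in> carrier R.
            \<not> S \<subseteq> P \<and> (\<forall>Q. primeideal Q R \<and> \<not> S \<subseteq> Q \<longrightarrow> Q \<in> U \<and> f \<notin> Q \<and> \<sigma> Q = frac R Q a f)"
    using s unfolding Spec_def rspace.simps partial_object.simps mem_Collect_eq by (rule conjunct2)
  from bspec[OF this P] obtain S c f where h: "S \<subseteq> carrier R" "c \<in> carrier R" "f \<in> carrier R" "\<not> S \<subseteq> P"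
    "\<forall>Q. primeideal Q R \<and> \<not> S \<subseteq> Q \<longrightarrow> Q \<in> U \<and> f \<notin> Q \<and> \<sigma> Q = frac R Q c f" by (elim exE bexE conjE)
  obtain k where k: "k \<in> S" "k \<notin> P" using h(4) by blast
  show ?thesis
  proof (rule that[OF h(2,3) _ k(2)])
    show "k \<in> carrier R" using k h by blast
    show "\<forall>Q\<in>Dopen R k. Q \<in> U \<and> f \<notin> Q \<and> \<sigma> Q = frac R Q c f"
    proof
      fix Q assume "Q \<in> Dopen R k"
      then show "Q \<in> U \<and> f \<notin> Q \<and> \<sigma> Q = frac R Q c f" using mp[OF spec[OF h(5), of Q]] k(1) by (auto simp: Dopen_def)
    qed
  qed
qed

lemma Spec_section_ext: "\<sigma> \<in> sct (Spec R) U \<Longrightarrow> \<sigma> \<in> extensional U"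
  by (simp add: Spec_def)

end

section \<open>Affine charts\<close>

lemma restr_opn: "opn X U \<Longrightarrow> opn (restr X U) V \<longleftrightarrow> opn X V \<and> V \<subseteq> U"
  by (simp add: restr_def openin_open_subtopology)

lemma restr_simps: "sec (restr X U) = sec X" "res (restr X U) = res X"
  by (simp_all add: restr_def)

lemma restr_pts: "opn X U \<Longrightarrow> pts (restr X U) = U"
  using opn_subset[of X U] by (auto simp: restr_def topspace_subtopology)

text \<open>The isomorphism with the spectrum is kept as a pair of mutually inverse morphisms, so
  that points, open sets and sections can be transported in either direction.\<close>

locale affine_chart =
  fixes X :: "('p, 's) rspace" and U0 :: "'p set" and R :: "'s ring" (structure) and \<phi> \<psi>
  assumes X: "ringed_space X" and U0: "opn X U0" and R: "cring R"
    and \<phi>: "\<phi> \<in> rmaps (restr X U0) (Spec R)" and \<psi>: "\<psi> \<in> rmaps (Spec R) (restr X U0)"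
    and \<psi>\<phi>: "rcomp (restr X U0) (Spec R) (restr X U0) \<psi> \<phi> = rid (restr X U0)"
    and \<phi>\<psi>: "rcomp (Spec R) (restr X U0) (Spec R) \<phi> \<psi> = rid (Spec R)"
begin

lemma \<psi>\<phi>_point: "y \<in> U0 \<Longrightarrow> pmap \<psi> (pmap \<phi> y) = y"
  using arg_cong[OF \<psi>\<phi>, of "\<lambda>f. pmap f y"] restr_pts[OF U0] by (simp add: rcomp_def rid_def)

lemma \<phi>\<psi>_point: "primeideal Q R \<Longrightarrow> pmap \<phi> (pmap \<psi> Q) = Q"
  using arg_cong[OF \<phi>\<psi>, of "\<lambda>f. pmap f Q"] Spec_pts[OF R] by (simp add: rcomp_def rid_def)

lemma \<phi>_prime: "y \<in> U0 \<Longrightarrow> primeideal (pmap \<phi> y) R"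
  using rmaps_pmap[OF \<phi>, of y] Spec_pts[OF R] restr_pts[OF U0] by simp

lemma \<psi>_U0: "primeideal Q R \<Longrightarrow> pmap \<psi> Q \<in> U0"
  using rmaps_pmap[OF \<psi>, of Q] Spec_pts[OF R] restr_pts[OF U0] by simp

abbreviation "back V \<equiv> pre (Spec R) \<psi> V"
abbreviation "fore D \<equiv> pre (restr X U0) \<phi> D"

lemma mem_back: "Q \<in> back V \<longleftrightarrow> primeideal Q R \<and> pmap \<psi> Q \<in> V"
  by (simp add: pre_def Spec_pts[OF R])

lemma mem_fore: "y \<in> fore D \<longleftrightarrow> y \<in> U0 \<and> pmap \<phi> y \<in> D"
  by (simp add: pre_def restr_pts[OF U0])

lemma fore_open: "opn (Spec R) D \<Longrightarrow> opn X (fore D)"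
  using rmaps_pre_open[OF \<phi>] restr_opn[OF U0] by blast

lemma back_open: "opn X V \<Longrightarrow> V \<subseteq> U0 \<Longrightarrow> opn (Spec R) (back V)"
  using rmaps_pre_open[OF \<psi>] restr_opn[OF U0] by blast

lemma fore_back: "V \<subseteq> U0 \<Longrightarrow> fore (back V) = V"
  using \<psi>\<phi>_point \<phi>_prime by (auto simp: mem_fore mem_back)

lemma fore_sub: "D \<subseteq> back V \<Longrightarrow> fore D \<subseteq> V"
  using \<psi>\<phi>_point by (force simp: mem_fore mem_back)

lemma co_\<psi>: "opn X V \<Longrightarrow> V \<subseteq> U0 \<Longrightarrow> s \<in> sct X V \<Longrightarrow> co \<psi> V s \<in> sct (Spec R) (back V)"
  using rmaps_co[OF \<psi>, of V s] restr_opn[OF U0] by (simp add: restr_simps)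

lemma co_\<phi>_hom: "opn (Spec R) D \<Longrightarrow> co \<phi> D \<in> ring_hom (sec (Spec R) D) (sec X (fore D))"
  using rmaps_co_hom[OF \<phi>, of D] by (simp add: restr_simps)

text \<open>Comorphisms commute with restriction, and those of \<open>\<phi>\<close> and
  \<open>\<psi>\<close> are inverse to each other on \<open>V\<close>. Restriction in
  \<open>X\<close> can therefore be computed with fractions on the spectrum.\<close>

lemma co_\<phi>_restrict:
  assumes V: "opn X V" "V \<subseteq> U0" and s: "s \<in> sct X V" and D: "opn (Spec R) D" "D \<subseteq> back V"
  shows "co \<phi> D (restrict (co \<psi> V s) D) = res X V (fore D) s"
proof -
  have Vo: "opn (restr X U0) V" using V restr_opn[OF U0] by simp
  have s': "s \<in> sct (restr X U0) V" using s by (simp add: restr_simps)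
  have "co \<phi> (back V) (co \<psi> V s) = co (rid (restr X U0)) V s"
    unfolding \<psi>\<phi>[symmetric] by (rule co_rcomp[OF Vo s', symmetric])
  also have "\<dots> = s" using Vo s' by (simp add: rid_def)
  finally have "co \<phi> (back V) (co \<psi> V s) = s" .
  with rmaps_res[OF \<phi> back_open[OF V] D co_\<psi>[OF V s]] show ?thesis
    by (simp add: Spec_simps[OF R] restr_simps fore_back[OF V(2)])
qed

lemma local_fraction:
  assumes V: "opn X V" "V \<subseteq> U0" and s: "s \<in> sct X V" and y: "y \<in> V"
  obtains c f h where "c \<in> carrier R" "f \<in> carrier R" "h \<in> carrier R" "h \<notin> pmap \<phi> y" "Dopen R h \<subseteq> back V"
    "\<forall>Q\<in>Dopen R h. f \<notin> Q \<and> co \<psi> V s Q = frac R Q c f"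
proof -
  have "pmap \<phi> y \<in> back V" using y V \<phi>_prime \<psi>\<phi>_point by (auto simp: mem_back)
  from Spec_sectionE[OF R co_\<psi>[OF V s] this] obtain c f h where h: "c \<in> carrier R" "f \<in> carrier R" "h \<in> carrier R" "h \<notin> pmap \<phi> y"
    "\<forall>Q\<in>Dopen R h. Q \<in> back V \<and> f \<notin> Q \<and> co \<psi> V s Q = frac R Q c f" .
  show ?thesis by (rule that[OF h(1-4)]) (use h(5) in auto)
qed

text \<open>Writing \<open>a = c/f\<close> on \<open>Dopen R h\<close>, every prime contains \<open>c h\<close>, so \<open>c h\<close> is nilpotent.\<close>

lemma locally_nilpotent:
  assumes W: "opn X W" and a: "a \<in> sct X W" and nu: "\<And>w. w \<in> W \<Longrightarrow> germ X w W a \<notin> Units (stalk X w)"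
    and x: "x \<in> W" "x \<in> U0"
  shows "\<exists>V. \<exists>n::nat. opn X V \<and> x \<in> V \<and> V \<subseteq> W \<and> res X W V a [^]\<^bsub>sec X V\<^esub> n = \<zero>\<^bsub>sec X V\<^esub>"
proof -
  interpret cring R by (rule R)
  define V1 where "V1 = W \<inter> U0"
  have V1: "opn X V1" "V1 \<subseteq> U0" "V1 \<subseteq> W" "x \<in> V1" using W U0 x by (auto simp: V1_def)
  define a1 where "a1 = res X W V1 a"
  have a1: "a1 \<in> sct X V1" unfolding a1_def by (rule ringed_space_res[OF X W V1(1,3) a])
  obtain c f h where cfh: "c \<in> carrier R" "f \<in> carrier R" "h \<in> carrier R" "h \<notin> pmap \<phi> x" "Dopen R h \<subseteq> back V1"
    and fr: "\<forall>Q\<in>Dopen R h. f \<notin> Q \<and> co \<psi> V1 a1 Q = frac R Q c f"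
    using local_fraction[OF V1(1,2) a1 V1(4)] .
  have D: "opn (Spec R) (Dopen R h)" by (rule Dopen_open[OF R cfh(3)])
  have sec: "co \<phi> E (\<lambda>Q\<in>E. frac R Q c f) = res X W (fore E) a" if E: "opn (Spec R) E" "E \<subseteq> Dopen R h" for E
  proof -
    have "(\<lambda>Q\<in>E. frac R Q c f) = restrict (co \<psi> V1 a1) E"
    proof (rule restrict_ext)
      fix Q assume "Q \<in> E"
      then show "frac R Q c f = co \<psi> V1 a1 Q" using bspec[OF fr subsetD[OF E(2)]] by simp
    qed
    moreover have "res X V1 (fore E) a1 = res X W (fore E) a"
      unfolding a1_def using ringed_space_res_res[OF X W V1(1) fore_open[OF E(1)] fore_sub V1(3) a] E(2) cfh(5) by blast
    ultimately show ?thesis using co_\<phi>_restrict[OF V1(1,2) a1 E(1)] E(2) cfh(5) by auto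
  qed
  \<comment> \<open>If \<open>c\<close> avoided \<open>Q\<close>, then \<open>c / f\<close> would
    have the inverse \<open>f / c\<close> on the smaller open set where \<open>h\<close> and
    \<open>c\<close> are both invertible. Then \<open>a\<close> would have a unit germ at the point
    of \<open>W\<close> corresponding to \<open>Q\<close>, contrary to assumption.\<close>
  have c_mem: "c \<in> Q" if Q: "Q \<in> Dopen R h" for Q
  proof (rule ccontr)
    assume nc: "c \<notin> Q"
    have Qp: "primeideal Q R" "h \<notin> Q" using Q by (auto simp: Dopen_def)
    let ?E = "Dopen R (h \<otimes> c)"
    have E: "opn (Spec R) ?E" by (rule Dopen_open[OF R]) (use cfh in simp)
    note mult_iff = Dopen_mult_iff[OF R cfh(1,3)]
    have sub: "?E \<subseteq> Dopen R h" unfolding subset_iff mult_iff Dopen_iff[OF R, of _ h] by blast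
    have cE: "\<And>P. P \<in> ?E \<Longrightarrow> c \<notin> P" unfolding mult_iff by blast
    have QE: "Q \<in> ?E" unfolding mult_iff using Qp nc by simp
    let ?\<sigma> = "\<lambda>Q\<in>?E. frac R Q c f" and ?\<tau> = "\<lambda>Q\<in>?E. frac R Q f c"
    have \<sigma>: "?\<sigma> \<in> sct (Spec R) ?E" by (rule Spec_section[OF R E cfh(1,2)]) (use bspec[OF fr subsetD[OF sub]] in simp)
    have \<tau>: "?\<tau> \<in> sct (Spec R) ?E" by (rule Spec_section[OF R E cfh(2,1) cE])
    have "frac R P c f \<otimes>\<^bsub>loc_ring R P\<^esub> frac R P f c = frac R P \<one> \<one>" if P: "P \<in> ?E" for P
    proof -
      have "primeideal P R" using P by (simp add: Dopen_def)
      then interpret L: loc_at_prime R P by (rule locI[OF R])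
      have cf: "c \<in> carrier R - P" "f \<in> carrier R - P" using cE[OF P] bspec[OF fr subsetD[OF sub P]] cfh(1,2) by auto
      show ?thesis unfolding L.loc_mult[OF cfh(1,2) cf(2,1)]
        by (rule L.frac_eqI[of _ _ _ _ \<one>]) (use cf L.one_notin L.comp_mult cfh(1,2) in \<open>auto simp: m_comm\<close>)
    qed
    then have "?\<sigma> \<otimes>\<^bsub>sec (Spec R) ?E\<^esub> ?\<tau> = \<one>\<^bsub>sec (Spec R) ?E\<^esub>"
      by (simp add: Spec_simps[OF R] cong: restrict_cong)
    then have "res X W (fore ?E) a \<otimes>\<^bsub>sec X (fore ?E)\<^esub> co \<phi> ?E ?\<tau> = \<one>\<^bsub>sec X (fore ?E)\<^esub>"
      using ring_hom_mult[OF co_\<phi>_hom[OF E] \<sigma> \<tau>] ring_hom_one[OF co_\<phi>_hom[OF E]] sec[OF E sub] by simp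
    moreover have "res X W (fore ?E) a \<in> sct X (fore ?E)" "co \<phi> ?E ?\<tau> \<in> sct X (fore ?E)"
      using ring_hom_closed[OF co_\<phi>_hom[OF E] \<sigma>] ring_hom_closed[OF co_\<phi>_hom[OF E] \<tau>] sec[OF E sub] by simp_all
    ultimately have u: "res X W (fore ?E) a \<in> Units (sec X (fore ?E))"
      by (intro cring.UnitsI[OF ringed_space_cring[OF X fore_open[OF E]]])
    have y: "pmap \<psi> Q \<in> fore ?E" using QE Qp \<psi>_U0 \<phi>\<psi>_point by (simp add: mem_fore)
    have EW: "fore ?E \<subseteq> W" using fore_sub[of ?E V1] sub cfh(5) V1(3) by blast
    have "germ X (pmap \<psi> Q) W a \<in> Units (stalk X (pmap \<psi> Q))"
      using germ_unit_iff[OF X W _ a, of "pmap \<psi> Q"] fore_open[OF E] y EW u by blast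
    then show False using nu y EW by blast
  qed
  have "\<exists>n::nat. (c \<otimes> h) [^] n = \<zero>"
  proof (rule ccontr)
    assume "\<not> ?thesis"
    then obtain P where P: "primeideal P R" "c \<otimes> h \<notin> P" using prime_avoiding_powers[of "c \<otimes> h"] cfh by auto
    then have "P \<in> Dopen R (c \<otimes> h)" unfolding Dopen_iff[OF R] by simp
    then have "P \<in> Dopen R h" "c \<notin> P" unfolding Dopen_mult_iff[OF R cfh(3,1)] by (simp_all add: Dopen_iff[OF R])
    then show False using c_mem by blast
  qed
  then obtain n :: nat where n: "(c \<otimes> h) [^] n = \<zero>" ..
  let ?D = "Dopen R h" let ?V = "fore ?D"
  have V: "opn X ?V" "x \<in> ?V" "?V \<subseteq> W"
    using fore_open[OF D] x \<phi>_prime cfh(4) fore_sub[OF cfh(5)] V1(3) by (auto simp: mem_fore Dopen_def)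
  have inP: "primeideal Q R" "f \<in> carrier R - Q" "h \<in> carrier R - Q" if "Q \<in> ?D" for Q
    using that bspec[OF fr that] cfh by (auto simp: Dopen_def)
  have pow_mem: "(\<lambda>Q\<in>?D. frac R Q (c [^] k) (f [^] k)) \<in> sct (Spec R) ?D" for k :: nat
    by (rule Spec_section[OF R D]) (use cfh loc_at_prime.comp_pow[OF locI[OF R inP(1)] inP(2)] in auto)
  have pow: "co \<phi> ?D (\<lambda>Q\<in>?D. frac R Q (c [^] k) (f [^] k)) = res X W ?V a [^]\<^bsub>sec X ?V\<^esub> k" for k :: nat
  proof (induction k)
    case 0
    have "(\<lambda>Q\<in>?D. frac R Q (c [^] (0::nat)) (f [^] (0::nat))) = \<one>\<^bsub>sec (Spec R) ?D\<^esub>" by (simp add: Spec_simps[OF R])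
    then show ?case using ring_hom_one[OF co_\<phi>_hom[OF D]] by simp
  next
    case (Suc k)
    have "frac R Q (c [^] Suc k) (f [^] Suc k) = frac R Q (c [^] k) (f [^] k) \<otimes>\<^bsub>loc_ring R Q\<^esub> frac R Q c f" if Q: "Q \<in> ?D" for Q
      using loc_at_prime.loc_mult[OF locI[OF R inP(1)[OF Q]] _ cfh(1) loc_at_prime.comp_pow[OF locI[OF R inP(1)[OF Q]] inP(2)[OF Q]] inP(2)[OF Q], of "c [^] k" k] cfh(1)
      by simp
    then have "(\<lambda>Q\<in>?D. frac R Q (c [^] Suc k) (f [^] Suc k)) =
        (\<lambda>Q\<in>?D. frac R Q (c [^] k) (f [^] k)) \<otimes>\<^bsub>sec (Spec R) ?D\<^esub> (\<lambda>Q\<in>?D. frac R Q c f)"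
      by (simp add: Spec_simps[OF R] cong: restrict_cong)
    moreover have "(\<lambda>Q\<in>?D. frac R Q c f) \<in> sct (Spec R) ?D" using pow_mem[of 1] cfh by simp
    ultimately have "co \<phi> ?D (\<lambda>Q\<in>?D. frac R Q (c [^] Suc k) (f [^] Suc k)) =
        co \<phi> ?D (\<lambda>Q\<in>?D. frac R Q (c [^] k) (f [^] k)) \<otimes>\<^bsub>sec X ?V\<^esub> co \<phi> ?D (\<lambda>Q\<in>?D. frac R Q c f)"
      using ring_hom_mult[OF co_\<phi>_hom[OF D] pow_mem] by (simp only:)
    then show ?case unfolding Suc.IH sec[OF D order_refl] by (simp only: monoid.nat_pow_Suc[OF ring.is_monoid[OF ringed_space_ring[OF X V(1)]]])
  qed
  let ?z = "\<zero>\<^bsub>sec (Spec R) ?D\<^esub>"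
  \<comment> \<open>The relation \<open>h [^] n \<otimes> c [^] n = \<zero>\<close> makes this
    fraction zero, because \<open>h [^] n\<close> lies outside every prime of
    \<open>Dopen R h\<close>.\<close>
  have "frac R Q (c [^] n) (f [^] n) = frac R Q \<zero> \<one>" if Q: "Q \<in> ?D" for Q
  proof -
    interpret L: loc_at_prime R Q by (rule locI[OF R inP(1)[OF Q]])
    have "h [^] n \<otimes> c [^] n = \<zero>" using n nat_pow_distrib[OF cfh(1,3), of n] cfh m_comm[of "h [^] n" "c [^] n"] by simp
    then show ?thesis
      by (intro L.frac_eqI[of _ _ _ _ "h [^] n"] L.comp_pow inP[OF Q]) (use cfh L.one_notin in auto)
  qed
  then have eq: "(\<lambda>Q\<in>?D. frac R Q (c [^] n) (f [^] n)) = ?z" by (simp add: Spec_simps[OF R] cong: restrict_cong)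
  \<comment> \<open>The image of the zero section is identified through idempotence under addition,
    which forces zero in the ring of sections of \<open>X\<close>. This uses additivity of the
    comorphism and no ring axioms for the sections of the spectrum.\<close>
  have "frac R Q \<zero> \<one> \<oplus>\<^bsub>loc_ring R Q\<^esub> frac R Q \<zero> \<one> = frac R Q \<zero> \<one>" if Q: "Q \<in> ?D" for Q
  proof -
    interpret L: loc_at_prime R Q by (rule locI[OF R inP(1)[OF Q]])
    show ?thesis using L.loc_add[of \<zero> \<zero> \<one> \<one>] L.one_notin by simp
  qed
  then have "?z \<oplus>\<^bsub>sec (Spec R) ?D\<^esub> ?z = ?z" by (simp add: Spec_simps[OF R] cong: restrict_cong)
  moreover have z: "?z \<in> sct (Spec R) ?D" using pow_mem[of n] eq by simp
  ultimately have zz: "co \<phi> ?D ?z \<oplus>\<^bsub>sec X ?V\<^esub> co \<phi> ?D ?z = co \<phi> ?D ?z"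
    using ring_hom_add[OF co_\<phi>_hom[OF D] z z] by simp
  have zc: "co \<phi> ?D ?z \<in> sct X ?V" using ring_hom_closed[OF co_\<phi>_hom[OF D] z] .
  interpret S: cring "sec X ?V" by (rule ringed_space_cring[OF X V(1)])
  have "co \<phi> ?D ?z = \<zero>\<^bsub>sec X ?V\<^esub>" using zz zc S.add.l_cancel_one by blast
  then have "res X W ?V a [^]\<^bsub>sec X ?V\<^esub> n = \<zero>\<^bsub>sec X ?V\<^esub>" using pow[of n] eq by simp
  then show ?thesis using V by (intro exI[of _ ?V] exI[of _ n] conjI)
qed

text \<open>A germ is determined by the numerator and the denominator of a local fraction; this bounds the
  cardinality of the residue field.\<close>

lemma stalk_inj_prod:
  assumes x: "x \<in> U0"
  shows "\<exists>e :: ('p set \<times> 's) set \<Rightarrow> 's \<times> 's. inj_on e (carrier (stalk X x))"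
proof -
  \<comment> \<open>The open set, the section and \<open>h\<close> are hidden behind existential
    quantifiers because the pair of \<open>c\<close> and \<open>f\<close> alone must determine the
    germ.\<close>
  define rep where "rep \<alpha> c f \<longleftrightarrow> (\<exists>V s h. opn X V \<and> V \<subseteq> U0 \<and> x \<in> V \<and> s \<in> sct X V \<and> \<alpha> = germ X x V s \<and> h \<in> carrier R \<and>
    h \<notin> pmap \<phi> x \<and> Dopen R h \<subseteq> back V \<and> (\<forall>Q\<in>Dopen R h. co \<psi> V s Q = frac R Q c f))" for \<alpha> c f
  have ex: "\<exists>p. rep \<alpha> (fst p) (snd p)" if \<alpha>: "\<alpha> \<in> carrier (stalk X x)" for \<alpha>
  proof -
    obtain V s where V: "opn X V" "x \<in> V" "s \<in> sct X V" "\<alpha> = germ X x V s" using stalk_carrierE[OF X \<alpha>] .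
    let ?V = "V \<inter> U0" and ?s = "res X V (V \<inter> U0) s"
    have V': "opn X ?V" "?V \<subseteq> U0" "x \<in> ?V" "?V \<subseteq> V" using V U0 x by auto
    have s': "?s \<in> sct X ?V" by (rule ringed_space_res[OF X V(1) V'(1,4) V(3)])
    obtain c f h where h: "c \<in> carrier R" "f \<in> carrier R" "h \<in> carrier R" "h \<notin> pmap \<phi> x" "Dopen R h \<subseteq> back ?V"
      and fr: "\<forall>Q\<in>Dopen R h. f \<notin> Q \<and> co \<psi> ?V ?s Q = frac R Q c f" using local_fraction[OF V'(1,2) s' V'(3)] .
    have "\<forall>Q\<in>Dopen R h. co \<psi> ?V ?s Q = frac R Q c f" using fr by simp
    moreover have "\<alpha> = germ X x ?V ?s" using germ_res[OF X V(1) V'(1,4,3) V(3)] V(4) by simp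
    ultimately have "rep \<alpha> c f" unfolding rep_def using V' s' h(3-5)
      by (intro exI[of _ ?V] exI[of _ ?s] exI[of _ h] conjI)
    then show ?thesis by (intro exI[of _ "(c, f)"]) simp
  qed
  have inj: "\<alpha> = \<beta>" if a: "rep \<alpha> c f" and b: "rep \<beta> c f" for \<alpha> \<beta> c f
  proof -
    obtain V s h where V: "opn X V" "V \<subseteq> U0" "x \<in> V" "s \<in> sct X V" "\<alpha> = germ X x V s" "h \<in> carrier R"
      "h \<notin> pmap \<phi> x" "Dopen R h \<subseteq> back V" "\<forall>Q\<in>Dopen R h. co \<psi> V s Q = frac R Q c f"
      using a unfolding rep_def by (elim exE conjE)
    obtain W t k where W: "opn X W" "W \<subseteq> U0" "x \<in> W" "t \<in> sct X W" "\<beta> = germ X x W t" "k \<in> carrier R"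
      "k \<notin> pmap \<phi> x" "Dopen R k \<subseteq> back W" "\<forall>Q\<in>Dopen R k. co \<psi> W t Q = frac R Q c f"
      using b unfolding rep_def by (elim exE conjE)
    \<comment> \<open>Two germs with the same numerator and denominator may be represented on
      different neighbourhoods; both local fractions are valid on this common one.\<close>
    let ?E = "Dopen R (h \<otimes> k)"
    note mult_iff = Dopen_mult_iff[OF R W(6) V(6)]
    have E: "opn (Spec R) ?E" by (rule Dopen_open[OF R ring.ring_simprules(5)[OF cring.axioms(1)[OF R] V(6) W(6)]])
    have Eh: "?E \<subseteq> Dopen R h" and Ek: "?E \<subseteq> Dopen R k"
      unfolding subset_iff mult_iff Dopen_iff[OF R, of _ h] Dopen_iff[OF R, of _ k] by blast+
    have EV: "?E \<subseteq> back V" and EW: "?E \<subseteq> back W" using Eh Ek V(8) W(8) by blast+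
    have "restrict (co \<psi> V s) ?E = restrict (co \<psi> W t) ?E"
    proof (rule restrict_ext)
      fix Q assume "Q \<in> ?E"
      then show "co \<psi> V s Q = co \<psi> W t Q" using bspec[OF V(9) subsetD[OF Eh]] bspec[OF W(9) subsetD[OF Ek]] by simp
    qed
    then have "res X V (fore ?E) s = res X W (fore ?E) t"
      using co_\<phi>_restrict[OF V(1,2,4) E EV] co_\<phi>_restrict[OF W(1,2,4) E EW] by simp
    moreover have "pmap \<phi> x \<in> ?E" unfolding mult_iff using \<phi>_prime[OF x] V(7) W(7) by simp
    then have "x \<in> fore ?E" using x by (simp add: mem_fore)
    ultimately show ?thesis unfolding V(5) W(5)
      by (intro germ_eqI[OF X V(1,4) W(1,4) fore_open[OF E] _ fore_sub[OF EV] fore_sub[OF EW]])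
  qed
  define e where "e \<alpha> = (SOME p. rep \<alpha> (fst p) (snd p))" for \<alpha>
  have "inj_on e (carrier (stalk X x))"
  proof (rule inj_onI)
    fix \<alpha> \<beta> assume h: "\<alpha> \<in> carrier (stalk X x)" "\<beta> \<in> carrier (stalk X x)" "e \<alpha> = e \<beta>"
    have "rep \<alpha> (fst (e \<alpha>)) (snd (e \<alpha>))" unfolding e_def by (rule someI_ex[OF ex[OF h(1)]])
    moreover have "rep \<beta> (fst (e \<beta>)) (snd (e \<beta>))" unfolding e_def by (rule someI_ex[OF ex[OF h(2)]])
    ultimately show "\<alpha> = \<beta>" using inj h(3) by simp
  qed
  then show ?thesis by (rule exI[of _ e])
qed

end

lemma scheme_chart:
  assumes X: "scheme X" and x: "x \<in> pts X"
  obtains U0 R \<phi> \<psi> where "affine_chart X U0 R \<phi> \<psi>" "x \<in> U0"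
proof -
  obtain U0 where U0: "affine_open X U0" "x \<in> U0" using assms by (auto simp: scheme_def)
  then obtain R :: "'b ring" where "cring R" "risomorphic (restr X U0) (Spec R)" by (auto simp: affine_open_def affine_scheme_def)
  then obtain f g where "f \<in> rmaps (restr X U0) (Spec R)" "g \<in> rmaps (Spec R) (restr X U0)"
    "rcomp (restr X U0) (Spec R) (restr X U0) g f = rid (restr X U0)" "rcomp (Spec R) (restr X U0) (Spec R) f g = rid (Spec R)"
    by (auto simp: risomorphic_def)
  then have "affine_chart X U0 R f g"
    using U0(1) scheme_ringed_space[OF X] \<open>cring R\<close> by (intro affine_chart.intro) (auto simp: affine_open_def)
  then show ?thesis using that U0(2) by blast
qed

section \<open>One-point schemes\<close>

text \<open>The spectrum of a field up to its encoding. The only section \<open>z\<close> over the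
  empty set is a parameter, since it is the undefined function for \<open>Spec\<close> and the zero
  of the field for \<open>field_scheme\<close>.\<close>

locale onepoint =
  fixes X :: "('p, 's) rspace" and x0 :: 'p and z :: 's
  assumes opn_iff: "opn X U \<longleftrightarrow> U = {} \<or> U = {x0}"
    and K: "field (sec X {x0})"
    and Z: "sct X {} = {z}" "z \<otimes>\<^bsub>sec X {}\<^esub> z = z" "z \<oplus>\<^bsub>sec X {}\<^esub> z = z" "\<one>\<^bsub>sec X {}\<^esub> = z" "\<zero>\<^bsub>sec X {}\<^esub> = z"
    and res0: "opn X U \<Longrightarrow> s \<in> sct X U \<Longrightarrow> res X U {} s = z"
    and res1: "s \<in> sct X {x0} \<Longrightarrow> res X {x0} {x0} s = s"
begin

sublocale K: field "sec X {x0}" by (rule K)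

lemma pts_eq: "pts X = {x0}"
  using opn_iff[of "pts X"] opn_iff[of "{x0}"] opn_subset[of X "{x0}"] by auto

lemma cring_empty: "cring (sec X {})"
proof (rule cringI)
  show "abelian_group (sec X {})" by (rule abelian_groupI) (simp_all add: Z)
  show "Group.comm_monoid (sec X {})" by (rule comm_monoidI) (simp_all add: Z)
qed (simp add: Z)

lemma ringed: "ringed_space X"
  unfolding ringed_space_def
proof (intro conjI allI impI ballI)
  show "cring (sec X U)" if "opn X U" for U
    using that cring_empty K.is_cring by (auto simp: opn_iff)
  show "res X U V \<in> ring_hom (sec X U) (sec X V)" if h: "opn X U \<and> opn X V \<and> V \<subseteq> U" for U V
  proof (cases "V = {}")
    case True
    have "\<one>\<^bsub>sec X U\<^esub> \<in> sct X U" "\<And>x y. x \<in> sct X U \<Longrightarrow> y \<in> sct X U \<Longrightarrow> x \<otimes>\<^bsub>sec X U\<^esub> y \<in> sct X U \<and> x \<oplus>\<^bsub>sec X U\<^esub> y \<in> sct X U"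
      using h Z by (auto simp: opn_iff)
    then show ?thesis using res0[of U] h Z True by (intro ring_hom_memI) simp_all
  next
    case False
    then have "U = {x0}" "V = {x0}" using h by (auto simp: opn_iff)
    then show ?thesis using res1 by (intro ring_hom_memI) simp_all
  qed
  show r: "res X U U s = s" if "opn X U" "s \<in> sct X U" for U s
    using that res0[of "{}" s] res1[of s] Z by (auto simp: opn_iff)
  show "res X V W (res X U V s) = res X U W s" if h: "opn X U \<and> opn X V \<and> opn X W \<and> W \<subseteq> V \<and> V \<subseteq> U" and s: "s \<in> sct X U" for U V W s
  proof (cases "W = {}")
    case True
    have "V = {} \<or> V = {x0} \<and> U = {x0}" using h by (auto simp: opn_iff)
    then have "res X U V s \<in> sct X V" using res0[of U s] res1[of s] s Z h by auto
    then show ?thesis using res0 h s True by simp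
  next
    case False
    then have "U = {x0}" "V = {x0}" "W = {x0}" using h by (auto simp: opn_iff)
    then show ?thesis using res1 s by simp
  qed
  fix \<U> \<sigma>
  assume h: "(\<forall>U\<in>\<U>. opn X U \<and> \<sigma> U \<in> sct X U) \<and> (\<forall>U\<in>\<U>. \<forall>V\<in>\<U>. res X U (U \<inter> V) (\<sigma> U) = res X V (U \<inter> V) (\<sigma> V))"
  then have sub: "U \<in> \<U> \<Longrightarrow> U = {} \<or> U = {x0}" and sec: "U \<in> \<U> \<Longrightarrow> \<sigma> U \<in> sct X U" for U by (auto simp: opn_iff)
  show "\<exists>!s. s \<in> sct X (\<Union>\<U>) \<and> (\<forall>U\<in>\<U>. res X (\<Union>\<U>) U s = \<sigma> U)"
  \<comment> \<open>A family of open sets of a point either contains the whole space, whose section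
    is then the glued one, or has empty union, over which there is exactly one section.\<close>
  proof (cases "{x0} \<in> \<U>")
    case True
    have e: "\<Union>\<U> = {x0}" using True sub by blast
    have "res X {x0} U (\<sigma> {x0}) = \<sigma> U" if "U \<in> \<U>" for U
      using sub[OF that] sec[OF that] sec[OF True] res1[of "\<sigma> {x0}"] res0[of "{x0}" "\<sigma> {x0}"] Z(1) by (auto simp: opn_iff)
    then show ?thesis unfolding e
      using True sec[OF True] res1 by (intro ex1I[of _ "\<sigma> {x0}"]) auto
  next
    case False
    have e: "\<Union>\<U> = {}" using False sub by blast
    have "res X {} U z = \<sigma> U" if "U \<in> \<U>" for U
    proof -
      have "U = {}" using e that by blast
      then show ?thesis using sec[OF that] res0[of "{}" z] Z(1) by (simp add: opn_iff)
    qed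
    then show ?thesis unfolding e using Z(1) by auto
  qed
qed

lemma opn_x0: "opn X {x0}" by (simp add: opn_iff)

lemma germ_unit: "s \<in> sct X {x0} \<Longrightarrow> germ X x0 {x0} s \<in> Units (stalk X x0) \<longleftrightarrow> s \<noteq> \<zero>\<^bsub>sec X {x0}\<^esub>"
proof -
  assume s: "s \<in> sct X {x0}"
  have "(\<exists>V. opn X V \<and> x0 \<in> V \<and> V \<subseteq> {x0} \<and> res X {x0} V s \<in> Units (sec X V)) \<longleftrightarrow> s \<in> Units (sec X {x0})"
  proof
    assume "\<exists>V. opn X V \<and> x0 \<in> V \<and> V \<subseteq> {x0} \<and> res X {x0} V s \<in> Units (sec X V)"
    then obtain V where "x0 \<in> V" "V \<subseteq> {x0}" "res X {x0} V s \<in> Units (sec X V)" by blast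
    moreover from this have "V = {x0}" by blast
    ultimately show "s \<in> Units (sec X {x0})" using res1[OF s] by simp
  next
    assume "s \<in> Units (sec X {x0})"
    then show "\<exists>V. opn X V \<and> x0 \<in> V \<and> V \<subseteq> {x0} \<and> res X {x0} V s \<in> Units (sec X V)"
      using res1[OF s] opn_x0 by (intro exI[of _ "{x0}"]) simp
  qed
  then show ?thesis using germ_unit_iff[OF ringed opn_x0 _ s] K.field_Units s by simp
qed

lemma germ_inj: "s \<in> sct X {x0} \<Longrightarrow> t \<in> sct X {x0} \<Longrightarrow> germ X x0 {x0} s = germ X x0 {x0} t \<Longrightarrow> s = t"
proof -
  assume s: "s \<in> sct X {x0}" and t: "t \<in> sct X {x0}" and e: "germ X x0 {x0} s = germ X x0 {x0} t"
  obtain W where "opn X W" "x0 \<in> W" "res X {x0} W s = res X {x0} W t"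
    using germ_eqE[OF ringed opn_x0 _ t e] by auto
  then show ?thesis using res1 s t by (auto simp: opn_iff)
qed

lemma stalk_germ:
  assumes "\<alpha> \<in> carrier (stalk X x0)" obtains s where "s \<in> sct X {x0}" "\<alpha> = germ X x0 {x0} s"
proof -
  obtain U s where "opn X U" "x0 \<in> U" "s \<in> sct X U" "\<alpha> = germ X x0 U s" using stalk_carrierE[OF ringed assms] .
  then show ?thesis using that by (auto simp: opn_iff)
qed

lemma stalk_field: "field (stalk X x0)"
proof -
  interpret S: cring "stalk X x0" using stalk_cring[OF ringed, of x0] pts_eq by simp
  have "Units (stalk X x0) = carrier (stalk X x0) - {\<zero>\<^bsub>stalk X x0\<^esub>}"
  proof (rule Set.set_eqI)
    fix \<alpha>
    show "\<alpha> \<in> Units (stalk X x0) \<longleftrightarrow> \<alpha> \<in> carrier (stalk X x0) - {\<zero>\<^bsub>stalk X x0\<^esub>}"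
    proof (cases "\<alpha> \<in> carrier (stalk X x0)")
      case True
      then obtain s where s: "s \<in> sct X {x0}" "\<alpha> = germ X x0 {x0} s" by (rule stalk_germ)
      have "\<alpha> = \<zero>\<^bsub>stalk X x0\<^esub> \<longleftrightarrow> s = \<zero>\<^bsub>sec X {x0}\<^esub>"
        using germ_inj[OF s(1) K.zero_closed] stalk_zero[OF ringed opn_x0] s(2) by auto
      then show ?thesis using germ_unit[OF s(1)] True s(2) by simp
    qed (use S.Units_closed in blast)
  qed
  then show ?thesis by (rule S.cring_fieldI)
qed

lemma locally_ringed: "locally_ringed X"
proof -
  interpret S: field "stalk X x0" by (rule stalk_field)
  have "m = {\<zero>\<^bsub>stalk X x0\<^esub>}" if m: "maximalideal m (stalk X x0)" for m
    using S.all_ideals maximalideal.I_notcarr[OF m] maximalideal.axioms(1)[OF m] by blast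
  then have "\<exists>!m. maximalideal m (stalk X x0)" using S.zeromaximalideal by blast
  then show ?thesis using ringed pts_eq by (simp add: locally_ringed_def)
qed

text \<open>The usual morphism from the spectrum of a field to \<open>B\<close> with image
  \<open>b\<close>, attached to a homomorphism from the local ring at \<open>b\<close>. Over open
  sets missing \<open>b\<close> the value is the only section over the empty set.\<close>

definition point_map where
  "point_map B b h = \<lparr>pmap = (\<lambda>x\<in>pts X. b), co = (\<lambda>V. if opn B V
     then (\<lambda>s\<in>sct B V. if b \<in> V then h (germ B b V s) else z) else (\<lambda>_. undefined))\<rparr>"

lemma pre_point_map: "pre X (point_map B b h) V = (if b \<in> V then {x0} else {})"
  by (auto simp: pre_def point_map_def pts_eq)

lemma co_point_map: "opn B V \<Longrightarrow> s \<in> sct B V \<Longrightarrow> co (point_map B b h) V s = (if b \<in> V then h (germ B b V s) else z)"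
  by (simp add: point_map_def)

text \<open>The hypothesis \<open>loc\<close> is locality of \<open>h\<close> in the form suited to
  a field, where being a unit means being nonzero.\<close>

lemma point_map_rmaps:
  assumes B: "ringed_space B" and b: "b \<in> pts B" and h: "h \<in> ring_hom (stalk B b) (sec X {x0})"
    and loc: "\<And>\<alpha>. \<alpha> \<in> carrier (stalk B b) \<Longrightarrow> h \<alpha> \<noteq> \<zero>\<^bsub>sec X {x0}\<^esub> \<Longrightarrow> \<alpha> \<in> Units (stalk B b)"
  shows "point_map B b h \<in> rmaps X B"
proof (rule rmapsI)
  have "continuous_map (topo X) (topo B) (\<lambda>_. b)" using b by simp
  then show "continuous_map (topo X) (topo B) (pmap (point_map B b h))"
    by (rule continuous_map_eq) (simp add: point_map_def)
  show "pmap (point_map B b h) \<in> extensional (pts X)" by (simp add: point_map_def)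
next
  fix V assume V: "opn B V"
  show hom: "co (point_map B b h) V \<in> ring_hom (sec B V) (sec X (pre X (point_map B b h) V))"
  proof (cases "b \<in> V")
    case True
    have "restrict (h \<circ> germ B b V) (sct B V) \<in> ring_hom (sec B V) (sec X {x0})"
      by (rule restrict_ring_hom[OF ringed_space_ring[OF B V] ring_hom_trans[OF germ_hom[OF B V True] h]])
    then show ?thesis unfolding pre_point_map using True V by (simp add: point_map_def o_def)
  next
    case False
    then show ?thesis unfolding pre_point_map using V ring.ring_simprules[OF ringed_space_ring[OF B V]]
      by (intro ring_hom_memI) (simp_all add: point_map_def Z)
  qed
  show "co (point_map B b h) V \<in> extensional (sct B V)" using V by (simp add: point_map_def)
next
  fix V assume "\<not> opn B V" then show "co (point_map B b h) V = (\<lambda>_. undefined)" by (simp add: point_map_def)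
next
  fix V W s assume VW: "opn B V" "opn B W" "W \<subseteq> V" and s: "s \<in> sct B V"
  note s' = ringed_space_res[OF B VW s]
  show "co (point_map B b h) W (res B V W s) =
      res X (pre X (point_map B b h) V) (pre X (point_map B b h) W) (co (point_map B b h) V s)"
  proof (cases "b \<in> W")
    case True
    then have "b \<in> V" using VW by blast
    have "h (germ B b V s) \<in> sct X {x0}" using ring_hom_closed[OF h stalk_carrierI[OF B VW(1) \<open>b \<in> V\<close> s]] .
    then show ?thesis unfolding pre_point_map co_point_map[OF VW(1) s] co_point_map[OF VW(2) s']
      using True \<open>b \<in> V\<close> germ_res[OF B VW True s] res1 by simp
  next
    case False
    have "co (point_map B b h) V s \<in> sct X (pre X (point_map B b h) V)"
      unfolding pre_point_map co_point_map[OF VW(1) s]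
      using ring_hom_closed[OF h stalk_carrierI[OF B VW(1) _ s]] Z by simp
    then show ?thesis using False res0[of "pre X (point_map B b h) V"] unfolding co_point_map[OF VW(2) s']
      by (simp add: pre_point_map opn_iff)
  qed
next
  fix x V s assume x: "x \<in> pts X" and V: "opn B V" "pmap (point_map B b h) x \<in> V" and s: "s \<in> sct B V"
    and u: "germ X x (pre X (point_map B b h) V) (co (point_map B b h) V s) \<in> Units (stalk X x)"
  have b': "pmap (point_map B b h) x = b" using x by (simp add: point_map_def)
  have bV: "b \<in> V" using V(2) b' by simp
  have x': "x = x0" using x pts_eq by simp
  note c = stalk_carrierI[OF B V(1) bV s]
  have "germ X x0 {x0} (h (germ B b V s)) \<in> Units (stalk X x0)"
    using u co_point_map[OF V(1) s, of b h] pre_point_map[of B b h V] bV x' by simp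
  then have "h (germ B b V s) \<noteq> \<zero>\<^bsub>sec X {x0}\<^esub>" using germ_unit[OF ring_hom_closed[OF h c]] by simp
  from loc[OF c this] show "germ B (pmap (point_map B b h) x) V s \<in> Units (stalk B (pmap (point_map B b h) x))"
    unfolding b' .
qed

definition ungerm where "ungerm \<alpha> = (THE s. s \<in> sct X {x0} \<and> germ X x0 {x0} s = \<alpha>)"

lemma ungerm_germ:
  assumes s: "s \<in> sct X {x0}" shows "ungerm (germ X x0 {x0} s) = s"
  unfolding ungerm_def
proof (rule the_equality)
  fix t assume "t \<in> sct X {x0} \<and> germ X x0 {x0} t = germ X x0 {x0} s"
  then show "t = s" using germ_inj[of t s] s by simp
qed (simp add: s)

lemma ungerm_hom: "ungerm \<in> ring_hom (stalk X x0) (sec X {x0})"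
proof (rule ring_hom_memI)
  note x0 = singletonI[of x0]
  fix \<alpha> \<beta> assume "\<alpha> \<in> carrier (stalk X x0)" "\<beta> \<in> carrier (stalk X x0)"
  then obtain s t where s: "s \<in> sct X {x0}" "\<alpha> = germ X x0 {x0} s" and t: "t \<in> sct X {x0}" "\<beta> = germ X x0 {x0} t"
    by (elim stalk_germ)
  show "ungerm (\<alpha> \<otimes>\<^bsub>stalk X x0\<^esub> \<beta>) = ungerm \<alpha> \<otimes>\<^bsub>sec X {x0}\<^esub> ungerm \<beta>"
    "ungerm (\<alpha> \<oplus>\<^bsub>stalk X x0\<^esub> \<beta>) = ungerm \<alpha> \<oplus>\<^bsub>sec X {x0}\<^esub> ungerm \<beta>"
    unfolding s(2) t(2) stalk_mult[OF ringed opn_x0 x0 s(1) t(1)] stalk_add[OF ringed opn_x0 x0 s(1) t(1)]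
    using s(1) t(1) by (simp_all add: ungerm_germ)
next
  fix \<alpha> assume "\<alpha> \<in> carrier (stalk X x0)"
  then show "ungerm \<alpha> \<in> sct X {x0}" by (rule stalk_germ) (simp add: ungerm_germ)
next
  show "ungerm \<one>\<^bsub>stalk X x0\<^esub> = \<one>\<^bsub>sec X {x0}\<^esub>"
    unfolding stalk_one[OF ringed opn_x0 singletonI] by (rule ungerm_germ) simp
qed

end

section \<open>Comparison of one-point schemes\<close>

lemma onepoint_hom_map:
  assumes X: "onepoint X x0 z" and Y: "onepoint Y y0 w" and \<theta>: "\<theta> \<in> ring_hom (sec Y {y0}) (sec X {x0})"
  shows "\<exists>f \<in> rmaps X Y. pmap f x0 = y0 \<and> (\<forall>s \<in> sct Y {y0}. co f {y0} s = \<theta> s) \<and> (\<forall>s \<in> sct Y {}. co f {} s = z)"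
proof -
  interpret X: onepoint X x0 z by (rule X)
  interpret Y: onepoint Y y0 w by (rule Y)
  let ?h = "\<theta> \<circ> Y.ungerm"
  have h: "?h \<in> ring_hom (stalk Y y0) (sec X {x0})" by (rule ring_hom_trans[OF Y.ungerm_hom \<theta>])
  have "X.point_map Y y0 ?h \<in> rmaps X Y"
  proof (rule X.point_map_rmaps[OF Y.ringed _ h])
    show "y0 \<in> pts Y" using Y.pts_eq by simp
    fix \<alpha> assume a: "\<alpha> \<in> carrier (stalk Y y0)" "?h \<alpha> \<noteq> \<zero>\<^bsub>sec X {x0}\<^esub>"
    obtain s where s: "s \<in> sct Y {y0}" "\<alpha> = germ Y y0 {y0} s" using Y.stalk_germ[OF a(1)] .
    have "s \<noteq> \<zero>\<^bsub>sec Y {y0}\<^esub>"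
      using a(2) s Y.ungerm_germ[OF s(1)] ring_hom_zero[OF \<theta> Y.K.ring_axioms X.K.ring_axioms] by auto
    then show "\<alpha> \<in> Units (stalk Y y0)" using Y.germ_unit[OF s(1)] s(2) by simp
  qed
  moreover have "pmap (X.point_map Y y0 ?h) x0 = y0" by (simp add: X.point_map_def X.pts_eq)
  moreover have "co (X.point_map Y y0 ?h) {y0} s = \<theta> s" if "s \<in> sct Y {y0}" for s
    using X.co_point_map[OF Y.opn_x0 that, of y0 ?h] Y.ungerm_germ[OF that] by simp
  moreover have "co (X.point_map Y y0 ?h) {} s = z" if "s \<in> sct Y {}" for s
    using X.co_point_map[of Y "{}" s y0 ?h] that by simp
  ultimately show ?thesis by blast
qed

lemma onepoint_iso_id:
  assumes X: "onepoint X x0 z" and Y: "onepoint Y y0 w" and f: "f \<in> rmaps X Y" and g: "g \<in> rmaps Y X"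
    and p: "pmap f x0 = y0" "pmap g y0 = x0" and f0: "\<forall>s \<in> sct Y {}. co f {} s = z" and g0: "\<forall>s \<in> sct X {}. co g {} s = w"
    and fg: "\<And>s. s \<in> sct X {x0} \<Longrightarrow> co f {y0} (co g {x0} s) = s"
  shows "rcomp X Y X g f = rid X"
proof -
  interpret X: onepoint X x0 z by (rule X)
  interpret Y: onepoint Y y0 w by (rule Y)
  show ?thesis
  proof (rule rmaps_eqI[OF rcomp_rmaps[OF f g X.ringed] rid_rmaps[OF X.ringed]])
    show "pmap (rcomp X Y X g f) x = pmap (rid X) x" if "x \<in> pts X" for x
      using that p by (simp add: rcomp_def rid_def X.pts_eq)
    fix V s assume V: "opn X V" and s: "s \<in> sct X V"
    have pre: "pre Y g {} = {}" "pre Y g {x0} = {y0}" using p Y.pts_eq by (auto simp: pre_def)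
    show "co (rcomp X Y X g f) V s = co (rid X) V s"
    proof (cases "V = {}")
      case True
      then show ?thesis using V s f0 g0 X.Z Y.Z pre by (simp add: rcomp_def rid_def)
    next
      case False
      then have "V = {x0}" using V by (simp add: X.opn_iff)
      then show ?thesis using V s fg pre by (simp add: rcomp_def rid_def)
    qed
  qed
qed

text \<open>The two spaces may have different types of points and sections. This is how a copy of
  the spectrum of a field is recognized as affine.\<close>

lemma onepoint_risomorphic:
  assumes X: "onepoint X x0 z" and Y: "onepoint Y y0 w" and \<theta>: "\<theta> \<in> ring_iso (sec Y {y0}) (sec X {x0})"
  shows "risomorphic X Y"
proof -
  interpret X: onepoint X x0 z by (rule X)
  interpret Y: onepoint Y y0 w by (rule Y)
  let ?\<eta> = "inv_into (sct Y {y0}) \<theta>"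
  have \<eta>: "?\<eta> \<in> ring_iso (sec X {x0}) (sec Y {y0})" by (rule ring_iso_set_sym[OF Y.K.ring_axioms \<theta>])
  have bij: "bij_betw \<theta> (sct Y {y0}) (sct X {x0})" and \<theta>h: "\<theta> \<in> ring_hom (sec Y {y0}) (sec X {x0})" and \<eta>h: "?\<eta> \<in> ring_hom (sec X {x0}) (sec Y {y0})"
    using \<theta> \<eta> by (auto simp: ring_iso_def)
  obtain f where f: "f \<in> rmaps X Y" "pmap f x0 = y0" "\<forall>s \<in> sct Y {y0}. co f {y0} s = \<theta> s" "\<forall>s \<in> sct Y {}. co f {} s = z"
    using onepoint_hom_map[OF X Y \<theta>h] by blast
  obtain g where g: "g \<in> rmaps Y X" "pmap g y0 = x0" "\<forall>s \<in> sct X {x0}. co g {x0} s = ?\<eta> s" "\<forall>s \<in> sct X {}. co g {} s = w"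
    using onepoint_hom_map[OF Y X \<eta>h] by blast
  have 1: "co f {y0} (co g {x0} s) = s" if "s \<in> sct X {x0}" for s
    using that f(3) g(3) ring_hom_closed[OF \<eta>h that] bij_betw_inv_into_right[OF bij that] by simp
  have 2: "co g {x0} (co f {y0} s) = s" if "s \<in> sct Y {y0}" for s
    using that f(3) g(3) ring_hom_closed[OF \<theta>h that] bij_betw_inv_into_left[OF bij that] by simp
  have "rcomp X Y X g f = rid X" by (rule onepoint_iso_id[OF X Y f(1) g(1) f(2) g(2) f(4) g(4) 1])
  moreover have "rcomp Y X Y f g = rid Y" by (rule onepoint_iso_id[OF Y X g(1) f(1) g(2) f(2) g(4) f(4) 2])
  ultimately show ?thesis unfolding risomorphic_def using f(1) g(1) by blast
qed

lemma Spec_field_onepoint: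
  fixes k :: "'s ring"
  assumes k: "field k"
  shows "onepoint (Spec k) {\<zero>\<^bsub>k\<^esub>} (\<lambda>_. undefined)"
    "(\<lambda>a. \<lambda>P\<in>{{\<zero>\<^bsub>k\<^esub>}}. frac k P a \<one>\<^bsub>k\<^esub>) \<in> ring_iso k (sec (Spec k) {{\<zero>\<^bsub>k\<^esub>}})"
proof -
  interpret k: field k by (rule k)
  note R = k.is_cring
  let ?P = "{\<zero>\<^bsub>k\<^esub>}"
  let ?\<theta> = "\<lambda>a. \<lambda>P\<in>{?P}. frac k P a \<one>\<^bsub>k\<^esub>"
  have prime: "primeideal P k \<longleftrightarrow> P = ?P" for P
    using k.zeroprimeideal k.all_ideals primeideal.I_notcarr primeideal.axioms(1) by blast
  interpret L: loc_at_prime k ?P by (rule locI[OF R k.zeroprimeideal])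
  have opn: "opn (Spec k) U \<longleftrightarrow> U = {} \<or> U = {?P}" for U
  proof -
    have "opn (Spec k) {?P}" using openin_topspace[of "topo (Spec k)"] by (simp add: Spec_pts[OF R] prime)
    moreover have "U \<subseteq> {?P}" if "opn (Spec k) U" using opn_subset[OF that] by (simp add: Spec_pts[OF R] prime)
    ultimately show ?thesis by auto
  qed
  have one: "\<one>\<^bsub>k\<^esub> \<in> carrier k - ?P" by simp
  have sec: "?\<theta> a \<in> sct (Spec k) {?P}" if "a \<in> carrier k" for a
    by (rule Spec_section[OF R]) (use that opn in auto)
  have inj: "a = b" if ab: "a \<in> carrier k" "b \<in> carrier k" "?\<theta> a = ?\<theta> b" for a b
  proof -
    have "frac k ?P a \<one>\<^bsub>k\<^esub> = frac k ?P b \<one>\<^bsub>k\<^esub>" using fun_cong[OF ab(3), of ?P] by simp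
    then obtain h where "h \<in> carrier k - ?P" "h \<otimes>\<^bsub>k\<^esub> (a \<otimes>\<^bsub>k\<^esub> \<one>\<^bsub>k\<^esub>) = h \<otimes>\<^bsub>k\<^esub> (b \<otimes>\<^bsub>k\<^esub> \<one>\<^bsub>k\<^esub>)"
      using L.frac_eqE[OF ab(2) one] by blast
    then show ?thesis using k.m_lcancel[of h a b] ab by simp
  qed
  have surj: "\<exists>a\<in>carrier k. \<sigma> = ?\<theta> a" if \<sigma>: "\<sigma> \<in> sct (Spec k) {?P}" for \<sigma>
  proof -
    from Spec_sectionE[OF R \<sigma> singletonI] obtain c f h where h: "c \<in> carrier k" "f \<in> carrier k" "h \<in> carrier k" "h \<notin> ?P"
      and fr: "\<forall>Q\<in>Dopen k h. Q \<in> {?P} \<and> f \<notin> Q \<and> \<sigma> Q = frac k Q c f" .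
    have "?P \<in> Dopen k h" using h(4) by (simp add: Dopen_def prime)
    from bspec[OF fr this] have f: "f \<in> carrier k - ?P" and s: "\<sigma> ?P = frac k ?P c f" using h(2) by auto
    then have u: "f \<in> Units k" using k.field_Units by simp
    define a where "a = c \<otimes>\<^bsub>k\<^esub> inv\<^bsub>k\<^esub> f"
    have a: "a \<in> carrier k" using h(1) u by (simp add: a_def)
    have "frac k ?P c f = frac k ?P a \<one>\<^bsub>k\<^esub>"
    proof (rule L.frac_eqI[OF h(1) a f one one])
      show "\<one>\<^bsub>k\<^esub> \<otimes>\<^bsub>k\<^esub> (c \<otimes>\<^bsub>k\<^esub> \<one>\<^bsub>k\<^esub>) = \<one>\<^bsub>k\<^esub> \<otimes>\<^bsub>k\<^esub> (a \<otimes>\<^bsub>k\<^esub> f)"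
        using h(1,2) u by (simp add: a_def k.m_assoc)
    qed
    then have "\<sigma> = ?\<theta> a" using s Spec_section_ext[OF R \<sigma>] by (intro extensionalityI[of _ "{?P}"]) auto
    then show ?thesis using a by blast
  qed
  show iso: "?\<theta> \<in> ring_iso k (sec (Spec k) {?P})"
  proof (rule ring_iso_memI)
    fix a b assume ab: "a \<in> carrier k" "b \<in> carrier k"
    have "frac k ?P (a \<otimes>\<^bsub>k\<^esub> b) \<one>\<^bsub>k\<^esub> = frac k ?P a \<one>\<^bsub>k\<^esub> \<otimes>\<^bsub>loc_ring k ?P\<^esub> frac k ?P b \<one>\<^bsub>k\<^esub>"
      "frac k ?P (a \<oplus>\<^bsub>k\<^esub> b) \<one>\<^bsub>k\<^esub> = frac k ?P a \<one>\<^bsub>k\<^esub> \<oplus>\<^bsub>loc_ring k ?P\<^esub> frac k ?P b \<one>\<^bsub>k\<^esub>"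
      using L.loc_mult[OF ab one one] L.loc_add[OF ab one one] ab by simp_all
    then show "?\<theta> (a \<otimes>\<^bsub>k\<^esub> b) = ?\<theta> a \<otimes>\<^bsub>sec (Spec k) {?P}\<^esub> ?\<theta> b" "?\<theta> (a \<oplus>\<^bsub>k\<^esub> b) = ?\<theta> a \<oplus>\<^bsub>sec (Spec k) {?P}\<^esub> ?\<theta> b"
      by (simp_all add: Spec_simps[OF R] restrict_def fun_eq_iff)
  next
    show "bij_betw ?\<theta> (carrier k) (sct (Spec k) {?P})"
      unfolding bij_betw_def using inj surj sec by (blast intro: inj_onI)
  qed (simp_all add: sec Spec_simps[OF R])
  show "onepoint (Spec k) ?P (\<lambda>_. undefined)"
  proof (rule onepoint.intro)
    show "opn (Spec k) U \<longleftrightarrow> U = {} \<or> U = {?P}" for U by (rule opn)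
    \<comment> \<open>Transport of the field structure along an isomorphism yields the target ring
      with its constants replaced by images; these equations show that the replacement changes
      nothing.\<close>
    have "?\<theta> \<one>\<^bsub>k\<^esub> = \<one>\<^bsub>sec (Spec k) {?P}\<^esub>" "?\<theta> \<zero>\<^bsub>k\<^esub> = \<zero>\<^bsub>sec (Spec k) {?P}\<^esub>"
      by (simp_all add: Spec_simps[OF R])
    then show "field (sec (Spec k) {?P})" using k.ring_iso_imp_img_field[OF iso] by simp
    show "sct (Spec k) {} = {\<lambda>_. undefined}" by (simp add: Spec_def)
    show "s \<in> sct (Spec k) {?P} \<Longrightarrow> res (Spec k) {?P} {?P} s = s" for s
      using Spec_section_ext[OF R, of s "{?P}"] by (simp add: Spec_simps[OF R] extensional_restrict)
  qed (simp_all add: Spec_simps[OF R] fun_eq_iff)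
qed

text \<open>Points and sections of \<open>Spec k\<close> have other types than \<open>'u\<close>, so
  it cannot be inserted into the cartesian square. This copy has both in \<open>'u\<close>; the zero
  of \<open>k\<close> serves as the point because it is an element at hand.\<close>

definition field_scheme :: "'u ring \<Rightarrow> 'u sch" where
  "field_scheme k = \<lparr>topo = discrete_topology {\<zero>\<^bsub>k\<^esub>},
     sec = (\<lambda>V. if V = {} then k\<lparr>carrier := {\<zero>\<^bsub>k\<^esub>}, one := \<zero>\<^bsub>k\<^esub>\<rparr> else k),
     res = (\<lambda>U V s. if V = {} then \<zero>\<^bsub>k\<^esub> else s)\<rparr>"

lemma field_scheme_onepoint:
  assumes k: "field k" shows "onepoint (field_scheme k) \<zero>\<^bsub>k\<^esub> \<zero>\<^bsub>k\<^esub>"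
proof -
  interpret k: field k by (rule k)
  show ?thesis
    by (rule onepoint.intro) (auto simp: field_scheme_def k.field_axioms)
qed

lemma field_scheme_scheme:
  assumes k: "field k" shows "scheme (field_scheme k)"
proof -
  interpret T: onepoint "field_scheme k" "\<zero>\<^bsub>k\<^esub>" "\<zero>\<^bsub>k\<^esub>" by (rule field_scheme_onepoint[OF k])
  have "restr (field_scheme k) {\<zero>\<^bsub>k\<^esub>} = field_scheme k"
    using T.pts_eq subtopology_topspace[of "topo (field_scheme k)"] by (simp add: restr_def)
  moreover have "sec (field_scheme k) {\<zero>\<^bsub>k\<^esub>} = k" by (simp add: field_scheme_def)
  then have "risomorphic (Spec k) (field_scheme k)"
    using onepoint_risomorphic[OF Spec_field_onepoint(1)[OF k] field_scheme_onepoint[OF k]] Spec_field_onepoint(2)[OF k] by simp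
  then have "risomorphic (field_scheme k) (Spec k)" unfolding risomorphic_def by blast
  ultimately have "affine_open (field_scheme k) {\<zero>\<^bsub>k\<^esub>}"
    unfolding affine_open_def affine_scheme_def using T.opn_x0 fieldE(1)[OF k] by auto
  then show ?thesis unfolding scheme_def using T.locally_ringed T.pts_eq by auto
qed

lemma inj_prod_infinite: "\<exists>f :: ('u::infinite) \<times> 'u \<Rightarrow> 'u. inj f"
proof -
  have "|UNIV :: ('u \<times> 'u) set| \<le>o |UNIV :: 'u set|"
    using card_of_Times_same_infinite[OF infinite_UNIV[where 'a = 'u]] unfolding UNIV_Times_UNIV by (rule ordIso_imp_ordLeq)
  then have "\<exists>f :: 'u \<times> 'u \<Rightarrow> 'u. inj f \<and> range f \<subseteq> UNIV" by (rule card_of_ordLeq[THEN iffD2])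
  then show ?thesis by (elim exE conjE) (rule exI)
qed

text \<open>The residue field at \<open>b\<close> fits into \<open>'u\<close>: representatives embed
  it into the stalk, a germ is determined by two elements of \<open>'u\<close>, and pairs of
  elements of the infinite type \<open>'u\<close> inject into \<open>'u\<close>. Its structure is
  transported along this injection.\<close>

lemma residue_field_point:
  fixes B :: "('u::infinite) sch"
  assumes B: "scheme B" and b: "b \<in> pts B"
  shows "\<exists>(T :: 'u sch) a t. scheme T \<and> a \<in> rmaps T B \<and> pts T = {t} \<and> pmap a t = b"
proof -
  have lB: "locally_ringed B" using B by (simp add: scheme_def)
  have rB: "ringed_space B" by (rule scheme_ringed_space[OF B])
  let ?S = "stalk B b"
  obtain m where m: "maximalideal m ?S" and unit: "\<And>a. a \<in> carrier ?S \<Longrightarrow> a \<notin> Units ?S \<longleftrightarrow> a \<in> m"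
    using locally_ringedD[OF lB b] by metis
  interpret S: cring ?S by (rule stalk_cring[OF rB b])
  interpret m: maximalideal m ?S by (rule m)
  let ?\<kappa> = "?S Quot m"
  have \<kappa>: "field ?\<kappa>" by (rule m.quotient_is_field[OF S.is_cring])
  obtain U0 R \<phi> \<psi> where ch: "affine_chart B U0 R \<phi> \<psi>" "b \<in> U0" using scheme_chart[OF B b] .
  obtain e1 :: "('u set \<times> 'u) set \<Rightarrow> 'u \<times> 'u" where e1: "inj_on e1 (carrier ?S)"
    using affine_chart.stalk_inj_prod[OF ch] by (rule exE)
  obtain e2 :: "'u \<times> 'u \<Rightarrow> 'u" where e2: "inj e2" using inj_prod_infinite by (rule exE)
  let ?q = "\<lambda>\<alpha>. m +>\<^bsub>?S\<^esub> \<alpha>"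
  have \<kappa>c: "carrier ?\<kappa> = ?q ` carrier ?S" by (auto simp: FactRing_def A_RCOSETS_def')
  define rep where "rep C = inv_into (carrier ?S) ?q C" for C
  have rep: "inj_on rep (carrier ?\<kappa>)" unfolding rep_def \<kappa>c by (rule inj_on_inv_into) simp
  have "rep ` carrier ?\<kappa> \<subseteq> carrier ?S"
  proof clarify
    fix C assume "C \<in> carrier ?\<kappa>"
    then show "rep C \<in> carrier ?S" unfolding rep_def \<kappa>c by (rule inv_into_into)
  qed
  then have "inj_on (e1 \<circ> rep) (carrier ?\<kappa>)" by (rule comp_inj_on[OF rep inj_on_subset[OF e1]])
  then have e: "inj_on (e2 \<circ> (e1 \<circ> rep)) (carrier ?\<kappa>)" by (rule comp_inj_on[OF _ inj_on_subset[OF e2 subset_UNIV]])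
  define \<epsilon> where "\<epsilon> = e2 \<circ> (e1 \<circ> rep)"
  define k where "k = image_ring \<epsilon> ?\<kappa>"
  have k: "field k" unfolding k_def by (rule field.inj_imp_image_ring_is_field[OF \<kappa>]) (use e \<epsilon>_def in simp)
  have iso: "\<epsilon> \<in> ring_iso ?\<kappa> k" unfolding k_def by (rule inj_imp_image_ring_iso) (use e \<epsilon>_def in simp)
  then have \<epsilon>h: "\<epsilon> \<in> ring_hom ?\<kappa> k" and \<epsilon>b: "inj_on \<epsilon> (carrier ?\<kappa>)" by (auto simp: ring_iso_def bij_betw_def)
  have qh: "?q \<in> ring_hom ?S ?\<kappa>" by (rule m.rcos_ring_hom)
  have h: "\<epsilon> \<circ> ?q \<in> ring_hom ?S k" by (rule ring_hom_trans[OF qh \<epsilon>h])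
  interpret T: onepoint "field_scheme k" "\<zero>\<^bsub>k\<^esub>" "\<zero>\<^bsub>k\<^esub>" by (rule field_scheme_onepoint[OF k])
  have seck: "sec (field_scheme k) {\<zero>\<^bsub>k\<^esub>} = k" by (simp add: field_scheme_def)
  have loc: "\<alpha> \<in> Units ?S" if \<alpha>: "\<alpha> \<in> carrier ?S" "(\<epsilon> \<circ> ?q) \<alpha> \<noteq> \<zero>\<^bsub>k\<^esub>" for \<alpha>
  proof (rule ccontr)
    assume "\<alpha> \<notin> Units ?S"
    then have "\<alpha> \<in> m" using unit[OF \<alpha>(1)] by simp
    then have "?q \<alpha> = m" using abelian_subgroup.a_rcos_const[OF abelian_subgroupI3[OF m.is_additive_subgroup S.is_abelian_group]] by simp
    then have "?q \<alpha> = \<zero>\<^bsub>?\<kappa>\<^esub>" by (simp add: FactRing_def)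
    then show False using \<alpha>(2) ring_hom_zero[OF \<epsilon>h field.is_ring[OF \<kappa>] field.is_ring[OF k]] by simp
  qed
  have "T.point_map B b (\<epsilon> \<circ> ?q) \<in> rmaps (field_scheme k) B"
    by (rule T.point_map_rmaps[OF rB b]) (use h loc seck in simp_all)
  moreover have "pmap (T.point_map B b (\<epsilon> \<circ> ?q)) \<zero>\<^bsub>k\<^esub> = b" by (simp add: T.point_map_def T.pts_eq)
  ultimately show ?thesis using field_scheme_scheme[OF k] T.pts_eq by blast
qed

section \<open>Open immersions\<close>

lemma open_immersion_image:
  assumes j: "open_immersion U Y j" and V: "opn U V" shows "opn Y (pmap j ` V)"
proof -
  have "homeomorphic_map (topo U) (subtopology (topo Y) (pmap j ` pts U)) (pmap j)" and o: "opn Y (pmap j ` pts U)"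
    using j by (auto simp: open_immersion_def embedding_map_def)
  then have "openin (subtopology (topo Y) (pmap j ` pts U)) (pmap j ` V)"
    using homeomorphic_imp_open_map V by (auto simp: open_map_def)
  then show ?thesis using openin_trans_full o by blast
qed

lemma open_immersion_inj: "open_immersion U Y j \<Longrightarrow> inj_on (pmap j) (pts U)"
  by (auto simp: open_immersion_def embedding_map_def dest: homeomorphic_imp_injective_map)

lemma open_immersion_pre_image:
  assumes j: "open_immersion U Y j" and V: "V \<subseteq> pts U" shows "pre U j (pmap j ` V) = V"
  using open_immersion_inj[OF j] V by (auto simp: pre_def inj_on_def)

lemma open_immersion_bij:
  "open_immersion U Y j \<Longrightarrow> opn Y V \<Longrightarrow> V \<subseteq> pmap j ` pts U \<Longrightarrow> bij_betw (co j V) (sct Y V) (sct U (pre U j V))"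
  by (simp add: open_immersion_def)

lemma inv_into_ring_hom:
  assumes R: "ring R" and h: "h \<in> ring_hom R S" and b: "bij_betw h (carrier R) (carrier S)"
  shows "inv_into (carrier R) h \<in> ring_hom S R"
  using ring_iso_set_sym[OF R, of h S] h b by (auto simp: ring_iso_def)

text \<open>Points are lifted by the inverse of the injective point map. A section over
  \<open>V\<close> is moved to the image of \<open>V\<close> by inverting the bijection there, and
  then pulled back along \<open>g\<close>.\<close>

lemma open_immersion_factor:
  assumes U: "ringed_space U" and Y: "ringed_space Y" and T: "ringed_space T"
    and j: "j \<in> rmaps U Y" "open_immersion U Y j" and g: "g \<in> rmaps T Y" "pmap g ` pts T \<subseteq> pmap j ` pts U"
  shows "\<exists>b \<in> rmaps T U. rcomp T U Y j b = g"
proof -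
  let ?l = "\<lambda>V. inv_into (sct Y (pmap j ` V)) (co j (pmap j ` V))"
  define b where "b = \<lparr>pmap = (\<lambda>t\<in>pts T. inv_into (pts U) (pmap j) (pmap g t)),
    co = (\<lambda>V. if opn U V then (\<lambda>s\<in>sct U V. co g (pmap j ` V) (?l V s)) else (\<lambda>_. undefined))\<rparr>"
  have pb: "pmap b t \<in> pts U" "pmap j (pmap b t) = pmap g t" if "t \<in> pts T" for t
  proof -
    have "pmap g t \<in> pmap j ` pts U" using g(2) that by blast
    then show "pmap b t \<in> pts U" "pmap j (pmap b t) = pmap g t"
      using that by (simp_all add: b_def inv_into_into f_inv_into_f)
  qed
  have im: "opn Y (pmap j ` V)" "pmap j ` V \<subseteq> pmap j ` pts U" "pre U j (pmap j ` V) = V" if V: "opn U V" for V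
    using open_immersion_image[OF j(2) V] open_immersion_pre_image[OF j(2) opn_subset[OF V]] opn_subset[OF V] by auto
  have pre_b: "pre T b V = pre T g (pmap j ` V)" if V: "opn U V" for V
  proof -
    have "pmap b t \<in> V \<longleftrightarrow> pmap g t \<in> pmap j ` V" if t: "t \<in> pts T" for t
    proof
      assume "pmap b t \<in> V" then show "pmap g t \<in> pmap j ` V" using pb(2)[OF t] by (metis imageI)
    next
      assume "pmap g t \<in> pmap j ` V"
      then obtain v where v: "v \<in> V" "pmap j (pmap b t) = pmap j v" using pb(2)[OF t] by auto
      then have "pmap b t = v"
        using inj_onD[OF open_immersion_inj[OF j(2)] v(2) pb(1)[OF t]] opn_subset[OF V] by blast
      then show "pmap b t \<in> V" using v by simp
    qed
    then show ?thesis by (auto simp: pre_def)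
  qed
  have bij: "bij_betw (co j (pmap j ` V)) (sct Y (pmap j ` V)) (sct U V)" if V: "opn U V" for V
    using open_immersion_bij[OF j(2) im(1,2)[OF V]] im(3)[OF V] by simp
  have jhom: "co j (pmap j ` V) \<in> ring_hom (sec Y (pmap j ` V)) (sec U V)" if V: "opn U V" for V
    using rmaps_co_hom[OF j(1) im(1)[OF V]] im(3)[OF V] by simp
  have lhom: "?l V \<in> ring_hom (sec U V) (sec Y (pmap j ` V))" if V: "opn U V" for V
    by (rule inv_into_ring_hom[OF ringed_space_ring[OF Y im(1)[OF V]] jhom[OF V] bij[OF V]])
  have l: "?l V s \<in> sct Y (pmap j ` V)" "co j (pmap j ` V) (?l V s) = s" if V: "opn U V" and s: "s \<in> sct U V" for V s
    using ring_hom_closed[OF lhom[OF V] s] bij_betw_inv_into_right[OF bij[OF V] s] by auto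
  have l_eq: "?l V (co j (pmap j ` V) y) = y" if V: "opn U V" and y: "y \<in> sct Y (pmap j ` V)" for V y
    by (rule bij_betw_inv_into_left[OF bij[OF V] y])
  have co_b: "co b V s = co g (pmap j ` V) (?l V s)" if "opn U V" "s \<in> sct U V" for V s
    using that by (simp add: b_def)
  have "b \<in> rmaps T U"
  proof (rule rmapsI)
    show "continuous_map (topo T) (topo U) (pmap b)"
      unfolding continuous_map_def
    proof (intro conjI allI impI Pi_I)
      show "pmap b t \<in> pts U" if "t \<in> pts T" for t by (rule pb(1)[OF that])
      show "openin (topo T) {x \<in> pts T. pmap b x \<in> V}" if V: "opn U V" for V
        using pre_b[OF V] rmaps_pre_open[OF g(1) im(1)[OF V]] by (simp add: pre_def)
    qed
    show "pmap b \<in> extensional (pts T)" by (simp add: b_def)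
  next
    fix V assume V: "opn U V"
    have "restrict (co g (pmap j ` V) \<circ> ?l V) (sct U V) \<in> ring_hom (sec U V) (sec T (pre T g (pmap j ` V)))"
      by (rule restrict_ring_hom[OF ringed_space_ring[OF U V] ring_hom_trans[OF lhom[OF V] rmaps_co_hom[OF g(1) im(1)[OF V]]]])
    then show "co b V \<in> ring_hom (sec U V) (sec T (pre T b V))"
      unfolding pre_b[OF V] using V by (simp add: b_def o_def)
    show "co b V \<in> extensional (sct U V)" using V by (simp add: b_def)
  next
    fix V assume "\<not> opn U V" then show "co b V = (\<lambda>_. undefined)" by (simp add: b_def)
  next
    fix V W s assume VW: "opn U V" "opn U W" "W \<subseteq> V" and s: "s \<in> sct U V"
    let ?y = "?l V s"
    have sub: "pmap j ` W \<subseteq> pmap j ` V" using VW(3) by blast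
    note r = ringed_space_res[OF Y im(1)[OF VW(1)] im(1)[OF VW(2)] sub l(1)[OF VW(1) s]]
    have "co j (pmap j ` W) (res Y (pmap j ` V) (pmap j ` W) ?y) = res U V W s"
      using rmaps_res[OF j(1) im(1)[OF VW(1)] im(1)[OF VW(2)] sub l(1)[OF VW(1) s]] im(3)[OF VW(1)] im(3)[OF VW(2)] l(2)[OF VW(1) s] by simp
    then have "?l W (res U V W s) = res Y (pmap j ` V) (pmap j ` W) ?y" using l_eq[OF VW(2) r] by simp
    then show "co b W (res U V W s) = res T (pre T b V) (pre T b W) (co b V s)"
      unfolding co_b[OF VW(2) ringed_space_res[OF U VW s]] co_b[OF VW(1) s] pre_b[OF VW(1)] pre_b[OF VW(2)]
      using rmaps_res[OF g(1) im(1)[OF VW(1)] im(1)[OF VW(2)] sub l(1)[OF VW(1) s]] by simp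
  next
    fix t V s assume t: "t \<in> pts T" and V: "opn U V" "pmap b t \<in> V" and s: "s \<in> sct U V"
      and u: "germ T t (pre T b V) (co b V s) \<in> Units (stalk T t)"
    let ?y = "?l V s" and ?V = "pmap j ` V"
    have gt: "pmap g t \<in> ?V" using V(2) pb(2)[OF t] by (metis imageI)
    \<comment> \<open>Locality is inherited from \<open>g\<close>: the germ is a unit on
      \<open>Y\<close>, hence the section is a unit on some neighbourhood \<open>V'\<close>, and
      pulling back along \<open>j\<close> gives a unit on its preimage in \<open>U\<close>.\<close>
    have "germ Y (pmap g t) ?V ?y \<in> Units (stalk Y (pmap g t))"
      by (rule rmaps_local[OF g(1) t im(1)[OF V(1)] gt l(1)[OF V(1) s]]) (use u pre_b[OF V(1)] co_b[OF V(1) s] in simp)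
    then obtain V' where V': "opn Y V'" "pmap g t \<in> V'" "V' \<subseteq> ?V" "res Y ?V V' ?y \<in> Units (sec Y V')"
      using germ_unit_iff[OF Y im(1)[OF V(1)] gt l(1)[OF V(1) s]] by (elim iffD1[THEN exE] conjE) blast+
    let ?W = "pre U j V'"
    have W: "opn U ?W" "?W \<subseteq> V" "pmap b t \<in> ?W"
      using rmaps_pre_open[OF j(1) V'(1)] im(3)[OF V(1)] V'(2,3) pb[OF t] by (auto simp: pre_def)
    obtain y' where y': "y' \<in> sct Y V'" "res Y ?V V' ?y \<in> sct Y V'" "res Y ?V V' ?y \<otimes>\<^bsub>sec Y V'\<^esub> y' = \<one>\<^bsub>sec Y V'\<^esub>"
      using V'(4) unfolding Units_def by blast
    note jV' = rmaps_co_hom[OF j(1) V'(1)]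
    have "co j V' (res Y ?V V' ?y) = res U V ?W s"
      using rmaps_res[OF j(1) im(1)[OF V(1)] V'(1,3) l(1)[OF V(1) s]] im(3)[OF V(1)] l(2)[OF V(1) s] by simp
    then have "res U V ?W s \<otimes>\<^bsub>sec U ?W\<^esub> co j V' y' = \<one>\<^bsub>sec U ?W\<^esub>"
      using ring_hom_mult[OF jV' y'(2,1)] ring_hom_one[OF jV'] y'(3) by simp
    then have "res U V ?W s \<in> Units (sec U ?W)"
      by (rule cring.UnitsI[OF ringed_space_cring[OF U W(1)] ringed_space_res[OF U V(1) W(1,2) s] ring_hom_closed[OF jV' y'(1)]])
    then show "germ U (pmap b t) V s \<in> Units (stalk U (pmap b t))"
      using germ_unit_iff[OF U V(1,2) s] W by blast
  qed
  moreover have "rcomp T U Y j b = g"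
  proof (rule rmaps_eqI[OF rcomp_rmaps[OF calculation j(1) Y] g(1)])
    show "pmap (rcomp T U Y j b) t = pmap g t" if "t \<in> pts T" for t using pb(2)[OF that] that by (simp add: rcomp_def)
    fix V s assume V: "opn Y V" and s: "s \<in> sct Y V"
    let ?W = "pre U j V" let ?V = "pmap j ` ?W"
    have W: "opn U ?W" by (rule rmaps_pre_open[OF j(1) V])
    have sub: "?V \<subseteq> V" by (auto simp: pre_def)
    note r = ringed_space_res[OF Y V im(1)[OF W] sub s]
    \<comment> \<open>Restricting \<open>s\<close> to the part of \<open>V\<close> inside the image
      of \<open>j\<close> does not change its pullback to \<open>U\<close>, because both open sets
      have the same preimage.\<close>
    have "co j ?V (res Y V ?V s) = co j V s"
      using rmaps_res[OF j(1) V im(1)[OF W] sub s] im(3)[OF W] ringed_space_res_id[OF U W rmaps_co[OF j(1) V s]] by simp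
    then have "?l ?W (co j V s) = res Y V ?V s" using l_eq[OF W r] by simp
    moreover have "pre T g ?V = pre T g V"
    proof -
      have "pmap g t \<in> ?V \<longleftrightarrow> pmap g t \<in> V" if t: "t \<in> pts T" for t
        using pb[OF t] sub by (metis (mono_tags, lifting) imageI mem_Collect_eq pre_def subsetD)
      then show ?thesis by (auto simp: pre_def)
    qed
    ultimately show "co (rcomp T U Y j b) V s = co g V s"
      unfolding co_rcomp[OF V s] co_b[OF W rmaps_co[OF j(1) V s]]
      using rmaps_res[OF g(1) V im(1)[OF W] sub s] ringed_space_res_id[OF T rmaps_pre_open[OF g(1) V] rmaps_co[OF g(1) V s]] by simp
  qed
  ultimately show ?thesis by blast
qed

section \<open>Empty schemes\<close>

text \<open>Gluing over the empty family: the sheaf axiom then asserts existence and uniqueness of a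
  section with no conditions.\<close>

lemma empty_sections:
  assumes T: "ringed_space T" obtains e where "sct T {} = {e}"
proof -
  have "\<exists>!s. s \<in> sct T {}" using ringed_space_glue[OF T, of "{}" undefined] by simp
  then obtain e where e: "e \<in> sct T {}" and uniq: "\<forall>s. s \<in> sct T {} \<longrightarrow> s = e" by (rule ex1E)
  have "sct T {} = {e}"
  proof
    show "sct T {} \<subseteq> {e}" using uniq by blast
  qed (use e in simp)
  then show ?thesis by (rule that)
qed

lemma empty_rmaps_unique:
  assumes T: "ringed_space T" "pts T = {}" and f: "f \<in> rmaps T Y" and g: "g \<in> rmaps T Y"
  shows "f = g"
proof (rule rmaps_eqI[OF f g])
  fix V s assume V: "opn Y V" "s \<in> sct Y V"
  have "pre T f V = {}" "pre T g V = {}" using T(2) by (auto simp: pre_def)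
  then have "co f V s \<in> sct T {}" "co g V s \<in> sct T {}" using rmaps_co[OF f V] rmaps_co[OF g V] by simp_all
  moreover obtain e where "sct T {} = {e}" using empty_sections[OF T(1)] .
  ultimately show "co f V s = co g V s" by simp
qed (simp add: T(2))

lemma empty_rmaps_exists:
  assumes T: "ringed_space T" "pts T = {}" and U: "ringed_space U"
  shows "\<exists>f. f \<in> rmaps T U"
proof -
  obtain e where E: "sct T {} = {e}" using empty_sections[OF T(1)] .
  then have e: "e \<in> sct T {}" and uniq: "\<And>s. s \<in> sct T {} \<Longrightarrow> s = e" by simp_all
  have o: "opn T {}" by simp
  note R = ring.ring_simprules[OF ringed_space_ring[OF T(1) o]]
  define f :: "('a, 'b, 'c, 'd) rmap" where "f = \<lparr>pmap = (\<lambda>_. undefined),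
    co = (\<lambda>V. if opn U V then (\<lambda>s\<in>sct U V. e) else (\<lambda>_. undefined))\<rparr>"
  have pre: "pre T f V = {}" for V using T(2) by (auto simp: pre_def)
  have "f \<in> rmaps T U"
  proof (rule rmapsI)
    show "continuous_map (topo T) (topo U) (pmap f)" using T(2) by (simp add: continuous_map_def)
    show "pmap f \<in> extensional (pts T)" by (simp add: f_def T(2))
  next
    fix V assume V: "opn U V"
    note S = ring.ring_simprules[OF ringed_space_ring[OF U V]]
    show "co f V \<in> ring_hom (sec U V) (sec T (pre T f V))"
      unfolding pre
    proof (rule ring_hom_memI)
      fix x y assume xy: "x \<in> sct U V" "y \<in> sct U V"
      show "co f V x \<in> sct T {}" using V xy e by (simp add: f_def)
      show "co f V (x \<otimes>\<^bsub>sec U V\<^esub> y) = co f V x \<otimes>\<^bsub>sec T {}\<^esub> co f V y"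
        "co f V (x \<oplus>\<^bsub>sec U V\<^esub> y) = co f V x \<oplus>\<^bsub>sec T {}\<^esub> co f V y"
        using V xy uniq[OF R(5)[OF e e]] uniq[OF R(1)[OF e e]] S(5)[OF xy] S(1)[OF xy] by (simp_all add: f_def)
    next
      show "co f V \<one>\<^bsub>sec U V\<^esub> = \<one>\<^bsub>sec T {}\<^esub>" using V uniq[OF R(6)] S(6) by (simp add: f_def)
    qed
    show "co f V \<in> extensional (sct U V)" using V by (simp add: f_def)
  next
    fix V assume "\<not> opn U V" then show "co f V = (\<lambda>_. undefined)" by (simp add: f_def)
  next
    fix V W s assume h: "opn U V" "opn U W" "W \<subseteq> V" "s \<in> sct U V"
    show "co f W (res U V W s) = res T (pre T f V) (pre T f W) (co f V s)"
      unfolding pre using h ringed_space_res[OF U h] ringed_space_res_id[OF T(1) o e] by (simp add: f_def)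
  qed (use T(2) in simp)
  then show ?thesis by (rule exI)
qed

section \<open>The exceptional divisor\<close>

text \<open>Regularity removes one factor \<open>c\<close> at a time, until the exponent is zero and
  the vanishing power is \<open>\<one>\<close>.\<close>

lemma (in cring) regular_nilpotent:
  assumes c: "c \<in> carrier R" and reg: "\<And>b. b \<in> carrier R \<Longrightarrow> c \<otimes> b = \<zero> \<Longrightarrow> b = \<zero>" and n: "c [^] (n::nat) = \<zero>"
  shows "\<one> = \<zero>"
  using n
proof (induction n)
  case (Suc n)
  have "c \<otimes> c [^] n = \<zero>" using Suc.prems nat_pow_Suc[of c n] m_comm[of c "c [^] n"] c by simp
  then have "c [^] n = \<zero>" by (rule reg[rotated]) (simp add: c)
  then show ?case by (rule Suc.IH)
qed simp

context
  fixes B :: "('p, 's) rspace" and Y :: "('q, 'r) rspace" and \<pi> and Z :: "'q set"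
  assumes B: "scheme B" and Y: "ringed_space Y" and \<pi>: "\<pi> \<in> rmaps B Y" and inv: "inverse_image_invertible B Y \<pi> Z"
begin

text \<open>A section vanishing on \<open>Z\<close> has nonunit germs there, and locality of
  \<open>\<pi>\<close> keeps its pullback a nonunit. The inverse image ideal at a point over
  \<open>Z\<close> thus lies in the maximal ideal, and so does its generator
  \<open>a\<close>.\<close>

lemma local_equation:
  assumes x: "x \<in> pts B"
  obtains W a where "opn B W" "x \<in> W" "a \<in> sct B W"
    "\<And>V b. opn B V \<Longrightarrow> V \<subseteq> W \<Longrightarrow> b \<in> sct B V \<Longrightarrow> res B W V a \<otimes>\<^bsub>sec B V\<^esub> b = \<zero>\<^bsub>sec B V\<^esub> \<Longrightarrow> b = \<zero>\<^bsub>sec B V\<^esub>"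
    "\<And>w. w \<in> W \<Longrightarrow> pmap \<pi> w \<in> Z \<Longrightarrow> germ B w W a \<notin> Units (stalk B w)"
proof -
  have lB: "locally_ringed B" and rB: "ringed_space B" using B by (auto simp: scheme_def locally_ringed_def)
  obtain W a where W: "opn B W" "x \<in> W" "a \<in> sct B W"
    and reg: "\<forall>W'. opn B W' \<and> W' \<subseteq> W \<longrightarrow> (\<forall>b \<in> sct B W'.
        res B W W' a \<otimes>\<^bsub>sec B W'\<^esub> b = \<zero>\<^bsub>sec B W'\<^esub> \<longrightarrow> b = \<zero>\<^bsub>sec B W'\<^esub>)"
    and gen: "\<forall>w\<in>W. inverse_image_ideal B Y \<pi> Z w = cgenideal (stalk B w) (germ B w W a)"
    using bspec[OF inv[unfolded inverse_image_invertible_def] x] by (elim exE conjE)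
  show ?thesis
  proof (rule that[OF W])
    show "b = \<zero>\<^bsub>sec B V\<^esub>" if "opn B V" "V \<subseteq> W" "b \<in> sct B V" "res B W V a \<otimes>\<^bsub>sec B V\<^esub> b = \<zero>\<^bsub>sec B V\<^esub>" for V b
      using mp[OF spec[OF reg, of V]] that by blast
    fix w assume w: "w \<in> W" "pmap \<pi> w \<in> Z"
    have wB: "w \<in> pts B" using w opn_subset[OF W(1)] by blast
    obtain m where m: "maximalideal m (stalk B w)" and unit: "\<And>a. a \<in> carrier (stalk B w) \<Longrightarrow> a \<notin> Units (stalk B w) \<longleftrightarrow> a \<in> m"
      using locally_ringedD[OF lB wB] by metis
    interpret S: cring "stalk B w" by (rule stalk_cring[OF rB wB])
    let ?G = "{germ B w (pre B \<pi> V) (co \<pi> V s) | V s. opn Y V \<and> pmap \<pi> w \<in> V \<and> s \<in> vanishing Y Z V}"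
    have "?G \<subseteq> m"
    proof clarify
      fix V s assume V: "opn Y V" "pmap \<pi> w \<in> V" and s: "s \<in> vanishing Y Z V"
      have s': "s \<in> sct Y V" "germ Y (pmap \<pi> w) V s \<notin> Units (stalk Y (pmap \<pi> w))"
        using s V(2) w(2) by (auto simp: vanishing_def)
      have "germ B w (pre B \<pi> V) (co \<pi> V s) \<in> carrier (stalk B w)"
        by (rule stalk_carrierI[OF rB rmaps_pre_open[OF \<pi> V(1)] _ rmaps_co[OF \<pi> V(1) s'(1)]]) (use wB V(2) in \<open>simp add: pre_def\<close>)
      then show "germ B w (pre B \<pi> V) (co \<pi> V s) \<in> m"
        using unit rmaps_local[OF \<pi> wB V s'(1)] s'(2) by blast
    qed
    then have "genideal (stalk B w) ?G \<subseteq> m" by (rule S.genideal_minimal[OF maximalideal.axioms(1)[OF m]])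
    then have "cgenideal (stalk B w) (germ B w W a) \<subseteq> m"
      using bspec[OF gen w(1)] by (simp add: inverse_image_ideal_def)
    moreover have c: "germ B w W a \<in> carrier (stalk B w)" by (rule stalk_carrierI[OF rB W(1) w(1) W(3)])
    ultimately show "germ B w W a \<notin> Units (stalk B w)" using S.cgenideal_self[OF c] unit[OF c] by blast
  qed
qed

text \<open>An equation of the exceptional divisor is regular, but its germs on the divisor are nonunits; on
  an open subset of the divisor it would be nilpotent.\<close>

lemma exceptional_nowhere_dense:
  assumes V: "opn B V" "V \<subseteq> pre B \<pi> Z" shows "V = {}"
proof (rule ccontr)
  assume "V \<noteq> {}"
  then obtain x where x: "x \<in> V" by blast
  have lB: "locally_ringed B" and rB: "ringed_space B" using B by (auto simp: scheme_def locally_ringed_def)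
  have xB: "x \<in> pts B" using x opn_subset[OF V(1)] by blast
  obtain W a where W: "opn B W" "x \<in> W" "a \<in> sct B W"
    and reg: "\<And>V b. opn B V \<Longrightarrow> V \<subseteq> W \<Longrightarrow> b \<in> sct B V \<Longrightarrow> res B W V a \<otimes>\<^bsub>sec B V\<^esub> b = \<zero>\<^bsub>sec B V\<^esub> \<Longrightarrow> b = \<zero>\<^bsub>sec B V\<^esub>"
    and nu: "\<And>w. w \<in> W \<Longrightarrow> pmap \<pi> w \<in> Z \<Longrightarrow> germ B w W a \<notin> Units (stalk B w)"
    using local_equation[OF xB] by blast
  let ?W = "W \<inter> V" let ?a = "res B W ?W a"
  have W': "opn B ?W" "x \<in> ?W" "?W \<subseteq> W" using W V x by auto
  have a': "?a \<in> sct B ?W" by (rule ringed_space_res[OF rB W(1) W'(1,3) W(3)])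
  have nu': "germ B w ?W ?a \<notin> Units (stalk B w)" if w: "w \<in> ?W" for w
    using nu[of w] w V(2) germ_res[OF rB W(1) W'(1,3) w W(3)] by (auto simp: pre_def)
  obtain U0 R \<phi> \<psi> where ch: "affine_chart B U0 R \<phi> \<psi>" "x \<in> U0" using scheme_chart[OF B xB] .
  have "\<exists>V. \<exists>n::nat. opn B V \<and> x \<in> V \<and> V \<subseteq> ?W \<and> res B ?W V ?a [^]\<^bsub>sec B V\<^esub> n = \<zero>\<^bsub>sec B V\<^esub>"
    by (rule affine_chart.locally_nilpotent[OF ch(1) W'(1) a' nu' W'(2) ch(2)])
  then obtain V' and n :: nat where V': "opn B V'" "x \<in> V'" "V' \<subseteq> ?W" "res B ?W V' ?a [^]\<^bsub>sec B V'\<^esub> n = \<zero>\<^bsub>sec B V'\<^esub>"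
    by (elim exE conjE)
  have e: "res B ?W V' ?a = res B W V' a" by (rule ringed_space_res_res[OF rB W(1) W'(1) V'(1,3) W'(3) W(3)])
  have "\<one>\<^bsub>sec B V'\<^esub> = \<zero>\<^bsub>sec B V'\<^esub>"
    by (rule cring.regular_nilpotent[OF ringed_space_cring[OF rB V'(1)] ringed_space_res[OF rB W(1) V'(1) _ W(3)]])
      (use V' e reg[OF V'(1)] in auto)
  then have "\<one>\<^bsub>stalk B x\<^esub> = \<zero>\<^bsub>stalk B x\<^esub>" using stalk_one[OF rB V'(1,2)] stalk_zero[OF rB V'(1,2)] by simp
  then show False using locally_ringedD[OF lB xB] by metis
qed

lemma exceptional_dim:
  assumes x: "x \<in> pre B \<pi> Z" shows "1 \<le> ring_dim (stalk B x)"
proof -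
  have lB: "locally_ringed B" and rB: "ringed_space B" using B by (auto simp: scheme_def locally_ringed_def)
  have xB: "x \<in> pts B" and xZ: "pmap \<pi> x \<in> Z" using x by (auto simp: pre_def)
  obtain W a where W: "opn B W" "x \<in> W" "a \<in> sct B W"
    and reg: "\<And>V b. opn B V \<Longrightarrow> V \<subseteq> W \<Longrightarrow> b \<in> sct B V \<Longrightarrow> res B W V a \<otimes>\<^bsub>sec B V\<^esub> b = \<zero>\<^bsub>sec B V\<^esub> \<Longrightarrow> b = \<zero>\<^bsub>sec B V\<^esub>"
    and nu: "\<And>w. w \<in> W \<Longrightarrow> pmap \<pi> w \<in> Z \<Longrightarrow> germ B w W a \<notin> Units (stalk B w)"
    using local_equation[OF xB] by blast
  obtain m where m: "maximalideal m (stalk B x)" and unit: "\<And>a. a \<in> carrier (stalk B x) \<Longrightarrow> a \<notin> Units (stalk B x) \<longleftrightarrow> a \<in> m"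
    and sub: "\<And>P. primeideal P (stalk B x) \<Longrightarrow> P \<subseteq> m" and ne: "\<one>\<^bsub>stalk B x\<^esub> \<noteq> \<zero>\<^bsub>stalk B x\<^esub>"
    using locally_ringedD[OF lB xB] by metis
  interpret S: cring "stalk B x" by (rule stalk_cring[OF rB xB])
  let ?\<alpha> = "germ B x W a"
  have \<alpha>: "?\<alpha> \<in> carrier (stalk B x)" by (rule stalk_carrierI[OF rB W])
  \<comment> \<open>Regularity is assumed for sections over all smaller open sets precisely so that
    it passes to germs: a product that vanishes as a germ vanishes over some \<open>W'\<close>,
    where the other factor can be cancelled to zero.\<close>
  have "\<beta> = \<zero>\<^bsub>stalk B x\<^esub>" if \<beta>: "\<beta> \<in> carrier (stalk B x)" "?\<alpha> \<otimes>\<^bsub>stalk B x\<^esub> \<beta> = \<zero>\<^bsub>stalk B x\<^esub>" for \<beta>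
  proof -
    obtain V s t where V: "opn B V" "x \<in> V" "V \<subseteq> W" "s \<in> sct B V" "t \<in> sct B V" "?\<alpha> = germ B x V s" "\<beta> = germ B x V t"
      using stalk_carrierE2[OF rB \<alpha> \<beta>(1) W(1,2)] by metis
    let ?a = "res B W V a"
    have a': "?a \<in> sct B V" by (rule ringed_space_res[OF rB W(1) V(1,3) W(3)])
    have z: "\<zero>\<^bsub>sec B V\<^esub> \<in> sct B V" by (rule ring.ring_simprules(2)[OF ringed_space_ring[OF rB V(1)]])
    have "germ B x V (?a \<otimes>\<^bsub>sec B V\<^esub> t) = germ B x V \<zero>\<^bsub>sec B V\<^esub>"
      using \<beta>(2) germ_res[OF rB W(1) V(1,3,2) W(3)] V(7) stalk_mult[OF rB V(1,2) a' V(5)] stalk_zero[OF rB V(1,2)] by simp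
    then obtain W' where W': "opn B W'" "x \<in> W'" "W' \<subseteq> V" "res B V W' (?a \<otimes>\<^bsub>sec B V\<^esub> t) = res B V W' \<zero>\<^bsub>sec B V\<^esub>"
      using germ_eqE[OF rB V(1,2) z] by metis
    have "res B W W' a \<otimes>\<^bsub>sec B W'\<^esub> res B V W' t = \<zero>\<^bsub>sec B W'\<^esub>"
      using W'(4) ring_hom_mult[OF ringed_space_res_hom[OF rB V(1) W'(1,3)] a' V(5)] res_zero[OF rB V(1) W'(1,3)]
        ringed_space_res_res[OF rB W(1) V(1) W'(1,3) V(3) W(3)] by simp
    then have "res B V W' t = \<zero>\<^bsub>sec B W'\<^esub>"
      using reg[OF W'(1) _ ringed_space_res[OF rB V(1) W'(1,3) V(5)]] W'(3) V(3) by blast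
    then show ?thesis using germ_res[OF rB V(1) W'(1,3,2) V(5)] V(7) stalk_zero[OF rB W'(1,2)] by simp
  qed
  then have "?\<alpha> [^]\<^bsub>stalk B x\<^esub> n \<noteq> \<zero>\<^bsub>stalk B x\<^esub>" for n :: nat
    using S.regular_nilpotent[OF \<alpha>] ne by blast
  then obtain P where P: "primeideal P (stalk B x)" "?\<alpha> \<notin> P" using S.prime_avoiding_powers[OF \<alpha>] by blast
  have "?\<alpha> \<in> m" using nu[OF W(2) xZ] unit[OF \<alpha>] by simp
  then have Pm: "P \<subset> m" using sub[OF P(1)] P(2) by blast
  let ?P = "\<lambda>i::nat. if i = 0 then P else m"
  have "1 \<in> {n. \<exists>P. (\<forall>i\<le>n. primeideal (P i) (stalk B x)) \<and> (\<forall>i<n. P i \<subset> P (Suc i))}"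
    by (rule CollectI, rule exI[of _ ?P]) (use P(1) S.maximalideal_prime[OF m] Pm in auto)
  then have "enat 1 \<le> ring_dim (stalk B x)" unfolding ring_dim_def by (rule SUP_upper)
  then show ?thesis by (simp add: one_enat_def)
qed

end

text \<open>If two closed sets cover \<open>B\<close>, their complements have disjoint preimages in
  \<open>U\<close>, which are open in \<open>Y\<close> by way of \<open>\<iota>\<close>.
  Irreducibility of \<open>Y\<close> makes one of them empty, so one closed set contains the image
  of \<open>U\<close> and, by density, everything.\<close>

lemma irreducible_of_dense_open:
  assumes Y: "irreducible_in (topo Y) (pts Y)" and \<iota>: "open_immersion U Y \<iota>" and j: "j \<in> rmaps U B"
    and U: "pts U \<noteq> {}" and dense: "\<And>V. opn B V \<Longrightarrow> V \<inter> pmap j ` pts U = {} \<Longrightarrow> V = {}"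
  shows "irreducible_in (topo B) (pts B)"
  unfolding irreducible_in_def
proof (intro conjI allI impI)
  show "pts B \<noteq> {}" using U rmaps_pmap[OF j] by blast
  fix A1 A2 assume h: "closedin (topo B) A1 \<and> closedin (topo B) A2 \<and> pts B \<subseteq> A1 \<union> A2"
  have cover: "pts B \<subseteq> A" if A: "closedin (topo B) A" "pmap j ` pts U \<subseteq> A" for A
    using dense[of "pts B - A"] A by (auto simp: closedin_def)
  define N where "N A = pmap \<iota> ` pre U j (pts B - A)" for A
  have N: "opn Y (N A)" if "closedin (topo B) A" for A
    unfolding N_def using that by (intro open_immersion_image[OF \<iota>] rmaps_pre_open[OF j]) (auto simp: closedin_def)
  have "N A1 \<inter> N A2 = {}"
  proof (rule ccontr)
    assume "N A1 \<inter> N A2 \<noteq> {}"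
    then obtain x y where xy: "x \<in> pre U j (pts B - A1)" "y \<in> pre U j (pts B - A2)" "pmap \<iota> x = pmap \<iota> y" by (auto simp: N_def)
    then have "x = y" using open_immersion_inj[OF \<iota>] by (auto simp: pre_def inj_on_def)
    then show False using xy(1,2) h by (auto simp: pre_def)
  qed
  then have "pts Y \<subseteq> (pts Y - N A1) \<union> (pts Y - N A2)" by blast
  moreover have "closedin (topo Y) (pts Y - N A1)" "closedin (topo Y) (pts Y - N A2)" using N h by (auto intro: closedin_diff)
  ultimately have "pts Y \<subseteq> pts Y - N A1 \<or> pts Y \<subseteq> pts Y - N A2" using Y by (simp add: irreducible_in_def)
  moreover have "N A \<subseteq> pts Y" if "closedin (topo B) A" for A using opn_subset[OF N[OF that]] .
  ultimately have "N A1 = {} \<or> N A2 = {}" using h by blast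
  then have "pmap j ` pts U \<subseteq> A1 \<or> pmap j ` pts U \<subseteq> A2" using rmaps_pmap[OF j] by (auto simp: N_def pre_def)
  then show "pts B \<subseteq> A1 \<or> pts B \<subseteq> A2" using cover h by blast
qed simp

section \<open>The blowup\<close>

lemma Sm_cmp_und:
  assumes "f \<in> homs (Sm X) Y W" "g \<in> homs (Sm X) W V"
  shows "und (cmp (Sm X) g f) = rcomp (fst Y) (fst W) (fst V) (und g) (und f)"
  using assms by (auto simp: Sm_homs Sm_simps)

lemma Sm_hom_image: "f \<in> homs (Sm X) Y W \<Longrightarrow> image_arr f = pmap (und f) ` pts (fst Y)"
  by (auto simp: Sm_homs image_arr_def)

lemma Sm_hom_und: "f \<in> homs (Sm X) Y W \<Longrightarrow> f = (Y, und f, W) \<and> und f \<in> rmaps (fst Y) (fst W) \<and>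
    rcomp (fst Y) (fst W) X (snd W) (und f) = snd Y \<and> Y \<in> smooth_over X \<and> W \<in> smooth_over X"
  by (auto simp: Sm_homs)

text \<open>A point of \<open>B\<close> over \<open>U\<close> is lifted to \<open>U\<close> by testing the cartesian square on the spectrum of its
  residue field.\<close>

lemma open_immersion_preimage:
  fixes X :: "('u::infinite) sch"
  assumes \<iota>: "\<iota> \<in> homs (Sm X) U Y" "open_immersion (fst U) (fst Y) (und \<iota>)"
    and u: "u \<in> homs (Sm X) U B" and p: "p \<in> homs (Sm X) B Y" and pu: "cmp (Sm X) p u = \<iota>"
    and cart: "cartesian X u (idn (Sm X) U) p \<iota>"
  shows "complement_arr X u = pre (fst B) (und p) (complement_arr X \<iota>)"
proof -
  note \<iota>' = Sm_hom_und[OF \<iota>(1)] and u' = Sm_hom_und[OF u] and p' = Sm_hom_und[OF p]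
  have sch: "scheme (fst U)" "scheme (fst B)" "scheme (fst Y)" using smooth_overD \<iota>' p' by blast+
  note rs = sch[THEN scheme_ringed_space]
  have imu: "image_arr u = pmap (und u) ` pts (fst U)" and im\<iota>: "image_arr \<iota> = pmap (und \<iota>) ` pts (fst U)"
    by (rule Sm_hom_image[OF u], rule Sm_hom_image[OF \<iota>(1)])
  have src: "src (Sm X) u = U" "src (Sm X) p = B" "src (Sm X) \<iota> = U" "tgt (Sm X) p = Y" "tgt (Sm X) u = B" "tgt (Sm X) \<iota> = Y"
    using homsD[OF u] homsD[OF p] homsD[OF \<iota>(1)] by auto
  have comp: "und \<iota> = rcomp (fst U) (fst B) (fst Y) (und p) (und u)"
    using Sm_cmp_und[OF u p] pu by simp
  have lift: "\<exists>h. h \<in> rmaps T (fst U) \<and> rcomp T (fst U) (fst B) (und u) h = a"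
    if "scheme T" "a \<in> rmaps T (fst B)" "b \<in> rmaps T (fst U)" "rcomp T (fst B) (fst Y) (und p) a = rcomp T (fst U) (fst Y) (und \<iota>) b"
    for T :: "'u sch" and a b
  proof -
    have all: "\<forall>(T :: 'u sch) a b. scheme T \<and> a \<in> rmaps T (fst B) \<and> b \<in> rmaps T (fst U) \<and>
        rcomp T (fst B) (fst Y) (und p) a = rcomp T (fst U) (fst Y) (und \<iota>) b \<longrightarrow>
        (\<exists>!h. h \<in> rmaps T (fst U) \<and> rcomp T (fst U) (fst B) (und u) h = a \<and>
          rcomp T (fst U) (fst U) (und (idn (Sm X) U)) h = b)"
      using cart unfolding cartesian_def src Let_def by (elim conjE)
    have "scheme T \<and> a \<in> rmaps T (fst B) \<and> b \<in> rmaps T (fst U) \<and>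
        rcomp T (fst B) (fst Y) (und p) a = rcomp T (fst U) (fst Y) (und \<iota>) b" using that by simp
    from ex1_implies_ex[OF mp[OF spec[OF spec[OF spec[OF all]]] this]] show ?thesis by (elim exE conjE) (intro exI conjI)
  qed
  have "b \<in> pmap (und u) ` pts (fst U) \<longleftrightarrow> pmap (und p) b \<in> pmap (und \<iota>) ` pts (fst U)" if b: "b \<in> pts (fst B)" for b
  proof
    assume "b \<in> pmap (und u) ` pts (fst U)"
    then show "pmap (und p) b \<in> pmap (und \<iota>) ` pts (fst U)" unfolding comp by (auto simp: pmap_rcomp)
  next
    assume pb: "pmap (und p) b \<in> pmap (und \<iota>) ` pts (fst U)"
    obtain T :: "'u sch" and a t where T: "scheme T" "a \<in> rmaps T (fst B)" "pts T = {t}" "pmap a t = b"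
      using residue_field_point[OF sch(2) b] by (elim exE conjE)
    note rT = scheme_ringed_space[OF T(1)]
    \<comment> \<open>The image of \<open>?g\<close> is the single point below \<open>b\<close>,
      which lies in the image of \<open>\<iota>\<close>, so \<open>?g\<close> factors through
      \<open>U\<close>. Together with \<open>a\<close> this factor is a cone over the square, and
      the mediating map sends \<open>t\<close> to a point of \<open>U\<close> over
      \<open>b\<close>.\<close>
    let ?g = "rcomp T (fst B) (fst Y) (und p) a"
    have g: "?g \<in> rmaps T (fst Y)" using rcomp_rmaps[OF T(2) _ rs(3)] p' by blast
    have "pmap ?g ` pts T \<subseteq> pmap (und \<iota>) ` pts (fst U)" using pb T(3,4) by (simp add: pmap_rcomp)
    from open_immersion_factor[OF rs(1,3) rT _ \<iota>(2) g this]
    obtain c where c: "c \<in> rmaps T (fst U)" "rcomp T (fst U) (fst Y) (und \<iota>) c = ?g" using \<iota>' by blast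
    obtain h where h: "h \<in> rmaps T (fst U)" "rcomp T (fst U) (fst B) (und u) h = a"
      using lift[OF T(1,2) c(1) c(2)[symmetric]] by (elim exE conjE)
    have t: "t \<in> pts T" using T(3) by simp
    have "pmap (und u) (pmap h t) = b" using arg_cong[OF h(2), of "\<lambda>f. pmap f t"] T(4) by (simp add: pmap_rcomp[OF t])
    then show "b \<in> pmap (und u) ` pts (fst U)" using rmaps_pmap[OF h(1) t] by blast
  qed
  moreover have "pmap (und p) b \<in> pts (fst Y)" if "b \<in> pts (fst B)" for b using rmaps_pmap[OF _ that] p' by blast
  ultimately show ?thesis unfolding complement_arr_def src imu im\<iota> by (auto simp: pre_def)
qed

lemma (in wb_towers) blowup_complement_weq:
  assumes X: "scheme X"
    and \<iota>: "\<iota> \<in> WB_immersions X n" "\<iota> \<in> homs (Sm X) U Y"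
    and u: "u \<in> homs (Sm X) U B" "open_immersion (fst U) (fst B) (und u)"
    and p: "p \<in> homs (Sm X) B Y" and pu: "cmp (Sm X) p u = \<iota>"
    and inv: "inverse_image_invertible (fst B) (fst Y) (und p) (complement_arr X \<iota>)"
    and d: "reduced_closed_subscheme X B (pre (fst B) (und p) (complement_arr X \<iota>)) d"
    and cart: "cartesian X u (idn (Sm X) U) p \<iota>"
  shows "(rep_map X u :: ('u, 'v) parr) \<in> WB_weqs X 0"
proof -
  note \<iota>' = Sm_hom_und[OF \<iota>(2)] and u' = Sm_hom_und[OF u(1)] and p' = Sm_hom_und[OF p]
  have src: "src (Sm X) u = U" "src (Sm X) \<iota> = U" "tgt (Sm X) u = B" "tgt (Sm X) \<iota> = Y" "u \<in> Arr (Sm X)"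
    using homsD[OF u(1)] homsD[OF \<iota>(2)] by auto
  have wb: "open_immersion (fst U) (fst Y) (und \<iota>)" "irreducible_in (topo (fst Y)) (pts (fst Y))"
    using \<iota>(1) unfolding WB_immersions_def Let_def src mem_Collect_eq by (elim conjE, simp)+
  have sch: "scheme (fst U)" "scheme (fst B)" "scheme (fst Y)" using smooth_overD \<iota>' p' by blast+
  note rs = sch[THEN scheme_ringed_space]
  have und: "und p \<in> rmaps (fst B) (fst Y)" "und u \<in> rmaps (fst U) (fst B)" using p' u' by blast+
  note compl = open_immersion_preimage[OF \<iota>(2) wb(1) u(1) p pu cart]
  have imu: "complement_arr X u = pts (fst B) - pmap (und u) ` pts (fst U)"
    unfolding complement_arr_def src Sm_hom_image[OF u(1)] ..
  have dense: "V = {}" if V: "opn (fst B) V" "V \<inter> pmap (und u) ` pts (fst U) = {}" for V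
  proof (rule exceptional_nowhere_dense[OF sch(2) rs(3) und(1) inv V(1)])
    show "V \<subseteq> pre (fst B) (und p) (complement_arr X \<iota>)"
      unfolding compl[symmetric] imu using V opn_subset by blast
  qed
  show ?thesis
  proof (cases "pts (fst U) = {}")
    case False
    have irr: "irreducible_in (topo (fst B)) (pts (fst B))"
      by (rule irreducible_of_dense_open[OF wb(2,1) und(2) False dense])
    have "enat (0 + 1) \<le> codim (fst B) (complement_arr X u)"
      unfolding codim_def
    proof (rule INF_greatest)
      fix x assume "x \<in> generic_points (topo (fst B)) (complement_arr X u)"
      then have "x \<in> pre (fst B) (und p) (complement_arr X \<iota>)" unfolding compl generic_points_def by simp
      from exceptional_dim[OF sch(2) rs(3) und(1) inv this]
      show "enat (0 + 1) \<le> ring_dim (stalk (fst B) x)" by (simp add: one_enat_def)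
    qed
    \<comment> \<open>The exceptional divisor \<open>d\<close> supplies the smooth reduced
      complement demanded by \<open>WB_immersions\<close>, once the complement of \<open>u\<close>
      is known to be the preimage of the center.\<close>
    moreover have "reduced_closed_subscheme X B (complement_arr X u) d" using d compl by simp
    ultimately have "u \<in> WB_immersions X 0"
      unfolding WB_immersions_def Let_def mem_Collect_eq src using u(2) irr src(5) by blast
    then show ?thesis by (rule rep_map_WB_weqs)
  next
    case True \<comment> \<open>then \<open>B\<close> is empty too, and \<open>u\<close> is an isomorphism rather than an element of \<open>WB\<^sub>0\<close>\<close>
    have eB: "pts (fst B) = {}" by (rule dense[OF openin_topspace]) (simp add: True)
    obtain g where g: "g \<in> rmaps (fst B) (fst U)" using empty_rmaps_exists[OF rs(2) eB rs(1)] by (rule exE)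
    have over: "snd U \<in> rmaps (fst U) X" "snd B \<in> rmaps (fst B) X" using smooth_overD u' by blast+
    have "rcomp (fst B) (fst U) X (snd U) g = snd B"
      by (rule empty_rmaps_unique[OF rs(2) eB rcomp_rmaps[OF g over(1) scheme_ringed_space[OF X]] over(2)])
    then have v: "(B, g, U) \<in> homs (Sm X) B U" using g u' by (simp add: Sm_homs)
    have 1: "rcomp (fst B) (fst U) (fst B) (und u) g = rid (fst B)"
      by (rule empty_rmaps_unique[OF rs(2) eB rcomp_rmaps[OF g und(2) rs(2)] rid_rmaps[OF rs(2)]])
    have 2: "rcomp (fst U) (fst B) (fst U) g (und u) = rid (fst U)"
      by (rule empty_rmaps_unique[OF rs(1) True rcomp_rmaps[OF und(2) g rs(1)] rid_rmaps[OF rs(1)]])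
    have ueq: "u = (U, und u, B)" using u' by blast
    have "cmp (Sm X) u (B, g, U) = idn (Sm X) B" by (subst ueq) (simp add: Sm_simps 1)
    moreover have "cmp (Sm X) (B, g, U) u = idn (Sm X) U" by (subst ueq) (simp add: Sm_simps 2)
    ultimately show ?thesis by (rule iso_in_Sm_weq[OF u(1) v])
  qed
qed

theorem theorem7p25:
  fixes X :: "('u::infinite) sch"
    and T0 C0 :: "('u, 'v) parr ffact"
    and F C :: "nat \<Rightarrow> ('u, 'v) parr ffact"
    and n j k :: nat
    and \<iota> i p d q u :: "'u sarr"
  assumes base: "noetherian_scheme X" "separated_scheme X" "finite_krull_dim (topo X)"
    and M: "motivic_model_structure X T0 C0"
    and WBM: "\<And>m. WB_model_structure X m (F m) (C m)"
    and n: "1 \<le> n" and j: "j \<le> n" and k: "1 \<le> k" "k \<le> n + 1"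
    and iota: "\<iota> \<in> WB_immersions X n"
    and i: "reduced_closed_subscheme X (tgt (Sm X) \<iota>) (complement_arr X \<iota>) i"
    and p: "p \<in> Arr (Sm X)" "tgt (Sm X) p = tgt (Sm X) \<iota>"
    and blowup: "is_blowup (fst (src (Sm X) p)) (fst (tgt (Sm X) p)) (und p) (complement_arr X \<iota>)"
    and d: "reduced_closed_subscheme X (src (Sm X) p)
              (pre (fst (src (Sm X) p)) (und p) (complement_arr X \<iota>)) d"
    and u: "u \<in> homs (Sm X) (src (Sm X) \<iota>) (src (Sm X) p)"
      "open_immersion (fst (src (Sm X) u)) (fst (tgt (Sm X) u)) (und u)"
    and pu: "cmp (Sm X) p u = \<iota>"
    and left_square: "cartesian X d q p i"
    and right_square: "cartesian X u (idn (Sm X) (src (Sm X) \<iota>)) p \<iota>"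
  shows "(t_fun X F 1 (ho_rep X u) = s_fun X F 0 (ho_rep X u) \<and>
          iso_arr (Hcat X) (t_fun X F 1 (ho_rep X u)))
    \<and> (iso_arr (Hcat X) (t_fun X F k (ho_rep X \<iota>)) \<and>
         (let r = cmp (Hcat X) (t_fun X F k (ho_rep X u))
                    (the_inverse (Hcat X) (t_fun X F k (ho_rep X \<iota>))) in
          r \<in> homs (Hcat X) (tau X F k (rep_plus X (tgt (Sm X) p)))
                          (tau X F k (rep_plus X (src (Sm X) p))) \<and>
          cmp (Hcat X) (t_fun X F k (ho_rep X p)) r
            = idn (Hcat X) (tau X F k (rep_plus X (tgt (Sm X) p)))))
    \<and> (iso_arr (Hcat X) (s_fun X F j (ho_rep X \<iota>)) \<and>
         (let r = cmp (Hcat X) (s_fun X F j (ho_rep X u))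
                    (the_inverse (Hcat X) (s_fun X F j (ho_rep X \<iota>))) in
          r \<in> homs (Hcat X) (s_tilde X F j (rep_plus X (tgt (Sm X) p)))
                          (s_tilde X F j (rep_plus X (src (Sm X) p))) \<and>
          cmp (Hcat X) (s_fun X F j (ho_rep X p)) r
            = idn (Hcat X) (s_tilde X F j (rep_plus X (tgt (Sm X) p)))))"
proof -
  interpret wb_towers X T0 C0 F C by (rule wb_towers.intro[OF M WBM])
  define U Y B where "U = src (Sm X) \<iota>" and "Y = tgt (Sm X) \<iota>" and "B = src (Sm X) p"
  have \<iota>A: "\<iota> \<in> Arr (Sm X)" using iota by (simp add: WB_immersions_def)
  have hom: "\<iota> \<in> homs (Sm X) U Y" "u \<in> homs (Sm X) U B" "p \<in> homs (Sm X) B Y"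
    using \<iota>A u(1) p by (simp_all add: homs_def U_def Y_def B_def)
  have tp: "tgt (Sm X) p = Y" and su: "src (Sm X) u = U" "tgt (Sm X) u = B" using p(2) homsD[OF hom(2)] by (auto simp: Y_def)
  note rh = hom[THEN rep_map_hom]
  have pu': "cmp (sPsh X) (rep_map X p) (rep_map X u) = (rep_map X \<iota> :: ('u, 'v) parr)"
    unfolding rep_map_cmp[OF hom(2,3)] pu ..
  have \<iota>W: "(rep_map X \<iota> :: ('u, 'v) parr) \<in> WB_weqs X n" by (rule rep_map_WB_weqs[OF iota])
  have X: "scheme X" using base(1) by (simp add: noetherian_scheme_def)
  have inv: "inverse_image_invertible (fst B) (fst Y) (und p) (complement_arr X \<iota>)"
    using blowup unfolding is_blowup_def tp B_def[symmetric] by (elim conjE)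
  have uW: "(rep_map X u :: ('u, 'v) parr) \<in> WB_weqs X 0"
    by (rule blowup_complement_weq[OF X iota hom(1,2) u(2)[unfolded su] hom(3) pu inv d[folded B_def] right_square[folded U_def]])
  note sec = induced_section[OF _ rh(2,3) pu', folded ho_rep_def]
  have B: "rep_plus X B \<in> Obj (sPsh X)" by (simp add: sPsh_simps rep_plus_is_spsh)
  \<comment> \<open>The general result is applied with an identity in the role of \<open>p\<close>,
    so that the inverted map is \<open>u\<close> itself. Stage 1 is the one stage controlled by weak
    equivalences of index 0.\<close>
  have 1: "iso_arr (Hcat X) (t_fun X F 1 (ho_rep X u))"
    unfolding t_fun_def ho_rep_def
    by (rule induced_section(1)[OF tau_weq_functor rh(2) sPsh.idn_hom[OF B] sPsh.idn_left[OF rh(2)] tau_map_weq[OF uW rh(2)]]) simp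
  have k': "k \<le> Suc n" using k by simp
  have 2: "iso_arr (Hcat X) (t_fun X F k (ho_rep X \<iota>))"
    "cmp (Hcat X) (t_fun X F k (ho_rep X u)) (the_inverse (Hcat X) (t_fun X F k (ho_rep X \<iota>)))
       \<in> homs (Hcat X) (tau X F k (rep_plus X Y)) (tau X F k (rep_plus X B))"
    "cmp (Hcat X) (t_fun X F k (ho_rep X p)) (cmp (Hcat X) (t_fun X F k (ho_rep X u)) (the_inverse (Hcat X) (t_fun X F k (ho_rep X \<iota>))))
       = idn (Hcat X) (tau X F k (rep_plus X Y))"
    unfolding t_fun_def by (rule sec[OF tau_weq_functor tau_map_weq[OF \<iota>W rh(1) k']])+
  have 3: "iso_arr (Hcat X) (s_fun X F j (ho_rep X \<iota>))"
    "cmp (Hcat X) (s_fun X F j (ho_rep X u)) (the_inverse (Hcat X) (s_fun X F j (ho_rep X \<iota>)))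
       \<in> homs (Hcat X) (s_tilde X F j (rep_plus X Y)) (s_tilde X F j (rep_plus X B))"
    "cmp (Hcat X) (s_fun X F j (ho_rep X p)) (cmp (Hcat X) (s_fun X F j (ho_rep X u)) (the_inverse (Hcat X) (s_fun X F j (ho_rep X \<iota>))))
       = idn (Hcat X) (s_tilde X F j (rep_plus X Y))"
    unfolding s_fun_def by (rule sec[OF s_tilde_weq_functor s_tilde_map_weq[OF \<iota>W rh(1) j]])+
  have "t_fun X F 1 (ho_rep X u) = s_fun X F 0 (ho_rep X u)"
    unfolding t_fun_def s_fun_def s_tilde_0 ..
  with 1 2 3 show ?thesis unfolding tp B_def[symmetric] Let_def by blast
qed

end
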